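(* ($\mathsf{ZF}$) If there is a notion of forcing $\mathbb C$ such that no subset of $\mathbb C\setminus\{\mathbf 1_{\mathbb C}\}$ is a maximal antichain in $\mathbb C$, then there is a $\mathrm{CCC}_1$ notion of forcing which collapses $\omega_1$. Moreover, it is consistent with $\mathsf{ZF}$ that there is such a $\mathrm{CCC}_1$ notion of forcing collapsing $\omega_1$ which is in addition $\sigma$-closed.
   Context: Consistency is relative to the consistency of $\mathsf{ZFC}$ (equivalently, of $\mathsf{ZF}$). A notion of forcing is a preordered set $\mathbb P$ with a maximum $\mathbf 1_{\mathbb P}$. Conditions are compatible if they have a common extension; an antichain is a set of conditions any two distinct members of which are incompatible; a maximal antichain is one maximal under inclusion among antichains. $\mathbb P$ is $\mathrm{CCC}_1$ if every maximal antichain in $\mathbb P$ is countable. $\mathbb P$ is $\sigma$-closed if every decreasing $\omega$-sequence of conditions has a lower bound. $\mathbb P$ collapses $\omega_1$ if the ground model's $\omega_1$ is countable in the generic extension.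
   Formalization: The notion of forcing C is additionally required to have a condition other than its maximum; the one-point forcing satisfies the stated hypothesis vacuously, and the claim would then contradict ZFC. *)

theory Defs
  imports Main
begin

section \<open>First-order logic with equality in the language of set theory\<close>

text \<open>Formulas use de Bruijn indices; variables are the only terms.\<close>

datatype fm = Mem nat nat | Eq nat nat | Neg fm | And fm fm | All fm

fun lift_ren :: "(nat \<Rightarrow> nat) \<Rightarrow> nat \<Rightarrow> nat" where
  "lift_ren f 0 = 0"
| "lift_ren f (Suc i) = Suc (f i)"

primrec ren :: "(nat \<Rightarrow> nat) \<Rightarrow> fm \<Rightarrow> fm" where
  "ren f (Mem i j) = Mem (f i) (f j)"
| "ren f (Eq i j) = Eq (f i) (f j)"
| "ren f (Neg \<phi>) = Neg (ren f \<phi>)"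
| "ren f (And \<phi> \<psi>) = And (ren f \<phi>) (ren f \<psi>)"
| "ren f (All \<phi>) = All (ren (lift_ren f) \<phi>)"

abbreviation inst :: "nat \<Rightarrow> fm \<Rightarrow> fm" where
  "inst t \<equiv> ren (\<lambda>i. case i of 0 \<Rightarrow> t | Suc j \<Rightarrow> j)"

text \<open>\<open>closed_at n \<phi>\<close>: every free index of \<open>\<phi>\<close> is below \<open>n\<close>.\<close>

primrec closed_at :: "nat \<Rightarrow> fm \<Rightarrow> bool" where
  "closed_at n (Mem i j) \<longleftrightarrow> i < n \<and> j < n"
| "closed_at n (Eq i j) \<longleftrightarrow> i < n \<and> j < n"
| "closed_at n (Neg \<phi>) \<longleftrightarrow> closed_at n \<phi>"
| "closed_at n (And \<phi> \<psi>) \<longleftrightarrow> closed_at n \<phi> \<and> closed_at n \<psi>"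
| "closed_at n (All \<phi>) \<longleftrightarrow> closed_at (Suc n) \<phi>"

text \<open>Classical natural deduction. In \<open>AllI\<close> the premises are shifted, so that index 0 is an
  eigenvariable.\<close>

inductive deriv :: "fm set \<Rightarrow> fm \<Rightarrow> bool" (infix "\<turnstile>" 50) where
  Assm: "\<phi> \<in> \<Gamma> \<Longrightarrow> \<Gamma> \<turnstile> \<phi>"
| AndI: "\<Gamma> \<turnstile> \<phi> \<Longrightarrow> \<Gamma> \<turnstile> \<psi> \<Longrightarrow> \<Gamma> \<turnstile> And \<phi> \<psi>"
| AndE1: "\<Gamma> \<turnstile> And \<phi> \<psi> \<Longrightarrow> \<Gamma> \<turnstile> \<phi>"
| AndE2: "\<Gamma> \<turnstile> And \<phi> \<psi> \<Longrightarrow> \<Gamma> \<turnstile> \<psi>"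
| NegI: "insert \<phi> \<Gamma> \<turnstile> \<psi> \<Longrightarrow> insert \<phi> \<Gamma> \<turnstile> Neg \<psi> \<Longrightarrow> \<Gamma> \<turnstile> Neg \<phi>"
| NegE: "insert (Neg \<phi>) \<Gamma> \<turnstile> \<psi> \<Longrightarrow> insert (Neg \<phi>) \<Gamma> \<turnstile> Neg \<psi> \<Longrightarrow> \<Gamma> \<turnstile> \<phi>"
| AllI: "ren Suc ` \<Gamma> \<turnstile> \<phi> \<Longrightarrow> \<Gamma> \<turnstile> All \<phi>"
| AllE: "\<Gamma> \<turnstile> All \<phi> \<Longrightarrow> \<Gamma> \<turnstile> inst t \<phi>"
| EqRefl: "\<Gamma> \<turnstile> Eq t t"
| EqSubst: "\<Gamma> \<turnstile> Eq s t \<Longrightarrow> \<Gamma> \<turnstile> inst s \<phi> \<Longrightarrow> \<Gamma> \<turnstile> inst t \<phi>"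

definition consistent :: "fm set \<Rightarrow> bool" where
  "consistent T \<longleftrightarrow> \<not> (\<exists>\<phi>. T \<turnstile> \<phi> \<and> T \<turnstile> Neg \<phi>)"


section \<open>Writing formulas with named variables\<close>

text \<open>A formula scheme maps the number \<open>n\<close> of enclosing quantifiers to a formula. Inside a scheme
  a variable is named by the level of its binder (the number of quantifiers outside it), which is
  the de Bruijn index \<open>n - 1 - x\<close> at depth \<open>n\<close>. Hence HOL variables of type \<^typ>\<open>nat\<close> bound by
  the bold quantifiers serve as the variables of the object language, and a scheme without free
  variables denotes the sentence obtained at depth 0.\<close>

type_synonym scheme = "nat \<Rightarrow> fm"

definition mem :: "nat \<Rightarrow> nat \<Rightarrow> scheme" (infix "\<^bold>\<in>" 50) where
  "(x \<^bold>\<in> y) = (\<lambda>n. Mem (n - 1 - x) (n - 1 - y))"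

definition eq :: "nat \<Rightarrow> nat \<Rightarrow> scheme" (infix "\<^bold>=" 50) where
  "(x \<^bold>= y) = (\<lambda>n. Eq (n - 1 - x) (n - 1 - y))"

definition neg :: "scheme \<Rightarrow> scheme" ("\<^bold>\<not> _" [40] 40) where
  "(\<^bold>\<not> A) = (\<lambda>n. Neg (A n))"

definition conj :: "scheme \<Rightarrow> scheme \<Rightarrow> scheme" (infixr "\<^bold>\<and>" 35) where
  "(A \<^bold>\<and> B) = (\<lambda>n. And (A n) (B n))"

definition all :: "(nat \<Rightarrow> scheme) \<Rightarrow> scheme" (binder "\<^bold>\<forall>" 10) where
  "all A = (\<lambda>n. All (A n (Suc n)))"

definition disj :: "scheme \<Rightarrow> scheme \<Rightarrow> scheme" (infixr "\<^bold>\<or>" 30) where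
  "(A \<^bold>\<or> B) = (\<^bold>\<not> (\<^bold>\<not> A \<^bold>\<and> \<^bold>\<not> B))"

definition imp :: "scheme \<Rightarrow> scheme \<Rightarrow> scheme" (infixr "\<^bold>\<longrightarrow>" 25) where
  "(A \<^bold>\<longrightarrow> B) = (\<^bold>\<not> (A \<^bold>\<and> \<^bold>\<not> B))"

definition iff :: "scheme \<Rightarrow> scheme \<Rightarrow> scheme" (infixr "\<^bold>\<longleftrightarrow>" 25) where
  "(A \<^bold>\<longleftrightarrow> B) = ((A \<^bold>\<longrightarrow> B) \<^bold>\<and> (B \<^bold>\<longrightarrow> A))"

definition ex :: "(nat \<Rightarrow> scheme) \<Rightarrow> scheme" (binder "\<^bold>\<exists>" 10) where
  "ex A = (\<^bold>\<not> (\<^bold>\<forall>x. \<^bold>\<not> A x))"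

abbreviation sentence :: "scheme \<Rightarrow> fm" where
  "sentence A \<equiv> A 0"

text \<open>An arbitrary formula as a scheme: its free index \<open>i\<close> becomes the variable \<open>e i\<close>.\<close>

definition embed :: "fm \<Rightarrow> (nat \<Rightarrow> nat) \<Rightarrow> scheme" where
  "embed \<phi> e = (\<lambda>n. ren (\<lambda>i. n - 1 - e i) \<phi>)"

text \<open>Universal quantification over the \<open>k\<close> parameters with levels \<open>0, \<dots>, k - 1\<close>.\<close>

definition closure :: "nat \<Rightarrow> scheme \<Rightarrow> fm" where
  "closure k A = (All ^^ k) (A k)"


section \<open>The axioms of ZF and ZFC\<close>

definition subset :: "nat \<Rightarrow> nat \<Rightarrow> scheme" (infix "\<^bold>\<subseteq>" 50) where
  "(x \<^bold>\<subseteq> y) = (\<^bold>\<forall>z. z \<^bold>\<in> x \<^bold>\<longrightarrow> z \<^bold>\<in> y)"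

definition is_empty :: "nat \<Rightarrow> scheme" where
  "is_empty x = (\<^bold>\<forall>z. \<^bold>\<not> z \<^bold>\<in> x)"

definition is_succ :: "nat \<Rightarrow> nat \<Rightarrow> scheme" where
  "is_succ x y = (\<^bold>\<forall>z. z \<^bold>\<in> y \<^bold>\<longleftrightarrow> z \<^bold>\<in> x \<^bold>\<or> z \<^bold>= x)"

definition is_inductive :: "nat \<Rightarrow> scheme" where
  "is_inductive w =
    ((\<^bold>\<exists>z. is_empty z \<^bold>\<and> z \<^bold>\<in> w) \<^bold>\<and>
     (\<^bold>\<forall>x. x \<^bold>\<in> w \<^bold>\<longrightarrow> (\<^bold>\<exists>y. is_succ x y \<^bold>\<and> y \<^bold>\<in> w)))"

definition extensionality :: scheme where
  "extensionality = (\<^bold>\<forall>x. \<^bold>\<forall>y. (\<^bold>\<forall>z. z \<^bold>\<in> x \<^bold>\<longleftrightarrow> z \<^bold>\<in> y) \<^bold>\<longrightarrow> x \<^bold>= y)"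

definition foundation :: scheme where
  "foundation =
    (\<^bold>\<forall>x. (\<^bold>\<exists>y. y \<^bold>\<in> x) \<^bold>\<longrightarrow> (\<^bold>\<exists>y. y \<^bold>\<in> x \<^bold>\<and> (\<^bold>\<forall>z. z \<^bold>\<in> y \<^bold>\<longrightarrow> \<^bold>\<not> z \<^bold>\<in> x)))"

definition pairing :: scheme where
  "pairing = (\<^bold>\<forall>x. \<^bold>\<forall>y. \<^bold>\<exists>z. \<^bold>\<forall>u. u \<^bold>\<in> z \<^bold>\<longleftrightarrow> u \<^bold>= x \<^bold>\<or> u \<^bold>= y)"

definition union_ax :: scheme where
  "union_ax = (\<^bold>\<forall>x. \<^bold>\<exists>y. \<^bold>\<forall>z. z \<^bold>\<in> y \<^bold>\<longleftrightarrow> (\<^bold>\<exists>u. u \<^bold>\<in> x \<^bold>\<and> z \<^bold>\<in> u))"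

definition powerset :: scheme where
  "powerset = (\<^bold>\<forall>x. \<^bold>\<exists>y. \<^bold>\<forall>z. z \<^bold>\<in> y \<^bold>\<longleftrightarrow> z \<^bold>\<subseteq> x)"

definition infinity :: scheme where
  "infinity = (\<^bold>\<exists>w. is_inductive w)"

text \<open>In the two schemas the parameters are the variables \<open>0, \<dots>, k - 1\<close>. In \<open>separation\<close> the
  element variable is index 0 of \<open>\<phi>\<close>; in \<open>replacement\<close> the argument is index 0 and the value
  index 1. The set being separated or replaced may itself be copied into a parameter.\<close>

definition separation :: "nat \<Rightarrow> fm \<Rightarrow> fm" where
  "separation k \<phi> = closure k
    (\<^bold>\<forall>a. \<^bold>\<exists>b. \<^bold>\<forall>x. x \<^bold>\<in> b \<^bold>\<longleftrightarrow>
       x \<^bold>\<in> a \<^bold>\<and> embed \<phi> (\<lambda>i. case i of 0 \<Rightarrow> x | Suc j \<Rightarrow> j))"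

definition replacement :: "nat \<Rightarrow> fm \<Rightarrow> fm" where
  "replacement k \<phi> =
    (let F = (\<lambda>x y. embed \<phi> (\<lambda>i. case i of 0 \<Rightarrow> x | Suc 0 \<Rightarrow> y | Suc (Suc j) \<Rightarrow> j)) in
     closure k
      (\<^bold>\<forall>a. (\<^bold>\<forall>x. \<^bold>\<forall>y. \<^bold>\<forall>z. x \<^bold>\<in> a \<^bold>\<and> F x y \<^bold>\<and> F x z \<^bold>\<longrightarrow> y \<^bold>= z) \<^bold>\<longrightarrow>
         (\<^bold>\<exists>b. \<^bold>\<forall>y. y \<^bold>\<in> b \<^bold>\<longleftrightarrow> (\<^bold>\<exists>x. x \<^bold>\<in> a \<^bold>\<and> F x y))))"

definition ZF :: "fm set" where
  "ZF = {sentence extensionality, sentence foundation, sentence pairing, sentence union_ax,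
         sentence powerset, sentence infinity}
      \<union> {separation k \<phi> | k \<phi>. closed_at (k + 1) \<phi>}
      \<union> {replacement k \<phi> | k \<phi>. closed_at (k + 2) \<phi>}"

text \<open>Every family of nonempty pairwise disjoint sets has a transversal.\<close>

definition choice :: scheme where
  "choice =
    (\<^bold>\<forall>f. (\<^bold>\<forall>x. x \<^bold>\<in> f \<^bold>\<longrightarrow> \<^bold>\<not> is_empty x) \<^bold>\<and>
         (\<^bold>\<forall>x. \<^bold>\<forall>y. x \<^bold>\<in> f \<^bold>\<and> y \<^bold>\<in> f \<^bold>\<and> \<^bold>\<not> x \<^bold>= y \<^bold>\<longrightarrow> \<^bold>\<not> (\<^bold>\<exists>z. z \<^bold>\<in> x \<^bold>\<and> z \<^bold>\<in> y)) \<^bold>\<longrightarrow>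
       (\<^bold>\<exists>c. \<^bold>\<forall>x. x \<^bold>\<in> f \<^bold>\<longrightarrow> (\<^bold>\<exists>z. \<^bold>\<forall>u. u \<^bold>\<in> x \<^bold>\<and> u \<^bold>\<in> c \<^bold>\<longleftrightarrow> u \<^bold>= z)))"

definition ZFC :: "fm set" where
  "ZFC = insert (sentence choice) ZF"


section \<open>Pairs, functions, ordinals, countability\<close>

definition is_upair :: "nat \<Rightarrow> nat \<Rightarrow> nat \<Rightarrow> scheme" where
  "is_upair x y z = (\<^bold>\<forall>u. u \<^bold>\<in> z \<^bold>\<longleftrightarrow> u \<^bold>= x \<^bold>\<or> u \<^bold>= y)"

text \<open>\<open>z\<close> is the Kuratowski pair \<open>(x, y)\<close>.\<close>

definition is_pair :: "nat \<Rightarrow> nat \<Rightarrow> nat \<Rightarrow> scheme" where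
  "is_pair x y z = (\<^bold>\<exists>u. \<^bold>\<exists>v. is_upair x x u \<^bold>\<and> is_upair x y v \<^bold>\<and> is_upair u v z)"

definition pair_in :: "nat \<Rightarrow> nat \<Rightarrow> nat \<Rightarrow> scheme" where
  "pair_in x y r = (\<^bold>\<exists>z. is_pair x y z \<^bold>\<and> z \<^bold>\<in> r)"

definition triple_in :: "nat \<Rightarrow> nat \<Rightarrow> nat \<Rightarrow> nat \<Rightarrow> scheme" where
  "triple_in x y z r = (\<^bold>\<exists>u. is_pair y z u \<^bold>\<and> pair_in x u r)"

definition is_function :: "nat \<Rightarrow> nat \<Rightarrow> nat \<Rightarrow> scheme" where
  "is_function f a b =
    ((\<^bold>\<forall>z. z \<^bold>\<in> f \<^bold>\<longrightarrow> (\<^bold>\<exists>x. \<^bold>\<exists>y. x \<^bold>\<in> a \<^bold>\<and> y \<^bold>\<in> b \<^bold>\<and> is_pair x y z)) \<^bold>\<and>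
     (\<^bold>\<forall>x. x \<^bold>\<in> a \<^bold>\<longrightarrow> (\<^bold>\<exists>y. pair_in x y f)) \<^bold>\<and>
     (\<^bold>\<forall>x. \<^bold>\<forall>y. \<^bold>\<forall>y'. pair_in x y f \<^bold>\<and> pair_in x y' f \<^bold>\<longrightarrow> y \<^bold>= y'))"

definition is_injection :: "nat \<Rightarrow> nat \<Rightarrow> nat \<Rightarrow> scheme" where
  "is_injection f a b =
    (is_function f a b \<^bold>\<and>
     (\<^bold>\<forall>x. \<^bold>\<forall>x'. \<^bold>\<forall>y. pair_in x y f \<^bold>\<and> pair_in x' y f \<^bold>\<longrightarrow> x \<^bold>= x'))"

definition transitive :: "nat \<Rightarrow> scheme" where
  "transitive x = (\<^bold>\<forall>y. y \<^bold>\<in> x \<^bold>\<longrightarrow> y \<^bold>\<subseteq> x)"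

definition ordinal :: "nat \<Rightarrow> scheme" where
  "ordinal x = (transitive x \<^bold>\<and> (\<^bold>\<forall>y. y \<^bold>\<in> x \<^bold>\<longrightarrow> transitive y))"

definition is_omega :: "nat \<Rightarrow> scheme" where
  "is_omega w = (is_inductive w \<^bold>\<and> (\<^bold>\<forall>v. is_inductive v \<^bold>\<longrightarrow> w \<^bold>\<subseteq> v))"

definition countable :: "nat \<Rightarrow> scheme" where
  "countable x = (\<^bold>\<exists>w. \<^bold>\<exists>f. is_omega w \<^bold>\<and> is_injection f x w)"

definition is_omega1 :: "nat \<Rightarrow> scheme" where
  "is_omega1 x =
    (ordinal x \<^bold>\<and> \<^bold>\<not> countable x \<^bold>\<and> (\<^bold>\<forall>y. y \<^bold>\<in> x \<^bold>\<longrightarrow> countable y))"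


section \<open>Notions of forcing\<close>

definition notion_of_forcing :: "nat \<Rightarrow> nat \<Rightarrow> nat \<Rightarrow> scheme" where
  "notion_of_forcing P le one =
    ((\<^bold>\<forall>z. z \<^bold>\<in> le \<^bold>\<longrightarrow> (\<^bold>\<exists>p. \<^bold>\<exists>q. p \<^bold>\<in> P \<^bold>\<and> q \<^bold>\<in> P \<^bold>\<and> is_pair p q z)) \<^bold>\<and>
     (\<^bold>\<forall>p. p \<^bold>\<in> P \<^bold>\<longrightarrow> pair_in p p le) \<^bold>\<and>
     (\<^bold>\<forall>p. \<^bold>\<forall>q. \<^bold>\<forall>r. pair_in p q le \<^bold>\<and> pair_in q r le \<^bold>\<longrightarrow> pair_in p r le) \<^bold>\<and>
     one \<^bold>\<in> P \<^bold>\<and> (\<^bold>\<forall>p. p \<^bold>\<in> P \<^bold>\<longrightarrow> pair_in p one le))"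

definition compatible :: "nat \<Rightarrow> nat \<Rightarrow> nat \<Rightarrow> nat \<Rightarrow> scheme" where
  "compatible P le p q = (\<^bold>\<exists>r. r \<^bold>\<in> P \<^bold>\<and> pair_in r p le \<^bold>\<and> pair_in r q le)"

definition antichain :: "nat \<Rightarrow> nat \<Rightarrow> nat \<Rightarrow> scheme" where
  "antichain P le A =
    (A \<^bold>\<subseteq> P \<^bold>\<and>
     (\<^bold>\<forall>p. \<^bold>\<forall>q. p \<^bold>\<in> A \<^bold>\<and> q \<^bold>\<in> A \<^bold>\<and> \<^bold>\<not> p \<^bold>= q \<^bold>\<longrightarrow> \<^bold>\<not> compatible P le p q))"

definition maximal_antichain :: "nat \<Rightarrow> nat \<Rightarrow> nat \<Rightarrow> scheme" where
  "maximal_antichain P le A =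
    (antichain P le A \<^bold>\<and> (\<^bold>\<forall>B. antichain P le B \<^bold>\<and> A \<^bold>\<subseteq> B \<^bold>\<longrightarrow> A \<^bold>= B))"

definition CCC1 :: "nat \<Rightarrow> nat \<Rightarrow> scheme" where
  "CCC1 P le = (\<^bold>\<forall>A. maximal_antichain P le A \<^bold>\<longrightarrow> countable A)"

definition sigma_closed :: "nat \<Rightarrow> nat \<Rightarrow> scheme" where
  "sigma_closed P le =
    (\<^bold>\<forall>w. \<^bold>\<forall>f. is_omega w \<^bold>\<and> is_function f w P \<^bold>\<and>
        (\<^bold>\<forall>n. \<^bold>\<forall>m. \<^bold>\<forall>p. \<^bold>\<forall>q. is_succ n m \<^bold>\<and> pair_in n p f \<^bold>\<and> pair_in m q f
            \<^bold>\<longrightarrow> pair_in q p le) \<^bold>\<longrightarrow>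
        (\<^bold>\<exists>r. r \<^bold>\<in> P \<^bold>\<and> (\<^bold>\<forall>n. \<^bold>\<forall>p. pair_in n p f \<^bold>\<longrightarrow> pair_in r p le)))"

text \<open>No subset of \<open>P - {one}\<close> is a maximal antichain.\<close>

definition no_antichain_avoiding_top :: "nat \<Rightarrow> nat \<Rightarrow> nat \<Rightarrow> scheme" where
  "no_antichain_avoiding_top P le one =
    (\<^bold>\<forall>A. A \<^bold>\<subseteq> P \<^bold>\<and> \<^bold>\<not> one \<^bold>\<in> A \<^bold>\<longrightarrow> \<^bold>\<not> maximal_antichain P le A)"

text \<open>A forcing whose only condition is \<open>one\<close> satisfies \<open>no_antichain_avoiding_top\<close> vacuously (its
  only subset avoiding \<open>one\<close> is empty, hence not maximal), while ZFC proves that no CCC forcing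
  collapses \<open>\<omega>\<^sub>1\<close>. The degenerate case therefore has to be excluded as a hypothesis.\<close>

definition nontrivial :: "nat \<Rightarrow> nat \<Rightarrow> scheme" where
  "nontrivial P one = (\<^bold>\<exists>p. p \<^bold>\<in> P \<^bold>\<and> \<^bold>\<not> p \<^bold>= one)"


section \<open>Names and the forcing relation\<close>

text \<open>A name is a set all of whose elements are pairs \<open>(\<sigma>, p)\<close> with \<open>\<sigma>\<close> a name and \<open>p \<in> P\<close>. This
  recursion along membership is expressed by the existence of a set \<open>N\<close> witnessing it.\<close>

definition is_name :: "nat \<Rightarrow> nat \<Rightarrow> scheme" where
  "is_name P x =
    (\<^bold>\<exists>N. x \<^bold>\<in> N \<^bold>\<and>
       (\<^bold>\<forall>y. \<^bold>\<forall>z. y \<^bold>\<in> N \<^bold>\<and> z \<^bold>\<in> y \<^bold>\<longrightarrow>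
          (\<^bold>\<exists>s. \<^bold>\<exists>p. s \<^bold>\<in> N \<^bold>\<and> p \<^bold>\<in> P \<^bold>\<and> is_pair s p z)))"

text \<open>\<open>c\<close> is the canonical name of \<open>x\<close>, i.e. \<open>{(check y, one) | y \<in> x}\<close>; \<open>g\<close> is the function
  \<open>check\<close> restricted to a transitive set \<open>t\<close>.\<close>

definition is_check :: "nat \<Rightarrow> nat \<Rightarrow> nat \<Rightarrow> scheme" where
  "is_check one x c =
    (\<^bold>\<exists>t. \<^bold>\<exists>g. \<^bold>\<exists>b. transitive t \<^bold>\<and> x \<^bold>\<in> t \<^bold>\<and> is_function g t b \<^bold>\<and>
       (\<^bold>\<forall>y. \<^bold>\<forall>d. pair_in y d g \<^bold>\<longrightarrow>
          (\<^bold>\<forall>z. z \<^bold>\<in> d \<^bold>\<longleftrightarrow>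
             (\<^bold>\<exists>u. \<^bold>\<exists>v. u \<^bold>\<in> y \<^bold>\<and> pair_in u v g \<^bold>\<and> is_pair v one z))) \<^bold>\<and>
       pair_in x c g)"

definition in_dom :: "nat \<Rightarrow> nat \<Rightarrow> scheme" where
  "in_dom s x = (\<^bold>\<exists>p. pair_in s p x)"

text \<open>The forcing relation for atomic formulas is given by the simultaneous recursion

  \<^item> \<open>p \<tturnstile> x = y\<close> iff for all \<open>s \<in> dom x \<union> dom y\<close> and \<open>q \<le> p\<close>: \<open>q \<tturnstile> s \<in> x\<close> iff \<open>q \<tturnstile> s \<in> y\<close>;
  \<^item> \<open>p \<tturnstile> x \<in> y\<close> iff the set of \<open>r\<close> such that \<open>r \<le> a\<close> and \<open>r \<tturnstile> x = s\<close> for some \<open>(s, a) \<in> y\<close>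
    is dense below \<open>p\<close>.

  In the next definition \<open>E\<close> and \<open>M\<close> are sets of triples \<open>(p, x, y)\<close> which satisfy these clauses
  on a set \<open>N\<close> of names closed under passing to the domain.\<close>

definition atomic_forcing :: "nat \<Rightarrow> nat \<Rightarrow> nat \<Rightarrow> nat \<Rightarrow> nat \<Rightarrow> scheme" where
  "atomic_forcing P le N E M =
    ((\<^bold>\<forall>y. \<^bold>\<forall>s. y \<^bold>\<in> N \<^bold>\<and> in_dom s y \<^bold>\<longrightarrow> s \<^bold>\<in> N) \<^bold>\<and>
     (\<^bold>\<forall>p. \<^bold>\<forall>x. \<^bold>\<forall>y. p \<^bold>\<in> P \<^bold>\<and> x \<^bold>\<in> N \<^bold>\<and> y \<^bold>\<in> N \<^bold>\<longrightarrow>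
        (triple_in p x y E \<^bold>\<longleftrightarrow>
           (\<^bold>\<forall>s. \<^bold>\<forall>q. (in_dom s x \<^bold>\<or> in_dom s y) \<^bold>\<and> pair_in q p le \<^bold>\<longrightarrow>
              (triple_in q s x M \<^bold>\<longleftrightarrow> triple_in q s y M))) \<^bold>\<and>
        (triple_in p x y M \<^bold>\<longleftrightarrow>
           (\<^bold>\<forall>q. pair_in q p le \<^bold>\<longrightarrow>
              (\<^bold>\<exists>r. pair_in r q le \<^bold>\<and>
                 (\<^bold>\<exists>s. \<^bold>\<exists>a. pair_in s a y \<^bold>\<and> pair_in r a le \<^bold>\<and> triple_in r x s E))))))"

definition forces_eq :: "nat \<Rightarrow> nat \<Rightarrow> nat \<Rightarrow> nat \<Rightarrow> nat \<Rightarrow> scheme" where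
  "forces_eq P le p x y =
    (\<^bold>\<exists>N. \<^bold>\<exists>E. \<^bold>\<exists>M. atomic_forcing P le N E M \<^bold>\<and> x \<^bold>\<in> N \<^bold>\<and> y \<^bold>\<in> N \<^bold>\<and> triple_in p x y E)"

definition forces_mem :: "nat \<Rightarrow> nat \<Rightarrow> nat \<Rightarrow> nat \<Rightarrow> nat \<Rightarrow> scheme" where
  "forces_mem P le p x y =
    (\<^bold>\<exists>N. \<^bold>\<exists>E. \<^bold>\<exists>M. atomic_forcing P le N E M \<^bold>\<and> x \<^bold>\<in> N \<^bold>\<and> y \<^bold>\<in> N \<^bold>\<and> triple_in p x y M)"

text \<open>\<open>forces P le \<phi> e p\<close> is the formula of the ground model saying that \<open>p\<close> forces \<open>\<phi>\<close>, where the
  free index \<open>i\<close> of \<open>\<phi>\<close> is interpreted by the name held in the variable \<open>e i\<close>.\<close>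

primrec forces :: "nat \<Rightarrow> nat \<Rightarrow> fm \<Rightarrow> (nat \<Rightarrow> nat) \<Rightarrow> nat \<Rightarrow> scheme" where
  "forces P le (Mem i j) e p = forces_mem P le p (e i) (e j)"
| "forces P le (Eq i j) e p = forces_eq P le p (e i) (e j)"
| "forces P le (Neg \<phi>) e p = (\<^bold>\<forall>q. pair_in q p le \<^bold>\<longrightarrow> \<^bold>\<not> forces P le \<phi> e q)"
| "forces P le (And \<phi> \<psi>) e p = (forces P le \<phi> e p \<^bold>\<and> forces P le \<psi> e p)"
| "forces P le (All \<phi>) e p =
    (\<^bold>\<forall>x. is_name P x \<^bold>\<longrightarrow> forces P le \<phi> (\<lambda>i. case i of 0 \<Rightarrow> x | Suc j \<Rightarrow> e j) p)"

text \<open>The top condition forces the ground model's \<open>\<omega>\<^sub>1\<close> to be countable. Here \<open>countable 0 1\<close> is the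
  formula ``\<open>v\<close> is countable'' whose only free variable \<open>v\<close> is the de Bruijn index 0.\<close>

definition collapses_omega1 :: "nat \<Rightarrow> nat \<Rightarrow> nat \<Rightarrow> scheme" where
  "collapses_omega1 P le one =
    (\<^bold>\<exists>k. \<^bold>\<exists>c. is_omega1 k \<^bold>\<and> is_check one k c \<^bold>\<and> forces P le (countable 0 1) (\<lambda>_. c) one)"

end

theory Submission
  imports Defs "HOL-Library.Countable_Set"
begin

text \<open>By the completeness theorem one may argue in countable models of ZF. From \<open>C\<close> one obtains a
  family of nonempty sets \<open>X\<^sub>i\<close> without choice function: for an antichain \<open>i\<close> avoiding the top let
  \<open>X\<^sub>i\<close> consist of the non-top conditions incompatible with all of \<open>i\<close>; a choice function could be
  iterated through all the ordinals. Given such a family, take below a new top, for every \<open>i\<close>, a copy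
  of the collapse of \<open>\<omega>\<^sub>1\<close> by finite sequences \<open>q\<close>, in which every \<open>q\<close> is decorated with an element of
  \<open>X\<^sub>i\<close> that the order ignores. As the sequences are well-ordered, a maximal antichain without the top
  would select one decoration for every \<open>i\<close>, namely the one at its least \<open>q\<close>; so the top is the only
  maximal antichain.

  If \<open>(X\<^sub>n)\<close> is a sequence without choice function on any infinite set of indices, decorate \<open>q\<close> in the
  copy \<open>n\<close> by an element of \<open>X\<^bsub>max n |q|\<^esub>\<close> instead. A decreasing \<open>\<omega>\<close>-sequence of conditions then has
  bounded lengths, hence is eventually constant up to equivalence, and the forcing is \<open>\<sigma>\<close>-closed. Such
  a sequence exists in a symmetric extension by an \<open>\<omega> \<times> \<omega>\<close> matrix of Cohen reals, where \<open>X\<^sub>n\<close> is the set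
  of the reals in the \<open>n\<close>-th row.\<close>


section \<open>Semantics and completeness of first-order logic\<close>

text \<open>The models supplied by completeness may be ill-founded from outside, so names cannot be
  evaluated by recursion. An extension is instead the quotient of the names by forced equality,
  realised on \<open>nat\<close>, and every induction, recursion and separation inside a model has
  to concern a predicate definable there (\<open>dfn\<close>, \<open>df\<close>). The extension is
  again a model on \<open>nat\<close>, so the collapse is built over the symmetric extension exactly
  as over any other model. The collapsing sequences are injective because countability means an
  injection into \<omega>: read backwards, the generic sequence has to be a function on
  \<open>\<omega>\<^sub>1\<close>. The maximum in \<open>max n |q|\<close> acts in two directions.
  Rows at least \<open>n\<close> make a selection of one decoration per copy reach infinitely many
  rows; rows at least \<open>|q|\<close> do the same for the decorations along a decreasing sequence
  of unbounded length.\<close>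

primrec satk :: "'a set \<Rightarrow> ('a \<Rightarrow> 'a \<Rightarrow> bool) \<Rightarrow> ('a \<Rightarrow> 'a \<Rightarrow> bool) \<Rightarrow> (nat \<Rightarrow> 'a) \<Rightarrow> fm \<Rightarrow> bool" where
  "satk K m q e (Mem i j) = m (e i) (e j)"
| "satk K m q e (Eq i j) = q (e i) (e j)"
| "satk K m q e (Neg \<phi>) = (\<not> satk K m q e \<phi>)"
| "satk K m q e (And \<phi> \<psi>) = (satk K m q e \<phi> \<and> satk K m q e \<psi>)"
| "satk K m q e (All \<phi>) = (\<forall>x\<in>K. satk K m q (case_nat x e) \<phi>)"

text \<open>\<open>satk\<close> carries a domain and a separate relation for equality because
  equality is only a congruence in the term model and in the structure of names; \<open>sat\<close>
  is the case reached after passing to the quotient.\<close>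

abbreviation sat :: "('a \<Rightarrow> 'a \<Rightarrow> bool) \<Rightarrow> (nat \<Rightarrow> 'a) \<Rightarrow> fm \<Rightarrow> bool" where
  "sat E \<equiv> satk UNIV E (=)"

lemma satk_ren: "satk K m q e (ren f \<phi>) = satk K m q (\<lambda>i. e (f i)) \<phi>"
proof (induction \<phi> arbitrary: e f)
  case (All \<phi>)
  have "(\<lambda>i. case_nat x e (lift_ren f i)) = case_nat x (\<lambda>i. e (f i))" for x
    by (rule ext) (simp split: nat.split)
  then show ?case by (simp add: All)
qed simp_all

lemma ren_ren: "ren f (ren g \<phi>) = ren (\<lambda>i. f (g i)) \<phi>"
proof (induction \<phi> arbitrary: f g)
  case (All \<phi>)
  have "(\<lambda>i. lift_ren f (lift_ren g i)) = lift_ren (\<lambda>i. f (g i))"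
    by (rule ext, rename_tac i, case_tac i) auto
  then show ?case by (simp add: All)
qed simp_all

lemma lift_ren_id: "lift_ren (\<lambda>i. i) = (\<lambda>i. i)"
  by (rule ext, rename_tac i, case_tac i) auto

lemma ren_id: "ren (\<lambda>i. i) \<phi> = \<phi>"
  by (induction \<phi>) (simp_all add: lift_ren_id)

primrec fv :: "fm \<Rightarrow> nat set" where
  "fv (Mem i j) = {i, j}"
| "fv (Eq i j) = {i, j}"
| "fv (Neg \<phi>) = fv \<phi>"
| "fv (And \<phi> \<psi>) = fv \<phi> \<union> fv \<psi>"
| "fv (All \<phi>) = {i. Suc i \<in> fv \<phi>}"

lemma finite_fv: "finite (fv \<phi>)"
proof (induction \<phi>)
  case (All \<phi>)
  have "fv (All \<phi>) = Suc -` fv \<phi>" by auto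
  then show ?case using All by (metis finite_vimageI inj_Suc)
qed auto

lemma ren_cong: "(\<And>i. i \<in> fv \<phi> \<Longrightarrow> f i = g i) \<Longrightarrow> ren f \<phi> = ren g \<phi>"
proof (induction \<phi> arbitrary: f g)
  case (All \<phi>)
  have "lift_ren f i = lift_ren g i" if "i \<in> fv \<phi>" for i
    using that All.prems by (cases i) auto
  then have "ren (lift_ren f) \<phi> = ren (lift_ren g) \<phi>" by (rule All.IH)
  then show ?case by simp
next
  case (Neg \<phi>)
  have "ren f \<phi> = ren g \<phi>" by (rule Neg.IH) (use Neg.prems in simp)
  then show ?case by simp
next
  case (And \<phi> \<psi>)
  have "ren f \<phi> = ren g \<phi>" by (rule And.IH(1)) (use And.prems in simp)
  moreover have "ren f \<psi> = ren g \<psi>" by (rule And.IH(2)) (use And.prems in simp)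
  ultimately show ?case by simp
qed auto

lemma fv_ren: "fv (ren f \<phi>) = f ` fv \<phi>"
proof (induction \<phi> arbitrary: f)
  case (All \<phi>)
  show ?case
  proof (rule set_eqI, rule iffI)
    fix i assume "i \<in> fv (ren f (All \<phi>))"
    then obtain j where "j \<in> fv \<phi>" "Suc i = lift_ren f j" using All by auto
    then show "i \<in> f ` fv (All \<phi>)" by (cases j) auto
  next
    fix i assume "i \<in> f ` fv (All \<phi>)"
    then obtain j where "Suc j \<in> fv \<phi>" "i = f j" by auto
    then show "i \<in> fv (ren f (All \<phi>))" using All by (auto intro!: image_eqI[of _ _ "Suc j"])
  qed
qed auto

lemma satk_cong: "(\<And>i. i \<in> fv \<phi> \<Longrightarrow> e i = e' i) \<Longrightarrow> satk K m q e \<phi> = satk K m q e' \<phi>"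
proof (induction \<phi> arbitrary: e e')
  case (All \<phi>)
  have "satk K m q (case_nat x e) \<phi> = satk K m q (case_nat x e') \<phi>" for x
    by (rule All.IH) (use All.prems in \<open>auto split: nat.split\<close>)
  then show ?case by simp
next
  case (Neg \<phi>)
  have "satk K m q e \<phi> = satk K m q e' \<phi>" by (rule Neg.IH) (use Neg.prems in simp)
  then show ?case by simp
next
  case (And \<phi> \<psi>)
  have "satk K m q e \<phi> = satk K m q e' \<phi>" by (rule And.IH(1)) (use And.prems in simp)
  moreover have "satk K m q e \<psi> = satk K m q e' \<psi>" by (rule And.IH(2)) (use And.prems in simp)
  ultimately show ?case by simp
qed auto

lemma fv_closed_at: "closed_at n \<phi> \<longleftrightarrow> (\<forall>i\<in>fv \<phi>. i < n)"
proof (induction \<phi> arbitrary: n)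
  case (All \<phi>)
  have "(\<forall>i\<in>fv \<phi>. i < Suc n) \<longleftrightarrow> (\<forall>i. Suc i \<in> fv \<phi> \<longrightarrow> i < n)"
    by (metis Suc_less_eq Suc_pred gr0I zero_less_Suc)
  then show ?case by (simp add: All)
qed auto

section \<open>Soundness and structural properties of derivations\<close>

theorem soundness: "\<Gamma> \<turnstile> \<phi> \<Longrightarrow> \<forall>\<psi>\<in>\<Gamma>. sat E e \<psi> \<Longrightarrow> sat E e \<phi>"
proof (induction arbitrary: e rule: deriv.induct)
  case (NegI \<phi> \<Gamma> \<psi>)
  then show ?case by (metis insert_iff satk.simps(3))
next
  case (NegE \<phi> \<Gamma> \<psi>)
  then show ?case by (metis insert_iff satk.simps(3))
next
  case (AllI \<Gamma> \<phi>)
  then show ?case by (simp add: satk_ren)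
next
  case (AllE \<Gamma> \<phi> t)
  have "(\<lambda>i. e (case i of 0 \<Rightarrow> t | Suc j \<Rightarrow> j)) = case_nat (e t) e"
    by (rule ext) (simp split: nat.split)
  then show ?case using AllE by (simp add: satk_ren)
next
  case (EqSubst \<Gamma> s t \<phi>)
  have "(\<lambda>i. e (case i of 0 \<Rightarrow> r | Suc j \<Rightarrow> j)) = case_nat (e r) e" for r
    by (rule ext) (simp split: nat.split)
  then show ?case using EqSubst.IH(1)[OF EqSubst.prems] EqSubst.IH(2)[OF EqSubst.prems]
    by (simp add: satk_ren)
qed auto

lemma weaken: "\<Gamma> \<turnstile> \<phi> \<Longrightarrow> \<Gamma> \<subseteq> \<Delta> \<Longrightarrow> \<Delta> \<turnstile> \<phi>"
proof (induction arbitrary: \<Delta> rule: deriv.induct)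
  case (AllI \<Gamma> \<phi>)
  then show ?case by (metis deriv.AllI image_mono)
next
  case (NegI \<phi> \<Gamma> \<psi>)
  have "insert \<phi> \<Gamma> \<subseteq> insert \<phi> \<Delta>" using NegI.prems by blast
  then show ?case using NegI.IH by (meson deriv.NegI)
next
  case (NegE \<phi> \<Gamma> \<psi>)
  have "insert (Neg \<phi>) \<Gamma> \<subseteq> insert (Neg \<phi>) \<Delta>" using NegE.prems by blast
  then show ?case using NegE.IH by (meson deriv.NegE)
next
  case (EqSubst \<Gamma> s t \<phi>)
  show ?case
    using deriv.EqSubst[OF EqSubst.IH(1)[OF EqSubst.prems] EqSubst.IH(2)[OF EqSubst.prems]] .
next
  case (AllE \<Gamma> \<phi> t)
  show ?case by (rule deriv.AllE) (rule AllE.IH[OF AllE.prems])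
qed (auto intro: deriv.intros)

text \<open>The renaming need not be injective. It is used to turn a fresh index into the
  eigenvariable 0, and to bring a contradiction back from doubled indices by halving.\<close>

lemma deriv_ren: "\<Gamma> \<turnstile> \<phi> \<Longrightarrow> ren f ` \<Gamma> \<turnstile> ren f \<phi>"
proof (induction arbitrary: f rule: deriv.induct)
  case (AllI \<Gamma> \<phi>)
  have "ren (lift_ren f) ` ren Suc ` \<Gamma> = ren Suc ` ren f ` \<Gamma>"
    by (simp add: image_image ren_ren)
  then show ?case using AllI.IH[of "lift_ren f"] by (auto intro: deriv.AllI)
next
  case (AllE \<Gamma> \<phi> t)
  have "ren f (inst t \<phi>) = inst (f t) (ren (lift_ren f) \<phi>)"
    unfolding ren_ren by (rule ren_cong) (simp split: nat.split)
  then show ?case using AllE.IH[of f] deriv.AllE by force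
next
  case (EqSubst \<Gamma> s t \<phi>)
  have *: "ren f (inst t \<phi>) = inst (f t) (ren (lift_ren f) \<phi>)" for t
    unfolding ren_ren by (rule ren_cong) (simp split: nat.split)
  show ?case using EqSubst.IH[of f] deriv.EqSubst unfolding * by force
qed (auto intro: deriv.intros)

lemma compactness: "\<Gamma> \<turnstile> \<phi> \<Longrightarrow> \<exists>\<Delta>\<subseteq>\<Gamma>. finite \<Delta> \<and> \<Delta> \<turnstile> \<phi>"
proof (induction rule: deriv.induct)
  case (Assm \<phi> \<Gamma>)
  then show ?case by (intro exI[of _ "{\<phi>}"]) (auto intro: deriv.Assm)
next
  case (AndI \<Gamma> \<phi> \<psi>)
  then obtain A B where "A \<subseteq> \<Gamma>" "finite A" "A \<turnstile> \<phi>" "B \<subseteq> \<Gamma>" "finite B" "B \<turnstile> \<psi>" by blast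
  then show ?case by (intro exI[of _ "A \<union> B"]) (auto intro!: deriv.AndI intro: weaken)
next
  case (NegI \<phi> \<Gamma> \<psi>)
  then obtain A B where "A \<subseteq> insert \<phi> \<Gamma>" "finite A" "A \<turnstile> \<psi>" "B \<subseteq> insert \<phi> \<Gamma>" "finite B" "B \<turnstile> Neg \<psi>"
    by blast
  then have "insert \<phi> ((A \<union> B) - {\<phi>}) \<turnstile> \<psi>" "insert \<phi> ((A \<union> B) - {\<phi>}) \<turnstile> Neg \<psi>"
    by (auto elim!: weaken)
  then have "(A \<union> B) - {\<phi>} \<turnstile> Neg \<phi>" by (rule deriv.NegI)
  then show ?case using \<open>A \<subseteq> _\<close> \<open>B \<subseteq> _\<close> \<open>finite A\<close> \<open>finite B\<close>
    by (intro exI[of _ "(A \<union> B) - {\<phi>}"]) auto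
next
  case (NegE \<phi> \<Gamma> \<psi>)
  then obtain A B where "A \<subseteq> insert (Neg \<phi>) \<Gamma>" "finite A" "A \<turnstile> \<psi>"
     "B \<subseteq> insert (Neg \<phi>) \<Gamma>" "finite B" "B \<turnstile> Neg \<psi>"
    by blast
  then have "insert (Neg \<phi>) ((A \<union> B) - {Neg \<phi>}) \<turnstile> \<psi>" "insert (Neg \<phi>) ((A \<union> B) - {Neg \<phi>}) \<turnstile> Neg \<psi>"
    by (auto elim!: weaken)
  then have "(A \<union> B) - {Neg \<phi>} \<turnstile> \<phi>" by (rule deriv.NegE)
  then show ?case using \<open>A \<subseteq> _\<close> \<open>B \<subseteq> _\<close> \<open>finite A\<close> \<open>finite B\<close>
    by (intro exI[of _ "(A \<union> B) - {Neg \<phi>}"]) auto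
next
  case (AllI \<Gamma> \<phi>)
  then obtain A where "A \<subseteq> ren Suc ` \<Gamma>" "finite A" "A \<turnstile> \<phi>" by blast
  moreover obtain B where "B \<subseteq> \<Gamma>" "finite B" "A = ren Suc ` B"
    using finite_subset_image[OF \<open>finite A\<close> \<open>A \<subseteq> _\<close>] by blast
  ultimately show ?case by (meson deriv.AllI)
next
  case (EqSubst \<Gamma> s t \<phi>)
  then obtain A B where "A \<subseteq> \<Gamma>" "finite A" "A \<turnstile> Eq s t" "B \<subseteq> \<Gamma>" "finite B" "B \<turnstile> inst s \<phi>" by blast
  then show ?case by (intro exI[of _ "A \<union> B"]) (auto intro!: deriv.EqSubst[of _ s t] intro: weaken)
next
  case (EqRefl \<Gamma> t)
  then show ?case by (intro exI[of _ "{}"]) (auto intro: deriv.EqRefl)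
next
  case (AndE1 \<Gamma> \<phi> \<psi>)
  then show ?case by (meson deriv.AndE1)
next
  case (AndE2 \<Gamma> \<phi> \<psi>)
  then show ?case by (meson deriv.AndE2)
next
  case (AllE \<Gamma> \<phi> t)
  then obtain A where "A \<subseteq> \<Gamma>" "finite A" "A \<turnstile> All \<phi>" by blast
  then show ?case using deriv.AllE[of A \<phi> t] by blast
qed

lemma cut: "insert \<phi> \<Gamma> \<turnstile> \<psi> \<Longrightarrow> \<Gamma> \<turnstile> \<phi> \<Longrightarrow> \<Gamma> \<turnstile> \<psi>"
proof -
  assume a: "insert \<phi> \<Gamma> \<turnstile> \<psi>" and b: "\<Gamma> \<turnstile> \<phi>"
  have "insert (Neg \<psi>) \<Gamma> \<turnstile> Neg \<phi>"
  proof (rule deriv.NegI)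
    show "insert \<phi> (insert (Neg \<psi>) \<Gamma>) \<turnstile> \<psi>" using a by (rule weaken) auto
    show "insert \<phi> (insert (Neg \<psi>) \<Gamma>) \<turnstile> Neg \<psi>" by (rule deriv.Assm) auto
  qed
  then show ?thesis using b by (meson deriv.NegE subset_insertI weaken)
qed

text \<open>\<open>AllI\<close> wants its eigenvariable at index 0 over a shifted context. The
  renaming that sends \<open>y\<close> to 0 and shifts every other index acts on the context like
  the shift, since \<open>y\<close> does not occur there, and turns the instance at \<open>y\<close>
  back into the body.\<close>

lemma generalize_fresh:
  assumes "\<Gamma> \<turnstile> inst y \<phi>" "\<And>\<psi>. \<psi> \<in> \<Gamma> \<Longrightarrow> y \<notin> fv \<psi>" "y \<notin> fv (All \<phi>)"
  shows "\<Gamma> \<turnstile> All \<phi>"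
proof (rule deriv.AllI)
  let ?f = "\<lambda>i. if i = y then 0 else Suc i"
  have "ren ?f ` \<Gamma> = ren Suc ` \<Gamma>"
    using assms(2) by (intro image_cong refl ren_cong) auto
  moreover have "ren ?f (inst y \<phi>) = \<phi>"
  proof -
    have "ren ?f (inst y \<phi>) = ren (\<lambda>i. i) \<phi>"
      unfolding ren_ren using assms(3) by (intro ren_cong) (auto split: nat.split)
    then show ?thesis by (simp add: ren_id)
  qed
  ultimately show "ren Suc ` \<Gamma> \<turnstile> \<phi>" using deriv_ren[OF assms(1), of ?f] by simp
qed

section \<open>Henkin's construction\<close>

lemma inconsistent_insertD: "\<not> consistent (insert \<phi> \<Gamma>) \<Longrightarrow> \<Gamma> \<turnstile> Neg \<phi>"
  unfolding consistent_def by (blast intro: deriv.NegI)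

lemma inconsistent_insert_NegD: "\<not> consistent (insert (Neg \<phi>) \<Gamma>) \<Longrightarrow> \<Gamma> \<turnstile> \<phi>"
  unfolding consistent_def by (blast intro: deriv.NegE)

lemma consistent_insert: "consistent \<Gamma> \<Longrightarrow> \<Gamma> \<turnstile> \<phi> \<Longrightarrow> consistent (insert \<phi> \<Gamma>)"
  unfolding consistent_def by (blast intro: cut)

instance fm :: countable
  by countable_datatype

text \<open>Variables are the only terms, so a fresh variable takes the role of a Henkin constant
  and the language is not extended. Each formula is decided at the stage given by its code; a
  refuted universal formula receives a counterexample at the same time.\<close>

fun henkin :: "fm set \<Rightarrow> nat \<Rightarrow> fm set" where
  "henkin T 0 = T"
| "henkin T (Suc n) = (let \<phi> = from_nat n; \<Gamma> = henkin T n in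
     if consistent (insert \<phi> \<Gamma>) then insert \<phi> \<Gamma>
     else (case \<phi> of
         All \<chi> \<Rightarrow> insert (Neg (inst (SOME y. \<forall>\<psi>\<in>insert \<phi> \<Gamma>. y \<notin> fv \<psi>) \<chi>)) (insert (Neg \<phi>) \<Gamma>)
       | _ \<Rightarrow> insert (Neg \<phi>) \<Gamma>))"

text \<open>A theory with only even indices leaves the odd ones free. Each stage adds finitely many
  formulas, so all large odd indices stay available as witnesses.\<close>

lemma henkin_fresh:
  assumes "\<forall>\<phi>\<in>T. \<forall>i\<in>fv \<phi>. even i"
  shows "\<exists>N. \<forall>\<phi>\<in>henkin T n. \<forall>i\<in>fv \<phi>. even i \<or> i < N"
proof (induction n)
  case 0
  then show ?case using assms by auto
next
  case (Suc n)
  then obtain N where N: "\<forall>\<phi>\<in>henkin T n. \<forall>i\<in>fv \<phi>. even i \<or> i < N" by blast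
  obtain A where A: "finite A" "henkin T (Suc n) \<subseteq> henkin T n \<union> A"
  proof
    let ?\<phi> = "from_nat n :: fm"
    let ?A = "{?\<phi>, Neg ?\<phi>} \<union> (case ?\<phi> of All \<chi> \<Rightarrow> {Neg (inst (SOME y. \<forall>\<psi>\<in>insert ?\<phi> (henkin T n). y \<notin> fv \<psi>) \<chi>)} | _ \<Rightarrow> {})"
    show "finite ?A" by (simp split: fm.split)
    show "henkin T (Suc n) \<subseteq> henkin T n \<union> ?A" by (auto simp: Let_def split: fm.split)
  qed
  have "finite (\<Union>(fv ` A))" using A finite_fv by blast
  then obtain M where M: "\<forall>i\<in>\<Union>(fv ` A). i < M" using finite_nat_set_iff_bounded by blast
  show ?case
    by (rule exI[of _ "max M N"]) (use A(2) M N in \<open>fastforce simp: less_max_iff_disj\<close>)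
qed

lemma henkin_some_fresh:
  assumes "\<forall>\<phi>\<in>T. \<forall>i\<in>fv \<phi>. even i"
  shows "\<forall>\<psi>\<in>insert \<phi> (henkin T n). (SOME y. \<forall>\<psi>\<in>insert \<phi> (henkin T n). y \<notin> fv \<psi>) \<notin> fv \<psi>"
proof -
  obtain N where N: "\<forall>\<phi>\<in>henkin T n. \<forall>i\<in>fv \<phi>. even i \<or> i < N" using henkin_fresh[OF assms] by blast
  obtain M where M: "\<forall>i\<in>fv \<phi>. i < M" using finite_fv finite_nat_set_iff_bounded by blast
  have "\<forall>\<psi>\<in>insert \<phi> (henkin T n). 2 * (M + N) + 1 \<notin> fv \<psi>"
    using M N by fastforce
  then show ?thesis by (rule someI)
qed

text \<open>The delicate case adds a counterexample to a refuted \<open>All \<chi>\<close>. Were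
  this inconsistent, the instance at the fresh index would be derivable, hence
  \<open>All \<chi>\<close> itself by \<open>generalize_fresh\<close>.\<close>

lemma henkin_consistent:
  assumes T: "consistent T" and ev: "\<forall>\<phi>\<in>T. \<forall>i\<in>fv \<phi>. even i"
  shows "consistent (henkin T n)"
proof (induction n)
  case 0
  then show ?case using T by simp
next
  case (Suc n)
  let ?\<phi> = "from_nat n :: fm"
  let ?\<Gamma> = "henkin T n"
  let ?y = "SOME y. \<forall>\<psi>\<in>insert ?\<phi> ?\<Gamma>. y \<notin> fv \<psi>"
  show ?case
  proof (cases "consistent (insert ?\<phi> ?\<Gamma>)")
    case True
    then show ?thesis by (simp add: Let_def)
  next
    case False
    then have neg: "?\<Gamma> \<turnstile> Neg ?\<phi>" by (rule inconsistent_insertD)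
    then have c: "consistent (insert (Neg ?\<phi>) ?\<Gamma>)" using Suc by (rule consistent_insert[rotated])
    have "consistent (insert (Neg (inst ?y \<chi>)) (insert (Neg ?\<phi>) ?\<Gamma>))" if chi: "?\<phi> = All \<chi>" for \<chi>
    proof (rule ccontr)
      assume "\<not> ?thesis"
      then have "insert (Neg ?\<phi>) ?\<Gamma> \<turnstile> inst ?y \<chi>" by (rule inconsistent_insert_NegD)
      moreover have fr: "\<forall>\<psi>\<in>insert ?\<phi> ?\<Gamma>. ?y \<notin> fv \<psi>" by (rule henkin_some_fresh[OF ev])
      ultimately have "insert (Neg ?\<phi>) ?\<Gamma> \<turnstile> All \<chi>" using chi
        by (intro generalize_fresh[where y = ?y]) auto
      moreover have "insert (Neg ?\<phi>) ?\<Gamma> \<turnstile> Neg (All \<chi>)" using chi by (intro deriv.Assm) auto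
      ultimately show False using c unfolding consistent_def by blast
    qed
    then show ?thesis using False c by (auto simp: Let_def split: fm.split)
  qed
qed

lemma henkin_mono: "n \<le> k \<Longrightarrow> henkin T n \<subseteq> henkin T k"
proof (induction k rule: dec_induct)
  case (step k)
  have "henkin T k \<subseteq> henkin T (Suc k)" by (auto simp: Let_def split: fm.split)
  then show ?case using step by blast
qed simp

text \<open>The elements of the term model are the indices themselves, so an assignment is a
  renaming and truth under it is membership of the renamed formula in the maximal consistent set
  \<open>H\<close>.\<close>

lemma term_model:
  assumes T: "consistent T" and ev: "\<forall>\<phi>\<in>T. \<forall>i\<in>fv \<phi>. even i"
  shows "\<exists>H. T \<subseteq> H \<and> (\<forall>\<phi>. H \<turnstile> \<phi> \<longrightarrow> \<phi> \<in> H) \<and>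
    (\<forall>\<phi> f. satk UNIV (\<lambda>i j. Mem i j \<in> H) (\<lambda>i j. Eq i j \<in> H) f \<phi> \<longleftrightarrow> ren f \<phi> \<in> H)"
proof -
  define H where "H = (\<Union>n. henkin T n)"
  have con: "consistent H"
    unfolding consistent_def
  proof (rule notI, elim exE conjE)
    fix \<phi> assume "H \<turnstile> \<phi>" "H \<turnstile> Neg \<phi>"
    then obtain A B where AB: "A \<subseteq> H" "finite A" "A \<turnstile> \<phi>" "B \<subseteq> H" "finite B" "B \<turnstile> Neg \<phi>"
      by (meson compactness)
    have "\<exists>n. C \<subseteq> henkin T n" if "finite C" "C \<subseteq> H" for C
      using that
    proof (induction rule: finite_induct)
      case (insert x F)
      then obtain n k where "F \<subseteq> henkin T n" "x \<in> henkin T k" unfolding H_def by blast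
      then have "insert x F \<subseteq> henkin T (max n k)"
        using henkin_mono[of n "max n k"] henkin_mono[of k "max n k"] by force
      then show ?case by blast
    qed simp
    then obtain n where "A \<union> B \<subseteq> henkin T n" using AB by (meson Un_least finite_UnI)
    then have "henkin T n \<turnstile> \<phi>" "henkin T n \<turnstile> Neg \<phi>" using AB weaken by auto
    then show False using henkin_consistent[OF T ev] unfolding consistent_def by blast
  qed
  have ded: "\<phi> \<in> H" if "H \<turnstile> \<phi>" for \<phi>
  proof (rule ccontr)
    obtain n where n: "\<phi> = from_nat n" by (metis from_nat_to_nat)
    assume "\<phi> \<notin> H"
    then have "\<phi> \<notin> henkin T (Suc n)" unfolding H_def by blast
    then have "Neg \<phi> \<in> henkin T (Suc n)" using n by (auto simp: Let_def split: if_splits fm.splits)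
    then have "Neg \<phi> \<in> H" unfolding H_def by blast
    then have "H \<turnstile> Neg \<phi>" by (rule deriv.Assm)
    with that con show False unfolding consistent_def by blast
  qed
  have neg: "Neg \<phi> \<in> H \<longleftrightarrow> \<phi> \<notin> H" for \<phi>
  proof
    assume "Neg \<phi> \<in> H"
    then show "\<phi> \<notin> H" using con unfolding consistent_def by (meson deriv.Assm)
  next
    obtain n where n: "\<phi> = from_nat n" by (metis from_nat_to_nat)
    assume "\<phi> \<notin> H"
    then have "\<phi> \<notin> henkin T (Suc n)" unfolding H_def by blast
    then have "Neg \<phi> \<in> henkin T (Suc n)" using n by (auto simp: Let_def split: if_splits fm.splits)
    then show "Neg \<phi> \<in> H" unfolding H_def by blast
  qed
  have all: "All \<chi> \<in> H \<longleftrightarrow> (\<forall>y. inst y \<chi> \<in> H)" for \<chi>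
  proof
    assume "All \<chi> \<in> H"
    then show "\<forall>y. inst y \<chi> \<in> H" using ded[OF deriv.AllE[OF deriv.Assm]] by blast
  next
    assume a: "\<forall>y. inst y \<chi> \<in> H"
    obtain n where n: "All \<chi> = from_nat n" by (metis from_nat_to_nat)
    show "All \<chi> \<in> H"
    proof (rule ccontr)
      assume "All \<chi> \<notin> H"
      then have "All \<chi> \<notin> henkin T (Suc n)" unfolding H_def by blast
      then have "\<exists>y. Neg (inst y \<chi>) \<in> henkin T (Suc n)"
        by (auto simp: Let_def n[symmetric] split: if_splits)
      then show False using a neg unfolding H_def by blast
    qed
  qed
  have "satk UNIV (\<lambda>i j. Mem i j \<in> H) (\<lambda>i j. Eq i j \<in> H) f \<phi> \<longleftrightarrow> ren f \<phi> \<in> H" for f \<phi>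
  proof (induction \<phi> arbitrary: f)
    case (And \<phi> \<psi>)
    have "And a b \<in> H \<longleftrightarrow> a \<in> H \<and> b \<in> H" for a b
      by (meson ded deriv.AndE1 deriv.AndE2 deriv.AndI deriv.Assm)
    then show ?case using And by simp
  next
    case (All \<phi>)
    have "inst y (ren (lift_ren f) \<phi>) = ren (case_nat y f) \<phi>" for y
      unfolding ren_ren by (rule ren_cong) (auto split: nat.split)
    then show ?case using All by (simp add: all)
  qed (simp_all add: neg)
  moreover have "T \<subseteq> H" unfolding H_def using henkin.simps(1) by blast
  ultimately show ?thesis using ded by (intro exI[of _ H]) blast
qed

text \<open>The quotient is realised on \<^typ>\<open>nat\<close>, so that
  it can be treated as a structure with domain \<^term>\<open>UNIV\<close>.\<close>

lemma quotient_structure: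
  fixes K :: "'a::countable set"
  assumes refl: "\<And>x. x \<in> K \<Longrightarrow> q x x"
    and sym: "\<And>x y. x \<in> K \<Longrightarrow> y \<in> K \<Longrightarrow> q x y \<Longrightarrow> q y x"
    and trans: "\<And>x y z. x \<in> K \<Longrightarrow> y \<in> K \<Longrightarrow> z \<in> K \<Longrightarrow> q x y \<Longrightarrow> q y z \<Longrightarrow> q x z"
    and cong: "\<And>x y x' y'. x \<in> K \<Longrightarrow> y \<in> K \<Longrightarrow> x' \<in> K \<Longrightarrow> y' \<in> K \<Longrightarrow> q x x' \<Longrightarrow> q y y' \<Longrightarrow> m x y \<Longrightarrow> m x' y'"
    and inf: "\<And>F. finite F \<Longrightarrow> F \<subseteq> K \<Longrightarrow> \<exists>x\<in>K. \<forall>y\<in>F. \<not> q x y"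
  shows "\<exists>E h. h ` K = (UNIV :: nat set) \<and> (\<forall>x\<in>K. \<forall>y\<in>K. h x = h y \<longleftrightarrow> q x y) \<and>
    (\<forall>x\<in>K. \<forall>y\<in>K. E (h x) (h y) \<longleftrightarrow> m x y)"
proof -
  define cl where "cl x = {y \<in> K. q x y}" for x
  have cl: "cl x = cl y \<longleftrightarrow> q x y" if "x \<in> K" "y \<in> K" for x y
    unfolding cl_def using that refl sym trans by blast
  \<comment> \<open>Infinitely many classes are needed to enumerate them by all of
    \<open>nat\<close>.\<close>
  have inf': "infinite (cl ` K)"
  proof
    assume "finite (cl ` K)"
    then obtain F where F: "F \<subseteq> K" "finite F" "cl ` K = cl ` F"
      by (meson finite_subset_image subset_refl)
    then obtain x where "x \<in> K" "\<forall>y\<in>F. \<not> q x y" using inf[OF F(2,1)] by blast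
    moreover have "cl x \<in> cl ` F" using F \<open>x \<in> K\<close> by blast
    ultimately show False using cl F(1) by blast
  qed
  have "countable (cl ` K)" by simp
  then have bij: "bij_betw (to_nat_on (cl ` K)) (cl ` K) UNIV"
    using inf' by (rule to_nat_on_infinite)
  define h where "h x = to_nat_on (cl ` K) (cl x)" for x
  have h1: "h ` K = UNIV" using bij unfolding h_def bij_betw_def by (metis image_image)
  have h2: "h x = h y \<longleftrightarrow> q x y" if "x \<in> K" "y \<in> K" for x y
    using inj_on_eq_iff[OF bij_betw_imp_inj_on[OF bij], of "cl x" "cl y"] cl[OF that] that
    unfolding h_def by simp
  define E where "E a b \<longleftrightarrow> (\<exists>x\<in>K. \<exists>y\<in>K. h x = a \<and> h y = b \<and> m x y)" for a b
  have "E (h x) (h y) \<longleftrightarrow> m x y" if "x \<in> K" "y \<in> K" for x y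
    unfolding E_def using that h2 cong by blast
  then show ?thesis using h1 h2 by blast
qed

lemma satk_quotient:
  assumes "h ` K = UNIV" "\<forall>x\<in>K. \<forall>y\<in>K. h x = h y \<longleftrightarrow> q x y"
    "\<forall>x\<in>K. \<forall>y\<in>K. E (h x) (h y) \<longleftrightarrow> m x y" "\<And>i. e i \<in> K"
  shows "satk K m q e \<phi> \<longleftrightarrow> sat E (\<lambda>i. h (e i)) \<phi>"
  using assms(4)
proof (induction \<phi> arbitrary: e)
  case (All \<phi>)
  have "(\<lambda>i. h (case_nat x e i)) = case_nat (h x) (\<lambda>i. h (e i))" for x
    by (rule ext) (simp split: nat.split)
  moreover have "satk K m q (case_nat x e) \<phi> \<longleftrightarrow> sat E (\<lambda>i. h (case_nat x e i)) \<phi>" if "x \<in> K" for x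
    using that All.prems by (intro All.IH) (simp split: nat.split)
  ultimately have "(\<forall>x\<in>K. satk K m q (case_nat x e) \<phi>) \<longleftrightarrow> (\<forall>a\<in>h ` K. sat E (case_nat a (\<lambda>i. h (e i))) \<phi>)"
    by simp
  then show ?case using assms(1) by simp
qed (use assms in auto)

section \<open>Evaluating schemes\<close>

text \<open>The value of a scheme at depth \<open>n\<close>: \<open>v\<close> assigns values to the levels below \<open>n\<close>, and \<open>w\<close> to
  the de Bruijn indices that point outside of the scheme.\<close>

definition hold :: "'a set \<Rightarrow> ('a \<Rightarrow> 'a \<Rightarrow> bool) \<Rightarrow> ('a \<Rightarrow> 'a \<Rightarrow> bool) \<Rightarrow> (nat \<Rightarrow> 'a) \<Rightarrow> scheme \<Rightarrow> nat \<Rightarrow> (nat \<Rightarrow> 'a) \<Rightarrow> bool" where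
  "hold K m q w A n v = satk K m q (\<lambda>i. if i < n then v (n - 1 - i) else w (i - n)) (A n)"

lemma hold_mem: "x < n \<Longrightarrow> y < n \<Longrightarrow> hold K m q w (x \<^bold>\<in> y) n v = m (v x) (v y)"
  by (simp add: hold_def mem_def)

lemma hold_eq: "x < n \<Longrightarrow> y < n \<Longrightarrow> hold K m q w (x \<^bold>= y) n v = q (v x) (v y)"
  by (simp add: hold_def eq_def)

lemma hold_neg: "hold K m q w (\<^bold>\<not> A) n v = (\<not> hold K m q w A n v)"
  by (simp add: hold_def neg_def)

lemma hold_conj: "hold K m q w (A \<^bold>\<and> B) n v = (hold K m q w A n v \<and> hold K m q w B n v)"
  by (simp add: hold_def conj_def)

lemma hold_all: "hold K m q w (all A) n v = (\<forall>x\<in>K. hold K m q w (A n) (Suc n) (v(n := x)))"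
proof -
  have "case_nat x (\<lambda>i. if i < n then v (n - 1 - i) else w (i - n))
    = (\<lambda>i. if i < Suc n then (v(n := x)) (Suc n - 1 - i) else w (i - Suc n))" for x
    by (rule ext) (auto split: nat.split)
  then show ?thesis by (simp add: hold_def all_def)
qed

lemma hold_disj: "hold K m q w (A \<^bold>\<or> B) n v = (hold K m q w A n v \<or> hold K m q w B n v)"
  by (simp add: disj_def hold_neg hold_conj)

lemma hold_imp: "hold K m q w (A \<^bold>\<longrightarrow> B) n v = (hold K m q w A n v \<longrightarrow> hold K m q w B n v)"
  by (simp add: imp_def hold_neg hold_conj)

lemma hold_iff: "hold K m q w (A \<^bold>\<longleftrightarrow> B) n v = (hold K m q w A n v \<longleftrightarrow> hold K m q w B n v)"
  by (auto simp add: iff_def hold_imp hold_conj)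

lemma hold_ex: "hold K m q w (ex A) n v = (\<exists>x\<in>K. hold K m q w (A n) (Suc n) (v(n := x)))"
  by (simp add: ex_def hold_neg hold_all)

lemmas hold_basic = hold_mem hold_eq hold_neg hold_conj hold_all hold_disj hold_imp hold_iff hold_ex

lemma satk_hold: "satk K m q e (sentence A) = hold K m q e A 0 v"
  by (simp add: hold_def)

text \<open>Pairing and union collect the finite set \<open>F\<close> into one element
  \<open>u\<close>. If \<open>u\<close> were equal to a member of \<open>F\<close> it would be a
  member of itself, which foundation and singletons exclude. The argument runs modulo
  \<open>q\<close>, since equality is not yet identity.\<close>

lemma infinite_quotient:
  assumes cong: "\<And>x y x' y'. x \<in> K \<Longrightarrow> y \<in> K \<Longrightarrow> x' \<in> K \<Longrightarrow> y' \<in> K \<Longrightarrow> q x x' \<Longrightarrow> q y y' \<Longrightarrow> m x y \<Longrightarrow> m x' y'"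
    and refl: "\<And>x. x \<in> K \<Longrightarrow> q x x"
    and sym: "\<And>x y. x \<in> K \<Longrightarrow> y \<in> K \<Longrightarrow> q x y \<Longrightarrow> q y x"
    and ax: "satk K m q e (sentence pairing)" "satk K m q e (sentence union_ax)"
      "satk K m q e (sentence foundation)"
    and ne: "K \<noteq> {}"
    and F: "finite F" "F \<subseteq> K"
  shows "\<exists>x\<in>K. \<forall>y\<in>F. \<not> q x y"
proof -
  have P: "\<exists>z\<in>K. \<forall>u\<in>K. m u z \<longleftrightarrow> q u x \<or> q u y" if "x \<in> K" "y \<in> K" for x y
    using ax(1) that unfolding satk_hold[where v = e] pairing_def by (simp add: hold_basic)
  have U: "\<exists>y\<in>K. \<forall>z\<in>K. m z y \<longleftrightarrow> (\<exists>u\<in>K. m u x \<and> m z u)" if "x \<in> K" for x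
    using ax(2) that unfolding satk_hold[where v = e] union_ax_def by (simp add: hold_basic)
  have FD: "(\<exists>y\<in>K. m y x) \<longrightarrow> (\<exists>y\<in>K. m y x \<and> (\<forall>z\<in>K. m z y \<longrightarrow> \<not> m z x))" if "x \<in> K" for x
    using ax(3) that unfolding satk_hold[where v = e] foundation_def by (simp add: hold_basic)
  have "\<exists>u\<in>K. \<forall>x\<in>F. m x u" using F
  proof (induction rule: finite_induct)
    case empty
    then show ?case using ne by blast
  next
    case (insert a F)
    then obtain u where u: "u \<in> K" "\<forall>x\<in>F. m x u" by auto
    obtain a' where a': "a' \<in> K" "\<forall>z\<in>K. m z a' \<longleftrightarrow> q z a \<or> q z a" using P[of a a] insert.prems by blast
    obtain w where w: "w \<in> K" "\<forall>z\<in>K. m z w \<longleftrightarrow> q z u \<or> q z a'" using P[OF u(1) a'(1)] by blast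
    obtain t where t: "t \<in> K" "\<forall>z\<in>K. m z t \<longleftrightarrow> (\<exists>r\<in>K. m r w \<and> m z r)" using U[OF w(1)] by blast
    have "m a t" using t w a' insert refl by blast
    moreover have "m x t" if "x \<in> F" for x using that t w u insert refl by blast
    ultimately show ?case using t by blast
  qed
  then obtain u where u: "u \<in> K" "\<forall>x\<in>F. m x u" by blast
  have irr: "\<not> m x x" if "x \<in> K" for x
  proof
    assume "m x x"
    obtain s where s: "s \<in> K" "\<forall>z\<in>K. m z s \<longleftrightarrow> q z x \<or> q z x" using P[OF \<open>x \<in> K\<close> \<open>x \<in> K\<close>] by blast
    then have ms: "m x s" using that refl by simp
    then obtain y where y: "y \<in> K" "m y s" "\<forall>z\<in>K. m z y \<longrightarrow> \<not> m z s"
      using FD[OF s(1)] \<open>x \<in> K\<close> by blast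
    have "q y x" using s y by blast
    then have "m x y" using \<open>m x x\<close> that y sym refl cong by metis
    then show False using y(3) ms that by blast
  qed
  have "\<not> q u y" if "y \<in> F" for y
  proof
    assume "q u y"
    then have "m u u" using u that F cong refl sym by (meson subsetD)
    then show False using irr u by blast
  qed
  then show ?thesis using u by blast
qed

theorem completeness:
  assumes T: "consistent T" and "{sentence pairing, sentence union_ax, sentence foundation} \<subseteq> T"
  shows "\<exists>(E :: nat \<Rightarrow> nat \<Rightarrow> bool) e. \<forall>\<phi>\<in>T. sat E e \<phi>"
proof -
  \<comment> \<open>Doubling frees the odd indices for the Henkin witnesses; halving undoes
    it.\<close>
  let ?f = "\<lambda>i::nat. 2 * i"
  have "consistent (ren ?f ` T)"
    unfolding consistent_def
  proof (rule notI, elim exE conjE)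
    fix \<phi> assume "ren ?f ` T \<turnstile> \<phi>" "ren ?f ` T \<turnstile> Neg \<phi>"
    from this[THEN deriv_ren, of "\<lambda>i. i div 2"]
    show False using T by (simp add: image_image ren_ren ren_id consistent_def)
  qed
  moreover have "\<forall>\<phi>\<in>ren ?f ` T. \<forall>i\<in>fv \<phi>. even i" by (auto simp: fv_ren)
  ultimately obtain H where H: "ren ?f ` T \<subseteq> H" "\<And>\<phi>. H \<turnstile> \<phi> \<Longrightarrow> \<phi> \<in> H"
    "\<And>\<phi> f. satk UNIV (\<lambda>i j. Mem i j \<in> H) (\<lambda>i j. Eq i j \<in> H) f \<phi> \<longleftrightarrow> ren f \<phi> \<in> H"
    using term_model by metis
  let ?m = "\<lambda>i j. Mem i j \<in> H" and ?q = "\<lambda>i j. Eq i j \<in> H"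
  have T: "satk UNIV ?m ?q ?f \<phi>" if "\<phi> \<in> T" for \<phi> using that H(1,3) by blast
  have sub: "inst t \<phi> \<in> H" if "?q s t" "inst s \<phi> \<in> H" for s t \<phi>
    by (rule H(2), rule deriv.EqSubst) (rule deriv.Assm[OF that(1)], rule deriv.Assm[OF that(2)])
  have refl: "?q x x" for x by (meson H(2) deriv.EqRefl)
  \<comment> \<open>Instantiating index 0 lowers the other indices by one, so \<open>Suc x\<close>
    stands for \<open>x\<close>: the two instances are \<open>Eq x x\<close> and
    \<open>Eq y x\<close>.\<close>
  have sym: "?q y x" if "?q x y" for x y
    using sub[OF that, of "Eq 0 (Suc x)"] refl[of x] by simp
  have trans: "?q x z" if "?q x y" "?q y z" for x y z
    using sub[OF that(2), of "Eq (Suc x) 0"] that(1) by simp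
  have cong: "?m x' y'" if "?q x x'" "?q y y'" "?m x y" for x x' y y'
    using sub[OF that(1), of "Mem 0 (Suc y)"] sub[OF that(2), of "Mem (Suc x') 0"] that(3) by simp
  have inf: "\<exists>x\<in>UNIV. \<forall>y\<in>F. \<not> ?q x y" if "finite F" for F
    by (rule infinite_quotient[where m = ?m and e = ?f])
      (use T assms that refl in \<open>auto intro: cong sym\<close>)
  have "\<exists>E h. h ` UNIV = (UNIV :: nat set) \<and> (\<forall>x\<in>UNIV. \<forall>y\<in>UNIV. h x = h y \<longleftrightarrow> ?q x y) \<and>
    (\<forall>x\<in>UNIV. \<forall>y\<in>UNIV. E (h x) (h y) \<longleftrightarrow> ?m x y)"
  proof (rule quotient_structure)
    show "?q x x" for x by (rule refl)
    show "?q y x" if "?q x y" for x y using that by (rule sym)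
    show "?q x z" if "?q x y" "?q y z" for x y z using that by (rule trans)
    show "?m x' y'" if "?q x x'" "?q y y'" "?m x y" for x x' y y' using that by (rule cong)
    show "\<exists>x\<in>UNIV. \<forall>y\<in>F. \<not> ?q x y" if "finite F" for F using that by (rule inf)
  qed
  then obtain E h where Eh: "h ` UNIV = (UNIV :: nat set)" "\<forall>x\<in>UNIV. \<forall>y\<in>UNIV. h x = h y \<longleftrightarrow> ?q x y"
    "\<forall>x\<in>UNIV. \<forall>y\<in>UNIV. E (h x) (h y) \<longleftrightarrow> ?m x y"
    by (elim exE conjE)
  show ?thesis using T satk_quotient[OF Eh] by blast
qed

section \<open>Models of ZF\<close>

text \<open>Both schemas admit an arbitrary assignment as parameters. As a formula has finitely many
  free indices, this is the same as the axioms with explicitly quantified parameters.\<close>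

locale zf =
  fixes E :: "'a \<Rightarrow> 'a \<Rightarrow> bool" (infix "\<epsilon>" 50)
  assumes extensional: "(\<And>z. z \<epsilon> x \<longleftrightarrow> z \<epsilon> y) \<Longrightarrow> x = y"
    and foundation: "y \<epsilon> x \<Longrightarrow> \<exists>y. y \<epsilon> x \<and> (\<forall>z. z \<epsilon> y \<longrightarrow> \<not> z \<epsilon> x)"
    and pairing: "\<exists>z. \<forall>u. u \<epsilon> z \<longleftrightarrow> u = x \<or> u = y"
    and union: "\<exists>y. \<forall>z. z \<epsilon> y \<longleftrightarrow> (\<exists>u. u \<epsilon> x \<and> z \<epsilon> u)"
    and powerset: "\<exists>y. \<forall>z. z \<epsilon> y \<longleftrightarrow> (\<forall>u. u \<epsilon> z \<longrightarrow> u \<epsilon> x)"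
    and infinity: "\<exists>w. (\<exists>z. (\<forall>u. \<not> u \<epsilon> z) \<and> z \<epsilon> w) \<and>
      (\<forall>x. x \<epsilon> w \<longrightarrow> (\<exists>y. (\<forall>u. u \<epsilon> y \<longleftrightarrow> u \<epsilon> x \<or> u = x) \<and> y \<epsilon> w))"
    and separation: "\<exists>b. \<forall>x. x \<epsilon> b \<longleftrightarrow> x \<epsilon> a \<and> sat E (case_nat x e) \<phi>"
    and replacement: "(\<forall>x y z. x \<epsilon> a \<and> sat E (case_nat x (case_nat y e)) \<phi> \<and>
        sat E (case_nat x (case_nat z e)) \<phi> \<longrightarrow> y = z) \<Longrightarrow>
      \<exists>b. \<forall>y. y \<epsilon> b \<longleftrightarrow> (\<exists>x. x \<epsilon> a \<and> sat E (case_nat x (case_nat y e)) \<phi>)"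
begin

subsection \<open>Definability with parameters\<close>

text \<open>An index of a formula is interpreted either by a variable (\<^const>\<open>Inl\<close>) or by a parameter
  (\<^const>\<open>Inr\<close>).\<close>

definition asg :: "(nat \<Rightarrow> nat + 'a) \<Rightarrow> (nat \<Rightarrow> 'a) \<Rightarrow> nat \<Rightarrow> 'a" where
  "asg r e i = (case r i of Inl j \<Rightarrow> e j | Inr c \<Rightarrow> c)"

text \<open>Formulas are hardly ever written out: definability with parameters is closed under
  connectives, quantifiers and substitution of definable terms, and the rules in \<open>dfs\<close>
  follow the shape of the predicate.\<close>

definition dfn :: "((nat \<Rightarrow> 'a) \<Rightarrow> bool) \<Rightarrow> bool" where
  "dfn P \<longleftrightarrow> (\<exists>\<phi> r. \<forall>e. P e \<longleftrightarrow> sat E (asg r e) \<phi>)"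

definition df :: "((nat \<Rightarrow> 'a) \<Rightarrow> 'a) \<Rightarrow> bool" where
  "df t \<longleftrightarrow> dfn (\<lambda>e. e 0 = t (\<lambda>i. e (Suc i)))"

named_theorems dfs

lemma dfnI: "(\<And>e. P e \<longleftrightarrow> sat E (asg r e) \<phi>) \<Longrightarrow> dfn P"
  unfolding dfn_def by blast

lemma dfn_asg: "dfn P \<Longrightarrow> dfn (\<lambda>e. P (asg r e))"
proof -
  assume "dfn P"
  then obtain \<phi> s where P: "\<And>e. P e \<longleftrightarrow> sat E (asg s e) \<phi>" unfolding dfn_def by blast
  show ?thesis
  proof (rule dfnI)
    fix e
    have "asg s (asg r e) = asg (\<lambda>i. case s i of Inl j \<Rightarrow> r j | Inr c \<Rightarrow> Inr c) e"
      by (rule ext) (simp add: asg_def split: sum.split)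
    then show "P (asg r e) \<longleftrightarrow> sat E (asg (\<lambda>i. case s i of Inl j \<Rightarrow> r j | Inr c \<Rightarrow> Inr c) e) \<phi>"
      by (simp add: P)
  qed
qed

lemma dfn_ren: "dfn P \<Longrightarrow> dfn (\<lambda>e. P (\<lambda>i. e (f i)))"
  using dfn_asg[of P "\<lambda>i. Inl (f i)"] by (simp add: asg_def[abs_def])

lemma dfn_mem0: "dfn (\<lambda>e. e i \<epsilon> e j)"
  by (rule dfnI[where \<phi> = "Mem i j" and r = Inl]) (simp add: asg_def)

lemma dfn_eq0: "dfn (\<lambda>e. e i = e j)"
  by (rule dfnI[where \<phi> = "Eq i j" and r = Inl]) (simp add: asg_def)

lemma dfn_not [dfs]: "dfn P \<Longrightarrow> dfn (\<lambda>e. \<not> P e)"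
proof -
  assume "dfn P"
  then obtain \<phi> r where P: "\<And>e. P e \<longleftrightarrow> sat E (asg r e) \<phi>" unfolding dfn_def by blast
  show ?thesis
  proof (rule dfnI)
    fix e
    show "\<not> P e \<longleftrightarrow> sat E (asg r e) (Neg \<phi>)" by (simp only: P satk.simps)
  qed
qed

lemma dfn_conj [dfs]: "dfn P \<Longrightarrow> dfn Q \<Longrightarrow> dfn (\<lambda>e. P e \<and> Q e)"
proof -
  assume "dfn P" "dfn Q"
  then obtain \<phi> r \<psi> s where P: "\<And>e. P e \<longleftrightarrow> sat E (asg r e) \<phi>" and Q: "\<And>e. Q e \<longleftrightarrow> sat E (asg s e) \<psi>"
    unfolding dfn_def by blast
  \<comment> \<open>The two formulas may give one index different meanings; spreading them over the
    even and the odd indices keeps their interpretations apart.\<close>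
  let ?r = "\<lambda>i. if even i then r (i div 2) else s (i div 2)"
  show ?thesis
  proof (rule dfnI)
    fix e
    have "(\<lambda>i. asg ?r e (2 * i)) = asg r e" "(\<lambda>i. asg ?r e (2 * i + 1)) = asg s e"
      by (rule ext, simp add: asg_def)+
    then show "P e \<and> Q e \<longleftrightarrow> sat E (asg ?r e) (And (ren (\<lambda>i. 2 * i) \<phi>) (ren (\<lambda>i. 2 * i + 1) \<psi>))"
      by (simp only: P Q satk.simps satk_ren)
  qed
qed

lemma dfn_disj [dfs]: "dfn P \<Longrightarrow> dfn Q \<Longrightarrow> dfn (\<lambda>e. P e \<or> Q e)"
  using dfn_not[OF dfn_conj[OF dfn_not[of P] dfn_not[of Q]]] by simp

lemma dfn_imp [dfs]: "dfn P \<Longrightarrow> dfn Q \<Longrightarrow> dfn (\<lambda>e. P e \<longrightarrow> Q e)"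
  using dfn_disj[OF dfn_not[of P], of Q] by simp

lemma dfn_iff [dfs]: "dfn P \<Longrightarrow> dfn Q \<Longrightarrow> dfn (\<lambda>e. P e \<longleftrightarrow> Q e)"
  using dfn_conj[OF dfn_imp[of P Q] dfn_imp[of Q P]] by (simp only: iff_conv_conj_imp)

lemma dfn_all [dfs]: "dfn (\<lambda>e. P (\<lambda>i. e (Suc i)) (e 0)) \<Longrightarrow> dfn (\<lambda>e. \<forall>x. P e x)"
proof -
  assume "dfn (\<lambda>e. P (\<lambda>i. e (Suc i)) (e 0))"
  then obtain \<phi> r where P: "\<And>e. P (\<lambda>i. e (Suc i)) (e 0) \<longleftrightarrow> sat E (asg r e) \<phi>"
    unfolding dfn_def by blast
  \<comment> \<open>All indices interpreted by variable 0 are merged into the newly bound index; the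
    others move past the quantifier, and \<open>?r\<close> lowers the surviving variables by
    one.\<close>
  let ?f = "\<lambda>i. if r i = Inl 0 then 0 else Suc i"
  let ?r = "\<lambda>i. case r i of Inl (Suc j) \<Rightarrow> Inl j | x \<Rightarrow> x"
  show ?thesis
  proof (rule dfnI)
    fix e
    have "(\<lambda>i. case_nat x (asg ?r e) (?f i)) = asg r (case_nat x e)" for x
      by (rule ext) (auto simp add: asg_def split: sum.split nat.split)
    moreover have "P e x \<longleftrightarrow> sat E (asg r (case_nat x e)) \<phi>" for x
      using P[of "case_nat x e"] by simp
    ultimately show "(\<forall>x. P e x) \<longleftrightarrow> sat E (asg ?r e) (All (ren ?f \<phi>))"
      by (simp add: satk_ren)
  qed
qed

lemma dfn_ex [dfs]: "dfn (\<lambda>e. P (\<lambda>i. e (Suc i)) (e 0)) \<Longrightarrow> dfn (\<lambda>e. \<exists>x. P e x)"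
  using dfn_not[OF dfn_all[of "\<lambda>e x. \<not> P e x", OF dfn_not]] by simp

lemma dfn_const [dfs]: "dfn (\<lambda>e. b)"
proof (cases b)
  case True
  then show ?thesis using dfn_eq0[of 0 0] by simp
next
  case False
  then show ?thesis using dfn_not[OF dfn_eq0[of 0 0]] by simp
qed

lemma dfn_subst: "dfn (\<lambda>e. P (\<lambda>i. e (Suc i)) (e 0)) \<Longrightarrow> df t \<Longrightarrow> dfn (\<lambda>e. P e (t e))"
proof -
  assume a: "dfn (\<lambda>e. P (\<lambda>i. e (Suc i)) (e 0))" and t: "df t"
  have "dfn (\<lambda>e. \<exists>x. x = t e \<and> P e x)"
    by (rule dfn_ex, rule dfn_conj) (use t a in \<open>simp_all add: df_def\<close>)
  then show ?thesis by simp
qed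

lemma df_shift: "df t \<Longrightarrow> df (\<lambda>e. t (\<lambda>i. e (f i)))"
  unfolding df_def using dfn_ren[of "\<lambda>e. e 0 = t (\<lambda>i. e (Suc i))" "case_nat 0 (\<lambda>i. Suc (f i))"] by simp

lemma dfn_lift1: "dfn (\<lambda>e. R (e 0)) \<Longrightarrow> df t \<Longrightarrow> dfn (\<lambda>e. R (t e))"
  by (rule dfn_subst)

lemma dfn_lift2: "dfn (\<lambda>e. R (e 0) (e 1)) \<Longrightarrow> df t \<Longrightarrow> df s \<Longrightarrow> dfn (\<lambda>e. R (t e) (s e))"
proof (rule dfn_subst[where P = "\<lambda>e x. R x (s e)"])
  assume R: "dfn (\<lambda>e. R (e 0) (e 1))" and s: "df s"
  show "dfn (\<lambda>e. R (e 0) (s (\<lambda>i. e (Suc i))))"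
  proof (rule dfn_subst[where P = "\<lambda>e y. R (e 0) y"])
    show "dfn (\<lambda>e. R (e (Suc 0)) (e 0))"
      using dfn_ren[OF R, of "\<lambda>i. if i = 0 then 1 else 0"] by simp
  qed (use s in \<open>rule df_shift\<close>)
qed

lemma dfn_lift3: "dfn (\<lambda>e. R (e 0) (e 1) (e 2)) \<Longrightarrow> df t \<Longrightarrow> df s \<Longrightarrow> df u \<Longrightarrow> dfn (\<lambda>e. R (t e) (s e) (u e))"
proof (rule dfn_subst[where P = "\<lambda>e x. R x (s e) (u e)"])
  assume R: "dfn (\<lambda>e. R (e 0) (e 1) (e 2))" and s: "df s" and u: "df u"
  show "dfn (\<lambda>e. R (e 0) (s (\<lambda>i. e (Suc i))) (u (\<lambda>i. e (Suc i))))"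
  proof (rule dfn_subst[where P = "\<lambda>e y. R (e 0) y (u (\<lambda>i. e (Suc i)))"])
    show "dfn (\<lambda>e. R (e (Suc 0)) (e 0) (u (\<lambda>i. e (Suc (Suc i)))))"
    proof (rule dfn_subst[where P = "\<lambda>e z. R (e (Suc 0)) (e 0) z"])
      show "dfn (\<lambda>e. R (e (Suc (Suc 0))) (e (Suc 0)) (e 0))"
        using dfn_ren[OF R, of "\<lambda>i. if i = 0 then 2 else if i = 1 then 1 else 0"] by (simp add: numeral_2_eq_2)
    qed (use u in \<open>rule df_shift\<close>)
  qed (use s in \<open>rule df_shift\<close>)
qed

lemma dfn_lift4: "dfn (\<lambda>e. R (e 0) (e 1) (e 2) (e 3)) \<Longrightarrow> df t \<Longrightarrow> df s \<Longrightarrow> df u \<Longrightarrow> df w \<Longrightarrow>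
  dfn (\<lambda>e. R (t e) (s e) (u e) (w e))"
proof (rule dfn_subst[where P = "\<lambda>e x. R (t e) (s e) (u e) x"])
  assume R: "dfn (\<lambda>e. R (e 0) (e 1) (e 2) (e 3))" and t: "df t" and s: "df s" and u: "df u"
  have ts: "df (\<lambda>e. t (\<lambda>i. e (f i)))" "df (\<lambda>e. s (\<lambda>i. e (f i)))" "df (\<lambda>e. u (\<lambda>i. e (f i)))" for f
    using t s u by (auto intro: df_shift)
  show "dfn (\<lambda>e. R (t (\<lambda>i. e (Suc i))) (s (\<lambda>i. e (Suc i))) (u (\<lambda>i. e (Suc i))) (e 0))"
  proof (rule dfn_subst[where P = "\<lambda>e x. R (t (\<lambda>i. e (Suc i))) (s (\<lambda>i. e (Suc i))) x (e 0)"])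
    show "dfn (\<lambda>e. R (t (\<lambda>i. e (Suc (Suc i)))) (s (\<lambda>i. e (Suc (Suc i)))) (e 0) (e (Suc 0)))"
    proof (rule dfn_subst[where P = "\<lambda>e x. R (t (\<lambda>i. e (Suc (Suc i)))) x (e 0) (e (Suc 0))"])
      show "dfn (\<lambda>e. R (t (\<lambda>i. e (Suc (Suc (Suc i))))) (e 0) (e (Suc 0)) (e (Suc (Suc 0))))"
        by (rule dfn_subst[where P = "\<lambda>e x. R x (e 0) (e (Suc 0)) (e (Suc (Suc 0)))"])
          (use R in \<open>simp add: eval_nat_numeral\<close>, rule ts)
    qed (rule ts)
  qed (rule ts)
qed

lemma df_var [dfs]: "df (\<lambda>e. e n)"
  unfolding df_def by (rule dfn_eq0)

lemma df_const [dfs]: "df (\<lambda>e. c)"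
  unfolding df_def using dfn_asg[OF dfn_eq0[of 0 1], of "\<lambda>i. if i = 0 then Inl 0 else Inr c"]
  by (simp add: asg_def)

lemma dfn_mem [dfs]: "df t \<Longrightarrow> df s \<Longrightarrow> dfn (\<lambda>e. t e \<epsilon> s e)"
  by (rule dfn_lift2[of "(\<epsilon>)", OF dfn_mem0])

lemma dfn_eq [dfs]: "df t \<Longrightarrow> df s \<Longrightarrow> dfn (\<lambda>e. t e = s e)"
  by (rule dfn_lift2[of "(=)", OF dfn_eq0])

lemma df_lift1: "df (\<lambda>e. F (e 0)) \<Longrightarrow> df t \<Longrightarrow> df (\<lambda>e. F (t e))"
  unfolding df_def
  by (rule dfn_lift2[of "\<lambda>x y. x = F y" "\<lambda>e. e 0" "\<lambda>e. t (\<lambda>i. e (Suc i))"])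
    (simp_all add: df_var df_shift[unfolded df_def] df_def)

lemma df_lift2: "df (\<lambda>e. F (e 0) (e 1)) \<Longrightarrow> df t \<Longrightarrow> df s \<Longrightarrow> df (\<lambda>e. F (t e) (s e))"
  unfolding df_def[of "\<lambda>e. F (t e) (s e)"]
  by (rule dfn_lift3[of "\<lambda>x y z. x = F y z" "\<lambda>e. e 0" "\<lambda>e. t (\<lambda>i. e (Suc i))" "\<lambda>e. s (\<lambda>i. e (Suc i))"])
    (simp_all add: df_var df_shift df_def[of "\<lambda>e. F (e 0) (e (Suc 0))"] numeral_2_eq_2)

lemma df_lift3: "df (\<lambda>e. F (e 0) (e 1) (e 2)) \<Longrightarrow> df t \<Longrightarrow> df s \<Longrightarrow> df u \<Longrightarrow> df (\<lambda>e. F (t e) (s e) (u e))"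
  unfolding df_def[of "\<lambda>e. F (t e) (s e) (u e)"]
  by (rule dfn_lift4[of "\<lambda>x y z w. x = F y z w" "\<lambda>e. e 0" "\<lambda>e. t (\<lambda>i. e (Suc i))" "\<lambda>e. s (\<lambda>i. e (Suc i))"
      "\<lambda>e. u (\<lambda>i. e (Suc i))"])
    (simp_all add: df_var df_shift df_def[of "\<lambda>e. F (e 0) (e (Suc 0)) (e (Suc (Suc 0)))"] eval_nat_numeral)

lemma df_if [dfs]: "dfn P \<Longrightarrow> df t \<Longrightarrow> df s \<Longrightarrow> df (\<lambda>e. if P e then t e else s e)"
proof -
  assume "dfn P" "df t" "df s"
  then have d: "dfn (\<lambda>e. P (\<lambda>i. e (Suc i)))" "df (\<lambda>e. t (\<lambda>i. e (Suc i)))" "df (\<lambda>e. s (\<lambda>i. e (Suc i)))"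
    by (simp_all add: dfn_ren df_shift)
  have "dfn (\<lambda>e. (P (\<lambda>i. e (Suc i)) \<and> e 0 = t (\<lambda>i. e (Suc i))) \<or>
      (\<not> P (\<lambda>i. e (Suc i)) \<and> e 0 = s (\<lambda>i. e (Suc i))))"
    by (intro dfn_disj dfn_conj dfn_not dfn_eq df_var d)
  then show ?thesis unfolding df_def by (rule back_subst[of dfn]) (rule ext, simp)
qed

lemma set_eq: "x = y \<longleftrightarrow> (\<forall>z. z \<epsilon> x \<longleftrightarrow> z \<epsilon> y)"
  using extensional by blast

text \<open>Extensionality reduces the definability of a set-valued operation to that of membership
  in its values; this treats every operation introduced through \<open>mk\<close>.\<close>

lemma df_eqI: "dfn (\<lambda>e. \<forall>z. z \<epsilon> e 0 \<longleftrightarrow> z \<epsilon> t (\<lambda>i. e (Suc i))) \<Longrightarrow> df t"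
  unfolding df_def by (simp only: set_eq)

subsection \<open>Basic operations\<close>

definition small :: "('a \<Rightarrow> bool) \<Rightarrow> bool" where
  "small P \<longleftrightarrow> (\<exists>a. \<forall>x. x \<epsilon> a \<longleftrightarrow> P x)"

definition mk :: "('a \<Rightarrow> bool) \<Rightarrow> 'a" where
  "mk P = (THE a. \<forall>x. x \<epsilon> a \<longleftrightarrow> P x)"

lemma mem_mk: "small P \<Longrightarrow> x \<epsilon> mk P \<longleftrightarrow> P x"
proof -
  assume "small P"
  then obtain a where a: "\<forall>x. x \<epsilon> a \<longleftrightarrow> P x" unfolding small_def by blast
  have "\<forall>x. x \<epsilon> mk P \<longleftrightarrow> P x" unfolding mk_def by (rule theI[of _ a]) (use a in \<open>auto intro: extensional\<close>)
  then show ?thesis by blast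
qed

lemma small_sub: "dfn (\<lambda>e. P (e 0)) \<Longrightarrow> (\<And>x. P x \<Longrightarrow> x \<epsilon> a) \<Longrightarrow> small P"
proof -
  assume d: "dfn (\<lambda>e. P (e 0))" and a: "\<And>x. P x \<Longrightarrow> x \<epsilon> a"
  obtain \<phi> r where P: "\<And>e. P (e 0) \<longleftrightarrow> sat E (asg r e) \<phi>" using d unfolding dfn_def by blast
  let ?f = "\<lambda>i. if r i = Inl 0 then 0 else Suc i"
  \<comment> \<open>\<open>P\<close> looks at \<open>e 0\<close> only, so the remaining variables
    may take any value.\<close>
  obtain b where b: "\<forall>x. x \<epsilon> b \<longleftrightarrow> x \<epsilon> a \<and> sat E (case_nat x (asg r (\<lambda>_. undefined))) (ren ?f \<phi>)"
    using separation by blast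
  have "(\<lambda>i. case_nat x (asg r (\<lambda>_. undefined)) (?f i)) = asg r (case_nat x (\<lambda>_. undefined))" for x
    by (rule ext) (auto simp: asg_def split: sum.split nat.split)
  then have "\<forall>x. x \<epsilon> b \<longleftrightarrow> P x"
    using b a P[of "case_nat _ (\<lambda>_. undefined)"] by (auto simp: satk_ren)
  then show ?thesis unfolding small_def by blast
qed

lemma small_repl:
  assumes d: "dfn (\<lambda>e. R (e 0) (e 1))"
    and f: "\<And>x y z. x \<epsilon> a \<Longrightarrow> R x y \<Longrightarrow> R x z \<Longrightarrow> y = z"
  shows "small (\<lambda>y. \<exists>x. x \<epsilon> a \<and> R x y)"
proof -
  obtain \<phi> r where P: "\<And>e. R (e 0) (e 1) \<longleftrightarrow> sat E (asg r e) \<phi>" using d unfolding dfn_def by blast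
  let ?f = "\<lambda>i. if r i = Inl 0 then 0 else if r i = Inl 1 then 1 else Suc (Suc i)"
  let ?e = "asg r (\<lambda>_. undefined)"
  have "(\<lambda>i. case_nat x (case_nat y ?e) (?f i)) = asg r (case_nat x (case_nat y (\<lambda>_. undefined)))" for x y
    by (rule ext) (auto simp: asg_def split: sum.split nat.split)
  then have R: "sat E (case_nat x (case_nat y ?e)) (ren ?f \<phi>) \<longleftrightarrow> R x y" for x y
    using P[of "case_nat x (case_nat y (\<lambda>_. undefined))"] by (simp add: satk_ren)
  show ?thesis
    using replacement[of a ?e "ren ?f \<phi>"] f unfolding R small_def by blast
qed

lemma small_img: "df (\<lambda>e. F (e 0)) \<Longrightarrow> small (\<lambda>y. \<exists>x. x \<epsilon> a \<and> y = F x)"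
  using small_repl[of "\<lambda>x y. y = F x" a] dfn_ren[of "\<lambda>e. e 0 = F (e (Suc 0))" "\<lambda>i. if i = 0 then 1 else 0"]
  by (simp add: df_def)

definition emp :: 'a where "emp = mk (\<lambda>_. False)"
definition upair :: "'a \<Rightarrow> 'a \<Rightarrow> 'a" where "upair x y = mk (\<lambda>z. z = x \<or> z = y)"
definition Unn :: "'a \<Rightarrow> 'a" where "Unn x = mk (\<lambda>z. \<exists>u. u \<epsilon> x \<and> z \<epsilon> u)"
definition Pw :: "'a \<Rightarrow> 'a" where "Pw x = mk (\<lambda>z. \<forall>u. u \<epsilon> z \<longrightarrow> u \<epsilon> x)"
definition un :: "'a \<Rightarrow> 'a \<Rightarrow> 'a" where "un x y = Unn (upair x y)"
definition suc :: "'a \<Rightarrow> 'a" where "suc x = un x (upair x x)"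
definition pair :: "'a \<Rightarrow> 'a \<Rightarrow> 'a" where "pair x y = upair (upair x x) (upair x y)"

lemma mem_emp [simp]: "\<not> x \<epsilon> emp"
proof -
  have "small (\<lambda>_. False)" by (rule small_sub[of _ undefined]) (auto intro: dfs)
  then show ?thesis unfolding emp_def by (simp add: mem_mk)
qed

lemma mem_upair [simp]: "z \<epsilon> upair x y \<longleftrightarrow> z = x \<or> z = y"
  unfolding upair_def by (rule mem_mk) (simp add: small_def pairing)

lemma mem_Unn [simp]: "z \<epsilon> Unn x \<longleftrightarrow> (\<exists>u. u \<epsilon> x \<and> z \<epsilon> u)"
  unfolding Unn_def by (rule mem_mk) (simp add: small_def union)

lemma mem_Pw [simp]: "z \<epsilon> Pw x \<longleftrightarrow> (\<forall>u. u \<epsilon> z \<longrightarrow> u \<epsilon> x)"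
  unfolding Pw_def by (rule mem_mk) (simp add: small_def powerset)

lemma mem_un [simp]: "z \<epsilon> un x y \<longleftrightarrow> z \<epsilon> x \<or> z \<epsilon> y"
  unfolding un_def by auto

lemma mem_suc [simp]: "z \<epsilon> suc x \<longleftrightarrow> z \<epsilon> x \<or> z = x"
  unfolding suc_def by auto

lemma upair_eq: "upair a b = upair c d \<longleftrightarrow> (a = c \<and> b = d) \<or> (a = d \<and> b = c)"
  unfolding set_eq[of "upair a b"] by (auto; metis)

lemma pair_inj [simp]: "pair a b = pair c d \<longleftrightarrow> a = c \<and> b = d"
  unfolding pair_def upair_eq by auto

lemma emp_eq: "x = emp \<longleftrightarrow> (\<forall>y. \<not> y \<epsilon> x)"
  unfolding set_eq[of x] by simp

lemma pair_ne [simp]: "pair a b \<noteq> emp" "emp \<noteq> pair a b"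
  unfolding set_eq pair_def by auto

lemma df_upair [dfs]: "df t \<Longrightarrow> df s \<Longrightarrow> df (\<lambda>e. upair (t e) (s e))"
  by (rule df_lift2[of upair]) (rule df_eqI, unfold mem_upair, intro dfs)

lemma df_Unn [dfs]: "df t \<Longrightarrow> df (\<lambda>e. Unn (t e))"
  by (rule df_lift1[of Unn]) (rule df_eqI, unfold mem_Unn, intro dfs)

lemma df_Pw [dfs]: "df t \<Longrightarrow> df (\<lambda>e. Pw (t e))"
  by (rule df_lift1[of Pw]) (rule df_eqI, unfold mem_Pw, intro dfs)

lemma df_un [dfs]: "df t \<Longrightarrow> df s \<Longrightarrow> df (\<lambda>e. un (t e) (s e))"
  unfolding un_def by (intro dfs)

lemma df_suc [dfs]: "df t \<Longrightarrow> df (\<lambda>e. suc (t e))"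
  unfolding suc_def by (intro dfs)

lemma df_pair [dfs]: "df t \<Longrightarrow> df s \<Longrightarrow> df (\<lambda>e. pair (t e) (s e))"
  unfolding pair_def by (intro dfs)

definition prod :: "'a \<Rightarrow> 'a \<Rightarrow> 'a" where
  "prod a b = mk (\<lambda>z. \<exists>x y. x \<epsilon> a \<and> y \<epsilon> b \<and> z = pair x y)"

lemma mem_prod [simp]: "z \<epsilon> prod a b \<longleftrightarrow> (\<exists>x y. x \<epsilon> a \<and> y \<epsilon> b \<and> z = pair x y)"
  unfolding prod_def
  by (rule mem_mk, rule small_sub[of _ "Pw (Pw (un a b))"], intro dfs) (auto simp: pair_def)

lemma df_prod [dfs]: "df t \<Longrightarrow> df s \<Longrightarrow> df (\<lambda>e. prod (t e) (s e))"
  by (rule df_lift2[of prod]) (rule df_eqI, unfold mem_prod, intro dfs)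

lemma pair_mem_UnnD: "pair x y \<epsilon> r \<Longrightarrow> x \<epsilon> Unn (Unn r) \<and> y \<epsilon> Unn (Unn r)"
  unfolding mem_Unn by (metis mem_upair pair_def)

text \<open>The components of a pair, described by their elements; the junk value is the empty set.\<close>

definition fs :: "'a \<Rightarrow> 'a" where "fs z = mk (\<lambda>u. \<exists>x y. z = pair x y \<and> u \<epsilon> x)"
definition sn :: "'a \<Rightarrow> 'a" where "sn z = mk (\<lambda>u. \<exists>x y. z = pair x y \<and> u \<epsilon> y)"

lemma mem_fs: "u \<epsilon> fs z \<longleftrightarrow> (\<exists>x y. z = pair x y \<and> u \<epsilon> x)"
  unfolding fs_def
  by (rule mem_mk, rule small_sub[of _ "Unn (Unn z)"], intro dfs) (metis mem_Unn mem_upair pair_def)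

lemma mem_sn: "u \<epsilon> sn z \<longleftrightarrow> (\<exists>x y. z = pair x y \<and> u \<epsilon> y)"
  unfolding sn_def
  by (rule mem_mk, rule small_sub[of _ "Unn (Unn z)"], intro dfs) (metis mem_Unn mem_upair pair_def)

lemma fs_pair [simp]: "fs (pair x y) = x"
  by (rule extensional) (auto simp: mem_fs)

lemma sn_pair [simp]: "sn (pair x y) = y"
  by (rule extensional) (auto simp: mem_sn)

lemma df_fs [dfs]: "df t \<Longrightarrow> df (\<lambda>e. fs (t e))"
  by (rule df_lift1[of fs]) (rule df_eqI, unfold mem_fs, intro dfs)

lemma df_sn [dfs]: "df t \<Longrightarrow> df (\<lambda>e. sn (t e))"
  by (rule df_lift1[of sn]) (rule df_eqI, unfold mem_sn, intro dfs)

text \<open>The union of all values of the relation \<open>f\<close> at \<open>x\<close>, i.e. the value if it is unique.\<close>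

definition app :: "'a \<Rightarrow> 'a \<Rightarrow> 'a" where "app f x = mk (\<lambda>u. \<exists>y. pair x y \<epsilon> f \<and> u \<epsilon> y)"

lemma mem_app: "u \<epsilon> app f x \<longleftrightarrow> (\<exists>y. pair x y \<epsilon> f \<and> u \<epsilon> y)"
  unfolding app_def
  by (rule mem_mk, rule small_sub[of _ "Unn (Unn (Unn f))"], intro dfs) (meson mem_Unn pair_mem_UnnD)

lemma app_eq: "pair x y \<epsilon> f \<Longrightarrow> (\<And>z. pair x z \<epsilon> f \<Longrightarrow> z = y) \<Longrightarrow> app f x = y"
  unfolding set_eq[of "app f x"] mem_app by blast

lemma df_app [dfs]: "df t \<Longrightarrow> df s \<Longrightarrow> df (\<lambda>e. app (t e) (s e))"
  by (rule df_lift2[of app]) (rule df_eqI, unfold mem_app, intro dfs)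

subsection \<open>Foundation, the natural numbers, recursion\<close>

definition trn :: "'a \<Rightarrow> bool" where "trn t \<longleftrightarrow> (\<forall>x y. x \<epsilon> t \<and> y \<epsilon> x \<longrightarrow> y \<epsilon> t)"

lemma dfn_trn [dfs]: "df t \<Longrightarrow> dfn (\<lambda>e. trn (t e))"
  by (rule dfn_lift1[of trn]) (unfold trn_def, intro dfs)

definition indset :: "'a \<Rightarrow> bool" where
  "indset v \<longleftrightarrow> emp \<epsilon> v \<and> (\<forall>x. x \<epsilon> v \<longrightarrow> suc x \<epsilon> v)"

definition om :: 'a where "om = mk (\<lambda>n. \<forall>v. indset v \<longrightarrow> n \<epsilon> v)"

lemma dfn_indset [dfs]: "df t \<Longrightarrow> dfn (\<lambda>e. indset (t e))"
  by (rule dfn_lift1[of indset]) (unfold indset_def, intro dfs)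

lemma indset_ex: "\<exists>w. indset w"
proof -
  obtain w where w: "(\<exists>z. (\<forall>u. \<not> u \<epsilon> z) \<and> z \<epsilon> w) \<and>
      (\<forall>x. x \<epsilon> w \<longrightarrow> (\<exists>y. (\<forall>u. u \<epsilon> y \<longleftrightarrow> u \<epsilon> x \<or> u = x) \<and> y \<epsilon> w))" using infinity by blast
  have "emp \<epsilon> w" using w emp_eq by metis
  moreover have "suc x \<epsilon> w" if "x \<epsilon> w" for x
  proof -
    obtain y where "\<forall>u. u \<epsilon> y \<longleftrightarrow> u \<epsilon> x \<or> u = x" "y \<epsilon> w" using w \<open>x \<epsilon> w\<close> by blast
    moreover from this have "suc x = y" by (intro extensional) simp
    ultimately show ?thesis by simp
  qed
  ultimately show ?thesis unfolding indset_def by blast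
qed

lemma mem_om: "n \<epsilon> om \<longleftrightarrow> (\<forall>v. indset v \<longrightarrow> n \<epsilon> v)"
proof -
  obtain w where "indset w" using indset_ex by blast
  then have "small (\<lambda>n. \<forall>v. indset v \<longrightarrow> n \<epsilon> v)"
    by (intro small_sub[of _ w] dfs) blast
  then show ?thesis unfolding om_def by (rule mem_mk)
qed

lemma emp_om [simp]: "emp \<epsilon> om" and suc_om [simp]: "n \<epsilon> om \<Longrightarrow> suc n \<epsilon> om"
  unfolding mem_om indset_def by auto

lemma om_induct [consumes 2, case_names emp suc]:
  assumes d: "dfn (\<lambda>e. P (e 0))" and n: "n \<epsilon> om" and base: "P emp"
    and step: "\<And>n. n \<epsilon> om \<Longrightarrow> P n \<Longrightarrow> P (suc n)"
  shows "P n"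
proof -
  have s: "small (\<lambda>n. n \<epsilon> om \<and> P n)"
    by (rule small_sub[of _ om]) (intro dfs d, blast)
  have "indset (mk (\<lambda>n. n \<epsilon> om \<and> P n))" unfolding indset_def mem_mk[OF s] using base step by simp
  then show ?thesis using n mem_om mem_mk[OF s] by blast
qed

lemma om_cases: "n \<epsilon> om \<Longrightarrow> n = emp \<or> (\<exists>m. m \<epsilon> om \<and> n = suc m)"
  by (rule om_induct[of "\<lambda>n. n = emp \<or> (\<exists>m. m \<epsilon> om \<and> n = suc m)"]) (intro dfs | auto)+

lemma trn_om: "trn om"
proof -
  have "\<forall>y. y \<epsilon> x \<longrightarrow> y \<epsilon> om" if "x \<epsilon> om" for x
    by (rule om_induct[OF _ that]) (intro dfs, auto)
  then show ?thesis unfolding trn_def by blast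
qed

lemma om_trans: "x \<epsilon> n \<Longrightarrow> n \<epsilon> om \<Longrightarrow> x \<epsilon> om"
  using trn_om unfolding trn_def by blast

text \<open>The recursion theorem is first proved on the class of sets lying in some transitive set, since
  the existence of transitive closures itself relies on a recursion on \<open>om\<close>.\<close>

definition W :: "'a \<Rightarrow> bool" where "W x \<longleftrightarrow> (\<exists>t. trn t \<and> x \<epsilon> t)"

lemma dfn_W [dfs]: "df t \<Longrightarrow> dfn (\<lambda>e. W (t e))"
  by (rule dfn_lift1[of W]) (unfold W_def, intro dfs)

text \<open>Inside a transitive set containing \<open>x\<close> the counterexamples form a set by
  separation; foundation gives a minimal one, and transitivity keeps its elements within reach of
  the induction hypothesis.\<close>

lemma W_induct:
  assumes d: "dfn (\<lambda>e. P (e 0))" and st: "\<And>x. W x \<Longrightarrow> (\<And>y. y \<epsilon> x \<Longrightarrow> P y) \<Longrightarrow> P x" and "W x"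
  shows "P x"
proof (rule ccontr)
  assume n: "\<not> P x"
  obtain t where t: "trn t" "x \<epsilon> t" using \<open>W x\<close> W_def by blast
  have sm: "small (\<lambda>z. z \<epsilon> t \<and> \<not> P z)" by (rule small_sub[of _ t]) (intro dfs d, blast)
  then obtain z where z: "z \<epsilon> t" "\<not> P z" "\<forall>y. y \<epsilon> z \<longrightarrow> \<not> (y \<epsilon> t \<and> \<not> P y)"
    using foundation[of x "mk (\<lambda>z. z \<epsilon> t \<and> \<not> P z)"] mem_mk[OF sm] t n by blast
  have "W z" using t(1) z(1) W_def by blast
  then have "P z"
  proof (rule st)
    fix y assume "y \<epsilon> z"
    moreover from this have "y \<epsilon> t" using t(1) z(1) unfolding trn_def by blast
    ultimately show "P y" using z(3) by blast
  qed
  then show False using z by blast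
qed

text \<open>Three levels of membership suffice to reach the components of the elements of a set of pairs.\<close>

definition bl :: "'a \<Rightarrow> 'a \<Rightarrow> bool" where
  "bl u x \<longleftrightarrow> u \<epsilon> x \<or> (\<exists>w. u \<epsilon> w \<and> w \<epsilon> x) \<or> (\<exists>w v. u \<epsilon> w \<and> w \<epsilon> v \<and> v \<epsilon> x)"

lemma dfn_bl [dfs]: "df t \<Longrightarrow> df s \<Longrightarrow> dfn (\<lambda>e. bl (t e) (s e))"
  by (rule dfn_lift2[of bl]) (unfold bl_def, intro dfs)

lemma bl_mem: "u \<epsilon> x \<Longrightarrow> bl u x"
  unfolding bl_def by blast

lemma bl_pair: "pair u v \<epsilon> x \<Longrightarrow> bl u x"
  unfolding bl_def by (metis mem_upair pair_def)

lemma bl_trn: "trn t \<Longrightarrow> x \<epsilon> t \<Longrightarrow> bl u x \<Longrightarrow> u \<epsilon> t"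
  unfolding trn_def bl_def by blast

text \<open>Claiming \<open>P\<close> for \<open>x\<close>, its elements and their elements turns
  this into ordinary membership induction: the hypothesis at the elements of \<open>x\<close> then
  covers all three levels of \<open>bl\<close>.\<close>

lemma W_bl_induct:
  assumes d: "dfn (\<lambda>e. P (e 0))" and st: "\<And>x. W x \<Longrightarrow> (\<And>y. bl y x \<Longrightarrow> P y) \<Longrightarrow> P x" and "W x"
  shows "P x"
proof -
  note d' = dfn_lift1[of P, OF d]
  have "P x \<and> (\<forall>y. y \<epsilon> x \<longrightarrow> P y) \<and> (\<forall>w y. w \<epsilon> x \<and> y \<epsilon> w \<longrightarrow> P y)"
  proof (rule W_induct[OF _ _ \<open>W x\<close>])
    show "dfn (\<lambda>e. P (e 0) \<and> (\<forall>y. y \<epsilon> e 0 \<longrightarrow> P y) \<and> (\<forall>w y. w \<epsilon> e 0 \<and> y \<epsilon> w \<longrightarrow> P y))"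
      by (intro dfs d')
    fix x
    assume "W x" and IH: "\<And>y. y \<epsilon> x \<Longrightarrow> P y \<and> (\<forall>z. z \<epsilon> y \<longrightarrow> P z) \<and> (\<forall>w z. w \<epsilon> y \<and> z \<epsilon> w \<longrightarrow> P z)"
    then have "P y" if "bl y x" for y using that unfolding bl_def by blast
    then show "P x \<and> (\<forall>y. y \<epsilon> x \<longrightarrow> P y) \<and> (\<forall>w y. w \<epsilon> x \<and> y \<epsilon> w \<longrightarrow> P y)"
      using st[OF \<open>W x\<close>] IH by blast
  qed
  then show ?thesis by blast
qed

lemma W_irrefl: "W x \<Longrightarrow> \<not> bl x x"
proof -
  assume "W x"
  show ?thesis by (rule W_bl_induct[of "\<lambda>x. \<not> bl x x", OF _ _ \<open>W x\<close>]) (intro dfs, blast)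
qed

definition rst :: "'a \<Rightarrow> 'a \<Rightarrow> 'a" where
  "rst g x = mk (\<lambda>z. z \<epsilon> g \<and> (\<exists>u v. z = pair u v \<and> bl u x))"

lemma mem_rst: "z \<epsilon> rst g x \<longleftrightarrow> z \<epsilon> g \<and> (\<exists>u v. z = pair u v \<and> bl u x)"
  unfolding rst_def by (rule mem_mk, rule small_sub[of _ g], intro dfs) blast

lemma df_rst [dfs]: "df t \<Longrightarrow> df s \<Longrightarrow> df (\<lambda>e. rst (t e) (s e))"
  by (rule df_lift2[of rst]) (rule df_eqI, unfold mem_rst, intro dfs)

text \<open>These are the approximations from the usual proof of the recursion theorem, on a
  transitive domain \<open>t\<close>. Single-valuedness is implied, since the equation determines
  \<open>y\<close> from \<open>x\<close> and \<open>g\<close>. The parameter \<open>a\<close> stays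
  explicit to keep the result definable in it.\<close>

definition att :: "('a \<Rightarrow> 'a \<Rightarrow> 'a \<Rightarrow> 'a) \<Rightarrow> 'a \<Rightarrow> 'a \<Rightarrow> 'a \<Rightarrow> bool" where
  "att H a g t \<longleftrightarrow> trn t \<and> (\<forall>x. x \<epsilon> t \<longrightarrow> (\<exists>y. pair x y \<epsilon> g)) \<and>
     (\<forall>x y. pair x y \<epsilon> g \<longrightarrow> x \<epsilon> t \<and> y = H a x (rst g x))"

definition wrec :: "('a \<Rightarrow> 'a \<Rightarrow> 'a \<Rightarrow> 'a) \<Rightarrow> 'a \<Rightarrow> 'a \<Rightarrow> 'a" where
  "wrec H a x = (if W x then THE y. \<exists>g t. att H a g t \<and> x \<epsilon> t \<and> pair x y \<epsilon> g else emp)"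

definition blam :: "'a \<Rightarrow> ('a \<Rightarrow> 'a) \<Rightarrow> 'a" where
  "blam x F = mk (\<lambda>z. \<exists>u. bl u x \<and> z = pair u (F u))"

lemma small_bl: "small (\<lambda>u. bl u x)"
  by (rule small_sub[of _ "un x (un (Unn x) (Unn (Unn x)))"]) (intro dfs, auto simp: bl_def)

lemma mem_blam: "df (\<lambda>e. F (e 0)) \<Longrightarrow> z \<epsilon> blam x F \<longleftrightarrow> (\<exists>u. bl u x \<and> z = pair u (F u))"
proof -
  assume d: "df (\<lambda>e. F (e 0))"
  have "small (\<lambda>z. \<exists>u. u \<epsilon> mk (\<lambda>u. bl u x) \<and> z = pair u (F u))"
    by (rule small_img[of "\<lambda>u. pair u (F u)"]) (intro dfs d)
  then show ?thesis unfolding blam_def mem_mk[OF small_bl] by (rule mem_mk)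
qed

lemma app_blam: "df (\<lambda>e. F (e 0)) \<Longrightarrow> bl u x \<Longrightarrow> app (blam x F) u = F u"
  by (rule app_eq) (auto simp: mem_blam)

context
  fixes H :: "'a \<Rightarrow> 'a \<Rightarrow> 'a \<Rightarrow> 'a"
  assumes dfH: "df (\<lambda>e. H (e 0) (e 1) (e 2))"
begin

lemma df_H: "df t \<Longrightarrow> df s \<Longrightarrow> df u \<Longrightarrow> df (\<lambda>e. H (t e) (s e) (u e))"
  by (rule df_lift3[OF dfH])

lemma dfn_att: "df t \<Longrightarrow> df s \<Longrightarrow> df u \<Longrightarrow> dfn (\<lambda>e. att H (t e) (s e) (u e))"
  by (rule dfn_lift3[of "att H"]) (unfold att_def, intro dfs df_H)

lemma att_unique:
  assumes a: "att H a g t" and b: "att H a g' t'" and x: "x \<epsilon> t" "x \<epsilon> t'"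
    and y: "pair x y \<epsilon> g" "pair x y' \<epsilon> g'"
  shows "y = y'"
proof -
  have "W x" using a x unfolding att_def W_def by blast
  have "x \<epsilon> t \<longrightarrow> x \<epsilon> t' \<longrightarrow> (\<forall>y y'. pair x y \<epsilon> g \<longrightarrow> pair x y' \<epsilon> g' \<longrightarrow> y = y')"
  proof (rule W_bl_induct[OF _ _ \<open>W x\<close>])
    show "dfn (\<lambda>e. e 0 \<epsilon> t \<longrightarrow> e 0 \<epsilon> t' \<longrightarrow> (\<forall>y y'. pair (e 0) y \<epsilon> g \<longrightarrow> pair (e 0) y' \<epsilon> g' \<longrightarrow> y = y'))"
      by (intro dfs)
    fix x assume IH: "\<And>u. bl u x \<Longrightarrow> u \<epsilon> t \<longrightarrow> u \<epsilon> t' \<longrightarrow> (\<forall>y y'. pair u y \<epsilon> g \<longrightarrow> pair u y' \<epsilon> g' \<longrightarrow> y = y')"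
    show "x \<epsilon> t \<longrightarrow> x \<epsilon> t' \<longrightarrow> (\<forall>y y'. pair x y \<epsilon> g \<longrightarrow> pair x y' \<epsilon> g' \<longrightarrow> y = y')"
    proof (intro impI allI)
      fix y y' assume x: "x \<epsilon> t" "x \<epsilon> t'" and y: "pair x y \<epsilon> g" "pair x y' \<epsilon> g'"
      have u: "u \<epsilon> t" "u \<epsilon> t'" if "bl u x" for u
        using that x a b bl_trn unfolding att_def by blast+
      have "pair u v \<epsilon> g \<longleftrightarrow> pair u v \<epsilon> g'" if "bl u x" for u v
        using IH[OF that] u[OF that] a b unfolding att_def by metis
      then have "rst g x = rst g' x" by (intro extensional) (auto simp: mem_rst)
      then show "y = y'" using y a b unfolding att_def by metis
    qed
  qed
  then show ?thesis using x y by blast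
qed

text \<open>All approximations at points of a transitive set \<open>t0\<close> are glued together;
  by uniqueness they agree, and \<open>D\<close> is the set of points reached. Should
  \<open>x\<close> itself be missing from \<open>D\<close>, one more pair completes the
  approximation.\<close>

lemma att_ex: "W x \<Longrightarrow> \<exists>g t. att H a g t \<and> x \<epsilon> t"
proof (rule W_induct[of "\<lambda>x. \<exists>g t. att H a g t \<and> x \<epsilon> t"])
  show "dfn (\<lambda>e. \<exists>g t. att H a g t \<and> e 0 \<epsilon> t)" by (intro dfs dfn_att)
next
  fix x assume "W x" and IH: "\<And>y. y \<epsilon> x \<Longrightarrow> \<exists>g t. att H a g t \<and> y \<epsilon> t"
  obtain t0 where t0: "trn t0" "x \<epsilon> t0" using \<open>W x\<close> W_def by blast
  have "small (\<lambda>u. u \<epsilon> t0 \<and> (\<exists>g s. att H a g s \<and> u \<epsilon> s))"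
    by (rule small_sub[of _ t0]) (intro dfs dfn_att, blast)
  then obtain D where D: "\<And>u. u \<epsilon> D \<longleftrightarrow> u \<epsilon> t0 \<and> (\<exists>g s. att H a g s \<and> u \<epsilon> s)"
    unfolding small_def by blast
  have trD: "trn D" unfolding trn_def D using t0 unfolding trn_def att_def by blast
  have xD: "u \<epsilon> D" if "u \<epsilon> x" for u using that IH t0 unfolding D trn_def by blast
  have "small (\<lambda>z. \<exists>u. u \<epsilon> D \<and> (\<exists>g s v. att H a g s \<and> u \<epsilon> s \<and> pair u v \<epsilon> g \<and> z = pair u v))"
    by (rule small_repl) (intro dfs dfn_att, use att_unique in blast)
  then obtain G where G: "\<And>z. z \<epsilon> G \<longleftrightarrow> (\<exists>u. u \<epsilon> D \<and> (\<exists>g s v. att H a g s \<and> u \<epsilon> s \<and> pair u v \<epsilon> g \<and> z = pair u v))"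
    unfolding small_def by blast
  have G': "pair u v \<epsilon> G \<longleftrightarrow> u \<epsilon> D \<and> (\<exists>g s. att H a g s \<and> u \<epsilon> s \<and> pair u v \<epsilon> g)" for u v
    unfolding G by auto
  have rG: "rst g u = rst G u" if "att H a g s" "u \<epsilon> s" "u \<epsilon> D" for g s u
  proof -
    have "pair w c \<epsilon> g \<longleftrightarrow> pair w c \<epsilon> G" if w: "bl w u" for w c
    proof -
      have ws: "w \<epsilon> s" "w \<epsilon> D" using w bl_trn \<open>att H a g s\<close> \<open>u \<epsilon> s\<close> \<open>u \<epsilon> D\<close> trD unfolding att_def by blast+
      then obtain c' where c': "pair w c' \<epsilon> g" using \<open>att H a g s\<close> unfolding att_def by blast
      show ?thesis unfolding G' using ws c' \<open>att H a g s\<close> att_unique by blast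
    qed
    then show ?thesis by (intro extensional) (auto simp: mem_rst)
  qed
  have attG: "att H a G D" unfolding att_def
  proof (intro conjI allI impI)
    show "trn D" by (rule trD)
    show "\<exists>y. pair u y \<epsilon> G" if "u \<epsilon> D" for u using that D unfolding G' att_def by blast
    show "u \<epsilon> D" if "pair u v \<epsilon> G" for u v using that G' by blast
    show "v = H a u (rst G u)" if uv: "pair u v \<epsilon> G" for u v
    proof -
      obtain g s where gs: "u \<epsilon> D" "att H a g s" "u \<epsilon> s" "pair u v \<epsilon> g" using uv unfolding G' by blast
      then have "v = H a u (rst g u)" unfolding att_def by blast
      then show ?thesis using rG gs by simp
    qed
  qed
  show "\<exists>g t. att H a g t \<and> x \<epsilon> t"
  proof (cases "x \<epsilon> D")
    case True
    then show ?thesis using attG by blast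
  next
    case False
    define D' where "D' = un D (upair x x)"
    define G'' where "G'' = un G (upair (pair x (H a x (rst G x))) (pair x (H a x (rst G x))))"
    have D': "u \<epsilon> D' \<longleftrightarrow> u \<epsilon> D \<or> u = x" for u unfolding D'_def by auto
    have G'': "pair u v \<epsilon> G'' \<longleftrightarrow> pair u v \<epsilon> G \<or> (u = x \<and> v = H a x (rst G x))" for u v
      unfolding G''_def by auto
    \<comment> \<open>No point of the enlarged domain has \<open>x\<close> below it, so the new pair
      does not change any restriction.\<close>
    have "\<not> bl x u" if "u \<epsilon> D'" for u
      using that False bl_trn[OF trD] W_irrefl[OF \<open>W x\<close>] unfolding D' by blast
    then have r: "rst G'' u = rst G u" if "u \<epsilon> D'" for u
      using that by (intro extensional) (auto simp: mem_rst G'')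
    have "att H a G'' D'" unfolding att_def
    proof (intro conjI allI impI)
      show "trn D'" using trD xD unfolding trn_def D' by blast
      show "\<exists>y. pair u y \<epsilon> G''" if "u \<epsilon> D'" for u using that attG unfolding G'' D' att_def by blast
      show uD: "u \<epsilon> D'" if "pair u v \<epsilon> G''" for u v using that attG unfolding G'' D' att_def by blast
      show "v = H a u (rst G'' u)" if uv: "pair u v \<epsilon> G''" for u v
        unfolding r[OF uD[OF uv]] using uv attG unfolding G'' att_def by blast
    qed
    then show ?thesis using D' by blast
  qed
qed

lemma wrec_char: "W x \<Longrightarrow> y = wrec H a x \<longleftrightarrow> (\<exists>g t. att H a g t \<and> x \<epsilon> t \<and> pair x y \<epsilon> g)"
proof -
  assume "W x"
  then obtain g t where gt: "att H a g t" "x \<epsilon> t" using att_ex by blast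
  then obtain y0 where y0: "pair x y0 \<epsilon> g" unfolding att_def by blast
  define Q where "Q y \<longleftrightarrow> (\<exists>g t. att H a g t \<and> x \<epsilon> t \<and> pair x y \<epsilon> g)" for y
  have ex1: "\<exists>!y. Q y"
  proof (rule ex1I[of _ y0])
    show "Q y0" unfolding Q_def using gt y0 by blast
    fix y assume "Q y"
    then obtain g' t' where "att H a g' t'" "x \<epsilon> t'" "pair x y \<epsilon> g'" unfolding Q_def by (elim exE conjE)
    then show "y = y0" by (rule att_unique[OF _ gt(1) _ gt(2) _ y0])
  qed
  have "wrec H a x = The Q" unfolding wrec_def Q_def using \<open>W x\<close> by simp
  then have "y = wrec H a x \<longleftrightarrow> Q y" using theI'[OF ex1] the1_equality[OF ex1] by metis
  then show ?thesis unfolding Q_def .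
qed

lemma df_wrec: "df t \<Longrightarrow> df s \<Longrightarrow> df (\<lambda>e. wrec H (t e) (s e))"
proof (rule df_lift2[of "wrec H"])
  have "e 0 = wrec H (e 1) (e 2) \<longleftrightarrow>
    (W (e 2) \<and> (\<exists>g t. att H (e 1) g t \<and> e 2 \<epsilon> t \<and> pair (e 2) (e 0) \<epsilon> g)) \<or> (\<not> W (e 2) \<and> e 0 = emp)" for e :: "nat \<Rightarrow> 'a"
    using wrec_char[of "e 2" "e 0" "e 1"] by (auto simp: wrec_def)
  moreover have "dfn (\<lambda>e. (W (e 2) \<and> (\<exists>g t. att H (e 1) g t \<and> e 2 \<epsilon> t \<and> pair (e 2) (e 0) \<epsilon> g)) \<or> (\<not> W (e 2) \<and> e 0 = emp))"
    by (intro dfs dfn_att)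
  ultimately show "df (\<lambda>e. wrec H (e 0) (e 1))" unfolding df_def by (simp add: numeral_2_eq_2)
qed

lemma wrec_W: "W x \<Longrightarrow> wrec H a x = H a x (blam x (wrec H a))"
proof -
  assume "W x"
  then obtain g t where gt: "att H a g t" "x \<epsilon> t" using att_ex by blast
  then obtain y where y: "pair x y \<epsilon> g" unfolding att_def by blast
  have d: "df (\<lambda>e. wrec H a (e 0))" by (intro dfs df_wrec)
  have "pair u v \<epsilon> g \<longleftrightarrow> v = wrec H a u" if "bl u x" for u v
  proof -
    have t: "trn t" using gt(1) unfolding att_def by blast
    have u: "u \<epsilon> t" by (rule bl_trn[OF t gt(2) that])
    have "W u" using u t unfolding W_def by blast
    obtain v' where v': "pair u v' \<epsilon> g" using gt(1) u unfolding att_def by blast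
    show ?thesis
    proof
      show "v = wrec H a u" if "pair u v \<epsilon> g" unfolding wrec_char[OF \<open>W u\<close>] using that gt(1) u by blast
      assume "v = wrec H a u"
      then obtain g' t' where "att H a g' t'" "u \<epsilon> t'" "pair u v \<epsilon> g'" using wrec_char[OF \<open>W u\<close>] by blast
      then have "v = v'" using att_unique[OF _ gt(1) _ u _ v'] by blast
      then show "pair u v \<epsilon> g" using v' by simp
    qed
  qed
  then have "rst g x = blam x (wrec H a)"
    by (intro extensional) (auto simp: mem_rst mem_blam[OF d])
  moreover have "y = wrec H a x" using wrec_char[OF \<open>W x\<close>] gt y by blast
  ultimately show ?thesis using gt y unfolding att_def by metis
qed

end

text \<open>\<open>G n\<close> consists of \<open>a\<close> and the elements of elements of earlier
  stages, and the union of all stages is transitive. The recursion is legitimate at this point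
  because every \<open>n\<close> in \<open>om\<close> lies in the transitive set
  \<open>om\<close>.\<close>

lemma transitive_superset: "\<exists>t. trn t \<and> (\<forall>x. x \<epsilon> a \<longrightarrow> x \<epsilon> t)"
proof -
  define H where "H a n f = mk (\<lambda>z. z \<epsilon> a \<or> (\<exists>u v w. pair u v \<epsilon> f \<and> u \<epsilon> n \<and> w \<epsilon> v \<and> z \<epsilon> w))" for a n f
  have mH: "z \<epsilon> H a n f \<longleftrightarrow> z \<epsilon> a \<or> (\<exists>u v w. pair u v \<epsilon> f \<and> u \<epsilon> n \<and> w \<epsilon> v \<and> z \<epsilon> w)" for a n f z
    unfolding H_def by (rule mem_mk, rule small_sub[of _ "un a (Unn (Unn (Unn (Unn f))))"], intro dfs)
      (meson mem_un mem_Unn pair_mem_UnnD)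
  have dH: "df (\<lambda>e. H (e 0) (e 1) (e 2))" by (rule df_eqI, unfold mH, intro dfs)
  define G where "G = wrec H a"
  have dG: "df (\<lambda>e. G (e 0))" unfolding G_def by (intro dfs df_wrec[OF dH])
  have G: "z \<epsilon> G n \<longleftrightarrow> z \<epsilon> a \<or> (\<exists>u w. u \<epsilon> n \<and> w \<epsilon> G u \<and> z \<epsilon> w)" if "n \<epsilon> om" for n z
  proof -
    have "W n" using that trn_om unfolding W_def by blast
    have "z \<epsilon> G n \<longleftrightarrow> z \<epsilon> H a n (blam n G)" unfolding G_def wrec_W[OF dH \<open>W n\<close>, symmetric] ..
    then show ?thesis unfolding mH mem_blam[OF dG] using bl_mem by auto
  qed
  have "small (\<lambda>y. \<exists>n. n \<epsilon> om \<and> y = G n)" by (rule small_img[OF dG])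
  then obtain r where r: "\<And>y. y \<epsilon> r \<longleftrightarrow> (\<exists>n. n \<epsilon> om \<and> y = G n)" unfolding small_def by blast
  have "trn (Unn r)" unfolding trn_def mem_Unn r
  proof (intro allI impI, elim conjE exE)
    fix z y n u assume "y \<epsilon> z" "z \<epsilon> u" "n \<epsilon> om" "u = G n"
    then have "y \<epsilon> G (suc n)" using G[OF suc_om[of n], of y] by auto
    then show "\<exists>u. (\<exists>n. n \<epsilon> om \<and> u = G n) \<and> y \<epsilon> u" using \<open>n \<epsilon> om\<close> suc_om by blast
  qed
  moreover have "x \<epsilon> Unn r" if "x \<epsilon> a" for x unfolding mem_Unn r using that G[OF emp_om] emp_om by blast
  ultimately show ?thesis by blast
qed

lemma all_W [simp]: "W x"
  using transitive_superset[of "upair x x"] unfolding W_def by auto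

lemma eps_induct [consumes 1, case_names less]:
  assumes "dfn (\<lambda>e. P (e 0))" "\<And>x. (\<And>y. y \<epsilon> x \<Longrightarrow> P y) \<Longrightarrow> P x"
  shows "P x"
  by (rule W_induct[of P, OF assms(1) _ all_W]) (rule assms(2))

lemma bl_induct [consumes 1, case_names less]:
  assumes "dfn (\<lambda>e. P (e 0))" "\<And>x. (\<And>y. bl y x \<Longrightarrow> P y) \<Longrightarrow> P x"
  shows "P x"
  by (rule W_bl_induct[of P, OF assms(1) _ all_W]) (rule assms(2))

lemma bl_irrefl: "\<not> bl x x"
  using W_irrefl by simp

lemma irrefl [simp]: "\<not> x \<epsilon> x"
  using bl_irrefl bl_mem by blast

lemma no_cycle: "x \<epsilon> y \<Longrightarrow> \<not> y \<epsilon> x"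
  using bl_irrefl unfolding bl_def by blast

lemma wrec:
  assumes "df (\<lambda>e. H (e 0) (e 1) (e 2))"
  shows "wrec H a x = H a x (blam x (wrec H a))"
  using wrec_W[OF assms] by simp

subsection \<open>Ordinals\<close>

definition Ord :: "'a \<Rightarrow> bool" where "Ord x \<longleftrightarrow> trn x \<and> (\<forall>y. y \<epsilon> x \<longrightarrow> trn y)"

lemma dfn_Ord [dfs]: "df t \<Longrightarrow> dfn (\<lambda>e. Ord (t e))"
  by (rule dfn_lift1[of Ord]) (unfold Ord_def, intro dfs)

lemma Ord_mem: "Ord x \<Longrightarrow> y \<epsilon> x \<Longrightarrow> Ord y"
  unfolding Ord_def trn_def by blast

lemma Ord_trans: "Ord x \<Longrightarrow> y \<epsilon> x \<Longrightarrow> z \<epsilon> y \<Longrightarrow> z \<epsilon> x"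
  unfolding Ord_def trn_def by blast

lemma Ord_linear: "Ord x \<Longrightarrow> Ord y \<Longrightarrow> x \<epsilon> y \<or> x = y \<or> y \<epsilon> x"
proof -
  have "Ord x \<longrightarrow> (\<forall>y. Ord y \<longrightarrow> x \<epsilon> y \<or> x = y \<or> y \<epsilon> x)"
  proof (rule eps_induct[of "\<lambda>x. Ord x \<longrightarrow> (\<forall>y. Ord y \<longrightarrow> x \<epsilon> y \<or> x = y \<or> y \<epsilon> x)"], intro dfs, intro impI allI)
    fix x y
    assume IH: "\<And>z. z \<epsilon> x \<Longrightarrow> Ord z \<longrightarrow> (\<forall>y. Ord y \<longrightarrow> z \<epsilon> y \<or> z = y \<or> y \<epsilon> z)" and x: "Ord x" and "Ord y"
    have "Ord y \<longrightarrow> x \<epsilon> y \<or> x = y \<or> y \<epsilon> x"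
    proof (rule eps_induct[of "\<lambda>y. Ord y \<longrightarrow> x \<epsilon> y \<or> x = y \<or> y \<epsilon> x"], intro dfs, intro impI)
      fix y assume IH2: "\<And>z. z \<epsilon> y \<Longrightarrow> Ord z \<longrightarrow> x \<epsilon> z \<or> x = z \<or> z \<epsilon> x" and y: "Ord y"
      show "x \<epsilon> y \<or> x = y \<or> y \<epsilon> x"
      proof (rule ccontr)
        assume n: "\<not> ?thesis"
        have "z \<epsilon> y" if "z \<epsilon> x" for z using n IH[OF that] x y that Ord_mem Ord_trans by metis
        moreover have "z \<epsilon> x" if "z \<epsilon> y" for z using n IH2[OF that] x y that Ord_mem Ord_trans by metis
        ultimately show False using n extensional by blast
      qed
    qed
    then show "x \<epsilon> y \<or> x = y \<or> y \<epsilon> x" using \<open>Ord y\<close> by blast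
  qed
  then show "Ord x \<Longrightarrow> Ord y \<Longrightarrow> ?thesis" by blast
qed

lemma Ord_least:
  assumes "dfn (\<lambda>e. P (e 0))" "Ord x" "P x"
  shows "\<exists>y. Ord y \<and> P y \<and> (\<forall>z. z \<epsilon> y \<longrightarrow> \<not> P z)"
proof (rule ccontr)
  note d = dfn_lift1[of P, OF assms(1)]
  assume n: "\<not> ?thesis"
  have "Ord x \<longrightarrow> \<not> P x"
    by (rule eps_induct[of "\<lambda>x. Ord x \<longrightarrow> \<not> P x"], intro dfs d) (use n Ord_mem in blast)
  then show False using assms by blast
qed

lemma Ord_emp [simp]: "Ord emp"
  unfolding Ord_def trn_def by simp

lemma Ord_suc [simp]: "Ord x \<Longrightarrow> Ord (suc x)"
  unfolding Ord_def trn_def mem_suc by blast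

lemma Ord_Unn: "(\<And>y. y \<epsilon> x \<Longrightarrow> Ord y) \<Longrightarrow> Ord (Unn x)"
  unfolding Ord_def trn_def mem_Unn by blast

lemma Ord_nat: "n \<epsilon> om \<Longrightarrow> Ord n"
  by (rule om_induct[of Ord]) (intro dfs | simp)+

lemma Ord_om [simp]: "Ord om"
  using Ord_nat trn_om unfolding Ord_def by blast

lemma Ord_subset: "Ord x \<Longrightarrow> Ord y \<Longrightarrow> (\<And>z. z \<epsilon> x \<Longrightarrow> z \<epsilon> y) \<Longrightarrow> x \<epsilon> y \<or> x = y"
  using Ord_linear[of x y] irrefl[of y] by blast

lemma suc_inj [simp]: "suc x = suc y \<longleftrightarrow> x = y"
proof
  assume "suc x = suc y"
  then have "x \<epsilon> suc y" "y \<epsilon> suc x" using mem_suc[of x x] mem_suc[of y y] by simp_all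
  then show "x = y" using no_cycle[of x y] by auto
qed simp

lemma Ord_un: "Ord x \<Longrightarrow> Ord y \<Longrightarrow> un x y = x \<or> un x y = y"
proof -
  assume "Ord x" "Ord y"
  then have "(\<forall>z. z \<epsilon> x \<longrightarrow> z \<epsilon> y) \<or> (\<forall>z. z \<epsilon> y \<longrightarrow> z \<epsilon> x)"
    using Ord_linear[of x y] Ord_trans by blast
  then show ?thesis unfolding set_eq by auto
qed

lemma no_Ord_set: "\<exists>y. Ord y \<and> \<not> y \<epsilon> x"
proof (rule ccontr)
  assume n: "\<not> ?thesis"
  have s: "small Ord" by (rule small_sub[of Ord x]) (intro dfs, use n in blast)
  have "Ord (mk Ord)" unfolding Ord_def[of "mk Ord"] trn_def mem_mk[OF s] using Ord_mem unfolding Ord_def trn_def by blast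
  then show False using mem_mk[OF s] irrefl by blast
qed

definition Hrank :: "'a \<Rightarrow> 'a \<Rightarrow> 'a \<Rightarrow> 'a" where
  "Hrank a x f = mk (\<lambda>z. \<exists>u. u \<epsilon> x \<and> (z \<epsilon> app f u \<or> z = app f u))"

definition rank :: "'a \<Rightarrow> 'a" where "rank = wrec Hrank emp"

lemma mem_Hrank: "z \<epsilon> Hrank a x f \<longleftrightarrow> (\<exists>u. u \<epsilon> x \<and> (z \<epsilon> app f u \<or> z = app f u))"
proof -
  have s: "small (\<lambda>y. \<exists>u. u \<epsilon> x \<and> y = suc (app f u))" by (rule small_img) (intro dfs)
  show ?thesis unfolding Hrank_def
    by (rule mem_mk, rule small_sub[of _ "Unn (mk (\<lambda>y. \<exists>u. u \<epsilon> x \<and> y = suc (app f u)))"], intro dfs)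
      (auto simp: mem_mk[OF s])
qed

lemma df_Hrank: "df (\<lambda>e. Hrank (e 0) (e 1) (e 2))"
  by (rule df_eqI, unfold mem_Hrank, intro dfs)

lemma df_rank [dfs]: "df t \<Longrightarrow> df (\<lambda>e. rank (t e))"
  unfolding rank_def by (intro dfs df_wrec[OF df_Hrank])

lemma mem_rank: "z \<epsilon> rank x \<longleftrightarrow> (\<exists>u. u \<epsilon> x \<and> (z \<epsilon> rank u \<or> z = rank u))"
proof -
  have d: "df (\<lambda>e. rank (e 0))" by (intro dfs)
  have "z \<epsilon> rank x \<longleftrightarrow> z \<epsilon> Hrank emp x (blam x rank)"
    unfolding rank_def using wrec[OF df_Hrank, of emp x] by simp
  then show ?thesis unfolding mem_Hrank using app_blam[OF d bl_mem] by metis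
qed

lemma Ord_rank [simp]: "Ord (rank x)"
proof (rule eps_induct[of "\<lambda>x. Ord (rank x)"], intro dfs)
  fix x assume IH: "\<And>y. y \<epsilon> x \<Longrightarrow> Ord (rank y)"
  show "Ord (rank x)" unfolding Ord_def trn_def
  proof (intro conjI allI impI)
    show "z \<epsilon> rank x" if "y \<epsilon> rank x \<and> z \<epsilon> y" for y z
      using that IH Ord_trans unfolding mem_rank[of _ x] by blast
    show "w \<epsilon> y" if "y \<epsilon> rank x" "z \<epsilon> y \<and> w \<epsilon> z" for y z w
      using that IH Ord_trans Ord_mem unfolding mem_rank[of _ x] by metis
  qed
qed

lemma rank_mem: "y \<epsilon> x \<Longrightarrow> rank y \<epsilon> rank x"
  unfolding mem_rank[of _ x] by blast

lemma rank_bl: "bl y x \<Longrightarrow> rank y \<epsilon> rank x"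
  unfolding bl_def using rank_mem Ord_trans[OF Ord_rank] by metis

subsection \<open>Functions, countability, and \<open>\<omega>\<^sub>1\<close>\<close>

definition isfun :: "'a \<Rightarrow> 'a \<Rightarrow> 'a \<Rightarrow> bool" where
  "isfun f a b \<longleftrightarrow> (\<forall>z. z \<epsilon> f \<longrightarrow> (\<exists>x y. x \<epsilon> a \<and> y \<epsilon> b \<and> z = pair x y)) \<and>
     (\<forall>x. x \<epsilon> a \<longrightarrow> (\<exists>y. pair x y \<epsilon> f)) \<and>
     (\<forall>x y y'. pair x y \<epsilon> f \<and> pair x y' \<epsilon> f \<longrightarrow> y = y')"

definition isinj :: "'a \<Rightarrow> 'a \<Rightarrow> 'a \<Rightarrow> bool" where
  "isinj f a b \<longleftrightarrow> isfun f a b \<and> (\<forall>x x' y. pair x y \<epsilon> f \<and> pair x' y \<epsilon> f \<longrightarrow> x = x')"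

definition cntb :: "'a \<Rightarrow> bool" where "cntb x \<longleftrightarrow> (\<exists>f. isinj f x om)"

definition is_om1 :: "'a \<Rightarrow> bool" where
  "is_om1 k \<longleftrightarrow> Ord k \<and> \<not> cntb k \<and> (\<forall>y. y \<epsilon> k \<longrightarrow> cntb y)"

lemma dfn_isfun [dfs]: "df t \<Longrightarrow> df s \<Longrightarrow> df u \<Longrightarrow> dfn (\<lambda>e. isfun (t e) (s e) (u e))"
  by (rule dfn_lift3[of isfun]) (unfold isfun_def, intro dfs)

lemma dfn_isinj [dfs]: "df t \<Longrightarrow> df s \<Longrightarrow> df u \<Longrightarrow> dfn (\<lambda>e. isinj (t e) (s e) (u e))"
  by (rule dfn_lift3[of isinj]) (unfold isinj_def, intro dfs)

lemma dfn_cntb [dfs]: "df t \<Longrightarrow> dfn (\<lambda>e. cntb (t e))"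
  by (rule dfn_lift1[of cntb]) (unfold cntb_def, intro dfs)

text \<open>Hartogs: a countable ordinal \<open>a\<close> is determined by the relation that an injection \<open>f\<close> into
  \<open>om\<close> transports to \<open>om\<close>. The reflexive order is used to distinguish \<open>0\<close> from \<open>1\<close>.\<close>

definition codes :: "'a \<Rightarrow> 'a \<Rightarrow> bool" where
  "codes r a \<longleftrightarrow> Ord a \<and> (\<exists>f. isinj f a om \<and> (\<forall>z. z \<epsilon> r \<longleftrightarrow>
     (\<exists>x y n m. pair x n \<epsilon> f \<and> pair y m \<epsilon> f \<and> (x \<epsilon> y \<or> x = y) \<and> z = pair n m)))"

lemma dfn_codes [dfs]: "df t \<Longrightarrow> df s \<Longrightarrow> dfn (\<lambda>e. codes (t e) (s e))"
  by (rule dfn_lift2[of codes]) (unfold codes_def, intro dfs)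

text \<open>By induction on membership, points of \<open>a\<close> and \<open>b\<close> carrying the
  same number are equal: their predecessors are read off from the same relation on numbers.\<close>

lemma codes_subset:
  assumes "Ord a" "Ord b" and f: "isinj f a om" and g: "isinj g b om"
    and eq: "\<And>n m. (\<exists>x y. pair x n \<epsilon> f \<and> pair y m \<epsilon> f \<and> (x \<epsilon> y \<or> x = y)) \<longleftrightarrow>
      (\<exists>x y. pair x n \<epsilon> g \<and> pair y m \<epsilon> g \<and> (x \<epsilon> y \<or> x = y))"
    and "x \<epsilon> a"
  shows "x \<epsilon> b"
proof -
  have fa: "\<And>x. x \<epsilon> a \<Longrightarrow> \<exists>n. pair x n \<epsilon> f" "\<And>x n. pair x n \<epsilon> f \<Longrightarrow> x \<epsilon> a"
    and fi: "\<And>x n x'. pair x n \<epsilon> f \<Longrightarrow> pair x' n \<epsilon> f \<Longrightarrow> x = x'"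
    and ff: "\<And>x n n'. pair x n \<epsilon> f \<Longrightarrow> pair x n' \<epsilon> f \<Longrightarrow> n = n'"
    using f unfolding isinj_def isfun_def by (blast, fastforce, blast, blast)
  have ga: "\<And>x. x \<epsilon> b \<Longrightarrow> \<exists>n. pair x n \<epsilon> g" "\<And>x n. pair x n \<epsilon> g \<Longrightarrow> x \<epsilon> b"
    and gi: "\<And>x n x'. pair x n \<epsilon> g \<Longrightarrow> pair x' n \<epsilon> g \<Longrightarrow> x = x'"
    and gf: "\<And>x n n'. pair x n \<epsilon> g \<Longrightarrow> pair x n' \<epsilon> g \<Longrightarrow> n = n'"
    using g unfolding isinj_def isfun_def by (blast, fastforce, blast, blast)
  have "\<forall>y n. pair x n \<epsilon> f \<longrightarrow> pair y n \<epsilon> g \<longrightarrow> x = y"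
  proof (rule eps_induct[of "\<lambda>x. \<forall>y n. pair x n \<epsilon> f \<longrightarrow> pair y n \<epsilon> g \<longrightarrow> x = y"], intro dfs, intro allI impI)
    fix x y n
    assume IH: "\<And>z. z \<epsilon> x \<Longrightarrow> \<forall>y n. pair z n \<epsilon> f \<longrightarrow> pair y n \<epsilon> g \<longrightarrow> z = y"
      and x: "pair x n \<epsilon> f" and y: "pair y n \<epsilon> g"
    show "x = y"
    proof (rule extensional, rule iffI)
      fix z assume z: "z \<epsilon> x"
      then obtain m where m: "pair z m \<epsilon> f" using fa \<open>Ord a\<close> x Ord_trans by blast
      then obtain z' w where z': "pair z' m \<epsilon> g" "pair w n \<epsilon> g" "z' \<epsilon> w \<or> z' = w" using eq[of m n] x z by blast
      have "z = z'" using IH[OF z] m z' by blast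
      moreover have "w = y" using gi z' y by blast
      moreover have "z' \<noteq> w" using z' y m x z ff fi gf irrefl by metis
      ultimately show "z \<epsilon> y" using z' by blast
    next
      fix z assume z: "z \<epsilon> y"
      then obtain m where m: "pair z m \<epsilon> g" using ga \<open>Ord b\<close> y Ord_trans by blast
      then obtain z' w where z': "pair z' m \<epsilon> f" "pair w n \<epsilon> f" "z' \<epsilon> w \<or> z' = w" using eq[of m n] y z by blast
      have w: "w = x" using fi z' x by blast
      have "z' \<noteq> w" using z' y m x z ff gi gf irrefl by metis
      then have "z' \<epsilon> x" using z' w by blast
      moreover from this have "z' = z" using IH z' m by blast
      ultimately show "z \<epsilon> x" by blast
    qed
  qed
  moreover obtain n where n: "pair x n \<epsilon> f" using fa \<open>x \<epsilon> a\<close> by blast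
  \<comment> \<open>Here the reflexive order counts: it places \<open>n\<close> in the common field
    even if \<open>x\<close> has no predecessors, so \<open>g\<close> takes the value
    \<open>n\<close> as well.\<close>
  moreover obtain y where "pair y n \<epsilon> g" using eq[of n n] n by blast
  ultimately show ?thesis using ga by blast
qed

lemma codes_unique: "codes r a \<Longrightarrow> codes r b \<Longrightarrow> a = b"
proof -
  assume a: "codes r a" and b: "codes r b"
  obtain f where f: "isinj f a om" "\<And>z. z \<epsilon> r \<longleftrightarrow>
     (\<exists>x y n m. pair x n \<epsilon> f \<and> pair y m \<epsilon> f \<and> (x \<epsilon> y \<or> x = y) \<and> z = pair n m)"
    using a unfolding codes_def by blast
  obtain g where g: "isinj g b om" "\<And>z. z \<epsilon> r \<longleftrightarrow>
     (\<exists>x y n m. pair x n \<epsilon> g \<and> pair y m \<epsilon> g \<and> (x \<epsilon> y \<or> x = y) \<and> z = pair n m)"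
    using b unfolding codes_def by blast
  have eq: "(\<exists>x y. pair x n \<epsilon> f \<and> pair y m \<epsilon> f \<and> (x \<epsilon> y \<or> x = y)) \<longleftrightarrow>
      (\<exists>x y. pair x n \<epsilon> g \<and> pair y m \<epsilon> g \<and> (x \<epsilon> y \<or> x = y))" for n m
    using f(2)[of "pair n m"] g(2)[of "pair n m"] by simp
  have "Ord a" "Ord b" using a b unfolding codes_def by auto
  then show "a = b"
    using codes_subset[OF _ _ f(1) g(1) eq] codes_subset[OF _ _ g(1) f(1) eq[symmetric]]
    by (intro extensional) blast
qed

text \<open>Replacement along \<open>codes\<close> bounds the countable ordinals by a set of
  relations on \<open>om\<close>. An ordinal outside this set is uncountable, and the least
  uncountable ordinal is as required.\<close>

lemma om1_ex: "\<exists>k. is_om1 k"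
proof -
  have s: "small (\<lambda>a. \<exists>r. r \<epsilon> Pw (prod om om) \<and> codes r a)"
    by (rule small_repl) (intro dfs, use codes_unique in blast)
  obtain y where y: "Ord y" "\<not> y \<epsilon> mk (\<lambda>a. \<exists>r. r \<epsilon> Pw (prod om om) \<and> codes r a)"
    using no_Ord_set by blast
  have "\<not> cntb y"
  proof
    assume "cntb y"
    then obtain f where f: "isinj f y om" unfolding cntb_def by blast
    let ?R = "\<lambda>z. \<exists>u v n m. pair u n \<epsilon> f \<and> pair v m \<epsilon> f \<and> (u \<epsilon> v \<or> u = v) \<and> z = pair n m"
    have sub: "?R z \<Longrightarrow> z \<epsilon> prod om om" for z
      using f unfolding isinj_def isfun_def by (auto; metis pair_inj)
    have sR: "small ?R" by (rule small_sub[OF _ sub]) (intro dfs)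
    have "codes (mk ?R) y" unfolding codes_def mem_mk[OF sR] using y f by blast
    moreover have "mk ?R \<epsilon> Pw (prod om om)" unfolding mem_Pw mem_mk[OF sR] using sub by blast
    ultimately show False using y mem_mk[OF s] by blast
  qed
  then obtain k where "Ord k" "\<not> cntb k" "\<forall>z. z \<epsilon> k \<longrightarrow> cntb z"
    using Ord_least[of "\<lambda>y. \<not> cntb y" y, OF dfn_not[OF dfn_cntb[OF df_var]] y(1)] by auto
  then show ?thesis unfolding is_om1_def by blast
qed

end

section \<open>Forcing over a model of ZF\<close>

context zf
begin

lemma small_finite: "finite F \<Longrightarrow> small (\<lambda>x. x \<in> F)"
proof (induction rule: finite_induct)
  case empty
  show ?case unfolding small_def using mem_emp by blast
next
  case (insert x F)
  then obtain a where "\<forall>y. y \<epsilon> a \<longleftrightarrow> y \<in> F" unfolding small_def by blast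
  then have "\<forall>y. y \<epsilon> un a (upair x x) \<longleftrightarrow> y \<in> insert x F" by auto
  then show ?case unfolding small_def by blast
qed

lemma infinite_UNIV: "infinite (UNIV :: 'a set)"
proof
  assume "finite (UNIV :: 'a set)"
  from small_finite[OF this] show False unfolding small_def using irrefl by blast
qed

text \<open>No witnesses are chosen: for each index the least ordinal that works is unique, so
  replacement collects their successors and the union bounds them.\<close>

lemma Ord_collection:
  assumes Q: "dfn (\<lambda>e. Q (e 0) (e 1))"
  shows "\<exists>a. Ord a \<and> (\<forall>i b. i \<epsilon> d \<longrightarrow> Ord b \<longrightarrow> Q i b \<longrightarrow> (\<exists>b. b \<epsilon> a \<and> Q i b))"
proof -
  note dQ = dfn_lift2[of Q, OF Q]
  have s: "small (\<lambda>c. \<exists>i. i \<epsilon> d \<and> (\<exists>b. Ord b \<and> Q i b \<and> (\<forall>z. z \<epsilon> b \<longrightarrow> \<not> Q i z) \<and> c = suc b))"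
  proof (rule small_repl, intro dfs dQ, elim exE conjE)
    fix i c c' b b' assume "Ord b" "Q i b" "\<forall>z. z \<epsilon> b \<longrightarrow> \<not> Q i z" "Ord b'" "Q i b'"
      "\<forall>z. z \<epsilon> b' \<longrightarrow> \<not> Q i z" "c = suc b" "c' = suc b'"
    then show "c = c'" using Ord_linear[of b b'] by auto
  qed
  then obtain r where r: "\<And>c. c \<epsilon> r \<longleftrightarrow> (\<exists>i. i \<epsilon> d \<and> (\<exists>b. Ord b \<and> Q i b \<and> (\<forall>z. z \<epsilon> b \<longrightarrow> \<not> Q i z) \<and> c = suc b))"
    unfolding small_def by blast
  have "Ord (Unn r)" by (rule Ord_Unn) (auto simp: r)
  moreover have "\<exists>b. b \<epsilon> Unn r \<and> Q i b" if i: "i \<epsilon> d" and b: "Ord b" "Q i b" for i b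
  proof -
    obtain b' where b': "Ord b'" "Q i b'" "\<forall>z. z \<epsilon> b' \<longrightarrow> \<not> Q i z"
      using Ord_least[of "Q i", OF dQ[OF df_const df_var] b] by blast
    then have "suc b' \<epsilon> r" using r i by blast
    then have "b' \<epsilon> Unn r" unfolding mem_Unn by (meson mem_suc)
    then show ?thesis using b' by blast
  qed
  ultimately show ?thesis by blast
qed

definition nof :: "'a \<Rightarrow> 'a \<Rightarrow> 'a \<Rightarrow> bool" where
  "nof P le one \<longleftrightarrow>
    (\<forall>z. z \<epsilon> le \<longrightarrow> (\<exists>p q. p \<epsilon> P \<and> q \<epsilon> P \<and> z = pair p q)) \<and>
    (\<forall>p. p \<epsilon> P \<longrightarrow> pair p p \<epsilon> le) \<and>
    (\<forall>p q r. pair p q \<epsilon> le \<and> pair q r \<epsilon> le \<longrightarrow> pair p r \<epsilon> le) \<and>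
    one \<epsilon> P \<and> (\<forall>p. p \<epsilon> P \<longrightarrow> pair p one \<epsilon> le)"

definition tr :: "'a \<Rightarrow> 'a \<Rightarrow> 'a \<Rightarrow> 'a" where "tr p x y = pair p (pair x y)"

lemma tr_inj [simp]: "tr p x y = tr p' x' y' \<longleftrightarrow> p = p' \<and> x = x' \<and> y = y'"
  unfolding tr_def by simp

lemma df_tr [dfs]: "df t \<Longrightarrow> df s \<Longrightarrow> df u \<Longrightarrow> df (\<lambda>e. tr (t e) (s e) (u e))"
  unfolding tr_def by (intro dfs)

end

locale forcing = zf E for E :: "'a::countable \<Rightarrow> 'a \<Rightarrow> bool" (infix "\<epsilon>" 50) +
  fixes P le one :: 'a
  assumes nof: "nof P le one"
begin

definition lq :: "'a \<Rightarrow> 'a \<Rightarrow> bool" where "lq p q \<longleftrightarrow> pair p q \<epsilon> le"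

lemma dfn_lq [dfs]: "df t \<Longrightarrow> df s \<Longrightarrow> dfn (\<lambda>e. lq (t e) (s e))"
  unfolding lq_def by (intro dfs)

lemma lq_P: assumes "lq p q" shows "p \<epsilon> P" "q \<epsilon> P"
proof -
  obtain p' q' where "p' \<epsilon> P" "q' \<epsilon> P" "pair p q = pair p' q'"
    using nof assms unfolding nof_def lq_def by blast
  then show "p \<epsilon> P" "q \<epsilon> P" by simp_all
qed

lemma lq_refl: "p \<epsilon> P \<Longrightarrow> lq p p"
  and lq_trans: "lq p q \<Longrightarrow> lq q r \<Longrightarrow> lq p r"
  and one_P: "one \<epsilon> P"
  and lq_one: "p \<epsilon> P \<Longrightarrow> lq p one"
  using nof unfolding nof_def lq_def by blast+

subsection \<open>Forcing equality and membership\<close>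

definition Phi :: "('a \<Rightarrow> 'a \<Rightarrow> 'a \<Rightarrow> bool) \<Rightarrow> 'a \<Rightarrow> 'a \<Rightarrow> 'a \<Rightarrow> bool" where
  "Phi X p x y \<longleftrightarrow> p \<epsilon> P \<and>
    (\<forall>s a q. pair s a \<epsilon> x \<and> lq q p \<and> lq q a \<longrightarrow>
       (\<exists>r s' a'. lq r q \<and> pair s' a' \<epsilon> y \<and> lq r a' \<and> X r s s')) \<and>
    (\<forall>s a q. pair s a \<epsilon> y \<and> lq q p \<and> lq q a \<longrightarrow>
       (\<exists>r s' a'. lq r q \<and> pair s' a' \<epsilon> x \<and> lq r a' \<and> X r s' s))"

text \<open>Forcing equality is the greatest fixed point of \<^const>\<open>Phi\<close> inside the model, which avoids a
  simultaneous recursion on two names.\<close>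

definition feq :: "'a \<Rightarrow> 'a \<Rightarrow> 'a \<Rightarrow> bool" where
  "feq p x y \<longleftrightarrow> (\<exists>Z. tr p x y \<epsilon> Z \<and>
     (\<forall>r s s'. tr r s s' \<epsilon> Z \<longrightarrow> Phi (\<lambda>r s s'. tr r s s' \<epsilon> Z) r s s'))"

definition fmem :: "'a \<Rightarrow> 'a \<Rightarrow> 'a \<Rightarrow> bool" where
  "fmem p x y \<longleftrightarrow> (\<forall>q. lq q p \<longrightarrow> (\<exists>r s a. lq r q \<and> pair s a \<epsilon> y \<and> lq r a \<and> feq r x s))"

lemma dfn_feq [dfs]: "df t \<Longrightarrow> df s \<Longrightarrow> df u \<Longrightarrow> dfn (\<lambda>e. feq (t e) (s e) (u e))"
  by (rule dfn_lift3[of feq]) (unfold feq_def Phi_def, intro dfs)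

lemma dfn_fmem [dfs]: "df t \<Longrightarrow> df s \<Longrightarrow> df u \<Longrightarrow> dfn (\<lambda>e. fmem (t e) (s e) (u e))"
  by (rule dfn_lift3[of fmem]) (unfold fmem_def, intro dfs)

lemma Phi_mono: "Phi X p x y \<Longrightarrow> (\<And>r s a s' a'. pair s a \<epsilon> x \<Longrightarrow> pair s' a' \<epsilon> y \<Longrightarrow> r \<epsilon> P \<Longrightarrow> X r s s' \<Longrightarrow> Y r s s') \<Longrightarrow> Phi Y p x y"
  unfolding Phi_def using lq_P by meson

text \<open>As for any greatest fixed point, the direction from right to left needs a postfixed set
  that contains the given triple. A transitive set around \<open>x\<close> and \<open>y\<close>
  confines all names involved, which makes the forced equations between them, together with that
  triple, a set.\<close>

lemma feq_unfold: "feq p x y \<longleftrightarrow> Phi feq p x y"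
proof
  assume "feq p x y"
  then obtain Z where Z: "tr p x y \<epsilon> Z" "\<And>r s s'. tr r s s' \<epsilon> Z \<Longrightarrow> Phi (\<lambda>r s s'. tr r s s' \<epsilon> Z) r s s'"
    unfolding feq_def by blast
  show "Phi feq p x y"
    by (rule Phi_mono[OF Z(2)[OF Z(1)]]) (use Z(2) feq_def in blast)
next
  assume a: "Phi feq p x y"
  obtain t where t: "trn t" "\<And>z. z \<epsilon> upair x y \<Longrightarrow> z \<epsilon> t" using transitive_superset by blast
  have "small (\<lambda>z. \<exists>r s s'. z = tr r s s' \<and> r \<epsilon> P \<and> s \<epsilon> t \<and> s' \<epsilon> t \<and> (feq r s s' \<or> (r = p \<and> s = x \<and> s' = y)))"
    by (rule small_sub[of _ "prod P (prod t t)"]) (intro dfs, auto simp: tr_def)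
  then obtain Z where Z: "\<And>z. z \<epsilon> Z \<longleftrightarrow> (\<exists>r s s'. z = tr r s s' \<and> r \<epsilon> P \<and> s \<epsilon> t \<and> s' \<epsilon> t \<and> (feq r s s' \<or> (r = p \<and> s = x \<and> s' = y)))"
    unfolding small_def by blast
  have Z': "tr r s s' \<epsilon> Z \<longleftrightarrow> r \<epsilon> P \<and> s \<epsilon> t \<and> s' \<epsilon> t \<and> (feq r s s' \<or> (r = p \<and> s = x \<and> s' = y))" for r s s'
    unfolding Z by auto
  have f: "Phi feq r s s'" if fe: "feq r s s'" for r s s'
  proof -
    obtain Z where Z: "tr r s s' \<epsilon> Z" "\<And>r s s'. tr r s s' \<epsilon> Z \<Longrightarrow> Phi (\<lambda>r s s'. tr r s s' \<epsilon> Z) r s s'"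
      using fe unfolding feq_def by blast
    show ?thesis
      by (rule Phi_mono[OF Z(2)[OF Z(1)]]) (use Z(2) feq_def in blast)
  qed
  show "feq p x y" unfolding feq_def
  proof (intro exI[of _ Z] conjI allI impI)
    show "tr p x y \<epsilon> Z" unfolding Z' using t a unfolding Phi_def by auto
    fix r s s' assume "tr r s s' \<epsilon> Z"
    then have r: "s \<epsilon> t" "s' \<epsilon> t" "Phi feq r s s'" using a f unfolding Z' by auto
    show "Phi (\<lambda>r s s'. tr r s s' \<epsilon> Z) r s s'"
      by (rule Phi_mono[OF r(3)]) (use r bl_pair bl_trn[OF t(1)] Z' in blast)
  qed
qed

lemma feq_P: "feq p x y \<Longrightarrow> p \<epsilon> P"
  unfolding feq_unfold[of p] Phi_def by blast

lemma feqD1: "feq p x y \<Longrightarrow> pair s a \<epsilon> x \<Longrightarrow> lq q p \<Longrightarrow> lq q a \<Longrightarrow>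
    \<exists>r s' a'. lq r q \<and> pair s' a' \<epsilon> y \<and> lq r a' \<and> feq r s s'"
  unfolding feq_unfold[of p] Phi_def by blast

lemma feqD2: "feq p x y \<Longrightarrow> pair s a \<epsilon> y \<Longrightarrow> lq q p \<Longrightarrow> lq q a \<Longrightarrow>
    \<exists>r s' a'. lq r q \<and> pair s' a' \<epsilon> x \<and> lq r a' \<and> feq r s' s"
  unfolding feq_unfold[of p] Phi_def by blast

lemma feqI:
  assumes "p \<epsilon> P"
    and "\<And>s a q. pair s a \<epsilon> x \<Longrightarrow> lq q p \<Longrightarrow> lq q a \<Longrightarrow>
       \<exists>r s' a'. lq r q \<and> pair s' a' \<epsilon> y \<and> lq r a' \<and> feq r s s'"
    and "\<And>s a q. pair s a \<epsilon> y \<Longrightarrow> lq q p \<Longrightarrow> lq q a \<Longrightarrow>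
       \<exists>r s' a'. lq r q \<and> pair s' a' \<epsilon> x \<and> lq r a' \<and> feq r s' s"
  shows "feq p x y"
  unfolding feq_unfold[of p] Phi_def using assms by blast

lemma feq_refl: "p \<epsilon> P \<Longrightarrow> feq p x x"
proof -
  have "\<forall>p. p \<epsilon> P \<longrightarrow> feq p x x"
  proof (rule bl_induct[of "\<lambda>x. \<forall>p. p \<epsilon> P \<longrightarrow> feq p x x"], intro dfs, intro allI impI)
    fix x p assume IH: "\<And>y. bl y x \<Longrightarrow> \<forall>p. p \<epsilon> P \<longrightarrow> feq p y y" and p: "p \<epsilon> P"
    show "feq p x x"
      by (rule feqI[OF p]) (use IH bl_pair lq_P lq_refl in meson)+
  qed
  then show "p \<epsilon> P \<Longrightarrow> feq p x x" by blast
qed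

lemma feq_sym: "feq p x y \<Longrightarrow> feq p y x"
proof -
  have "\<forall>y p. feq p x y \<longleftrightarrow> feq p y x"
  proof (rule bl_induct[of "\<lambda>x. \<forall>y p. feq p x y \<longleftrightarrow> feq p y x"], intro dfs, intro allI)
    fix x y p assume IH: "\<And>s. bl s x \<Longrightarrow> \<forall>y p. feq p s y \<longleftrightarrow> feq p y s"
    have IH': "pair s a \<epsilon> x \<Longrightarrow> feq r s s' \<longleftrightarrow> feq r s' s" for s a r s' using IH bl_pair by blast
    show "feq p x y \<longleftrightarrow> feq p y x"
    proof
      assume a: "feq p x y"
      show "feq p y x"
        by (rule feqI[OF feq_P[OF a]]) (use feqD1[OF a] feqD2[OF a] IH' in meson)+
    next
      assume a: "feq p y x"
      show "feq p x y"
        by (rule feqI[OF feq_P[OF a]]) (use feqD1[OF a] feqD2[OF a] IH' in meson)+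
    qed
  qed
  then show "feq p x y \<Longrightarrow> feq p y x" by blast
qed

lemma feq_mono: "feq p x y \<Longrightarrow> lq q p \<Longrightarrow> feq q x y"
  unfolding feq_unfold[of p] feq_unfold[of q] Phi_def using lq_trans lq_P by meson

lemma fmem_mono: "fmem p x y \<Longrightarrow> lq q p \<Longrightarrow> fmem q x y"
  unfolding fmem_def using lq_trans by blast

lemma feq_trans: "feq p x y \<Longrightarrow> feq p y z \<Longrightarrow> feq p x z"
proof -
  have "\<forall>y z p. feq p x y \<longrightarrow> feq p y z \<longrightarrow> feq p x z"
  proof (rule bl_induct[of "\<lambda>x. \<forall>y z p. feq p x y \<longrightarrow> feq p y z \<longrightarrow> feq p x z"], intro dfs, intro allI impI)
    fix x y z p assume IH: "\<And>s. bl s x \<Longrightarrow> \<forall>y z p. feq p s y \<longrightarrow> feq p y z \<longrightarrow> feq p s z"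
      and xy: "feq p x y" and yz: "feq p y z"
    have IH': "pair s a \<epsilon> x \<Longrightarrow> feq r s s' \<Longrightarrow> feq r s' s'' \<Longrightarrow> feq r s s''" for s a r s' s''
      using IH bl_pair by blast
    show "feq p x z"
    proof (rule feqI[OF feq_P[OF xy]])
      fix s a q assume s: "pair s a \<epsilon> x" "lq q p" "lq q a"
      obtain r s' a' where r: "lq r q" "pair s' a' \<epsilon> y" "lq r a'" "feq r s s'"
        using feqD1[OF xy s] by blast
      obtain r' s'' a'' where r': "lq r' r" "pair s'' a'' \<epsilon> z" "lq r' a''" "feq r' s' s''"
        using feqD1[OF yz r(2) lq_trans[OF r(1) s(2)] r(3)] by blast
      have "feq r' s s''" using IH'[OF s(1)] r'(4) feq_mono[OF r(4) r'(1)] by blast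
      then show "\<exists>r s' a'. lq r q \<and> pair s' a' \<epsilon> z \<and> lq r a' \<and> feq r s s'"
        using r' lq_trans[OF r'(1) r(1)] by blast
    next
      fix s a q assume s: "pair s a \<epsilon> z" "lq q p" "lq q a"
      obtain r s' a' where r: "lq r q" "pair s' a' \<epsilon> y" "lq r a'" "feq r s' s"
        using feqD2[OF yz s] by blast
      obtain r' s'' a'' where r': "lq r' r" "pair s'' a'' \<epsilon> x" "lq r' a''" "feq r' s'' s'"
        using feqD2[OF xy r(2) lq_trans[OF r(1) s(2)] r(3)] by blast
      have "feq r' s'' s" using IH'[OF r'(2)] r'(4) feq_mono[OF r(4) r'(1)] by blast
      then show "\<exists>r s' a'. lq r q \<and> pair s' a' \<epsilon> x \<and> lq r a' \<and> feq r s' s"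
        using r' lq_trans[OF r'(1) r(1)] by blast
    qed
  qed
  then show "feq p x y \<Longrightarrow> feq p y z \<Longrightarrow> feq p x z" by blast
qed

lemma feq_dense: "p \<epsilon> P \<Longrightarrow> (\<And>q. lq q p \<Longrightarrow> \<exists>r. lq r q \<and> feq r x y) \<Longrightarrow> feq p x y"
proof (rule feqI)
  fix s a q assume d: "\<And>q. lq q p \<Longrightarrow> \<exists>r. lq r q \<and> feq r x y" and s: "lq q p" "lq q a"
  obtain r where r: "lq r q" "feq r x y" using d s by blast
  have rr: "lq r r" "lq r a" using lq_P[OF r(1)] lq_refl lq_trans[OF r(1)] s by auto
  show "\<exists>r s' a'. lq r q \<and> pair s' a' \<epsilon> y \<and> lq r a' \<and> feq r s s'" if "pair s a \<epsilon> x"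
    using feqD1[OF r(2) that rr] lq_trans r(1) by blast
  show "\<exists>r s' a'. lq r q \<and> pair s' a' \<epsilon> x \<and> lq r a' \<and> feq r s' s" if "pair s a \<epsilon> y"
    using feqD2[OF r(2) that rr] lq_trans r(1) by blast
qed

lemma fmem_dense: "(\<And>q. lq q p \<Longrightarrow> \<exists>r. lq r q \<and> fmem r x y) \<Longrightarrow> fmem p x y"
  unfolding fmem_def using lq_trans lq_refl lq_P by meson

lemma fmemI: "pair s a \<epsilon> y \<Longrightarrow> lq p a \<Longrightarrow> feq p x s \<Longrightarrow> fmem p x y"
  unfolding fmem_def using feq_mono lq_refl lq_trans lq_P by meson

lemma fmem_cong1: "fmem p x y \<Longrightarrow> feq p x x' \<Longrightarrow> fmem p x' y"
  unfolding fmem_def using feq_mono feq_sym feq_trans lq_trans by meson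

lemma fmem_cong2: assumes xy: "fmem p x y" and yy: "feq p y y'" shows "fmem p x y'"
  unfolding fmem_def
proof (intro allI impI)
  fix q assume q: "lq q p"
  obtain r s a where r: "lq r q" "pair s a \<epsilon> y" "lq r a" "feq r x s" using xy q unfolding fmem_def by blast
  obtain r' s' a' where r': "lq r' r" "pair s' a' \<epsilon> y'" "lq r' a'" "feq r' s s'"
    using feqD1[OF yy r(2) lq_trans[OF r(1) q] r(3)] by blast
  show "\<exists>r s a. lq r q \<and> pair s a \<epsilon> y' \<and> lq r a \<and> feq r x s"
    using r' feq_trans[OF feq_mono[OF r(4) r'(1)] r'(4)] lq_trans[OF r'(1) r(1)] by blast
qed

lemma feq_iff: "feq p x y \<longleftrightarrow> p \<epsilon> P \<and>
    (\<forall>s a q. pair s a \<epsilon> x \<and> lq q p \<and> lq q a \<longrightarrow> fmem q s y) \<and>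
    (\<forall>s a q. pair s a \<epsilon> y \<and> lq q p \<and> lq q a \<longrightarrow> fmem q s x)"
proof (intro iffI conjI allI impI)
  assume a: "feq p x y"
  then show "p \<epsilon> P" by (rule feq_P)
  show "fmem q s y" if "pair s a \<epsilon> x \<and> lq q p \<and> lq q a" for s a q
    unfolding fmem_def using feqD1[OF a] that lq_trans by meson
  show "fmem q s x" if "pair s a \<epsilon> y \<and> lq q p \<and> lq q a" for s a q
    unfolding fmem_def using feqD2[OF a] that lq_trans feq_sym by meson
next
  assume a: "p \<epsilon> P \<and>
    (\<forall>s a q. pair s a \<epsilon> x \<and> lq q p \<and> lq q a \<longrightarrow> fmem q s y) \<and>
    (\<forall>s a q. pair s a \<epsilon> y \<and> lq q p \<and> lq q a \<longrightarrow> fmem q s x)"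
  have m: "\<exists>r s' a'. lq r q \<and> pair s' a' \<epsilon> y \<and> lq r a' \<and> feq r s s'" if "fmem q s y" "lq q p" for q s y
    using that lq_refl lq_P(1)[OF that(2)] unfolding fmem_def by blast
  show "feq p x y"
  proof (rule feqI)
    show "p \<epsilon> P" using a by blast
    show "\<exists>r s' a'. lq r q \<and> pair s' a' \<epsilon> y \<and> lq r a' \<and> feq r s s'"
      if "pair s a \<epsilon> x" "lq q p" "lq q a" for s a q
      by (rule m) (use that a in blast)+
    show "\<exists>r s' a'. lq r q \<and> pair s' a' \<epsilon> x \<and> lq r a' \<and> feq r s' s"
      if "pair s a \<epsilon> y" "lq q p" "lq q a" for s a q
      using m[of q s x] that a feq_sym by blast
  qed
qed

definition dm :: "'a \<Rightarrow> 'a \<Rightarrow> bool" where "dm s x \<longleftrightarrow> (\<exists>a. pair s a \<epsilon> x)"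

text \<open>This is the equality clause in the shape of the official recursion, in which the
  conditions attached to the elements of the names no longer appear.\<close>

lemma feq_iff_dm: "p \<epsilon> P \<Longrightarrow> feq p x y \<longleftrightarrow>
    (\<forall>s q. (dm s x \<or> dm s y) \<and> lq q p \<longrightarrow> (fmem q s x \<longleftrightarrow> fmem q s y))"
proof
  assume "feq p x y"
  then show "\<forall>s q. (dm s x \<or> dm s y) \<and> lq q p \<longrightarrow> (fmem q s x \<longleftrightarrow> fmem q s y)"
    using fmem_cong2 feq_mono feq_sym by blast
next
  assume p: "p \<epsilon> P" and a: "\<forall>s q. (dm s x \<or> dm s y) \<and> lq q p \<longrightarrow> (fmem q s x \<longleftrightarrow> fmem q s y)"
  show "feq p x y" unfolding feq_iff
  proof (intro conjI allI impI p)
    show "fmem q s y" if "pair s c \<epsilon> x \<and> lq q p \<and> lq q c" for s c q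
      using a that fmemI[of s c x q s] feq_refl lq_P unfolding dm_def by blast
    show "fmem q s x" if "pair s c \<epsilon> y \<and> lq q p \<and> lq q c" for s c q
      using a that fmemI[of s c y q s] feq_refl lq_P unfolding dm_def by blast
  qed
qed

definition AF :: "'a \<Rightarrow> 'a \<Rightarrow> 'a \<Rightarrow> bool" where
  "AF N Ee Mm \<longleftrightarrow> (\<forall>y s. y \<epsilon> N \<and> dm s y \<longrightarrow> s \<epsilon> N) \<and>
     (\<forall>p x y. p \<epsilon> P \<and> x \<epsilon> N \<and> y \<epsilon> N \<longrightarrow>
        (tr p x y \<epsilon> Ee \<longleftrightarrow> (\<forall>s q. (dm s x \<or> dm s y) \<and> lq q p \<longrightarrow> (tr q s x \<epsilon> Mm \<longleftrightarrow> tr q s y \<epsilon> Mm))) \<and>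
        (tr p x y \<epsilon> Mm \<longleftrightarrow> (\<forall>q. lq q p \<longrightarrow>
           (\<exists>r. lq r q \<and> (\<exists>s a. pair s a \<epsilon> y \<and> lq r a \<and> tr r x s \<epsilon> Ee)))))"

lemma dm_rank: "dm s x \<Longrightarrow> rank s \<epsilon> rank x"
  unfolding dm_def using bl_pair rank_bl by blast

text \<open>The clauses for equality and membership pass to domain elements of either name, so the
  induction runs over an ordinal bounding both ranks; \<open>rank x \<epsilon> suc k\<close> says
  that the rank is at most \<open>k\<close>.\<close>

lemma AF_feq:
  assumes "AF N Ee Mm" "p \<epsilon> P" "x \<epsilon> N" "y \<epsilon> N"
  shows "tr p x y \<epsilon> Ee \<longleftrightarrow> feq p x y"
proof -
  have N: "\<And>y s. y \<epsilon> N \<Longrightarrow> dm s y \<Longrightarrow> s \<epsilon> N"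
    and Ee: "\<And>p x y. p \<epsilon> P \<Longrightarrow> x \<epsilon> N \<Longrightarrow> y \<epsilon> N \<Longrightarrow> tr p x y \<epsilon> Ee \<longleftrightarrow>
      (\<forall>s q. (dm s x \<or> dm s y) \<and> lq q p \<longrightarrow> (tr q s x \<epsilon> Mm \<longleftrightarrow> tr q s y \<epsilon> Mm))"
    and Mm: "\<And>p x y. p \<epsilon> P \<Longrightarrow> x \<epsilon> N \<Longrightarrow> y \<epsilon> N \<Longrightarrow> tr p x y \<epsilon> Mm \<longleftrightarrow> (\<forall>q. lq q p \<longrightarrow>
           (\<exists>r. lq r q \<and> (\<exists>s a. pair s a \<epsilon> y \<and> lq r a \<and> tr r x s \<epsilon> Ee)))"
    using assms(1) unfolding AF_def by (blast, blast, blast)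
  let ?C = "\<lambda>k. \<forall>p x y. p \<epsilon> P \<longrightarrow> x \<epsilon> N \<longrightarrow> y \<epsilon> N \<longrightarrow> rank x \<epsilon> suc k \<longrightarrow> rank y \<epsilon> suc k \<longrightarrow> (tr p x y \<epsilon> Ee \<longleftrightarrow> feq p x y)"
  have "Ord k \<longrightarrow> ?C k" for k
  proof (rule eps_induct[of "\<lambda>k. Ord k \<longrightarrow> ?C k"], intro dfs, intro impI)
    fix k assume IH: "\<And>j. j \<epsilon> k \<Longrightarrow> Ord j \<longrightarrow> ?C j" and k: "Ord k"
    have IH': "tr p s t \<epsilon> Ee \<longleftrightarrow> feq p s t" if "p \<epsilon> P" "s \<epsilon> N" "t \<epsilon> N" "rank s \<epsilon> k" "rank t \<epsilon> k" for p s t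
    proof -
      have "\<exists>j. j \<epsilon> k \<and> rank s \<epsilon> suc j \<and> rank t \<epsilon> suc j"
        using Ord_linear[of "rank s" "rank t"] that by auto
      then show ?thesis using IH k Ord_mem that by blast
    qed
    show "?C k"
    proof (intro allI impI)
      fix p x y assume p: "p \<epsilon> P" and x: "x \<epsilon> N" "rank x \<epsilon> suc k" and y: "y \<epsilon> N" "rank y \<epsilon> suc k"
      have low: "rank s \<epsilon> k" if "dm s z" "rank z \<epsilon> suc k" for s z
        using that dm_rank Ord_trans[OF k] by fastforce
      have M: "tr q s z \<epsilon> Mm \<longleftrightarrow> fmem q s z" if "q \<epsilon> P" "s \<epsilon> N" "rank s \<epsilon> k" "z \<epsilon> N" "rank z \<epsilon> suc k" for q s z
      proof -
        have "tr r s t \<epsilon> Ee \<longleftrightarrow> feq r s t" if "pair t a \<epsilon> z" "lq r q'" for t a r q'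
        proof -
          have "dm t z" using that dm_def by blast
          then show ?thesis using IH'[OF lq_P(1)[OF that(2)] \<open>s \<epsilon> N\<close>] N low \<open>rank s \<epsilon> k\<close> \<open>z \<epsilon> N\<close> \<open>rank z \<epsilon> suc k\<close> by blast
        qed
        then show ?thesis unfolding Mm[OF \<open>q \<epsilon> P\<close> \<open>s \<epsilon> N\<close> \<open>z \<epsilon> N\<close>] fmem_def by meson
      qed
      have "tr q s x \<epsilon> Mm \<longleftrightarrow> fmem q s x" "tr q s y \<epsilon> Mm \<longleftrightarrow> fmem q s y"
        if s: "dm s x \<or> dm s y" and q: "lq q p" for s q
      proof -
        have "s \<epsilon> N" "rank s \<epsilon> k" using s x y N low by blast+
        then show "tr q s x \<epsilon> Mm \<longleftrightarrow> fmem q s x" "tr q s y \<epsilon> Mm \<longleftrightarrow> fmem q s y"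
          using M[OF lq_P(1)[OF q]] x y by blast+
      qed
      then show "tr p x y \<epsilon> Ee \<longleftrightarrow> feq p x y"
        unfolding Ee[OF p x(1) y(1)] feq_iff_dm[OF p] by blast
    qed
  qed
  moreover have "\<exists>k. Ord k \<and> rank x \<epsilon> suc k \<and> rank y \<epsilon> suc k"
    using Ord_linear[of "rank x" "rank y"] by (metis Ord_rank mem_suc)
  ultimately show ?thesis using assms by blast
qed

lemma AF_fmem:
  assumes "AF N Ee Mm" "p \<epsilon> P" "x \<epsilon> N" "y \<epsilon> N"
  shows "tr p x y \<epsilon> Mm \<longleftrightarrow> fmem p x y"
proof -
  have "tr p x y \<epsilon> Mm \<longleftrightarrow> (\<forall>q. lq q p \<longrightarrow>
           (\<exists>r. lq r q \<and> (\<exists>s a. pair s a \<epsilon> y \<and> lq r a \<and> tr r x s \<epsilon> Ee)))"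
    using assms unfolding AF_def by blast
  moreover have "tr r x s \<epsilon> Ee \<longleftrightarrow> feq r x s" if "pair s a \<epsilon> y" "lq r q" for r s a q
    using AF_feq[OF assms(1) lq_P(1)[OF that(2)] assms(3)] that assms unfolding AF_def dm_def by blast
  ultimately show ?thesis unfolding fmem_def by meson
qed

lemma AF_ex: "\<exists>N Ee Mm. AF N Ee Mm \<and> x \<epsilon> N \<and> y \<epsilon> N"
proof -
  obtain t where t: "trn t" "\<And>z. z \<epsilon> upair x y \<Longrightarrow> z \<epsilon> t" using transitive_superset by blast
  have "small (\<lambda>z. \<exists>r s s'. z = tr r s s' \<and> r \<epsilon> P \<and> s \<epsilon> t \<and> s' \<epsilon> t \<and> feq r s s')"
    by (rule small_sub[of _ "prod P (prod t t)"], intro dfs, auto simp: tr_def)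
  then obtain Ee where Ee: "\<And>z. z \<epsilon> Ee \<longleftrightarrow> (\<exists>r s s'. z = tr r s s' \<and> r \<epsilon> P \<and> s \<epsilon> t \<and> s' \<epsilon> t \<and> feq r s s')"
    unfolding small_def by blast
  have "small (\<lambda>z. \<exists>r s s'. z = tr r s s' \<and> r \<epsilon> P \<and> s \<epsilon> t \<and> s' \<epsilon> t \<and> fmem r s s')"
    by (rule small_sub[of _ "prod P (prod t t)"], intro dfs, auto simp: tr_def)
  then obtain Mm where Mm: "\<And>z. z \<epsilon> Mm \<longleftrightarrow> (\<exists>r s s'. z = tr r s s' \<and> r \<epsilon> P \<and> s \<epsilon> t \<and> s' \<epsilon> t \<and> fmem r s s')"
    unfolding small_def by blast
  have EM: "tr r s s' \<epsilon> Ee \<longleftrightarrow> r \<epsilon> P \<and> s \<epsilon> t \<and> s' \<epsilon> t \<and> feq r s s'"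
      "tr r s s' \<epsilon> Mm \<longleftrightarrow> r \<epsilon> P \<and> s \<epsilon> t \<and> s' \<epsilon> t \<and> fmem r s s'" for r s s'
    by (auto simp: Ee Mm)
  have N: "s \<epsilon> t" if "y \<epsilon> t" "dm s y" for y s
    using that bl_pair bl_trn[OF t(1)] unfolding dm_def by blast
  have "AF t Ee Mm" unfolding AF_def
  proof (intro conjI allI impI)
    show "s \<epsilon> t" if "y \<epsilon> t \<and> dm s y" for y s using that N by blast
    fix p x y assume a: "p \<epsilon> P \<and> x \<epsilon> t \<and> y \<epsilon> t"
    have "(tr q s x \<epsilon> Mm \<longleftrightarrow> tr q s y \<epsilon> Mm) \<longleftrightarrow> (fmem q s x \<longleftrightarrow> fmem q s y)"
      if "dm s x \<or> dm s y" "lq q p" for s q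
      unfolding EM using a N that lq_P(1)[OF that(2)] by blast
    then show "tr p x y \<epsilon> Ee \<longleftrightarrow> (\<forall>s q. (dm s x \<or> dm s y) \<and> lq q p \<longrightarrow> (tr q s x \<epsilon> Mm \<longleftrightarrow> tr q s y \<epsilon> Mm))"
      unfolding EM(1) using a feq_iff_dm[of p x y] by blast
    have "tr r x s \<epsilon> Ee \<longleftrightarrow> feq r x s" if "pair s a \<epsilon> y" "lq r q" for s a r q
      unfolding EM using a N that lq_P(1)[OF that(2)] dm_def by blast
    then show "tr p x y \<epsilon> Mm \<longleftrightarrow> (\<forall>q. lq q p \<longrightarrow>
           (\<exists>r. lq r q \<and> (\<exists>s a. pair s a \<epsilon> y \<and> lq r a \<and> tr r x s \<epsilon> Ee)))"
      unfolding EM(2) fmem_def using a by meson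
  qed
  moreover have "x \<epsilon> t" "y \<epsilon> t" using t by auto
  ultimately show ?thesis by blast
qed

lemma feq_AF: "p \<epsilon> P \<Longrightarrow> feq p x y \<longleftrightarrow> (\<exists>N Ee Mm. AF N Ee Mm \<and> x \<epsilon> N \<and> y \<epsilon> N \<and> tr p x y \<epsilon> Ee)"
  using AF_feq AF_ex by meson

lemma fmem_AF: "p \<epsilon> P \<Longrightarrow> fmem p x y \<longleftrightarrow> (\<exists>N Ee Mm. AF N Ee Mm \<and> x \<epsilon> N \<and> y \<epsilon> N \<and> tr p x y \<epsilon> Mm)"
  using AF_fmem AF_ex by meson

subsection \<open>Generic filters\<close>

definition generic :: "'a set \<Rightarrow> bool" where
  "generic G \<longleftrightarrow> (\<forall>p\<in>G. p \<epsilon> P) \<and> one \<in> G \<and> (\<forall>p\<in>G. \<forall>q. lq p q \<longrightarrow> q \<in> G) \<and>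
     (\<forall>p\<in>G. \<forall>q\<in>G. \<exists>r\<in>G. lq r p \<and> lq r q) \<and>
     (\<forall>D. (\<forall>p. p \<epsilon> P \<longrightarrow> (\<exists>q. q \<epsilon> D \<and> lq q p)) \<longrightarrow> (\<exists>q\<in>G. q \<epsilon> D))"

text \<open>Stage \<open>n\<close> moves into the \<open>n\<close>-th element of the model whenever
  that is possible below the current condition. A dense set always permits it, so every dense set of
  the countable model is met at its own code.\<close>

primrec gseq :: "'a \<Rightarrow> nat \<Rightarrow> 'a" where
  "gseq p 0 = p"
| "gseq p (Suc n) = (if \<exists>q. q \<epsilon> from_nat n \<and> lq q (gseq p n)
     then SOME q. q \<epsilon> from_nat n \<and> lq q (gseq p n) else gseq p n)"

lemma generic_ex: "p \<epsilon> P \<Longrightarrow> \<exists>G. generic G \<and> p \<in> G"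
proof -
  assume p: "p \<epsilon> P"
  let ?d = "gseq p"
  define G where "G = {q. \<exists>n. lq (?d n) q}"
  have some: "?d (Suc n) \<epsilon> from_nat n \<and> lq (?d (Suc n)) (?d n)" if "\<exists>q. q \<epsilon> from_nat n \<and> lq q (?d n)" for n
    using someI_ex[OF that] that by simp
  have P: "?d n \<epsilon> P" for n
  proof (induction n)
    case (Suc n)
    then show ?case using some[of n] lq_P(1) by (cases "\<exists>q. q \<epsilon> from_nat n \<and> lq q (?d n)") auto
  qed (simp add: p)
  have step: "lq (?d (Suc n)) (?d n)" for n
    using some[of n] P[of n] lq_refl by (cases "\<exists>q. q \<epsilon> from_nat n \<and> lq q (?d n)") auto
  have dec: "lq (?d k) (?d n)" if "n \<le> k" for n k
    using that by (induction k rule: dec_induct) (use P lq_refl step lq_trans in blast)+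
  have "generic G" unfolding generic_def
  proof (intro conjI ballI allI impI)
    show "q \<epsilon> P" if "q \<in> G" for q using that lq_P unfolding G_def by blast
    show "one \<in> G" using lq_one P unfolding G_def by blast
    show "r \<in> G" if "q \<in> G" "lq q r" for q r using that lq_trans unfolding G_def by blast
    show "\<exists>s\<in>G. lq s q \<and> lq s r" if q: "q \<in> G" "r \<in> G" for q r
    proof -
      obtain n k where nk: "lq (?d n) q" "lq (?d k) r" using q unfolding G_def by blast
      have "?d (max n k) \<in> G" unfolding G_def using lq_refl P by blast
      then show ?thesis using nk dec[of n "max n k"] dec[of k "max n k"] lq_trans by (meson max.cobounded1 max.cobounded2)
    qed
    show "\<exists>q\<in>G. q \<epsilon> D" if D: "\<forall>p. p \<epsilon> P \<longrightarrow> (\<exists>q. q \<epsilon> D \<and> lq q p)" for D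
    proof -
      have "\<exists>q. q \<epsilon> D \<and> lq q (?d (to_nat D))" using D P by blast
      then have "?d (Suc (to_nat D)) \<epsilon> D" using some[of "to_nat D"] by simp
      then show ?thesis using lq_refl P unfolding G_def by blast
    qed
  qed
  moreover have "p \<in> G" unfolding G_def using lq_refl[OF p] gseq.simps(1)[of p] by (metis mem_Collect_eq)
  ultimately show ?thesis by blast
qed

lemma generic_P: "generic G \<Longrightarrow> p \<in> G \<Longrightarrow> p \<epsilon> P"
  and generic_one: "generic G \<Longrightarrow> one \<in> G"
  and generic_up: "generic G \<Longrightarrow> p \<in> G \<Longrightarrow> lq p q \<Longrightarrow> q \<in> G"
  and generic_dir: "generic G \<Longrightarrow> p \<in> G \<Longrightarrow> q \<in> G \<Longrightarrow> \<exists>r\<in>G. lq r p \<and> lq r q"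
  unfolding generic_def by blast+

text \<open>Density below \<open>p\<close> is turned into density by adding the conditions
  incompatible with \<open>p\<close>; these cannot occur in a filter containing \<open>p\<close>.
  Stating it for a definable \<open>Q\<close> hides the passage to a set of the model.\<close>

lemma generic_below:
  assumes G: "generic G" "p \<in> G" and Q: "dfn (\<lambda>e. Q (e 0))" and d: "\<And>q. lq q p \<Longrightarrow> \<exists>r. lq r q \<and> Q r"
  shows "\<exists>r\<in>G. Q r"
proof -
  note Q' = dfn_lift1[of Q, OF Q]
  have "small (\<lambda>r. r \<epsilon> P \<and> (Q r \<or> (\<forall>s. lq s r \<longrightarrow> \<not> lq s p)))"
    by (rule small_sub[of _ P]) (intro dfs Q', blast)
  then obtain D where D: "\<And>r. r \<epsilon> D \<longleftrightarrow> r \<epsilon> P \<and> (Q r \<or> (\<forall>s. lq s r \<longrightarrow> \<not> lq s p))" unfolding small_def by blast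
  have "\<exists>r. r \<epsilon> D \<and> lq r q" if q: "q \<epsilon> P" for q
  proof (cases "\<exists>s. lq s q \<and> lq s p")
    case True
    then obtain s where s: "lq s q" "lq s p" by blast
    then obtain r where "lq r s" "Q r" using d by blast
    then show ?thesis using D lq_P lq_trans s by blast
  next
    case False
    then show ?thesis using D q lq_refl by blast
  qed
  then obtain r where r: "r \<in> G" "r \<epsilon> D" using G unfolding generic_def by blast
  obtain s where "s \<in> G" "lq s r" "lq s p" using G r generic_dir by blast
  then show ?thesis using r D by blast
qed

lemma generic_dense:
  assumes G: "generic G" and Q: "dfn (\<lambda>e. Q (e 0))" and d: "\<And>p. p \<epsilon> P \<Longrightarrow> \<exists>r. lq r p \<and> Q r"
  shows "\<exists>r\<in>G. Q r"
  by (rule generic_below[OF G generic_one[OF G] Q]) (use d lq_P in blast)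

end

section \<open>Symmetric extensions\<close>

text \<open>A symmetric system is given by a set \<open>I\<close> of (indices of) involutive automorphisms \<open>T g\<close> and a
  directed set \<open>S\<close> of supports, where \<open>fx s g\<close> means that \<open>g\<close> fixes the support \<open>s\<close>. Instead of a
  normal filter of subgroups it suffices that every \<open>g\<close> commutes with all automorphisms fixing some
  support. For empty \<open>I\<close> one obtains all names.\<close>

locale symsys = forcing E P le one for E :: "'a::countable \<Rightarrow> 'a \<Rightarrow> bool" (infix "\<epsilon>" 50) and P le one +
  fixes I S :: 'a and T :: "'a \<Rightarrow> 'a \<Rightarrow> 'a" and fx :: "'a \<Rightarrow> 'a \<Rightarrow> bool"
  assumes T_P: "g \<epsilon> I \<Longrightarrow> p \<epsilon> P \<Longrightarrow> T g p \<epsilon> P"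
    and T_inv: "g \<epsilon> I \<Longrightarrow> p \<epsilon> P \<Longrightarrow> T g (T g p) = p"
    and T_le: "g \<epsilon> I \<Longrightarrow> lq p q \<Longrightarrow> lq (T g p) (T g q)"
    and T_one: "g \<epsilon> I \<Longrightarrow> T g one = one"
    and df_T0: "df (\<lambda>e. T (e 0) (e 1))"
    and dfn_fx0: "dfn (\<lambda>e. fx (e 0) (e 1))"
    and S_ne: "\<exists>s. s \<epsilon> S"
    and S_dir: "s \<epsilon> S \<Longrightarrow> s' \<epsilon> S \<Longrightarrow> \<exists>t. t \<epsilon> S \<and> (\<forall>g. g \<epsilon> I \<longrightarrow> fx t g \<longrightarrow> fx s g \<and> fx s' g)"
    and S_comm: "g \<epsilon> I \<Longrightarrow> s \<epsilon> S \<Longrightarrow> \<exists>t. t \<epsilon> S \<and>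
      (\<forall>h. h \<epsilon> I \<longrightarrow> fx t h \<longrightarrow> fx s h \<and> (\<forall>p. p \<epsilon> P \<longrightarrow> T g (T h p) = T h (T g p)))"
begin

lemma df_T: "df t \<Longrightarrow> df s \<Longrightarrow> df (\<lambda>e. T (t e) (s e))"
  by (rule df_lift2[of T, OF df_T0])

lemma dfn_fx: "df t \<Longrightarrow> df s \<Longrightarrow> dfn (\<lambda>e. fx (t e) (s e))"
  by (rule dfn_lift2[of fx, OF dfn_fx0])

definition Htau :: "'a \<Rightarrow> 'a \<Rightarrow> 'a \<Rightarrow> 'a" where
  "Htau g x f = mk (\<lambda>z. \<exists>w. w \<epsilon> x \<and> (\<exists>s a. w = pair s a \<and> z = pair (app f s) (T g a)))"

definition tau :: "'a \<Rightarrow> 'a \<Rightarrow> 'a" where "tau = wrec Htau"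

lemma mem_Htau: "z \<epsilon> Htau g x f \<longleftrightarrow> (\<exists>w. w \<epsilon> x \<and> (\<exists>s a. w = pair s a \<and> z = pair (app f s) (T g a)))"
  unfolding Htau_def by (rule mem_mk, rule small_repl, intro dfs df_T) auto

lemma df_Htau: "df (\<lambda>e. Htau (e 0) (e 1) (e 2))"
  by (rule df_eqI, unfold mem_Htau, intro dfs df_T)

lemma df_tau [dfs]: "df t \<Longrightarrow> df s \<Longrightarrow> df (\<lambda>e. tau (t e) (s e))"
  unfolding tau_def by (rule df_wrec[OF df_Htau])

lemma mem_tau: "z \<epsilon> tau g x \<longleftrightarrow> (\<exists>s a. pair s a \<epsilon> x \<and> z = pair (tau g s) (T g a))"
proof -
  have d: "df (\<lambda>e. tau g (e 0))" by (intro dfs)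
  have "z \<epsilon> tau g x \<longleftrightarrow> z \<epsilon> Htau g x (blam x (tau g))"
    unfolding tau_def using wrec[OF df_Htau, of g x] by simp
  then show ?thesis unfolding mem_Htau using app_blam[OF d bl_pair] by metis
qed

lemma tau_pair: "pair s a \<epsilon> x \<Longrightarrow> pair (tau g s) (T g a) \<epsilon> tau g x"
  unfolding mem_tau by blast

definition sym :: "'a \<Rightarrow> bool" where
  "sym x \<longleftrightarrow> (\<exists>s. s \<epsilon> S \<and> (\<forall>g. g \<epsilon> I \<longrightarrow> fx s g \<longrightarrow> tau g x = x))"

definition HS :: "'a \<Rightarrow> bool" where
  "HS x \<longleftrightarrow> (\<exists>N. x \<epsilon> N \<and> (\<forall>y. y \<epsilon> N \<longrightarrow> sym y) \<and>
     (\<forall>y z. y \<epsilon> N \<and> z \<epsilon> y \<longrightarrow> (\<exists>s p. s \<epsilon> N \<and> p \<epsilon> P \<and> z = pair s p)))"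

lemma dfn_sym [dfs]: "df t \<Longrightarrow> dfn (\<lambda>e. sym (t e))"
  by (rule dfn_lift1[of sym]) (unfold sym_def, intro dfs dfn_fx)

lemma dfn_HS [dfs]: "df t \<Longrightarrow> dfn (\<lambda>e. HS (t e))"
  by (rule dfn_lift1[of HS]) (unfold HS_def, intro dfs)

lemma HS_sym: "HS x \<Longrightarrow> sym x"
  unfolding HS_def by blast

lemma HS_elem: "HS x \<Longrightarrow> z \<epsilon> x \<Longrightarrow> \<exists>s p. HS s \<and> p \<epsilon> P \<and> z = pair s p"
  unfolding HS_def by metis

lemma HS_pair: "HS x \<Longrightarrow> pair s p \<epsilon> x \<Longrightarrow> HS s \<and> p \<epsilon> P"
  using HS_elem[of x "pair s p"] by auto

text \<open>The witness \<open>N\<close> must be a set: it consists of the hereditarily symmetric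
  members of a transitive set around \<open>x\<close>, together with \<open>x\<close>.\<close>

lemma HSI:
  assumes "sym x" and e: "\<And>z. z \<epsilon> x \<Longrightarrow> \<exists>s p. HS s \<and> p \<epsilon> P \<and> z = pair s p"
  shows "HS x"
proof -
  obtain t where t: "trn t" "\<And>z. z \<epsilon> upair x x \<Longrightarrow> z \<epsilon> t" using transitive_superset by blast
  have "small (\<lambda>y. y \<epsilon> t \<and> (HS y \<or> y = x))" by (rule small_sub[of _ t]) (intro dfs, blast)
  then obtain N where N: "\<And>y. y \<epsilon> N \<longleftrightarrow> y \<epsilon> t \<and> (HS y \<or> y = x)" unfolding small_def by blast
  show ?thesis unfolding HS_def
  proof (rule exI[of _ N], intro conjI allI impI)
    show "x \<epsilon> N" unfolding N using t(2) by simp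
    show "sym y" if "y \<epsilon> N" for y using that assms(1) HS_sym unfolding N by blast
    fix y z assume a: "y \<epsilon> N \<and> z \<epsilon> y"
    then obtain s p where s: "HS s" "p \<epsilon> P" "z = pair s p" using e HS_elem unfolding N by blast
    then have "s \<epsilon> t" using a bl_pair bl_trn[OF t(1)] unfolding N by blast
    then show "\<exists>s p. s \<epsilon> N \<and> p \<epsilon> P \<and> z = pair s p" using s unfolding N by blast
  qed
qed

lemma HS_induct:
  assumes d: "dfn (\<lambda>e. Q (e 0))" and x: "HS x"
    and st: "\<And>x. HS x \<Longrightarrow> (\<And>s p. pair s p \<epsilon> x \<Longrightarrow> Q s) \<Longrightarrow> Q x"
  shows "Q x"
proof -
  note d' = dfn_lift1[of Q, OF d]
  have "HS x \<longrightarrow> Q x"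
    by (rule bl_induct[of "\<lambda>x. HS x \<longrightarrow> Q x"], intro dfs d') (use st HS_pair bl_pair in blast)
  then show ?thesis using x by blast
qed

lemma tau_inv: "g \<epsilon> I \<Longrightarrow> HS x \<Longrightarrow> tau g (tau g x) = x"
proof -
  assume g: "g \<epsilon> I" and "HS x"
  show ?thesis
  proof (rule HS_induct[OF _ \<open>HS x\<close>, of "\<lambda>x. tau g (tau g x) = x"], intro dfs)
    fix x assume x: "HS x" and IH: "\<And>s p. pair s p \<epsilon> x \<Longrightarrow> tau g (tau g s) = s"
    show "tau g (tau g x) = x"
    proof (rule extensional)
      fix z
      have "z \<epsilon> tau g (tau g x) \<longleftrightarrow> (\<exists>s a. pair s a \<epsilon> x \<and> z = pair (tau g (tau g s)) (T g (T g a)))"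
        unfolding mem_tau[of z] by (auto simp: mem_tau)
      also have "\<dots> \<longleftrightarrow> (\<exists>s a. pair s a \<epsilon> x \<and> z = pair s a)"
        using IH T_inv[OF g] HS_pair[OF x] by metis
      also have "\<dots> \<longleftrightarrow> z \<epsilon> x" using HS_elem[OF x] by blast
      finally show "z \<epsilon> tau g (tau g x) \<longleftrightarrow> z \<epsilon> x" .
    qed
  qed
qed

lemma tau_comm:
  assumes c: "\<And>p. p \<epsilon> P \<Longrightarrow> T g (T h p) = T h (T g p)" and "HS x"
  shows "tau g (tau h x) = tau h (tau g x)"
proof (rule HS_induct[OF _ \<open>HS x\<close>, of "\<lambda>x. tau g (tau h x) = tau h (tau g x)"], intro dfs)
  fix x assume x: "HS x" and IH: "\<And>s p. pair s p \<epsilon> x \<Longrightarrow> tau g (tau h s) = tau h (tau g s)"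
  show "tau g (tau h x) = tau h (tau g x)"
  proof (rule extensional)
    fix z
    have "z \<epsilon> tau g (tau h x) \<longleftrightarrow> (\<exists>s a. pair s a \<epsilon> x \<and> z = pair (tau g (tau h s)) (T g (T h a)))"
      unfolding mem_tau[of z] by (auto simp: mem_tau)
    also have "\<dots> \<longleftrightarrow> (\<exists>s a. pair s a \<epsilon> x \<and> z = pair (tau h (tau g s)) (T h (T g a)))"
      using IH c HS_pair[OF x] by metis
    also have "\<dots> \<longleftrightarrow> z \<epsilon> tau h (tau g x)" unfolding mem_tau[of z] by (auto simp: mem_tau)
    finally show "z \<epsilon> tau g (tau h x) \<longleftrightarrow> z \<epsilon> tau h (tau g x)" .
  qed
qed

text \<open>This is where \<open>S_comm\<close> replaces normality of a filter of subgroups: an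
  automorphism that commutes with \<open>g\<close> and fixes \<open>x\<close> also fixes
  \<open>tau g x\<close>.\<close>

lemma HS_tau: "g \<epsilon> I \<Longrightarrow> HS x \<Longrightarrow> HS (tau g x)"
proof -
  assume g: "g \<epsilon> I" and "HS x"
  show ?thesis
  proof (rule HS_induct[OF _ \<open>HS x\<close>, of "\<lambda>x. HS (tau g x)"], intro dfs)
    fix x assume x: "HS x" and IH: "\<And>s p. pair s p \<epsilon> x \<Longrightarrow> HS (tau g s)"
    show "HS (tau g x)"
    proof (rule HSI)
      obtain s where s: "s \<epsilon> S" "\<And>h. h \<epsilon> I \<Longrightarrow> fx s h \<Longrightarrow> tau h x = x" using HS_sym[OF x] unfolding sym_def by blast
      obtain t where t: "t \<epsilon> S" "\<forall>h. h \<epsilon> I \<longrightarrow> fx t h \<longrightarrow> fx s h \<and> (\<forall>p. p \<epsilon> P \<longrightarrow> T g (T h p) = T h (T g p))"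
        using S_comm[OF g s(1)] by blast
      have "tau h (tau g x) = tau g x" if h: "h \<epsilon> I" "fx t h" for h
        using tau_comm[of g h x] t h x s(2)[OF h(1)] by metis
      then show "sym (tau g x)" using t(1) unfolding sym_def by blast
      show "\<exists>s p. HS s \<and> p \<epsilon> P \<and> z = pair s p" if "z \<epsilon> tau g x" for z
        using that IH T_P[OF g] HS_pair[OF x] unfolding mem_tau by blast
    qed
  qed
qed

text \<open>Because the automorphisms are involutions, closure of \<open>y\<close> under one of them
  already implies that \<open>y\<close> is mapped onto itself.\<close>

lemma HS_intro:
  assumes e: "\<And>z. z \<epsilon> y \<Longrightarrow> \<exists>s p. HS s \<and> p \<epsilon> P \<and> z = pair s p"
    and s0: "s0 \<epsilon> S"
    and inv: "\<And>g s p. g \<epsilon> I \<Longrightarrow> fx s0 g \<Longrightarrow> pair s p \<epsilon> y \<Longrightarrow> HS s \<Longrightarrow> p \<epsilon> P \<Longrightarrow> pair (tau g s) (T g p) \<epsilon> y"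
  shows "HS y"
proof (rule HSI[OF _ e])
  have e': "HS s \<and> p \<epsilon> P" if "pair s p \<epsilon> y" for s p using e[OF that] by auto
  have "tau g y = y" if g: "g \<epsilon> I" "fx s0 g" for g
  proof (rule extensional, rule iffI)
    fix z assume "z \<epsilon> tau g y"
    then show "z \<epsilon> y" unfolding mem_tau using inv[OF g] e' by blast
  next
    fix z assume z: "z \<epsilon> y"
    then obtain s p where s: "HS s" "p \<epsilon> P" "z = pair s p" using e by blast
    then have "pair (tau g s) (T g p) \<epsilon> y" using inv[OF g] z by blast
    from tau_pair[OF this, of g] show "z \<epsilon> tau g y" using s tau_inv T_inv g by simp
  qed
  then show "sym y" using s0 unfolding sym_def by blast
qed

text \<open>One implication suffices: the converse results from a second application, as
  \<open>T g\<close> and \<open>tau g\<close> are involutions.\<close>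

lemma feq_tau1: "g \<epsilon> I \<Longrightarrow> HS x \<Longrightarrow> HS y \<Longrightarrow> feq p x y \<Longrightarrow> feq (T g p) (tau g x) (tau g y)"
proof -
  assume g: "g \<epsilon> I" and "HS x"
  have "\<forall>y p. HS y \<longrightarrow> feq p x y \<longrightarrow> feq (T g p) (tau g x) (tau g y)"
  proof (rule HS_induct[OF _ \<open>HS x\<close>, of "\<lambda>x. \<forall>y p. HS y \<longrightarrow> feq p x y \<longrightarrow> feq (T g p) (tau g x) (tau g y)"], intro dfs df_T,
      intro allI impI)
    fix x y p assume x: "HS x" and y: "HS y" and f: "feq p x y"
      and IH: "\<And>s p. pair s p \<epsilon> x \<Longrightarrow> \<forall>y p. HS y \<longrightarrow> feq p s y \<longrightarrow> feq (T g p) (tau g s) (tau g y)"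
    have p: "p \<epsilon> P" using f feq_P by blast
    have inv: "lq (T g q) r" if "lq q (T g r)" "r \<epsilon> P" for q r
      using T_le[OF g that(1)] T_inv[OF g that(2)] by simp
    have inv': "lq (T g r) q" if "lq r (T g q)" "q \<epsilon> P" for q r
      using T_le[OF g that(1)] T_inv[OF g that(2)] by simp
    show "feq (T g p) (tau g x) (tau g y)"
    proof (rule feqI[OF T_P[OF g p]])
      fix u b q assume u: "pair u b \<epsilon> tau g x" and q: "lq q (T g p)" "lq q b"
      obtain s a where s: "pair s a \<epsilon> x" "u = tau g s" "b = T g a" using u unfolding mem_tau by auto
      have a: "a \<epsilon> P" using HS_pair[OF x s(1)] by blast
      obtain r s' a' where r: "lq r (T g q)" "pair s' a' \<epsilon> y" "lq r a'" "feq r s s'"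
        using feqD1[OF f s(1) inv[OF q(1) p] inv[OF q(2)[unfolded s(3)] a]] by blast
      have "feq (T g r) u (tau g s')" using IH[OF s(1)] HS_pair[OF y r(2)] r(4) s(2) by blast
      then show "\<exists>r s' a'. lq r q \<and> pair s' a' \<epsilon> tau g y \<and> lq r a' \<and> feq r u s'"
        using inv'[OF r(1) lq_P(1)[OF q(1)]] tau_pair[OF r(2)] T_le[OF g r(3)] by blast
    next
      fix u b q assume u: "pair u b \<epsilon> tau g y" and q: "lq q (T g p)" "lq q b"
      obtain s a where s: "pair s a \<epsilon> y" "u = tau g s" "b = T g a" using u unfolding mem_tau by auto
      have a: "a \<epsilon> P" "HS s" using HS_pair[OF y s(1)] by blast+
      obtain r s' a' where r: "lq r (T g q)" "pair s' a' \<epsilon> x" "lq r a'" "feq r s' s"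
        using feqD2[OF f s(1) inv[OF q(1) p] inv[OF q(2)[unfolded s(3)] a(1)]] by blast
      have "feq (T g r) (tau g s') u" using IH[OF r(2)] a(2) r(4) s(2) by blast
      then show "\<exists>r s' a'. lq r q \<and> pair s' a' \<epsilon> tau g x \<and> lq r a' \<and> feq r s' u"
        using inv'[OF r(1) lq_P(1)[OF q(1)]] tau_pair[OF r(2)] T_le[OF g r(3)] by blast
    qed
  qed
  then show "HS y \<Longrightarrow> feq p x y \<Longrightarrow> ?thesis" by blast
qed

lemma feq_tau: "g \<epsilon> I \<Longrightarrow> HS x \<Longrightarrow> HS y \<Longrightarrow> p \<epsilon> P \<Longrightarrow> feq (T g p) (tau g x) (tau g y) \<longleftrightarrow> feq p x y"
  using feq_tau1 feq_tau1[of g "tau g x" "tau g y" "T g p"] HS_tau tau_inv T_inv by auto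

lemma fmem_tau1: "g \<epsilon> I \<Longrightarrow> HS x \<Longrightarrow> HS y \<Longrightarrow> p \<epsilon> P \<Longrightarrow> fmem p x y \<Longrightarrow> fmem (T g p) (tau g x) (tau g y)"
  unfolding fmem_def
proof (intro allI impI)
  fix q assume g: "g \<epsilon> I" and x: "HS x" and y: "HS y" and p: "p \<epsilon> P" and q: "lq q (T g p)"
    and f: "\<forall>q. lq q p \<longrightarrow> (\<exists>r s a. lq r q \<and> pair s a \<epsilon> y \<and> lq r a \<and> feq r x s)"
  have "lq (T g q) p" using T_le[OF g q] T_inv[OF g p] by simp
  then obtain r s a where r: "lq r (T g q)" "pair s a \<epsilon> y" "lq r a" "feq r x s" using f by blast
  have "lq (T g r) q" using T_le[OF g r(1)] T_inv[OF g lq_P(1)[OF q]] by simp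
  moreover have "feq (T g r) (tau g x) (tau g s)" using feq_tau1[OF g x _ r(4)] HS_pair[OF y r(2)] by blast
  ultimately show "\<exists>r s a. lq r q \<and> pair s a \<epsilon> tau g y \<and> lq r a \<and> feq r (tau g x) s"
    using tau_pair[OF r(2)] T_le[OF g r(3)] by blast
qed

lemma fmem_tau: "g \<epsilon> I \<Longrightarrow> HS x \<Longrightarrow> HS y \<Longrightarrow> p \<epsilon> P \<Longrightarrow> fmem (T g p) (tau g x) (tau g y) \<longleftrightarrow> fmem p x y"
  using fmem_tau1 fmem_tau1[of g "tau g x" "tau g y" "T g p"] HS_tau tau_inv T_inv T_P by auto

subsection \<open>The forcing relation and the truth lemma\<close>

text \<open>Quantifiers range over the hereditarily symmetric names, so this forces truth in the
  symmetric submodel. If all names are symmetric, it is the ordinary forcing relation.\<close>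

primrec fK :: "fm \<Rightarrow> (nat \<Rightarrow> 'a) \<Rightarrow> 'a \<Rightarrow> bool" where
  "fK (Mem i j) e p = fmem p (e i) (e j)"
| "fK (Eq i j) e p = feq p (e i) (e j)"
| "fK (Neg \<phi>) e p = (\<forall>q. lq q p \<longrightarrow> \<not> fK \<phi> e q)"
| "fK (And \<phi> \<psi>) e p = (fK \<phi> e p \<and> fK \<psi> e p)"
| "fK (All \<phi>) e p = (\<forall>x. HS x \<longrightarrow> fK \<phi> (case_nat x e) p)"

lemma fK_mono: "fK \<phi> e p \<Longrightarrow> lq q p \<Longrightarrow> fK \<phi> e q"
proof (induction \<phi> arbitrary: e)
  case (Neg \<phi>)
  then show ?case using lq_trans by auto
qed (use fmem_mono feq_mono in auto)

lemma fK_dense: "p \<epsilon> P \<Longrightarrow> (\<And>q. lq q p \<Longrightarrow> \<exists>r. lq r q \<and> fK \<phi> e r) \<Longrightarrow> fK \<phi> e p"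
proof (induction \<phi> arbitrary: e)
  case (Mem i j)
  then show ?case by (auto intro: fmem_dense)
next
  case (Eq i j)
  then show ?case by (auto intro: feq_dense)
next
  case (Neg \<phi>)
  show ?case unfolding fK.simps
  proof (intro allI impI notI)
    fix q assume q: "lq q p" "fK \<phi> e q"
    then obtain r where "lq r q" "fK (Neg \<phi>) e r" using Neg.prems by blast
    then show False using q fK_mono lq_refl lq_P by (metis fK.simps(3))
  qed
next
  case (And \<phi> \<psi>)
  have "\<exists>r. lq r q \<and> fK \<phi> e r" "\<exists>r. lq r q \<and> fK \<psi> e r" if "lq q p" for q
    using And.prems(2)[OF that] by auto
  then show ?case using And.IH And.prems(1) by simp
next
  case (All \<phi>)
  have "\<exists>r. lq r q \<and> fK \<phi> (case_nat x e) r" if "lq q p" "HS x" for q x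
    using All.prems(2)[OF that(1)] that(2) by auto
  then show ?case using All.IH All.prems(1) by simp
qed

lemma not_fK: "p \<epsilon> P \<Longrightarrow> \<not> fK \<phi> e p \<Longrightarrow> \<exists>q. lq q p \<and> fK (Neg \<phi>) e q"
  using fK_dense[of p \<phi> e] by auto

text \<open>The recursion on the formula takes place outside the model, so definability of forcing
  holds for each formula separately.\<close>

lemma dfn_fK0: "dfn (\<lambda>e. fK \<phi> (\<lambda>i. e (f i)) (e j))"
proof (induction \<phi> arbitrary: f j)
  case (Mem i j)
  then show ?case by (simp, intro dfs)
next
  case (Eq i j)
  then show ?case by (simp, intro dfs)
next
  case (Neg \<phi>)
  show ?case unfolding fK.simps by (intro dfs Neg)
next
  case (And \<phi> \<psi>)
  show ?case unfolding fK.simps by (intro dfs And)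
next
  case (All \<phi>)
  have *: "case_nat (e 0) (\<lambda>i. e (Suc (f i))) = (\<lambda>i. e (case_nat 0 (\<lambda>i. Suc (f i)) i))" for e :: "nat \<Rightarrow> 'a"
    by (rule ext) (simp split: nat.split)
  show ?case unfolding fK.simps by (intro dfs) (unfold *, rule All)
qed

lemma dfn_fK1: "df t \<Longrightarrow> df s \<Longrightarrow> dfn (\<lambda>e. fK \<phi> (case_nat (t e) c) (s e))"
proof (rule dfn_lift2[of "\<lambda>x p. fK \<phi> (case_nat x c) p"])
  have *: "asg (\<lambda>i. case i of 0 \<Rightarrow> Inl 1 | Suc 0 \<Rightarrow> Inl 0 | Suc (Suc i) \<Rightarrow> Inr (c i)) e
    = (\<lambda>i. case i of 0 \<Rightarrow> e 1 | Suc 0 \<Rightarrow> e 0 | Suc (Suc i) \<Rightarrow> c i)" for e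
    by (rule ext) (simp add: asg_def split: nat.split)
  have **: "(\<lambda>i. case Suc i of 0 \<Rightarrow> e 1 | Suc 0 \<Rightarrow> e 0 | Suc (Suc i) \<Rightarrow> c i) = case_nat (e 0) c" for e :: "nat \<Rightarrow> 'a"
    by (rule ext) (simp split: nat.split)
  show "dfn (\<lambda>e. fK \<phi> (case_nat (e 0) c) (e 1))"
    using dfn_asg[OF dfn_fK0[of \<phi> Suc 0], of "\<lambda>i. case i of 0 \<Rightarrow> Inl 1 | Suc 0 \<Rightarrow> Inl 0 | Suc (Suc i) \<Rightarrow> Inr (c i)"]
    unfolding * ** by simp
qed

lemma case_nat_self: "case_nat (e 0) (\<lambda>i. e (Suc i)) = e"
  by (rule ext) (simp split: nat.split)

lemma dfn_fK: "df s \<Longrightarrow> dfn (\<lambda>x. fK \<phi> e (s x))"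
  using dfn_fK1[of "\<lambda>_. e 0" s \<phi> "\<lambda>i. e (Suc i)"] df_const unfolding case_nat_self by blast

lemma dfn_fK2: "df t \<Longrightarrow> df u \<Longrightarrow> df s \<Longrightarrow> dfn (\<lambda>e. fK \<phi> (case_nat (t e) (case_nat (u e) c)) (s e))"
proof (rule dfn_lift3[of "\<lambda>x y p. fK \<phi> (case_nat x (case_nat y c)) p"])
  let ?r = "\<lambda>i. case i of 0 \<Rightarrow> Inl 2 | Suc 0 \<Rightarrow> Inl 0 | Suc (Suc 0) \<Rightarrow> Inl 1 | Suc (Suc (Suc i)) \<Rightarrow> Inr (c i)"
  have *: "asg ?r e
    = (\<lambda>i. case i of 0 \<Rightarrow> e 2 | Suc 0 \<Rightarrow> e 0 | Suc (Suc 0) \<Rightarrow> e 1 | Suc (Suc (Suc i)) \<Rightarrow> c i)" for e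
    by (rule ext) (simp add: asg_def split: nat.split)
  have **: "(\<lambda>i. case Suc i of 0 \<Rightarrow> e 2 | Suc 0 \<Rightarrow> e 0 | Suc (Suc 0) \<Rightarrow> e 1 | Suc (Suc (Suc i)) \<Rightarrow> c i)
      = case_nat (e 0) (case_nat (e 1) c)" for e :: "nat \<Rightarrow> 'a"
    by (rule ext) (simp split: nat.split)
  show "dfn (\<lambda>e. fK \<phi> (case_nat (e 0) (case_nat (e 1) c)) (e 2))"
    using dfn_asg[OF dfn_fK0[of \<phi> Suc 0], of ?r]
    unfolding * ** by simp
qed

text \<open>The quantifier case goes through because \<open>tau g\<close> permutes the hereditarily
  symmetric names.\<close>

lemma fK_tau: "g \<epsilon> I \<Longrightarrow> (\<And>i. HS (e i)) \<Longrightarrow> p \<epsilon> P \<Longrightarrow> fK \<phi> (\<lambda>i. tau g (e i)) (T g p) \<longleftrightarrow> fK \<phi> e p"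
proof (induction \<phi> arbitrary: e p)
  case (Mem i j)
  then show ?case by (simp add: fmem_tau)
next
  case (Eq i j)
  then show ?case by (simp add: feq_tau)
next
  case (Neg \<phi>)
  note g = Neg.prems(1)
  have IH: "fK \<phi> (\<lambda>i. tau g (e i)) (T g q) \<longleftrightarrow> fK \<phi> e q" if "q \<epsilon> P" for q
    using Neg.IH[OF g Neg.prems(2) that] .
  show ?case unfolding fK.simps
  proof (intro iffI allI impI)
    fix q assume a: "\<forall>q. lq q (T g p) \<longrightarrow> \<not> fK \<phi> (\<lambda>i. tau g (e i)) q" and q: "lq q p"
    show "\<not> fK \<phi> e q" using a T_le[OF g q] IH[OF lq_P(1)[OF q]] by blast
  next
    fix q assume a: "\<forall>q. lq q p \<longrightarrow> \<not> fK \<phi> e q" and q: "lq q (T g p)"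
    have "lq (T g q) p" using T_le[OF g q] T_inv[OF g Neg.prems(3)] by simp
    then have "\<not> fK \<phi> e (T g q)" using a by blast
    then show "\<not> fK \<phi> (\<lambda>i. tau g (e i)) q"
      using IH[OF T_P[OF g lq_P(1)[OF q]]] T_inv[OF g lq_P(1)[OF q]] by simp
  qed
next
  case (And \<phi> \<psi>)
  then show ?case by simp
next
  case (All \<phi>)
  note g = All.prems(1)
  have c: "(\<lambda>i. tau g (case_nat x e i)) = case_nat (tau g x) (\<lambda>i. tau g (e i))" for x
    by (rule ext) (simp split: nat.split)
  have "HS (case_nat x e i)" if "HS x" for x i using that All.prems(2) by (simp split: nat.split)
  then have IH: "fK \<phi> (case_nat (tau g x) (\<lambda>i. tau g (e i))) (T g p) \<longleftrightarrow> fK \<phi> (case_nat x e) p" if "HS x" for x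
    using All.IH[OF g, of "case_nat x e" p] All.prems(3) that unfolding c by blast
  show ?case unfolding fK.simps
  proof (intro iffI allI impI)
    fix x assume "\<forall>x. HS x \<longrightarrow> fK \<phi> (case_nat x (\<lambda>i. tau g (e i))) (T g p)" "HS x"
    then show "fK \<phi> (case_nat x e) p" using IH HS_tau[OF g] by blast
  next
    fix x assume "\<forall>x. HS x \<longrightarrow> fK \<phi> (case_nat x e) p" "HS x"
    then show "fK \<phi> (case_nat x (\<lambda>i. tau g (e i))) (T g p)"
      using IH[OF HS_tau[OF g]] HS_tau[OF g] tau_inv[OF g] by metis
  qed
qed

definition eqG :: "'a set \<Rightarrow> 'a \<Rightarrow> 'a \<Rightarrow> bool" where "eqG G x y \<longleftrightarrow> (\<exists>p\<in>G. feq p x y)"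
definition memG :: "'a set \<Rightarrow> 'a \<Rightarrow> 'a \<Rightarrow> bool" where "memG G x y \<longleftrightarrow> (\<exists>p\<in>G. fmem p x y)"

text \<open>Negation and the universal quantifier use that the conditions deciding a formula are
  dense and definable in the model, hence met by \<open>G\<close>. Equality and membership of names
  are read through \<open>G\<close> and are not yet identity and a structure on values.\<close>

lemma truth:
  assumes G: "generic G"
  shows "(\<And>i. HS (e i)) \<Longrightarrow> satk {x. HS x} (memG G) (eqG G) e \<phi> \<longleftrightarrow> (\<exists>p\<in>G. fK \<phi> e p)"
proof (induction \<phi> arbitrary: e)
  case (Neg \<phi>)
  have "(\<exists>p\<in>G. fK \<phi> e p) \<longleftrightarrow> \<not> (\<exists>p\<in>G. fK (Neg \<phi>) e p)"
  proof
    assume "\<exists>p\<in>G. fK \<phi> e p"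
    then obtain p where p: "p \<in> G" "fK \<phi> e p" by blast
    show "\<not> (\<exists>p\<in>G. fK (Neg \<phi>) e p)"
    proof
      assume "\<exists>p\<in>G. fK (Neg \<phi>) e p"
      then obtain q where q: "q \<in> G" "fK (Neg \<phi>) e q" by blast
      obtain r where "lq r p" "lq r q" using generic_dir[OF G p(1) q(1)] by blast
      then show False using p q fK_mono by auto
    qed
  next
    assume n: "\<not> (\<exists>p\<in>G. fK (Neg \<phi>) e p)"
    have d: "dfn (\<lambda>x. fK \<phi> e (x 0) \<or> fK (Neg \<phi>) e (x 0))"
      by (intro dfs dfn_fK)
    obtain p where "p \<in> G" "fK \<phi> e p \<or> fK (Neg \<phi>) e p"
      using generic_dense[OF G d] not_fK lq_refl by blast
    then show "\<exists>p\<in>G. fK \<phi> e p" using n by blast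
  qed
  then show ?case using Neg by simp
next
  case (And \<phi> \<psi>)
  have "(\<exists>p\<in>G. fK (And \<phi> \<psi>) e p) \<longleftrightarrow> (\<exists>p\<in>G. fK \<phi> e p) \<and> (\<exists>p\<in>G. fK \<psi> e p)"
  proof
    assume "(\<exists>p\<in>G. fK \<phi> e p) \<and> (\<exists>p\<in>G. fK \<psi> e p)"
    then obtain p q where p: "p \<in> G" "fK \<phi> e p" and q: "q \<in> G" "fK \<psi> e q" by blast
    obtain r where "r \<in> G" "lq r p" "lq r q" using generic_dir[OF G p(1) q(1)] by blast
    then show "\<exists>p\<in>G. fK (And \<phi> \<psi>) e p"
      using p q fK_mono unfolding fK.simps by blast
  qed auto
  then show ?case using And by simp
next
  case (All \<phi>)
  have "HS (case_nat x e i)" if "HS x" for x i using that All.prems by (simp split: nat.split)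
  then have IH: "satk {x. HS x} (memG G) (eqG G) (case_nat x e) \<phi> \<longleftrightarrow> (\<exists>p\<in>G. fK \<phi> (case_nat x e) p)" if "HS x" for x
    using All.IH that by blast
  have "(\<forall>x. HS x \<longrightarrow> (\<exists>p\<in>G. fK \<phi> (case_nat x e) p)) \<longleftrightarrow> (\<exists>p\<in>G. fK (All \<phi>) e p)"
  proof
    assume a: "\<forall>x. HS x \<longrightarrow> (\<exists>p\<in>G. fK \<phi> (case_nat x e) p)"
    \<comment> \<open>These conditions decide the universal statement: they force it or force a
      particular name to be a counterexample.\<close>
    let ?Q = "\<lambda>p. fK (All \<phi>) e p \<or> (\<exists>x. HS x \<and> fK (Neg \<phi>) (case_nat x e) p)"
    have d: "dfn (\<lambda>x. ?Q (x 0))" by (rule dfn_disj[OF dfn_fK]) (intro dfs dfn_fK1)+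
    have "\<exists>q. lq q p \<and> ?Q q" if p: "p \<epsilon> P" for p
    proof (cases "fK (All \<phi>) e p")
      case True
      then show ?thesis using lq_refl[OF p] by blast
    next
      case False
      then obtain x where "HS x" "\<not> fK \<phi> (case_nat x e) p" by auto
      then show ?thesis using not_fK[OF p] by blast
    qed
    from generic_dense[OF G d this] obtain p where p: "p \<in> G" "?Q p" by blast
    moreover have False if "HS x" and n: "fK (Neg \<phi>) (case_nat x e) p" for x
    proof -
      obtain q where q: "q \<in> G" "fK \<phi> (case_nat x e) q" using a \<open>HS x\<close> by blast
      obtain r where "lq r p" "lq r q" using generic_dir[OF G p(1) q(1)] by blast
      then show False using n q fK_mono by auto
    qed
    ultimately show "\<exists>p\<in>G. fK (All \<phi>) e p" by blast
  next
    assume "\<exists>p\<in>G. fK (All \<phi>) e p"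
    then show "\<forall>x. HS x \<longrightarrow> (\<exists>p\<in>G. fK \<phi> (case_nat x e) p)" by auto
  qed
  then show ?case using IH by simp
qed (simp_all add: memG_def eqG_def)

lemma eqG_refl: "generic G \<Longrightarrow> eqG G x x"
  unfolding eqG_def using generic_one feq_refl one_P by blast

lemma eqG_sym: "eqG G x y \<Longrightarrow> eqG G y x"
  unfolding eqG_def using feq_sym by blast

lemma eqG_trans: "generic G \<Longrightarrow> eqG G x y \<Longrightarrow> eqG G y z \<Longrightarrow> eqG G x z"
  unfolding eqG_def using generic_dir feq_mono feq_trans by meson

lemma memG_cong: "generic G \<Longrightarrow> eqG G x x' \<Longrightarrow> eqG G y y' \<Longrightarrow> memG G x y \<Longrightarrow> memG G x' y'"
  unfolding eqG_def memG_def
proof (elim bexE)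
  fix p q r assume G: "generic G" and p: "p \<in> G" "feq p x x'" and q: "q \<in> G" "feq q y y'" and r: "r \<in> G" "fmem r x y"
  obtain s where s: "s \<in> G" "lq s p" "lq s q" using generic_dir[OF G p(1) q(1)] by blast
  obtain t where t: "t \<in> G" "lq t s" "lq t r" using generic_dir[OF G s(1) r(1)] by blast
  have "fmem t x' y'"
    using fmem_cong2[OF fmem_cong1[OF fmem_mono[OF r(2) t(3)] feq_mono[OF p(2) lq_trans[OF t(2) s(2)]]]
      feq_mono[OF q(2) lq_trans[OF t(2) s(3)]]] .
  then show "\<exists>p\<in>G. fmem p x' y'" using t by blast
qed

text \<open>Forced membership only yields densely many matching elements; genericity produces one
  whose condition lies in \<open>G\<close>.\<close>

lemma memG_iff: "generic G \<Longrightarrow> memG G x y \<longleftrightarrow> (\<exists>s a. pair s a \<epsilon> y \<and> a \<in> G \<and> eqG G x s)"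
proof
  assume G: "generic G" and "memG G x y"
  then obtain p where p: "p \<in> G" "fmem p x y" unfolding memG_def by blast
  have "\<exists>r\<in>G. \<exists>s a. pair s a \<epsilon> y \<and> lq r a \<and> feq r x s"
    by (rule generic_below[OF G p(1), of "\<lambda>r. \<exists>s a. pair s a \<epsilon> y \<and> lq r a \<and> feq r x s"], intro dfs)
      (use p(2) in \<open>unfold fmem_def, blast\<close>)
  then show "\<exists>s a. pair s a \<epsilon> y \<and> a \<in> G \<and> eqG G x s"
    using generic_up[OF G] unfolding eqG_def by blast
next
  assume G: "generic G" and "\<exists>s a. pair s a \<epsilon> y \<and> a \<in> G \<and> eqG G x s"
  then obtain s a p where s: "pair s a \<epsilon> y" "a \<in> G" "p \<in> G" "feq p x s" unfolding eqG_def by blast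
  obtain r where "r \<in> G" "lq r a" "lq r p" using generic_dir[OF G s(2,3)] by blast
  then show "memG G x y" unfolding memG_def using s fmemI feq_mono by blast
qed

subsection \<open>Canonical names\<close>

definition Hchk :: "'a \<Rightarrow> 'a \<Rightarrow> 'a \<Rightarrow> 'a" where
  "Hchk a x f = mk (\<lambda>z. \<exists>u. u \<epsilon> x \<and> z = pair (app f u) one)"

definition chk :: "'a \<Rightarrow> 'a" where "chk = wrec Hchk emp"

lemma mem_Hchk: "z \<epsilon> Hchk a x f \<longleftrightarrow> (\<exists>u. u \<epsilon> x \<and> z = pair (app f u) one)"
  unfolding Hchk_def by (rule mem_mk, rule small_img, intro dfs)

lemma df_Hchk: "df (\<lambda>e. Hchk (e 0) (e 1) (e 2))"
  by (rule df_eqI, unfold mem_Hchk, intro dfs)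

lemma df_chk [dfs]: "df t \<Longrightarrow> df (\<lambda>e. chk (t e))"
  unfolding chk_def by (rule df_wrec[OF df_Hchk]) (rule dfs)

lemma mem_chk: "z \<epsilon> chk x \<longleftrightarrow> (\<exists>u. u \<epsilon> x \<and> z = pair (chk u) one)"
proof -
  have d: "df (\<lambda>e. chk (e 0))" by (intro dfs)
  have "z \<epsilon> chk x \<longleftrightarrow> z \<epsilon> Hchk emp x (blam x chk)"
    unfolding chk_def using wrec[OF df_Hchk, of emp x] by simp
  then show ?thesis unfolding mem_Hchk using app_blam[OF d bl_mem] by metis
qed

lemma tau_chk: "g \<epsilon> I \<Longrightarrow> tau g (chk x) = chk x"
proof -
  assume g: "g \<epsilon> I"
  show ?thesis
  proof (rule eps_induct[of "\<lambda>x. tau g (chk x) = chk x"], intro dfs)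
    fix x assume IH: "\<And>y. y \<epsilon> x \<Longrightarrow> tau g (chk y) = chk y"
    show "tau g (chk x) = chk x"
      by (rule extensional, unfold mem_tau mem_chk) (use IH T_one[OF g] in \<open>metis pair_inj\<close>)
  qed
qed

lemma HS_chk [simp]: "HS (chk x)"
proof (rule eps_induct[of "\<lambda>x. HS (chk x)"], intro dfs)
  fix x assume IH: "\<And>y. y \<epsilon> x \<Longrightarrow> HS (chk y)"
  show "HS (chk x)"
    by (rule HSI) (use S_ne tau_chk IH one_P in \<open>auto simp: sym_def mem_chk\<close>)
qed

lemma feq_chk: "feq p (chk x) (chk y) \<Longrightarrow> x = y"
proof -
  have "\<forall>y p. feq p (chk x) (chk y) \<longrightarrow> x = y"
  proof (rule eps_induct[of "\<lambda>x. \<forall>y p. feq p (chk x) (chk y) \<longrightarrow> x = y"], intro dfs, intro allI impI)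
    fix x y p assume IH: "\<And>u. u \<epsilon> x \<Longrightarrow> \<forall>y p. feq p (chk u) (chk y) \<longrightarrow> u = y" and f: "feq p (chk x) (chk y)"
    note p = feq_P[OF f]
    show "x = y"
    proof (rule extensional, rule iffI)
      fix z assume z: "z \<epsilon> x"
      then have "pair (chk z) one \<epsilon> chk x" unfolding mem_chk by blast
      from feqD1[OF f this lq_refl[OF p] lq_one[OF p]] obtain r w where "w \<epsilon> y" "feq r (chk z) (chk w)"
        unfolding mem_chk by auto
      then show "z \<epsilon> y" using IH[OF z] by blast
    next
      fix z assume z: "z \<epsilon> y"
      then have "pair (chk z) one \<epsilon> chk y" unfolding mem_chk by blast
      from feqD2[OF f this lq_refl[OF p] lq_one[OF p]] obtain r w where "w \<epsilon> x" "feq r (chk w) (chk z)"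
        unfolding mem_chk by auto
      then show "z \<epsilon> x" using IH by blast
    qed
  qed
  then show "feq p (chk x) (chk y) \<Longrightarrow> x = y" by blast
qed

lemma eqG_chk: "eqG G (chk x) (chk y) \<Longrightarrow> x = y"
  unfolding eqG_def using feq_chk by blast

theorem extension_ex:
  assumes G: "generic G"
  shows "\<exists>E' val. val ` {x. HS x} = (UNIV :: nat set) \<and>
    (\<forall>x y. HS x \<longrightarrow> HS y \<longrightarrow> (val x = val y \<longleftrightarrow> eqG G x y)) \<and>
    (\<forall>x y. HS x \<longrightarrow> HS y \<longrightarrow> (E' (val x) (val y) \<longleftrightarrow> memG G x y))"
proof -
  have "\<exists>E' val. val ` {x. HS x} = (UNIV :: nat set) \<and>
    (\<forall>x\<in>{x. HS x}. \<forall>y\<in>{x. HS x}. val x = val y \<longleftrightarrow> eqG G x y) \<and>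
    (\<forall>x\<in>{x. HS x}. \<forall>y\<in>{x. HS x}. E' (val x) (val y) \<longleftrightarrow> memG G x y)"
  proof (rule quotient_structure)
    show "eqG G x x" for x by (rule eqG_refl[OF G])
    show "eqG G y x" if "eqG G x y" for x y using that by (rule eqG_sym)
    show "eqG G x z" if "eqG G x y" "eqG G y z" for x y z using G that by (rule eqG_trans)
    show "memG G x' y'" if "eqG G x x'" "eqG G y y'" "memG G x y" for x y x' y' using G that by (rule memG_cong)
    fix F assume F: "finite F" "F \<subseteq> {x. HS x}"
    show "\<exists>x\<in>{x. HS x}. \<forall>y\<in>F. \<not> eqG G x y"
    proof (rule ccontr)
      assume "\<not> ?thesis"
      then have "\<forall>x. \<exists>y. y \<in> F \<and> eqG G (chk x) y" using HS_chk by blast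
      then obtain f where f: "\<And>x. f x \<in> F" "\<And>x. eqG G (chk x) (f x)" by metis
      \<comment> \<open>Canonical names of different sets are never equal in the extension, so
        finitely many representatives would bound the infinite model.\<close>
      have "inj f"
        by (rule injI) (use f eqG_sym eqG_trans[OF G] eqG_chk in metis)
      moreover have "range f \<subseteq> F" using f by blast
      ultimately show False using F infinite_UNIV by (meson finite_imageD finite_subset)
    qed
  qed
  then show ?thesis by simp
qed

end

section \<open>The symmetric extension as a model of ZF\<close>

locale genext = symsys E P le one I S T fx
  for E :: "'a::countable \<Rightarrow> 'a \<Rightarrow> bool" (infix "\<epsilon>" 50) and P le one I S T fx +
  fixes G :: "'a set" and E' :: "nat \<Rightarrow> nat \<Rightarrow> bool" and val :: "'a \<Rightarrow> nat"
  assumes gen: "generic G"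
    and val_surj: "val ` {x. HS x} = UNIV"
    and val_eq: "HS x \<Longrightarrow> HS y \<Longrightarrow> val x = val y \<longleftrightarrow> eqG G x y"
    and val_mem: "HS x \<Longrightarrow> HS y \<Longrightarrow> E' (val x) (val y) \<longleftrightarrow> memG G x y"
begin

lemma val_ex: "\<exists>x. HS x \<and> val x = n"
  using val_surj by (metis UNIV_I image_iff mem_Collect_eq)

lemma val_truth: "(\<And>i. HS (e i)) \<Longrightarrow> sat E' (\<lambda>i. val (e i)) \<phi> \<longleftrightarrow> (\<exists>p\<in>G. fK \<phi> e p)"
  using satk_quotient[of val "{x. HS x}" "eqG G" E' "memG G" e \<phi>] val_surj val_eq val_mem truth[OF gen] by simp

lemma mem_val: "HS y \<Longrightarrow> E' a (val y) \<longleftrightarrow> (\<exists>s p. pair s p \<epsilon> y \<and> p \<in> G \<and> a = val s)"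
proof -
  assume y: "HS y"
  obtain x where x: "HS x" "a = val x" using val_ex[of a] by blast
  have "eqG G x s \<longleftrightarrow> val x = val s" if "pair s p \<epsilon> y" for s p
    using val_eq x HS_pair[OF y that] by blast
  then show ?thesis using val_mem[OF x(1) y] memG_iff[OF gen] x(2) by metis
qed

lemma mem_val': "HS x \<Longrightarrow> HS y \<Longrightarrow> E' (val x) (val y) \<longleftrightarrow> (\<exists>p\<in>G. fmem p x y)"
  using val_mem unfolding memG_def by blast

lemma G_below2: "p \<in> G \<Longrightarrow> q \<in> G \<Longrightarrow> \<exists>r\<in>G. lq r p \<and> lq r q"
  using generic_dir[OF gen] .

lemma G_P: "p \<in> G \<Longrightarrow> p \<epsilon> P" and G_up: "p \<in> G \<Longrightarrow> lq p q \<Longrightarrow> q \<in> G" and G_one: "one \<in> G"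
  using generic_P[OF gen] generic_up[OF gen] generic_one[OF gen] by blast+

text \<open>A generic condition either forces equality of the two names or exhibits an element of
  one of them that it keeps out of the other; the latter contradicts having the same
  members.\<close>

lemma E'_extensional:
  assumes ab: "\<And>z. E' z a \<longleftrightarrow> E' z b"
  shows "a = b"
proof -
  obtain x where x: "HS x" "a = val x" using val_ex[of a] by blast
  obtain y where y: "HS y" "b = val y" using val_ex[of b] by blast
  let ?Q = "\<lambda>x y p. \<exists>s c. pair s c \<epsilon> x \<and> lq p c \<and> (\<forall>q. lq q p \<longrightarrow> \<not> fmem q s y)"
  have d: "dfn (\<lambda>e. feq (e 0) x y \<or> ?Q x y (e 0) \<or> ?Q y x (e 0))" by (intro dfs)
  have nm: "\<exists>r. lq r q \<and> (\<forall>t. lq t r \<longrightarrow> \<not> fmem t s z)" if "\<not> fmem q s z" for q s z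
    using fmem_dense that by blast
  have "\<exists>r. lq r p \<and> (feq r x y \<or> ?Q x y r \<or> ?Q y x r)" if p: "p \<epsilon> P" for p
  proof (cases "feq p x y")
    case True
    then show ?thesis using lq_refl[OF p] by blast
  next
    case False
    then consider s c q where "pair s c \<epsilon> x" "lq q p" "lq q c" "\<not> fmem q s y"
      | s c q where "pair s c \<epsilon> y" "lq q p" "lq q c" "\<not> fmem q s x"
      using p unfolding feq_iff by blast
    then show ?thesis using nm lq_trans by cases meson+
  qed
  from generic_dense[OF gen d this] obtain r where r: "r \<in> G" "feq r x y \<or> ?Q x y r \<or> ?Q y x r" by blast
  have no: "\<not> ?Q x y r" if x: "HS x" and y: "HS y" and sub: "\<And>z. E' z (val x) \<Longrightarrow> E' z (val y)" for x y
  proof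
    assume "?Q x y r"
    then obtain s c where s: "pair s c \<epsilon> x" "lq r c" "\<forall>q. lq q r \<longrightarrow> \<not> fmem q s y" by blast
    have "E' (val s) (val x)" using mem_val[OF x] s G_up[OF r(1) s(2)] by blast
    then obtain q where q: "q \<in> G" "fmem q s y" using sub mem_val' HS_pair[OF x s(1)] y by blast
    obtain t where "lq t r" "lq t q" using G_below2[OF r(1) q(1)] by blast
    then show False using s q fmem_mono by blast
  qed
  have "feq r x y" using r(2) no[OF x(1) y(1)] no[OF y(1) x(1)] ab x y by blast
  then show ?thesis using val_eq x y r unfolding eqG_def by blast
qed

lemma HS_supp: "HS x \<Longrightarrow> \<exists>s. s \<epsilon> S \<and> (\<forall>g. g \<epsilon> I \<longrightarrow> fx s g \<longrightarrow> tau g x = x)"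
  using HS_sym unfolding sym_def by blast

lemma HS_supp2: "HS x \<Longrightarrow> HS y \<Longrightarrow> \<exists>s. s \<epsilon> S \<and> (\<forall>g. g \<epsilon> I \<longrightarrow> fx s g \<longrightarrow> tau g x = x \<and> tau g y = y)"
  using HS_supp[of x] HS_supp[of y] S_dir by meson

text \<open>An arbitrary assignment need not have names with a common support. A formula depends on
  finitely many indices only, so the first \<open>N\<close> values are named and the rest is filled
  with canonical names.\<close>

lemma env_names:
  fixes N :: nat
  shows "\<exists>e. (\<forall>i. HS (e i)) \<and> (\<forall>i<N. val (e i) = b i) \<and>
     (\<exists>s. s \<epsilon> S \<and> (\<forall>g. g \<epsilon> I \<longrightarrow> fx s g \<longrightarrow> (\<forall>i. tau g (e i) = e i)))"
proof (induction N)
  case 0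
  then show ?case using S_ne tau_chk by (intro exI[of _ "\<lambda>_. chk emp"]) auto
next
  case (Suc N)
  then obtain e s where e: "\<And>i. HS (e i)" "\<And>i. i < N \<Longrightarrow> val (e i) = b i"
    "s \<epsilon> S" "\<And>g i. g \<epsilon> I \<Longrightarrow> fx s g \<Longrightarrow> tau g (e i) = e i" by blast
  obtain x where x: "HS x" "val x = b N" using val_ex by blast
  obtain s' where s': "s' \<epsilon> S" "\<And>g. g \<epsilon> I \<Longrightarrow> fx s' g \<Longrightarrow> tau g x = x" using HS_supp[OF x(1)] by blast
  obtain t where "t \<epsilon> S" "\<forall>g. g \<epsilon> I \<longrightarrow> fx t g \<longrightarrow> fx s g \<and> fx s' g" using S_dir[OF e(3) s'(1)] by blast
  then show ?case using e x s' by (intro exI[of _ "e(N := x)"]) (auto simp: less_Suc_eq)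
qed

text \<open>Separation, replacement, power set and union below are all instances: a definable
  relation between names and conditions, bounded by a set and invariant under the automorphisms
  fixing a support, is itself a hereditarily symmetric name.\<close>

lemma name_ex:
  assumes d: "dfn (\<lambda>e. Q (e 0) (e 1))"
    and Q: "\<And>s p. Q s p \<Longrightarrow> HS s \<and> s \<epsilon> t \<and> p \<epsilon> P"
    and s0: "s0 \<epsilon> S"
    and inv: "\<And>g s p. g \<epsilon> I \<Longrightarrow> fx s0 g \<Longrightarrow> Q s p \<Longrightarrow> Q (tau g s) (T g p)"
  shows "\<exists>y. HS y \<and> (\<forall>s p. pair s p \<epsilon> y \<longleftrightarrow> Q s p) \<and> (\<forall>a. E' a (val y) \<longleftrightarrow> (\<exists>s p. Q s p \<and> p \<in> G \<and> a = val s))"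
proof -
  have "small (\<lambda>z. \<exists>s p. z = pair s p \<and> Q s p)"
    by (rule small_sub[of _ "prod t P"]) (intro dfs dfn_lift2[of Q, OF d], use Q in auto)
  then obtain y where y: "\<And>z. z \<epsilon> y \<longleftrightarrow> (\<exists>s p. z = pair s p \<and> Q s p)" unfolding small_def by blast
  have yQ: "pair s p \<epsilon> y \<longleftrightarrow> Q s p" for s p unfolding y by auto
  have "HS y" by (rule HS_intro[OF _ s0]) (use y Q inv yQ in blast)+
  moreover from this have "\<forall>a. E' a (val y) \<longleftrightarrow> (\<exists>s p. Q s p \<and> p \<in> G \<and> a = val s)"
    unfolding mem_val[OF \<open>HS y\<close>] yQ by blast
  ultimately show ?thesis using yQ by blast
qed

lemma dm_tau: "tau g x = x \<Longrightarrow> dm s x \<Longrightarrow> dm (tau g s) x"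
  unfolding dm_def using tau_pair by metis

lemma dm_set: "\<exists>t. \<forall>s. dm s x \<longrightarrow> s \<epsilon> t"
  using pair_mem_UnnD unfolding dm_def by blast

lemma dfn_dm [dfs]: "df t \<Longrightarrow> df s \<Longrightarrow> dfn (\<lambda>e. dm (t e) (s e))"
  by (rule dfn_lift2[of dm]) (unfold dm_def, intro dfs)

lemma dm_HS: "HS x \<Longrightarrow> dm s x \<Longrightarrow> HS s"
  unfolding dm_def using HS_pair by blast

lemma dm_fmem_tau:
  assumes "g \<epsilon> I" "tau g x = x" "HS x" "dm s x" "p \<epsilon> P" "fmem p s x"
  shows "dm (tau g s) x \<and> T g p \<epsilon> P \<and> fmem (T g p) (tau g s) x"
  using dm_tau[OF assms(2,4)] T_P[OF assms(1,5)] fmem_tau1[OF assms(1) dm_HS[OF assms(3,4)] assms(3,5,6)]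
  unfolding assms(2) by blast

text \<open>The extension has no external well-foundedness to appeal to. Induction on the name
  \<open>y\<close> in the ground model shows that below any condition forcing \<open>y\<close> into
  \<open>x\<close> some condition has a name \<open>z\<close> forced into \<open>x\<close> none of
  whose elements can be forced into \<open>x\<close> below it.\<close>

lemma E'_foundation: "E' b a \<Longrightarrow> \<exists>y. E' y a \<and> (\<forall>z. E' z y \<longrightarrow> \<not> E' z a)"
proof -
  assume ba: "E' b a"
  obtain x where x: "HS x" "a = val x" using val_ex[of a] by blast
  obtain y where y: "HS y" "b = val y" using val_ex[of b] by blast
  let ?M = "\<lambda>q. \<exists>z. HS z \<and> fmem q z x \<and> (\<forall>s c r. pair s c \<epsilon> z \<and> lq r q \<and> lq r c \<longrightarrow> \<not> fmem r s x)"
  have "\<forall>p. fmem p y x \<longrightarrow> (\<forall>q. lq q p \<longrightarrow> (\<exists>r. lq r q \<and> ?M r))"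
  proof (rule HS_induct[OF _ y(1), of "\<lambda>y. \<forall>p. fmem p y x \<longrightarrow> (\<forall>q. lq q p \<longrightarrow> (\<exists>r. lq r q \<and> ?M r))"], intro dfs, intro allI impI)
    fix y p q assume y: "HS y" and IH: "\<And>s c. pair s c \<epsilon> y \<Longrightarrow> \<forall>p. fmem p s x \<longrightarrow> (\<forall>q. lq q p \<longrightarrow> (\<exists>r. lq r q \<and> ?M r))"
      and f: "fmem p y x" and q: "lq q p"
    show "\<exists>r. lq r q \<and> ?M r"
    proof (cases "\<exists>s c r. pair s c \<epsilon> y \<and> lq r q \<and> lq r c \<and> fmem r s x")
      case True
      then obtain s c r where s: "pair s c \<epsilon> y" "lq r q" "lq r c" "fmem r s x" by blast
      then obtain t where "lq t r" "?M t" using IH[OF s(1), rule_format, OF s(4) lq_refl[OF lq_P(1)[OF s(2)]]] by (elim exE conjE) (rule that, assumption, blast)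
      then show ?thesis using lq_trans s by blast
    next
      case False
      then have "?M q" using y fmem_mono[OF f q] by blast
      then show ?thesis using lq_refl lq_P q by blast
    qed
  qed
  moreover obtain p where p: "p \<in> G" "fmem p y x" using ba mem_val' x y by blast
  ultimately have below: "\<And>q. lq q p \<Longrightarrow> \<exists>r. lq r q \<and> ?M r" by blast
  have "dfn (\<lambda>e. ?M (e 0))" by (intro dfs)
  then have "\<exists>q\<in>G. ?M q"
    by (rule generic_below[OF gen p(1)]) (rule below)
  then obtain q where q: "q \<in> G" "?M q" by (elim bexE)
  then obtain z where z: "HS z" "fmem q z x" "\<And>s c r. pair s c \<epsilon> z \<Longrightarrow> lq r q \<Longrightarrow> lq r c \<Longrightarrow> \<not> fmem r s x" by blast
  have "\<not> E' c a" if "E' c (val z)" for c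
  proof
    assume "E' c a"
    obtain s d where s: "pair s d \<epsilon> z" "d \<in> G" "c = val s" using mem_val[OF z(1)] \<open>E' c (val z)\<close> by blast
    have "HS s" using HS_pair[OF z(1) s(1)] by blast
    then obtain p where p: "p \<in> G" "fmem p s x" using mem_val' x \<open>E' c a\<close> s by blast
    obtain t where t: "t \<in> G" "lq t p" "lq t q" using G_below2[OF p(1) q(1)] by blast
    obtain u where u: "lq u t" "lq u d" using G_below2[OF t(1) s(2)] by blast
    then show False using z(3)[OF s(1), of u] lq_trans t fmem_mono[OF p(2)] by blast
  qed
  moreover have "E' (val z) a" using mem_val' z x q by blast
  ultimately show ?thesis by blast
qed

definition nup :: "'a \<Rightarrow> 'a \<Rightarrow> 'a" where "nup x y = upair (pair x one) (pair y one)"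

lemma df_nup [dfs]: "df t \<Longrightarrow> df s \<Longrightarrow> df (\<lambda>e. nup (t e) (s e))"
  unfolding nup_def by (intro dfs)

lemma tau_nup: "g \<epsilon> I \<Longrightarrow> tau g (nup x y) = nup (tau g x) (tau g y)"
  by (rule extensional, unfold mem_tau nup_def mem_upair) (metis T_one pair_inj)

lemma HS_nup: "HS x \<Longrightarrow> HS y \<Longrightarrow> HS (nup x y)"
proof -
  assume x: "HS x" and y: "HS y"
  obtain s where "s \<epsilon> S" "\<forall>g. g \<epsilon> I \<longrightarrow> fx s g \<longrightarrow> tau g x = x \<and> tau g y = y" using HS_supp2[OF x y] by blast
  then have "sym (nup x y)" using tau_nup unfolding sym_def by metis
  then show ?thesis by (rule HSI) (use x y one_P in \<open>auto simp: nup_def\<close>)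
qed

lemma mem_val_nup: "HS x \<Longrightarrow> HS y \<Longrightarrow> E' a (val (nup x y)) \<longleftrightarrow> a = val x \<or> a = val y"
  using mem_val[OF HS_nup] G_one by (auto simp: nup_def)

lemma mem_val_chk: "E' a (val (chk x)) \<longleftrightarrow> (\<exists>u. u \<epsilon> x \<and> a = val (chk u))"
  using mem_val[OF HS_chk] G_one by (auto simp: mem_chk)

lemma tau_env: "(\<And>i. tau g (e i) = e i) \<Longrightarrow> (\<lambda>i. tau g (case_nat s e i)) = case_nat (tau g s) e"
  by (rule ext) (simp split: nat.split)

lemma fK_tau1:
  assumes "g \<epsilon> I" "\<And>i. HS (e i)" "\<And>i. tau g (e i) = e i" "HS s" "p \<epsilon> P" "fK \<phi> (case_nat s e) p"
  shows "fK \<phi> (case_nat (tau g s) e) (T g p)"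
  using fK_tau[OF assms(1), of "case_nat s e" p \<phi>] assms by (simp add: tau_env split: nat.split)

lemma fK_tau2:
  assumes "g \<epsilon> I" "\<And>i. HS (e i)" "\<And>i. tau g (e i) = e i" "HS s" "HS s'" "p \<epsilon> P" "fK \<phi> (case_nat s (case_nat s' e)) p"
  shows "fK \<phi> (case_nat (tau g s) (case_nat (tau g s') e)) (T g p)"
proof -
  have "(\<lambda>i. tau g (case_nat s (case_nat s' e) i)) = case_nat (tau g s) (case_nat (tau g s') e)"
    using assms(3) by (intro ext) (simp split: nat.split)
  then show ?thesis using fK_tau[OF assms(1), of "case_nat s (case_nat s' e)" p \<phi>] assms by (simp split: nat.split)
qed

lemma val_env: "(\<lambda>i. val (case_nat s e i)) = case_nat (val s) (\<lambda>i. val (e i))"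
  by (rule ext) (simp split: nat.split)

lemma fv_bound: "\<exists>N. \<forall>i\<in>fv \<phi>. i < N"
  using finite_fv finite_nat_set_iff_bounded by blast

lemma E'_separation: "\<exists>d. \<forall>c. E' c d \<longleftrightarrow> E' c a \<and> sat E' (case_nat c b) \<phi>"
proof -
  obtain x where x: "HS x" "a = val x" using val_ex[of a] by blast
  obtain N where N: "\<forall>i\<in>fv \<phi>. i < N" using fv_bound by blast
  obtain e s1 where e: "\<And>i. HS (e i)" "\<And>i. i < N \<Longrightarrow> val (e i) = b i"
    "s1 \<epsilon> S" "\<And>g i. g \<epsilon> I \<Longrightarrow> fx s1 g \<Longrightarrow> tau g (e i) = e i" using env_names[of N b] by blast
  have sat: "sat E' (case_nat c b) \<phi> \<longleftrightarrow> sat E' (case_nat c (\<lambda>i. val (e i))) \<phi>" for c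
    by (rule satk_cong) (use N e(2) in \<open>force split: nat.split\<close>)
  obtain s2 where s2: "s2 \<epsilon> S" "\<And>g. g \<epsilon> I \<Longrightarrow> fx s2 g \<Longrightarrow> tau g x = x" using HS_supp[OF x(1)] by blast
  obtain s0 where s0: "s0 \<epsilon> S" "\<And>g. g \<epsilon> I \<Longrightarrow> fx s0 g \<Longrightarrow> fx s1 g \<and> fx s2 g" using S_dir[OF e(3) s2(1)] by blast
  obtain t where t: "\<And>s. dm s x \<Longrightarrow> s \<epsilon> t" using dm_set by blast
  let ?Q = "\<lambda>s p. dm s x \<and> p \<epsilon> P \<and> fmem p s x \<and> fK \<phi> (case_nat s e) p"
  have "\<exists>y. HS y \<and> (\<forall>s p. pair s p \<epsilon> y \<longleftrightarrow> ?Q s p) \<and> (\<forall>a. E' a (val y) \<longleftrightarrow> (\<exists>s p. ?Q s p \<and> p \<in> G \<and> a = val s))"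
  proof (rule name_ex[OF _ _ s0(1)])
    show "dfn (\<lambda>a. ?Q (a 0) (a 1))" by (intro dfs dfn_fK1)
    show "HS s \<and> s \<epsilon> t \<and> p \<epsilon> P" if "?Q s p" for s p using that t dm_HS[OF x(1)] by blast
    show "?Q (tau g s) (T g p)" if g: "g \<epsilon> I" "fx s0 g" and q: "?Q s p" for g s p
    proof -
      have t: "tau g x = x" "\<And>i. tau g (e i) = e i" using s0(2)[OF g] s2(2) e(4) g by blast+
      have s: "HS s" using q dm_HS[OF x(1)] by blast
      have "dm (tau g s) x \<and> T g p \<epsilon> P \<and> fmem (T g p) (tau g s) x"
        by (rule dm_fmem_tau[OF g(1) t(1) x(1)]) (use q in simp_all)
      moreover have "fK \<phi> (case_nat (tau g s) e) (T g p)"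
        by (rule fK_tau1[OF g(1) e(1) t(2) s]) (use q in simp_all)
      ultimately show ?thesis by simp
    qed
  qed
  then obtain y where y0: "\<forall>a. E' a (val y) \<longleftrightarrow> (\<exists>s p. ?Q s p \<and> p \<in> G \<and> a = val s)"
    by (elim exE conjE) (rule that)
  note y = y0[rule_format]
  have tr: "sat E' (case_nat (val s) (\<lambda>i. val (e i))) \<phi> \<longleftrightarrow> (\<exists>p\<in>G. fK \<phi> (case_nat s e) p)" if "HS s" for s
    using val_truth[of "case_nat s e" \<phi>] that e(1) unfolding val_env by (simp split: nat.split)
  have "E' c (val y) \<longleftrightarrow> E' c a \<and> sat E' (case_nat c b) \<phi>" for c
  proof
    assume "E' c (val y)"
    then show "E' c a \<and> sat E' (case_nat c b) \<phi>" unfolding y sat using tr dm_HS[OF x(1)] mem_val' x by blast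
  next
    assume c: "E' c a \<and> sat E' (case_nat c b) \<phi>"
    then obtain s d where s: "pair s d \<epsilon> x" "d \<in> G" "c = val s" using mem_val[OF x(1)] x(2) by blast
    have s': "HS s" using HS_pair[OF x(1) s(1)] by blast
    obtain p where p: "p \<in> G" "fmem p s x" using mem_val'[OF s' x(1)] c s x by blast
    obtain q where q: "q \<in> G" "fK \<phi> (case_nat s e) q" using tr[OF s'] c s sat by blast
    obtain r where r: "r \<in> G" "lq r p" "lq r q" using G_below2[OF p(1) q(1)] by blast
    have "?Q s r" using s r p q fmem_mono fK_mono G_P unfolding dm_def by blast
    then show "E' c (val y)" unfolding y using s r by blast
  qed
  then show ?thesis by blast
qed

text \<open>The names of level at most \<open>a\<close>. Unlike the cumulative hierarchy, this one is invariant
  under the automorphisms.\<close>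

definition HNm :: "'a \<Rightarrow> 'a \<Rightarrow> 'a \<Rightarrow> 'a" where
  "HNm a x f = mk (\<lambda>z. \<exists>u. u \<epsilon> x \<and> z \<epsilon> Pw (prod (app f u) P))"

definition Nm :: "'a \<Rightarrow> 'a" where "Nm = wrec HNm emp"

lemma mem_HNm: "z \<epsilon> HNm a x f \<longleftrightarrow> (\<exists>u. u \<epsilon> x \<and> z \<epsilon> Pw (prod (app f u) P))"
proof -
  have s: "small (\<lambda>y. \<exists>u. u \<epsilon> x \<and> y = Pw (prod (app f u) P))" by (rule small_img) (intro dfs)
  show ?thesis unfolding HNm_def
    by (rule mem_mk, rule small_sub[of _ "Unn (mk (\<lambda>y. \<exists>u. u \<epsilon> x \<and> y = Pw (prod (app f u) P)))"], intro dfs)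
      (unfold mem_Unn mem_mk[OF s], blast)
qed

lemma df_HNm: "df (\<lambda>e. HNm (e 0) (e 1) (e 2))"
  by (rule df_eqI, unfold mem_HNm, intro dfs)

lemma df_Nm [dfs]: "df t \<Longrightarrow> df (\<lambda>e. Nm (t e))"
  unfolding Nm_def by (rule df_wrec[OF df_HNm]) (rule dfs)

lemma mem_Nm: "z \<epsilon> Nm x \<longleftrightarrow> (\<exists>u. u \<epsilon> x \<and> z \<epsilon> Pw (prod (Nm u) P))"
proof -
  have d: "df (\<lambda>e. Nm (e 0))" by (intro dfs)
  have "z \<epsilon> Nm x \<longleftrightarrow> z \<epsilon> HNm emp x (blam x Nm)"
    unfolding Nm_def using wrec[OF df_HNm, of emp x] by simp
  then show ?thesis unfolding mem_HNm using app_blam[OF d bl_mem] by metis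
qed

lemma Nm_mono: "(\<And>u. u \<epsilon> a \<Longrightarrow> u \<epsilon> b) \<Longrightarrow> x \<epsilon> Nm a \<Longrightarrow> x \<epsilon> Nm b"
  unfolding mem_Nm[of x] by blast

lemma HS_Nm: "HS x \<Longrightarrow> x \<epsilon> Nm (suc (rank x))"
proof -
  assume "HS x"
  show ?thesis
  proof (rule HS_induct[OF _ \<open>HS x\<close>, of "\<lambda>x. x \<epsilon> Nm (suc (rank x))"], intro dfs)
    fix x assume x: "HS x" and IH: "\<And>s p. pair s p \<epsilon> x \<Longrightarrow> s \<epsilon> Nm (suc (rank s))"
    have "z \<epsilon> prod (Nm (rank x)) P" if z: "z \<epsilon> x" for z
    proof -
      obtain s p where s: "p \<epsilon> P" "z = pair s p" using HS_elem[OF x z] by blast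
      have "rank s \<epsilon> rank x" using z s bl_pair rank_bl by blast
      then have "u \<epsilon> rank x" if "u \<epsilon> suc (rank s)" for u using that Ord_trans[OF Ord_rank] by auto
      then have "s \<epsilon> Nm (rank x)" using IH Nm_mono[of "suc (rank s)"] \<open>z \<epsilon> x\<close> s by blast
      then show ?thesis using s by simp
    qed
    then show "x \<epsilon> Nm (suc (rank x))" unfolding mem_Nm[of x] by (intro exI[of _ "rank x"]) simp
  qed
qed

lemma tau_Nm: "g \<epsilon> I \<Longrightarrow> y \<epsilon> Nm a \<Longrightarrow> tau g y \<epsilon> Nm a"
proof -
  assume g: "g \<epsilon> I"
  have "\<forall>y. y \<epsilon> Nm a \<longrightarrow> tau g y \<epsilon> Nm a"
  proof (rule eps_induct[of "\<lambda>a. \<forall>y. y \<epsilon> Nm a \<longrightarrow> tau g y \<epsilon> Nm a"], intro dfs, intro allI impI)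
    fix a y assume IH: "\<And>b. b \<epsilon> a \<Longrightarrow> \<forall>y. y \<epsilon> Nm b \<longrightarrow> tau g y \<epsilon> Nm b" and y: "y \<epsilon> Nm a"
    then obtain b where b: "b \<epsilon> a" "y \<epsilon> Pw (prod (Nm b) P)" unfolding mem_Nm[of y] by blast
    have "z \<epsilon> prod (Nm b) P" if "z \<epsilon> tau g y" for z
      using that b(2) IH[OF b(1)] T_P[OF g] unfolding mem_tau mem_Pw mem_prod by (metis pair_inj)
    then have "tau g y \<epsilon> Pw (prod (Nm b) P)" unfolding mem_Pw by blast
    then show "tau g y \<epsilon> Nm a" unfolding mem_Nm[of "tau g y"] using b by blast
  qed
  then show "y \<epsilon> Nm a \<Longrightarrow> ?thesis" by blast
qed

lemma E'_replacement:
  assumes fn: "\<forall>c d d'. E' c a \<and> sat E' (case_nat c (case_nat d b)) \<phi> \<and> sat E' (case_nat c (case_nat d' b)) \<phi> \<longrightarrow> d = d'"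
  shows "\<exists>r. \<forall>d. E' d r \<longleftrightarrow> (\<exists>c. E' c a \<and> sat E' (case_nat c (case_nat d b)) \<phi>)"
proof -
  obtain x where x: "HS x" "a = val x" using val_ex[of a] by blast
  obtain N where N: "\<forall>i\<in>fv \<phi>. i < N" using fv_bound by blast
  obtain e s1 where e: "\<And>i. HS (e i)" "\<And>i. i < N \<Longrightarrow> val (e i) = b i"
    "s1 \<epsilon> S" "\<And>g i. g \<epsilon> I \<Longrightarrow> fx s1 g \<Longrightarrow> tau g (e i) = e i" using env_names[of N b] by blast
  have sat: "sat E' (case_nat c (case_nat d b)) \<phi> \<longleftrightarrow> sat E' (case_nat c (case_nat d (\<lambda>i. val (e i)))) \<phi>" for c d
    by (rule satk_cong) (use N e(2) in \<open>force split: nat.split\<close>)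
  obtain s2 where s2: "s2 \<epsilon> S" "\<And>g. g \<epsilon> I \<Longrightarrow> fx s2 g \<Longrightarrow> tau g x = x" using HS_supp[OF x(1)] by blast
  obtain s0 where s0: "s0 \<epsilon> S" "\<And>g. g \<epsilon> I \<Longrightarrow> fx s0 g \<Longrightarrow> fx s1 g \<and> fx s2 g" using S_dir[OF e(3) s2(1)] by blast
  obtain t where t: "\<And>s. dm s x \<Longrightarrow> s \<epsilon> t" using dm_set by blast
  \<comment> \<open>\<open>i\<close> codes an element name of \<open>x\<close> with a condition, and
    \<open>c\<close> is a level at which some name is forced to be its value.\<close>
  let ?C = "\<lambda>i c. \<exists>y. y \<epsilon> Nm c \<and> HS y \<and> fK \<phi> (case_nat (fs i) (case_nat y e)) (sn i)"
  have "dfn (\<lambda>a. ?C (a 0) (a 1))" by (intro dfs dfn_fK2)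
  from Ord_collection[OF this, of "prod t P"] obtain m where m: "Ord m"
    "\<And>i c. i \<epsilon> prod t P \<Longrightarrow> Ord c \<Longrightarrow> ?C i c \<Longrightarrow> \<exists>c. c \<epsilon> m \<and> ?C i c" by blast
  let ?Q = "\<lambda>y p. y \<epsilon> Nm m \<and> HS y \<and> p \<epsilon> P \<and> (\<exists>s. dm s x \<and> fmem p s x \<and> fK \<phi> (case_nat s (case_nat y e)) p)"
  have "\<exists>y. HS y \<and> (\<forall>s p. pair s p \<epsilon> y \<longleftrightarrow> ?Q s p) \<and> (\<forall>a. E' a (val y) \<longleftrightarrow> (\<exists>s p. ?Q s p \<and> p \<in> G \<and> a = val s))"
  proof (rule name_ex[OF _ _ s0(1)])
    show "dfn (\<lambda>a. ?Q (a 0) (a 1))" by (intro dfs dfn_fK2)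
    show "HS s \<and> s \<epsilon> Nm m \<and> p \<epsilon> P" if "?Q s p" for s p using that by blast
    show "?Q (tau g y) (T g p)" if g: "g \<epsilon> I" "fx s0 g" and q: "?Q y p" for g y p
    proof -
      have t: "tau g x = x" "\<And>i. tau g (e i) = e i" using s0(2)[OF g] s2(2) e(4) g by blast+
      obtain s where s: "dm s x" "fmem p s x" "fK \<phi> (case_nat s (case_nat y e)) p" using q by blast
      have s': "HS s" using s dm_HS[OF x(1)] by blast
      have "dm (tau g s) x \<and> fmem (T g p) (tau g s) x" "fK \<phi> (case_nat (tau g s) (case_nat (tau g y) e)) (T g p)"
        using dm_fmem_tau[OF g(1) t(1) x(1) s(1) _ s(2)] fK_tau2[OF g(1) e(1) t(2) s' _ _ s(3)] q
        by blast+
      then show ?thesis using q tau_Nm[OF g(1)] HS_tau[OF g(1)] T_P[OF g(1)] by blast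
    qed
  qed
  then obtain y where y0: "\<forall>a. E' a (val y) \<longleftrightarrow> (\<exists>s p. ?Q s p \<and> p \<in> G \<and> a = val s)"
    by (elim exE conjE) (rule that)
  note y = y0[rule_format]
  have tr: "sat E' (case_nat (val s) (case_nat (val w) (\<lambda>i. val (e i)))) \<phi> \<longleftrightarrow> (\<exists>p\<in>G. fK \<phi> (case_nat s (case_nat w e)) p)"
    if "HS s" "HS w" for s w
    using val_truth[of "case_nat s (case_nat w e)" \<phi>] that e(1) unfolding val_env by (simp split: nat.split)
  have "E' d (val y) \<longleftrightarrow> (\<exists>c. E' c a \<and> sat E' (case_nat c (case_nat d b)) \<phi>)" for d
  proof
    assume "E' d (val y)"
    then obtain w p s where w: "HS w" "p \<in> G" "d = val w" "dm s x" "fmem p s x" "fK \<phi> (case_nat s (case_nat w e)) p"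
      unfolding y by blast
    then have "E' (val s) a \<and> sat E' (case_nat (val s) (case_nat d b)) \<phi>"
      unfolding sat using tr dm_HS[OF x(1)] mem_val' x by blast
    then show "\<exists>c. E' c a \<and> sat E' (case_nat c (case_nat d b)) \<phi>" by blast
  next
    assume "\<exists>c. E' c a \<and> sat E' (case_nat c (case_nat d b)) \<phi>"
    then obtain c where c: "E' c a" "sat E' (case_nat c (case_nat d b)) \<phi>" by blast
    then obtain s k where s: "pair s k \<epsilon> x" "k \<in> G" "c = val s" using mem_val[OF x(1)] x(2) by blast
    have s': "HS s" "dm s x" using HS_pair[OF x(1) s(1)] s dm_def by blast+
    obtain w where w: "HS w" "d = val w" using val_ex[of d] by blast
    obtain p where p: "p \<in> G" "fmem p s x" using mem_val'[OF s'(1) x(1)] c s x by blast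
    obtain q where q: "q \<in> G" "fK \<phi> (case_nat s (case_nat w e)) q" using tr[OF s'(1) w(1)] c s sat w by blast
    have "\<exists>c. c \<epsilon> m \<and> ?C (pair s q) c"
      by (rule m(2)[of _ "suc (rank w)"]) (use t s' G_P[OF q(1)] HS_Nm[OF w(1)] w q in auto)
    then obtain c' w' where w': "c' \<epsilon> m" "w' \<epsilon> Nm c'" "HS w'" "fK \<phi> (case_nat s (case_nat w' e)) q" by auto
    have w'm: "w' \<epsilon> Nm m" by (rule Nm_mono[OF _ w'(2)]) (use Ord_trans[OF m(1) w'(1)] in blast)
    have "sat E' (case_nat c (case_nat (val w') b)) \<phi>" using tr[OF s'(1) w'(3)] q w' s sat by blast
    then have "d = val w'" using fn c by blast
    obtain r where r: "r \<in> G" "lq r p" "lq r q" using G_below2[OF p(1) q(1)] by blast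
    have "?Q w' r" using s' r p w' w'm fmem_mono fK_mono G_P by blast
    then show "E' d (val y)" unfolding y using r \<open>d = val w'\<close> by blast
  qed
  then show ?thesis by blast
qed

text \<open>A subset of \<open>a\<close> can always be renamed using element names of
  \<open>x\<close> and conditions forcing them into \<open>x\<close>. Such names lie in one power
  set of the ground model.\<close>

lemma E'_powerset: "\<exists>y. \<forall>z. E' z y \<longleftrightarrow> (\<forall>u. E' u z \<longrightarrow> E' u a)"
proof -
  obtain x where x: "HS x" "a = val x" using val_ex[of a] by blast
  obtain t where t: "\<And>s. dm s x \<Longrightarrow> s \<epsilon> t" using dm_set by blast
  obtain s0 where s0: "s0 \<epsilon> S" "\<And>g. g \<epsilon> I \<Longrightarrow> fx s0 g \<Longrightarrow> tau g x = x" using HS_supp[OF x(1)] by blast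
  let ?B = "\<lambda>s p. dm s x \<and> p \<epsilon> P \<and> fmem p s x"
  let ?Q = "\<lambda>y p. p = one \<and> HS y \<and> (\<forall>z. z \<epsilon> y \<longrightarrow> (\<exists>s p. z = pair s p \<and> ?B s p))"
  have "\<exists>y. HS y \<and> (\<forall>s p. pair s p \<epsilon> y \<longleftrightarrow> ?Q s p) \<and> (\<forall>a. E' a (val y) \<longleftrightarrow> (\<exists>s p. ?Q s p \<and> p \<in> G \<and> a = val s))"
  proof (rule name_ex[OF _ _ s0(1)])
    show "dfn (\<lambda>a. ?Q (a 0) (a 1))" by (intro dfs)
    show "HS s \<and> s \<epsilon> Pw (prod t P) \<and> p \<epsilon> P" if "?Q s p" for s p using that t one_P by force
    show "?Q (tau g y) (T g p)" if g: "g \<epsilon> I" "fx s0 g" and q: "?Q y p" for g y p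
    proof -
      note tx = s0(2)[OF g]
      have "?B (tau g s) (T g p)" if "?B s p" for s p
        using that dm_fmem_tau[OF g(1) tx x(1)] by blast
      moreover have "?B s a" if "pair s a \<epsilon> y" for s a using q that by force
      ultimately have "\<exists>s p. z = pair s p \<and> ?B s p" if "z \<epsilon> tau g y" for z
        using that unfolding mem_tau by blast
      moreover have "HS (tau g y)" "T g p = one" using q HS_tau[OF g(1)] T_one[OF g(1)] by simp_all
      ultimately show ?thesis by simp
    qed
  qed
  then obtain y where y0: "\<forall>a. E' a (val y) \<longleftrightarrow> (\<exists>s p. ?Q s p \<and> p \<in> G \<and> a = val s)"
    by (elim exE conjE) (rule that)
  note y = y0[rule_format]
  have "E' c (val y) \<longleftrightarrow> (\<forall>u. E' u c \<longrightarrow> E' u a)" for c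
  proof
    assume "E' c (val y)"
    then obtain w where w: "HS w" "c = val w" "\<forall>z. z \<epsilon> w \<longrightarrow> (\<exists>s p. z = pair s p \<and> ?B s p)" unfolding y by blast
    show "\<forall>u. E' u c \<longrightarrow> E' u a"
    proof (intro allI impI)
      fix u assume "E' u c"
      then obtain s p where s: "pair s p \<epsilon> w" "p \<in> G" "u = val s" using mem_val[OF w(1)] w(2) by blast
      then have "fmem p s x" using w(3) by fastforce
      then show "E' u a" using s mem_val' HS_pair[OF w(1) s(1)] x by blast
    qed
  next
    assume c: "\<forall>u. E' u c \<longrightarrow> E' u a"
    obtain w where w: "HS w" "c = val w" using val_ex[of c] by blast
    obtain s1 where s1: "s1 \<epsilon> S" "\<And>g. g \<epsilon> I \<Longrightarrow> fx s1 g \<Longrightarrow> tau g x = x \<and> tau g w = w" using HS_supp2[OF x(1) w(1)] by blast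
    \<comment> \<open>The bounded name for \<open>c\<close>: element names of \<open>x\<close>
      paired with conditions forcing them into \<open>w\<close> as well.\<close>
    let ?R = "\<lambda>s p. ?B s p \<and> fmem p s w"
    have "\<exists>y. HS y \<and> (\<forall>s p. pair s p \<epsilon> y \<longleftrightarrow> ?R s p) \<and> (\<forall>a. E' a (val y) \<longleftrightarrow> (\<exists>s p. ?R s p \<and> p \<in> G \<and> a = val s))"
    proof (rule name_ex[OF _ _ s1(1)])
      show "dfn (\<lambda>a. ?R (a 0) (a 1))" by (intro dfs)
      show "HS s \<and> s \<epsilon> t \<and> p \<epsilon> P" if "?R s p" for s p using that t dm_HS[OF x(1)] by blast
      show "?R (tau g s) (T g p)" if g: "g \<epsilon> I" "fx s1 g" and q: "?R s p" for g s p
      proof -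
        have t: "tau g x = x" "tau g w = w" using s1(2)[OF g] by auto
        have s: "HS s" using q dm_HS[OF x(1)] by blast
        show ?thesis
          using dm_fmem_tau[OF g(1) t(1) x(1)] fmem_tau1[OF g(1) s w(1), of p] q unfolding t(2) by blast
      qed
    qed
    then obtain y' where y0': "HS y'" "\<forall>s p. pair s p \<epsilon> y' \<longleftrightarrow> ?R s p"
      "\<forall>a. E' a (val y') \<longleftrightarrow> (\<exists>s p. ?R s p \<and> p \<in> G \<and> a = val s)"
      by (elim exE conjE) (rule that)
    note y' = y0'[rule_format]
    have "?Q y' one" using y'(1,2) HS_elem[OF y'(1)] by blast
    then have "E' (val y') (val y)" unfolding y using G_one by blast
    moreover have "val y' = c"
    proof (rule E'_extensional)
      fix u show "E' u (val y') \<longleftrightarrow> E' u c"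
      proof
        assume "E' u (val y')"
        then obtain s p where "?R s p" "p \<in> G" "u = val s" unfolding y' by blast
        then show "E' u c" using mem_val' dm_HS[OF x(1)] w by blast
      next
        assume u: "E' u c"
        then have "E' u (val x)" using c x by blast
        then obtain s k where s: "pair s k \<epsilon> x" "k \<in> G" "u = val s" using mem_val[OF x(1)] by blast
        have s': "HS s" "dm s x" using HS_pair[OF x(1) s(1)] s dm_def by blast+
        obtain p where p: "p \<in> G" "fmem p s x" using mem_val'[OF s'(1) x(1)] \<open>E' u (val x)\<close> s by blast
        obtain q where q: "q \<in> G" "fmem q s w" using mem_val'[OF s'(1) w(1)] u s w by blast
        obtain r where r: "r \<in> G" "lq r p" "lq r q" using G_below2[OF p(1) q(1)] by blast
        have "?R s r" using s' p q r fmem_mono G_P by blast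
        then show "E' u (val y')" unfolding y' using r s by blast
      qed
    qed
    ultimately show "E' c (val y)" by simp
  qed
  then show ?thesis by blast
qed

lemma E'_union: "\<exists>y. \<forall>z. E' z y \<longleftrightarrow> (\<exists>u. E' u a \<and> E' z u)"
proof -
  obtain x where x: "HS x" "a = val x" using val_ex[of a] by blast
  obtain s0 where s0: "s0 \<epsilon> S" "\<And>g. g \<epsilon> I \<Longrightarrow> fx s0 g \<Longrightarrow> tau g x = x" using HS_supp[OF x(1)] by blast
  obtain t where t: "trn t" "\<And>z. z \<epsilon> upair x x \<Longrightarrow> z \<epsilon> t" using transitive_superset by blast
  let ?Q = "\<lambda>s p. p \<epsilon> P \<and> (\<exists>y c d. pair y c \<epsilon> x \<and> pair s d \<epsilon> y \<and> lq p c \<and> lq p d)"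
  have "\<exists>y. HS y \<and> (\<forall>s p. pair s p \<epsilon> y \<longleftrightarrow> ?Q s p) \<and> (\<forall>a. E' a (val y) \<longleftrightarrow> (\<exists>s p. ?Q s p \<and> p \<in> G \<and> a = val s))"
  proof (rule name_ex[OF _ _ s0(1)])
    show "dfn (\<lambda>a. ?Q (a 0) (a 1))" by (intro dfs)
    show "HS s \<and> s \<epsilon> t \<and> p \<epsilon> P" if q: "?Q s p" for s p
    proof -
      obtain y c d where y: "pair y c \<epsilon> x" "pair s d \<epsilon> y" using q by blast
      have "x \<epsilon> t" using t(2) by simp
      then have "s \<epsilon> t" using bl_trn[OF t(1)] bl_pair y by blast
      then show ?thesis using q y HS_pair x(1) by blast
    qed
    show "?Q (tau g s) (T g p)" if g: "g \<epsilon> I" "fx s0 g" and q: "?Q s p" for g s p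
    proof -
      obtain y c d where y: "pair y c \<epsilon> x" "pair s d \<epsilon> y" "lq p c" "lq p d" using q by blast
      then show ?thesis
        using tau_pair[OF y(1), of g] tau_pair[OF y(2), of g] T_le[OF g(1)] T_P[OF g(1)] q s0(2)[OF g] by metis
    qed
  qed
  then obtain y where y0: "\<forall>a. E' a (val y) \<longleftrightarrow> (\<exists>s p. ?Q s p \<and> p \<in> G \<and> a = val s)"
    by (elim exE conjE) (rule that)
  note y = y0[rule_format]
  have "E' c (val y) \<longleftrightarrow> (\<exists>u. E' u a \<and> E' c u)" for c
  proof
    assume "E' c (val y)"
    then obtain s p w k d where s: "p \<in> G" "c = val s" "pair w k \<epsilon> x" "pair s d \<epsilon> w" "lq p k" "lq p d" unfolding y by blast
    then have "k \<in> G" "d \<in> G" using G_up by blast+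
    then have "E' (val w) a" "E' c (val w)" using mem_val[OF x(1)] x(2) s mem_val HS_pair[OF x(1) s(3)] by blast+
    then show "\<exists>u. E' u a \<and> E' c u" by blast
  next
    assume "\<exists>u. E' u a \<and> E' c u"
    then obtain u where u: "E' u a" "E' c u" by blast
    then obtain w k where w: "pair w k \<epsilon> x" "k \<in> G" "u = val w" using mem_val[OF x(1)] x(2) by blast
    then obtain s d where s: "pair s d \<epsilon> w" "d \<in> G" "c = val s" using u mem_val HS_pair[OF x(1) w(1)] by blast
    obtain r where "r \<in> G" "lq r k" "lq r d" using G_below2[OF w(2) s(2)] by blast
    then show "E' c (val y)" unfolding y using w s G_P by blast
  qed
  then show ?thesis by blast
qed

sublocale N: zf E'
proof (unfold_locales, goal_cases)
  case (1 x y)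
  then show ?case by (rule E'_extensional)
next
  case (2 y x)
  then show ?case by (rule E'_foundation)
next
  case (3 x y)
  obtain x' where x: "HS x'" "x = val x'" using val_ex[of x] by blast
  obtain y' where y: "HS y'" "y = val y'" using val_ex[of y] by blast
  show ?case using mem_val_nup[OF x(1) y(1)] x y by blast
next
  case (4 x)
  show ?case by (rule E'_union)
next
  case (5 x)
  show ?case by (rule E'_powerset)
next
  case 6
  show ?case
  proof (rule exI[of _ "val (chk om)"], intro conjI allI impI)
    show "\<exists>z. (\<forall>u. \<not> E' u z) \<and> E' z (val (chk om))"
      by (rule exI[of _ "val (chk emp)"]) (auto simp: mem_val_chk intro: emp_om)
    fix x assume "E' x (val (chk om))"
    then obtain n where n: "n \<epsilon> om" "x = val (chk n)" unfolding mem_val_chk by blast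
    show "\<exists>y. (\<forall>u. E' u y \<longleftrightarrow> E' u x \<or> u = x) \<and> E' y (val (chk om))"
      by (rule exI[of _ "val (chk (suc n))"]) (use n suc_om[OF n(1)] in \<open>auto simp: mem_val_chk simp del: suc_om\<close>)
  qed
next
  case (7 a e \<phi>)
  show ?case by (rule E'_separation)
next
  case (8 a e \<phi>)
  then show ?case by (rule E'_replacement)
qed

section \<open>Pairs, canonical names and \<omega> in the extension\<close>

lemma val_nup: "HS x \<Longrightarrow> HS y \<Longrightarrow> val (nup x y) = N.upair (val x) (val y)"
  by (rule N.extensional) (simp add: mem_val_nup)

definition opn :: "'a \<Rightarrow> 'a \<Rightarrow> 'a" where "opn x y = nup (nup x x) (nup x y)"

lemma df_opn [dfs]: "df t \<Longrightarrow> df s \<Longrightarrow> df (\<lambda>e. opn (t e) (s e))"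
  unfolding opn_def by (intro dfs)

lemma HS_opn: "HS x \<Longrightarrow> HS y \<Longrightarrow> HS (opn x y)"
  unfolding opn_def by (simp add: HS_nup)

lemma val_opn: "HS x \<Longrightarrow> HS y \<Longrightarrow> val (opn x y) = N.pair (val x) (val y)"
  unfolding opn_def N.pair_def by (simp add: HS_nup val_nup)

lemma tau_opn: "g \<epsilon> I \<Longrightarrow> tau g (opn x y) = opn (tau g x) (tau g y)"
  unfolding opn_def by (simp add: tau_nup)

lemma val_chk_inj [simp]: "val (chk x) = val (chk y) \<longleftrightarrow> x = y"
  using val_eq[OF HS_chk HS_chk] eqG_chk by blast

lemma val_chk_emp: "val (chk emp) = N.emp"
  by (simp add: N.emp_eq mem_val_chk)

lemma val_chk_suc: "val (chk (suc x)) = N.suc (val (chk x))"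
  by (rule N.extensional) (auto simp: mem_val_chk)

text \<open>As \<open>om\<close> may contain nonstandard numbers, foundation in the extension is
  used instead of counting: a minimal element of \<open>val (chk om)\<close> outside
  \<open>N.om\<close> would be empty or the successor of an element of \<open>N.om\<close>.\<close>

lemma val_chk_om: "val (chk om) = N.om"
proof (rule N.extensional, rule iffI)
  fix z assume z: "E' z (val (chk om))"
  show "E' z N.om"
  proof (rule ccontr)
    assume nz: "\<not> E' z N.om"
    have "N.small (\<lambda>z. E' z (val (chk om)) \<and> \<not> E' z N.om)"
      by (rule N.small_sub[of _ "val (chk om)"]) (intro N.dfs, blast)
    then obtain b where b: "\<And>z. E' z b \<longleftrightarrow> E' z (val (chk om)) \<and> \<not> E' z N.om" unfolding N.small_def by blast
    obtain y where y: "E' y b" "\<forall>w. E' w y \<longrightarrow> \<not> E' w b" using N.foundation[of z b] z nz b by blast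
    obtain n where n: "n \<epsilon> om" "y = val (chk n)" using y b mem_val_chk by blast
    have "y = N.emp \<or> (\<exists>m. m \<epsilon> om \<and> y = N.suc (val (chk m)))"
      using om_cases[OF n(1)] n(2) val_chk_emp val_chk_suc by blast
    moreover have "\<not> E' y N.om" using y b by blast
    ultimately obtain m where m: "m \<epsilon> om" "y = N.suc (val (chk m))" using N.emp_om by blast
    then have "\<not> E' (val (chk m)) b" using y by simp
    then have "E' (val (chk m)) N.om" using b m mem_val_chk by blast
    then show False using m N.suc_om \<open>\<not> E' y N.om\<close> by blast
  qed
next
  fix z assume z: "E' z N.om"
  have "N.indset (val (chk om))" unfolding N.indset_def
    using mem_val_chk val_chk_emp[symmetric] val_chk_suc[symmetric] emp_om suc_om by metis
  then show "E' z (val (chk om))" using z N.mem_om by blast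
qed

end

section \<open>Translation of the formulas\<close>

lemma upd_less: "(y :: nat) < n \<Longrightarrow> (v(n := x)) y = v y"
  by auto

lemma satk_closure: "satk UNIV m q e (closure k A) \<longleftrightarrow> (\<forall>v. hold UNIV m q e A k v)"
proof -
  \<comment> \<open>Generalised to \<open>n\<close> levels already assigned; the \<open>j\<close>
    remaining quantifiers then run over all assignments that agree with \<open>v\<close> below
    \<open>n\<close>.\<close>
  have "satk UNIV m q (\<lambda>i. if i < n then v (n - 1 - i) else e (i - n)) ((All ^^ j) (A (n + j))) \<longleftrightarrow>
    (\<forall>v'. (\<forall>i<n. v' i = v i) \<longrightarrow> hold UNIV m q e A (n + j) v')" for n j v
  proof (induction j arbitrary: n v)
    case 0
    have "hold UNIV m q e A n v' \<longleftrightarrow> hold UNIV m q e A n v" if "\<forall>i<n. v' i = v i" for v'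
    proof -
      have "(if i < n then v' (n - 1 - i) else e (i - n)) = (if i < n then v (n - 1 - i) else e (i - n))" for i
        using that by simp
      then show ?thesis unfolding hold_def by presburger
    qed
    then have "(\<forall>v'. (\<forall>i<n. v' i = v i) \<longrightarrow> hold UNIV m q e A n v') \<longleftrightarrow> hold UNIV m q e A n v" by blast
    then show ?case unfolding add_0_right funpow_0 by (simp only: hold_def)
  next
    case (Suc j)
    have c: "case_nat x (\<lambda>i. if i < n then v (n - 1 - i) else e (i - n))
      = (\<lambda>i. if i < Suc n then (v(n := x)) (Suc n - 1 - i) else e (i - Suc n))" for x
      by (rule ext) (auto split: nat.split)
    have "satk UNIV m q (\<lambda>i. if i < n then v (n - 1 - i) else e (i - n)) ((All ^^ Suc j) (A (n + Suc j))) \<longleftrightarrow>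
      (\<forall>x v'. (\<forall>i<Suc n. v' i = (v(n := x)) i) \<longrightarrow> hold UNIV m q e A (Suc n + j) v')"
      using Suc.IH[of "Suc n"] by (simp add: c)
    also have "\<dots> \<longleftrightarrow> (\<forall>v'. (\<forall>i<n. v' i = v i) \<longrightarrow> hold UNIV m q e A (n + Suc j) v')"
      by (auto simp: less_Suc_eq)
    finally show ?case .
  qed
  from this[of 0 e k] show ?thesis unfolding closure_def by simp
qed

lemma hold_embed:
  assumes "\<And>i. i \<in> fv \<phi> \<Longrightarrow> f i < n"
  shows "hold K m q w (embed \<phi> f) n v = satk K m q (\<lambda>i. v (f i)) \<phi>"
  unfolding hold_def embed_def satk_ren
proof (rule satk_cong)
  fix i assume "i \<in> fv \<phi>"
  then have "f i < n" by (rule assms)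
  then show "(if n - 1 - f i < n then v (n - 1 - (n - 1 - f i)) else w (n - 1 - f i - n)) = v (f i)"
    by simp
qed

declare fun_upd_apply [simp del]

lemmas hold_upd = hold_basic fun_upd_same upd_less

lemma sat_separation:
  assumes c: "closed_at (k + 1) \<phi>"
  shows "sat E e (separation k \<phi>) \<longleftrightarrow>
    (\<forall>v a. \<exists>b. \<forall>x. E x b \<longleftrightarrow> E x a \<and> sat E (case_nat x v) \<phi>)"
proof -
  have h: "hold UNIV E (=) e (embed \<phi> (\<lambda>i. case i of 0 \<Rightarrow> Suc (Suc k) | Suc j \<Rightarrow> j)) (Suc (Suc (Suc k)))
      (v(k := a, Suc k := b, Suc (Suc k) := x)) = sat E (case_nat x v) \<phi>" for v a b x
  proof (subst hold_embed)
    fix i assume "i \<in> fv \<phi>"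
    then have "i < k + 1" using c fv_closed_at by blast
    then show "(case i of 0 \<Rightarrow> Suc (Suc k) | Suc j \<Rightarrow> j) < Suc (Suc (Suc k))" by (auto simp: fun_upd_apply split: nat.split)
  next
    show "sat E (\<lambda>i. (v(k := a, Suc k := b, Suc (Suc k) := x)) (case i of 0 \<Rightarrow> Suc (Suc k) | Suc j \<Rightarrow> j)) \<phi>
      = sat E (case_nat x v) \<phi>"
    proof (rule satk_cong)
      fix i assume "i \<in> fv \<phi>"
      then have "i < k + 1" using c fv_closed_at by blast
      then show "(v(k := a, Suc k := b, Suc (Suc k) := x)) (case i of 0 \<Rightarrow> Suc (Suc k) | Suc j \<Rightarrow> j) = case_nat x v i"
        by (auto simp: fun_upd_apply split: nat.split)
    qed
  qed
  show ?thesis unfolding separation_def satk_closure by (rule iff_allI) (simp add: hold_upd h)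
qed

lemma sat_replacement:
  fixes E :: "'a \<Rightarrow> 'a \<Rightarrow> bool"
  assumes c: "closed_at (k + 2) \<phi>"
  shows "sat E e (replacement k \<phi>) \<longleftrightarrow> (\<forall>v a.
    (\<forall>x y z. E x a \<and> sat E (case_nat x (case_nat y v)) \<phi> \<and> sat E (case_nat x (case_nat z v)) \<phi> \<longrightarrow> y = z) \<longrightarrow>
    (\<exists>b. \<forall>y. E y b \<longleftrightarrow> (\<exists>x. E x a \<and> sat E (case_nat x (case_nat y v)) \<phi>)))"
proof -
  have h: "hold UNIV E (=) e (embed \<phi> (\<lambda>i. case i of 0 \<Rightarrow> s | Suc 0 \<Rightarrow> t | Suc (Suc j) \<Rightarrow> j)) n u = sat E (case_nat (u s) (case_nat (u t) v)) \<phi>"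
    if "s < n" "t < n" "k \<le> n" "\<And>i. i < k \<Longrightarrow> u i = v i" for s t n u v
  proof (subst hold_embed)
    fix i assume "i \<in> fv \<phi>"
    then have "i < k + 2" using c fv_closed_at by blast
    then show "(case i of 0 \<Rightarrow> s | Suc 0 \<Rightarrow> t | Suc (Suc j) \<Rightarrow> j) < n" using that by (auto split: nat.split)
  next
    show "sat E (\<lambda>i. u (case i of 0 \<Rightarrow> s | Suc 0 \<Rightarrow> t | Suc (Suc j) \<Rightarrow> j)) \<phi>
      = sat E (case_nat (u s) (case_nat (u t) v)) \<phi>"
    proof (rule satk_cong)
      fix i assume "i \<in> fv \<phi>"
      then have "i < k + 2" using c fv_closed_at by blast
      then show "u (case i of 0 \<Rightarrow> s | Suc 0 \<Rightarrow> t | Suc (Suc j) \<Rightarrow> j) = case_nat (u s) (case_nat (u t) v) i"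
        using that by (auto split: nat.split)
    qed
  qed
  show ?thesis unfolding replacement_def Let_def satk_closure
  proof (rule iff_allI)
    fix v :: "nat \<Rightarrow> 'a"
    have h': "hold UNIV E (=) e (embed \<phi> (\<lambda>i. case i of 0 \<Rightarrow> s | Suc 0 \<Rightarrow> t | Suc (Suc j) \<Rightarrow> j)) n u = sat E (case_nat (u s) (case_nat (u t) v)) \<phi>"
      if "s < n" "t < n" "k \<le> n" "\<And>i. i < k \<Longrightarrow> u i = v i" for s t n u
      using h[OF that] .
    show "hold UNIV E (=) e (\<^bold>\<forall>a. (\<^bold>\<forall>x. \<^bold>\<forall>y. \<^bold>\<forall>z. x \<^bold>\<in> a \<^bold>\<and>
         embed \<phi> (\<lambda>i. case i of 0 \<Rightarrow> x | Suc 0 \<Rightarrow> y | Suc (Suc j) \<Rightarrow> j) \<^bold>\<and>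
         embed \<phi> (\<lambda>i. case i of 0 \<Rightarrow> x | Suc 0 \<Rightarrow> z | Suc (Suc j) \<Rightarrow> j) \<^bold>\<longrightarrow> y \<^bold>= z) \<^bold>\<longrightarrow>
         (\<^bold>\<exists>b. \<^bold>\<forall>y. y \<^bold>\<in> b \<^bold>\<longleftrightarrow> (\<^bold>\<exists>x. x \<^bold>\<in> a \<^bold>\<and>
         embed \<phi> (\<lambda>i. case i of 0 \<Rightarrow> x | Suc 0 \<Rightarrow> y | Suc (Suc j) \<Rightarrow> j)))) k v \<longleftrightarrow>
      (\<forall>a. (\<forall>x y z. E x a \<and> sat E (case_nat x (case_nat y v)) \<phi> \<and> sat E (case_nat x (case_nat z v)) \<phi> \<longrightarrow> y = z) \<longrightarrow>
        (\<exists>b. \<forall>y. E y b \<longleftrightarrow> (\<exists>x. E x a \<and> sat E (case_nat x (case_nat y v)) \<phi>)))"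
      by (simp add: hold_upd h')
  qed
qed

lemma sat_axioms:
  "sat E e (sentence extensionality) \<longleftrightarrow> (\<forall>x y. (\<forall>z. E z x \<longleftrightarrow> E z y) \<longrightarrow> x = y)"
  "sat E e (sentence Defs.foundation) \<longleftrightarrow> (\<forall>x. (\<exists>y. E y x) \<longrightarrow> (\<exists>y. E y x \<and> (\<forall>z. E z y \<longrightarrow> \<not> E z x)))"
  "sat E e (sentence Defs.pairing) \<longleftrightarrow> (\<forall>x y. \<exists>z. \<forall>u. E u z \<longleftrightarrow> u = x \<or> u = y)"
  "sat E e (sentence union_ax) \<longleftrightarrow> (\<forall>x. \<exists>y. \<forall>z. E z y \<longleftrightarrow> (\<exists>u. E u x \<and> E z u))"
  "sat E e (sentence Defs.powerset) \<longleftrightarrow> (\<forall>x. \<exists>y. \<forall>z. E z y \<longleftrightarrow> (\<forall>u. E u z \<longrightarrow> E u x))"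
  "sat E e (sentence Defs.infinity) \<longleftrightarrow> (\<exists>w. (\<exists>z. (\<forall>u. \<not> E u z) \<and> E z w) \<and>
      (\<forall>x. E x w \<longrightarrow> (\<exists>y. (\<forall>u. E u y \<longleftrightarrow> E u x \<or> u = x) \<and> E y w)))"
  unfolding satk_hold[where v = e] extensionality_def Defs.foundation_def Defs.pairing_def union_ax_def
    Defs.powerset_def Defs.infinity_def is_inductive_def is_empty_def is_succ_def subset_def
  by (simp_all add: hold_upd)

theorem zf_ZF: "zf E \<longleftrightarrow> (\<forall>\<phi>\<in>ZF. sat E e \<phi>)"
proof
  assume "zf E"
  then interpret zf E .
  have "sat E e (separation k \<phi>)" if "closed_at (k + 1) \<phi>" for k \<phi>
    unfolding sat_separation[OF that] using separation by blast
  moreover have "sat E e (replacement k \<phi>)" if "closed_at (k + 2) \<phi>" for k \<phi>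
    unfolding sat_replacement[OF that] using replacement by blast
  moreover have "sat E e (sentence extensionality)" unfolding sat_axioms using set_eq by blast
  moreover have "sat E e (sentence Defs.foundation)" unfolding sat_axioms using foundation by blast
  moreover have "sat E e (sentence Defs.pairing)" unfolding sat_axioms using pairing by blast
  moreover have "sat E e (sentence union_ax)" unfolding sat_axioms using union by blast
  moreover have "sat E e (sentence Defs.powerset)" unfolding sat_axioms using powerset by blast
  moreover have "sat E e (sentence Defs.infinity)" unfolding sat_axioms by (rule infinity)
  ultimately show "\<forall>\<phi>\<in>ZF. sat E e \<phi>" unfolding ZF_def by blast
next
  assume a: "\<forall>\<phi>\<in>ZF. sat E e \<phi>"
  then have ax: "sat E e (sentence extensionality)" "sat E e (sentence Defs.foundation)"
    "sat E e (sentence Defs.pairing)" "sat E e (sentence union_ax)" "sat E e (sentence Defs.powerset)"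
    "sat E e (sentence Defs.infinity)"
    unfolding ZF_def by blast+
  \<comment> \<open>A formula has finitely many free indices, so the axiom with enough quantified
    parameters covers any assignment.\<close>
  have bound: "\<exists>k. closed_at (k + 1) \<phi> \<and> closed_at (k + 2) \<phi>" for \<phi>
  proof -
    obtain N where "\<forall>i\<in>fv \<phi>. i < N" using finite_fv finite_nat_set_iff_bounded by blast
    then show ?thesis by (intro exI[of _ N]) (auto simp: fv_closed_at)
  qed
  show "zf E"
  proof (unfold_locales, goal_cases)
    case (7 a' v \<phi>)
    obtain k where k: "closed_at (k + 1) \<phi>" using bound by blast
    then have "sat E e (separation k \<phi>)" using a unfolding ZF_def by blast
    then show ?case unfolding sat_separation[OF k] by blast
  next
    case (8 a' v \<phi>)
    obtain k where k: "closed_at (k + 2) \<phi>" using bound by blast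
    then have "sat E e (replacement k \<phi>)" using a unfolding ZF_def by blast
    then show ?case using 8 unfolding sat_replacement[OF k] by blast
  qed (use ax[unfolded sat_axioms] in blast)+
qed

section \<open>The vocabulary of the statement, read in a model\<close>

context zf
begin

definition compat :: "'a \<Rightarrow> 'a \<Rightarrow> 'a \<Rightarrow> 'a \<Rightarrow> bool" where
  "compat P le p q \<longleftrightarrow> (\<exists>r. r \<epsilon> P \<and> pair r p \<epsilon> le \<and> pair r q \<epsilon> le)"

definition antich :: "'a \<Rightarrow> 'a \<Rightarrow> 'a \<Rightarrow> bool" where
  "antich P le A \<longleftrightarrow> (\<forall>z. z \<epsilon> A \<longrightarrow> z \<epsilon> P) \<and>
    (\<forall>p q. p \<epsilon> A \<and> q \<epsilon> A \<and> p \<noteq> q \<longrightarrow> \<not> compat P le p q)"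

definition maxanti :: "'a \<Rightarrow> 'a \<Rightarrow> 'a \<Rightarrow> bool" where
  "maxanti P le A \<longleftrightarrow> antich P le A \<and> (\<forall>B. antich P le B \<and> (\<forall>z. z \<epsilon> A \<longrightarrow> z \<epsilon> B) \<longrightarrow> A = B)"

definition ccc1 :: "'a \<Rightarrow> 'a \<Rightarrow> bool" where
  "ccc1 P le \<longleftrightarrow> (\<forall>A. maxanti P le A \<longrightarrow> cntb A)"

definition sigcl :: "'a \<Rightarrow> 'a \<Rightarrow> bool" where
  "sigcl P le \<longleftrightarrow> (\<forall>f. isfun f om P \<and>
     (\<forall>n p q. pair n p \<epsilon> f \<and> pair (suc n) q \<epsilon> f \<longrightarrow> pair q p \<epsilon> le) \<longrightarrow>
     (\<exists>r. r \<epsilon> P \<and> (\<forall>n p. pair n p \<epsilon> f \<longrightarrow> pair r p \<epsilon> le)))"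

definition noanti :: "'a \<Rightarrow> 'a \<Rightarrow> 'a \<Rightarrow> bool" where
  "noanti P le one \<longleftrightarrow> (\<forall>A. (\<forall>z. z \<epsilon> A \<longrightarrow> z \<epsilon> P) \<and> \<not> one \<epsilon> A \<longrightarrow> \<not> maxanti P le A)"

definition nm :: "'a \<Rightarrow> 'a \<Rightarrow> bool" where
  "nm P x \<longleftrightarrow> (\<exists>N. x \<epsilon> N \<and>
     (\<forall>y z. y \<epsilon> N \<and> z \<epsilon> y \<longrightarrow> (\<exists>s p. s \<epsilon> N \<and> p \<epsilon> P \<and> z = pair s p)))"

definition ischk :: "'a \<Rightarrow> 'a \<Rightarrow> 'a \<Rightarrow> bool" where
  "ischk one x c \<longleftrightarrow> (\<exists>t g b. trn t \<and> x \<epsilon> t \<and> isfun g t b \<and>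
     (\<forall>y d. pair y d \<epsilon> g \<longrightarrow> (\<forall>z. z \<epsilon> d \<longleftrightarrow> (\<exists>u v. u \<epsilon> y \<and> pair u v \<epsilon> g \<and> z = pair v one))) \<and>
     pair x c \<epsilon> g)"

abbreviation hld :: "(nat \<Rightarrow> 'a) \<Rightarrow> scheme \<Rightarrow> nat \<Rightarrow> (nat \<Rightarrow> 'a) \<Rightarrow> bool" where
  "hld w \<equiv> hold UNIV (\<epsilon>) (=) w"

lemma upair_char: "(\<forall>u. u \<epsilon> z \<longleftrightarrow> u = x \<or> u = y) \<longleftrightarrow> z = upair x y"
  unfolding set_eq[of z] by simp

lemma hld_subset: "x < n \<Longrightarrow> y < n \<Longrightarrow> hld w (x \<^bold>\<subseteq> y) n v \<longleftrightarrow> (\<forall>z. z \<epsilon> v x \<longrightarrow> z \<epsilon> v y)"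
  by (simp add: subset_def hold_upd)

lemma hld_is_empty: "x < n \<Longrightarrow> hld w (is_empty x) n v \<longleftrightarrow> v x = emp"
  by (simp add: is_empty_def hold_upd emp_eq)

lemma hld_is_succ: "x < n \<Longrightarrow> y < n \<Longrightarrow> hld w (is_succ x y) n v \<longleftrightarrow> v y = suc (v x)"
  by (simp add: is_succ_def hold_upd set_eq[of _ "suc _"])

lemma hld_is_inductive: "x < n \<Longrightarrow> hld w (is_inductive x) n v \<longleftrightarrow> indset (v x)"
  by (simp add: is_inductive_def hold_upd hld_is_empty hld_is_succ indset_def)

lemma hld_is_upair: "x < n \<Longrightarrow> y < n \<Longrightarrow> z < n \<Longrightarrow> hld w (is_upair x y z) n v \<longleftrightarrow> v z = upair (v x) (v y)"
  by (simp add: is_upair_def hold_upd upair_char)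

lemma hld_is_pair: "x < n \<Longrightarrow> y < n \<Longrightarrow> z < n \<Longrightarrow> hld w (is_pair x y z) n v \<longleftrightarrow> v z = pair (v x) (v y)"
  by (simp add: is_pair_def hold_upd hld_is_upair pair_def)

lemma hld_pair_in: "x < n \<Longrightarrow> y < n \<Longrightarrow> z < n \<Longrightarrow> hld w (pair_in x y z) n v \<longleftrightarrow> pair (v x) (v y) \<epsilon> v z"
  by (simp add: pair_in_def hold_upd hld_is_pair)

lemma hld_triple_in: "p < n \<Longrightarrow> x < n \<Longrightarrow> y < n \<Longrightarrow> z < n \<Longrightarrow>
    hld w (triple_in p x y z) n v \<longleftrightarrow> tr (v p) (v x) (v y) \<epsilon> v z"
  by (simp add: triple_in_def hold_upd hld_is_pair hld_pair_in tr_def)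

lemma hld_is_function: "f < n \<Longrightarrow> a < n \<Longrightarrow> b < n \<Longrightarrow> hld w (is_function f a b) n v \<longleftrightarrow> isfun (v f) (v a) (v b)"
  by (simp add: is_function_def hold_upd hld_is_pair hld_pair_in isfun_def)

lemma hld_is_injection: "f < n \<Longrightarrow> a < n \<Longrightarrow> b < n \<Longrightarrow> hld w (is_injection f a b) n v \<longleftrightarrow> isinj (v f) (v a) (v b)"
  by (simp add: is_injection_def hold_upd hld_is_function hld_pair_in isinj_def)

lemma hld_transitive: "x < n \<Longrightarrow> hld w (transitive x) n v \<longleftrightarrow> trn (v x)"
  by (auto simp add: transitive_def hold_upd hld_subset trn_def)

lemma hld_ordinal: "x < n \<Longrightarrow> hld w (ordinal x) n v \<longleftrightarrow> Ord (v x)"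
  by (simp add: ordinal_def hold_upd hld_transitive Ord_def)

lemma om_char: "indset w \<and> (\<forall>v. indset v \<longrightarrow> (\<forall>z. z \<epsilon> w \<longrightarrow> z \<epsilon> v)) \<longleftrightarrow> w = om"
proof
  assume "indset w \<and> (\<forall>v. indset v \<longrightarrow> (\<forall>z. z \<epsilon> w \<longrightarrow> z \<epsilon> v))"
  then show "w = om" unfolding set_eq[of w] mem_om by blast
next
  assume "w = om"
  then show "indset w \<and> (\<forall>v. indset v \<longrightarrow> (\<forall>z. z \<epsilon> w \<longrightarrow> z \<epsilon> v))"
    using mem_om by (simp add: indset_def)
qed

lemma hld_is_omega: "x < n \<Longrightarrow> hld w (is_omega x) n v \<longleftrightarrow> v x = om"
  unfolding om_char[symmetric] by (simp add: is_omega_def hold_upd hld_is_inductive hld_subset)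

lemma hld_countable: "x < n \<Longrightarrow> hld w (Defs.countable x) n v \<longleftrightarrow> cntb (v x)"
  by (simp add: Defs.countable_def hold_upd hld_is_omega hld_is_injection cntb_def)

lemma sat_countable: "sat (\<epsilon>) e (Defs.countable 0 1) \<longleftrightarrow> cntb (e 0)"
proof -
  have "sat (\<epsilon>) e (Defs.countable 0 1) \<longleftrightarrow> hld (\<lambda>i. e (Suc i)) (Defs.countable 0) 1 (\<lambda>_. e 0)"
    unfolding hold_def by (rule satk_cong) auto
  then show ?thesis by (simp add: hld_countable)
qed

lemma hld_is_omega1: "x < n \<Longrightarrow> hld w (is_omega1 x) n v \<longleftrightarrow> is_om1 (v x)"
  by (simp add: is_omega1_def hold_upd hld_ordinal hld_countable is_om1_def)

lemma hld_notion_of_forcing: "P < n \<Longrightarrow> le < n \<Longrightarrow> one < n \<Longrightarrow>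
    hld w (notion_of_forcing P le one) n v \<longleftrightarrow> nof (v P) (v le) (v one)"
  by (simp add: notion_of_forcing_def hold_upd hld_is_pair hld_pair_in nof_def)

lemma hld_compatible: "P < n \<Longrightarrow> le < n \<Longrightarrow> p < n \<Longrightarrow> q < n \<Longrightarrow>
    hld w (compatible P le p q) n v \<longleftrightarrow> compat (v P) (v le) (v p) (v q)"
  by (simp add: compatible_def hold_upd hld_pair_in compat_def)

lemma hld_antichain: "P < n \<Longrightarrow> le < n \<Longrightarrow> A < n \<Longrightarrow>
    hld w (antichain P le A) n v \<longleftrightarrow> antich (v P) (v le) (v A)"
  by (simp add: antichain_def hold_upd hld_subset hld_compatible antich_def)

lemma hld_maximal_antichain: "P < n \<Longrightarrow> le < n \<Longrightarrow> A < n \<Longrightarrow>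
    hld w (maximal_antichain P le A) n v \<longleftrightarrow> maxanti (v P) (v le) (v A)"
  by (simp add: maximal_antichain_def hold_upd hld_subset hld_antichain maxanti_def)

lemma hld_CCC1: "P < n \<Longrightarrow> le < n \<Longrightarrow> hld w (CCC1 P le) n v \<longleftrightarrow> ccc1 (v P) (v le)"
  by (simp add: CCC1_def hold_upd hld_maximal_antichain hld_countable ccc1_def)

lemma hld_sigma_closed: "P < n \<Longrightarrow> le < n \<Longrightarrow> hld w (sigma_closed P le) n v \<longleftrightarrow> sigcl (v P) (v le)"
  by (simp add: sigma_closed_def hold_upd hld_is_omega hld_is_function hld_is_succ hld_pair_in sigcl_def)

lemma hld_no_antichain_avoiding_top: "P < n \<Longrightarrow> le < n \<Longrightarrow> one < n \<Longrightarrow>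
    hld w (no_antichain_avoiding_top P le one) n v \<longleftrightarrow> noanti (v P) (v le) (v one)"
  by (simp add: no_antichain_avoiding_top_def hold_upd hld_subset hld_maximal_antichain noanti_def)

lemma hld_nontrivial: "P < n \<Longrightarrow> one < n \<Longrightarrow> hld w (nontrivial P one) n v \<longleftrightarrow> (\<exists>p. p \<epsilon> v P \<and> p \<noteq> v one)"
  by (simp add: nontrivial_def hold_upd)

lemma hld_is_name: "P < n \<Longrightarrow> x < n \<Longrightarrow> hld w (is_name P x) n v \<longleftrightarrow> nm (v P) (v x)"
  by (simp add: is_name_def hold_upd hld_is_pair nm_def)

lemma hld_is_check: "one < n \<Longrightarrow> x < n \<Longrightarrow> c < n \<Longrightarrow> hld w (is_check one x c) n v \<longleftrightarrow> ischk (v one) (v x) (v c)"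
  by (simp add: is_check_def hold_upd hld_is_pair hld_pair_in hld_transitive hld_is_function ischk_def)

end

section \<open>The official forcing relation agrees with the semantic one\<close>

context forcing
begin

lemma hld_in_dom: "s < n \<Longrightarrow> x < n \<Longrightarrow> hld w (in_dom s x) n v \<longleftrightarrow> dm (v s) (v x)"
  by (simp add: in_dom_def hold_upd hld_pair_in dm_def)

lemma hld_atomic_forcing:
  assumes "Pv < n" "lv < n" "N < n" "Ee < n" "Mm < n" and v: "v Pv = P" "v lv = le"
  shows "hld w (atomic_forcing Pv lv N Ee Mm) n v \<longleftrightarrow> AF (v N) (v Ee) (v Mm)"
  using assms
  by (simp add: atomic_forcing_def hold_upd hld_pair_in hld_triple_in hld_in_dom AF_def lq_def)

lemma hld_forces_eq:
  assumes "Pv < n" "lv < n" "p < n" "x < n" "y < n" and v: "v Pv = P" "v lv = le" "v p \<epsilon> P"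
  shows "hld w (forces_eq Pv lv p x y) n v \<longleftrightarrow> feq (v p) (v x) (v y)"
  using assms by (simp add: forces_eq_def hold_upd hld_triple_in hld_atomic_forcing feq_AF)

lemma hld_forces_mem:
  assumes "Pv < n" "lv < n" "p < n" "x < n" "y < n" and v: "v Pv = P" "v lv = le" "v p \<epsilon> P"
  shows "hld w (forces_mem Pv lv p x y) n v \<longleftrightarrow> fmem (v p) (v x) (v y)"
  using assms by (simp add: forces_mem_def hold_upd hld_triple_in hld_atomic_forcing fmem_AF)

end

context symsys
begin

text \<open>The official relation quantifies over all names, so the symmetric system must make every
  name hereditarily symmetric. \<open>v p \<epsilon> P\<close> is kept through the recursion because
  the clauses of \<open>atomic_forcing\<close> speak about conditions only.\<close>

lemma hld_forces:
  assumes I: "\<And>x. HS x \<longleftrightarrow> nm P x"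
  shows "Pv < n \<Longrightarrow> lv < n \<Longrightarrow> p < n \<Longrightarrow> (\<And>i. e i < n) \<Longrightarrow> v Pv = P \<Longrightarrow> v lv = le \<Longrightarrow> v p \<epsilon> P \<Longrightarrow>
    hld w (forces Pv lv \<phi> e p) n v \<longleftrightarrow> fK \<phi> (\<lambda>i. v (e i)) (v p)"
proof (induction \<phi> arbitrary: n e p v)
  case (Mem i j)
  then show ?case by (simp add: hld_forces_mem)
next
  case (Eq i j)
  then show ?case by (simp add: hld_forces_eq)
next
  case (Neg \<phi>)
  have "hld w (forces Pv lv \<phi> e n) (Suc n) (v(n := q)) \<longleftrightarrow> fK \<phi> (\<lambda>i. v (e i)) q" if "lq q (v p)" for q
  proof -
    have "(\<lambda>i. (v(n := q)) (e i)) = (\<lambda>i. v (e i))" using Neg.prems(4) by (intro ext upd_less)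
    moreover have "hld w (forces Pv lv \<phi> e n) (Suc n) (v(n := q)) \<longleftrightarrow> fK \<phi> (\<lambda>i. (v(n := q)) (e i)) ((v(n := q)) n)"
      by (rule Neg.IH) (use Neg.prems lq_P(1)[OF that] in \<open>auto simp: fun_upd_apply intro: less_SucI\<close>)
    ultimately show ?thesis by (simp add: fun_upd_same)
  qed
  then show ?case using Neg.prems by (auto simp: hold_upd hld_pair_in lq_def)
next
  case (And \<phi> \<psi>)
  then show ?case by (simp add: hold_upd)
next
  case (All \<phi>)
  have "hld w (forces Pv lv \<phi> (\<lambda>i. case i of 0 \<Rightarrow> n | Suc j \<Rightarrow> e j) p) (Suc n) (v(n := x)) \<longleftrightarrow>
      fK \<phi> (case_nat x (\<lambda>i. v (e i))) (v p)" for x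
  proof -
    have "(\<lambda>i. (v(n := x)) (case i of 0 \<Rightarrow> n | Suc j \<Rightarrow> e j)) = case_nat x (\<lambda>i. v (e i))"
      using All.prems(4) by (intro ext) (auto simp: fun_upd_apply less_not_refl split: nat.split)
    moreover have "hld w (forces Pv lv \<phi> (\<lambda>i. case i of 0 \<Rightarrow> n | Suc j \<Rightarrow> e j) p) (Suc n) (v(n := x)) \<longleftrightarrow>
      fK \<phi> (\<lambda>i. (v(n := x)) (case i of 0 \<Rightarrow> n | Suc j \<Rightarrow> e j)) ((v(n := x)) p)"
      by (rule All.IH) (use All.prems in \<open>auto simp: fun_upd_apply intro: less_SucI split: nat.split\<close>)
    ultimately show ?thesis using All.prems by (simp add: upd_less)
  qed
  then show ?case using All.prems by (simp add: hold_upd hld_is_name I)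
qed

lemma chk_ischk: "ischk one x (chk x)"
proof -
  obtain t where t: "trn t" "\<And>z. z \<epsilon> upair x x \<Longrightarrow> z \<epsilon> t" using transitive_superset by blast
  have d: "df (\<lambda>e. chk (e 0))" "df (\<lambda>e. pair (e 0) (chk (e 0)))" by (intro dfs)+
  obtain b where b: "\<And>y. y \<epsilon> b \<longleftrightarrow> (\<exists>u. u \<epsilon> t \<and> y = chk u)" using small_img[OF d(1), of t] unfolding small_def by blast
  obtain g where g: "\<And>y. y \<epsilon> g \<longleftrightarrow> (\<exists>u. u \<epsilon> t \<and> y = pair u (chk u))" using small_img[of "\<lambda>u. pair u (chk u)", OF d(2), of t] unfolding small_def by blast
  have g': "pair y c \<epsilon> g \<longleftrightarrow> y \<epsilon> t \<and> c = chk y" for y c unfolding g by auto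
  have fn: "isfun g t b" unfolding isfun_def g' using b g by blast
  have rec:  "z \<epsilon> d \<longleftrightarrow> (\<exists>u v. u \<epsilon> y \<and> pair u v \<epsilon> g \<and> z = pair v one)" if "pair y d \<epsilon> g" for y d z
    using that t(1) unfolding g' trn_def by (auto simp: mem_chk)
  have xt: "x \<epsilon> t" using t(2) by simp
  then have "pair x (chk x) \<epsilon> g" unfolding g' by simp
  then show ?thesis unfolding ischk_def using t(1) xt fn rec by blast
qed

text \<open>If \<open>p\<close> did not force \<phi>, some condition below it would force the
  negation, contradicting truth in an extension through that condition. Forcing statements can
  therefore be verified by arguing inside models.\<close>

lemma fK_if_generic:
  assumes p: "p \<epsilon> P" and e: "\<And>i. HS (e i)"
    and g: "\<And>G E' val. genext (\<epsilon>) P le one I S T fx G E' val \<Longrightarrow> p \<in> G \<Longrightarrow> sat E' (\<lambda>i. val (e i)) \<phi>"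
  shows "fK \<phi> e p"
proof (rule ccontr)
  assume "\<not> fK \<phi> e p"
  then obtain q where q: "lq q p" "fK (Neg \<phi>) e q" using not_fK[OF p] by blast
  obtain G where G: "generic G" "q \<in> G" using generic_ex lq_P(1)[OF q(1)] by blast
  obtain E' val where ev: "val ` {x. HS x} = (UNIV :: nat set)"
    "\<forall>x y. HS x \<longrightarrow> HS y \<longrightarrow> (val x = val y \<longleftrightarrow> eqG G x y)"
    "\<forall>x y. HS x \<longrightarrow> HS y \<longrightarrow> (E' (val x) (val y) \<longleftrightarrow> memG G x y)"
    using extension_ex[OF G(1)] by blast
  interpret X: genext "(\<epsilon>)" P le one I S T fx G E' val
    by unfold_locales (rule G(1) ev(1) ev(2)[rule_format] ev(3)[rule_format]; assumption)+
  have "sat E' (\<lambda>i. val (e i)) \<phi>" by (rule g) (use X.genext_axioms generic_up[OF G q(1)] in blast)+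
  moreover have "sat E' (\<lambda>i. val (e i)) (Neg \<phi>)" unfolding X.val_truth[OF e] using G q by blast
  ultimately show False by simp
qed

end

declare fun_upd_apply [simp]

section \<open>Collapsing forcings without long antichains\<close>

context zf
begin

lemma dfn_compat [dfs]: "df t \<Longrightarrow> df s \<Longrightarrow> df u \<Longrightarrow> df w \<Longrightarrow> dfn (\<lambda>e. compat (t e) (s e) (u e) (w e))"
  by (rule dfn_lift4[of compat]) (unfold compat_def, intro dfs)

lemma dfn_antich [dfs]: "df t \<Longrightarrow> df s \<Longrightarrow> df u \<Longrightarrow> dfn (\<lambda>e. antich (t e) (s e) (u e))"
  by (rule dfn_lift3[of antich]) (unfold antich_def, intro dfs)

lemma isinj_mem: "isinj q n k \<Longrightarrow> z \<epsilon> q \<Longrightarrow> \<exists>m y. z = pair m y \<and> m \<epsilon> n \<and> y \<epsilon> k"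
  unfolding isinj_def isfun_def by blast

lemma isinj_dom: assumes "isinj q n k" "pair m y \<epsilon> q" shows "m \<epsilon> n" "y \<epsilon> k"
  using isinj_mem[OF assms] by auto

lemma isinj_fun: "isinj q n k \<Longrightarrow> pair m y \<epsilon> q \<Longrightarrow> pair m y' \<epsilon> q \<Longrightarrow> y = y'"
  and isinj_inj: "isinj q n k \<Longrightarrow> pair m y \<epsilon> q \<Longrightarrow> pair m' y \<epsilon> q \<Longrightarrow> m = m'"
  and isinj_tot: "isinj q n k \<Longrightarrow> m \<epsilon> n \<Longrightarrow> \<exists>y. pair m y \<epsilon> q"
  unfolding isinj_def isfun_def by blast+

lemma isinj_app: "isinj q n k \<Longrightarrow> pair m y \<epsilon> q \<Longrightarrow> app q m = y"
  using isinj_fun by (intro app_eq) blast+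

lemma isinj_app_mem: "isinj q n k \<Longrightarrow> m \<epsilon> n \<Longrightarrow> pair m (app q m) \<epsilon> q"
  using isinj_tot isinj_app by metis

lemma isinj_eqI:
  assumes s: "isinj s n k" and t: "isinj t n k" and eq: "\<And>m. m \<epsilon> n \<Longrightarrow> app s m = app t m"
  shows "s = t"
proof -
  have "z \<epsilon> b" if ab: "z \<epsilon> a" "isinj a n k" "isinj b n k" "\<And>m. m \<epsilon> n \<Longrightarrow> app a m = app b m" for a b z
  proof -
    obtain m y where m: "z = pair m y" "m \<epsilon> n" using isinj_mem[OF ab(2,1)] by blast
    have "y = app a m" using isinj_app[OF ab(2)] ab(1) m(1) by simp
    then have "y = app b m" using ab(4)[OF m(2)] by simp
    then show ?thesis using m isinj_app_mem[OF ab(3) m(2)] by simp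
  qed
  from this[OF _ s t eq] this[OF _ t s eq[symmetric]] show ?thesis by (intro extensional) blast
qed

section \<open>Finite injective sequences and their length-lexicographic order\<close>

definition len :: "'a \<Rightarrow> 'a" where "len q = mk (\<lambda>m. \<exists>y. pair m y \<epsilon> q)"

lemma mem_len: "m \<epsilon> len q \<longleftrightarrow> (\<exists>y. pair m y \<epsilon> q)"
  unfolding len_def by (rule mem_mk, rule small_sub[of _ "Unn (Unn q)"], intro dfs) (use pair_mem_UnnD in blast)

lemma df_len [dfs]: "df t \<Longrightarrow> df (\<lambda>e. len (t e))"
  by (rule df_lift1[of len]) (rule df_eqI, unfold mem_len, intro dfs)

lemma len_isinj: "isinj q n k \<Longrightarrow> len q = n"
  by (rule extensional) (use mem_len isinj_dom isinj_tot in blast)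

text \<open>Injectivity is what makes the inverse of the generic sequence a function from
  \<open>k\<close> to \<open>om\<close>; that the sequences are functions makes this inverse
  injective.\<close>

definition sq :: "'a \<Rightarrow> 'a \<Rightarrow> bool" where "sq k q \<longleftrightarrow> (\<exists>n. n \<epsilon> om \<and> isinj q n k)"

lemma dfn_sq [dfs]: "df t \<Longrightarrow> df s \<Longrightarrow> dfn (\<lambda>e. sq (t e) (s e))"
  by (rule dfn_lift2[of sq]) (unfold sq_def, intro dfs)

lemma sq_isinj: "sq k q \<Longrightarrow> isinj q (len q) k \<and> len q \<epsilon> om"
  unfolding sq_def using len_isinj by blast

lemma sq_bound: "sq k q \<Longrightarrow> q \<epsilon> Pw (prod om k)"
  unfolding sq_def mem_Pw mem_prod using isinj_mem om_trans by metis

lemma sq_emp: "sq k emp"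
  unfolding sq_def isinj_def isfun_def by (rule exI[of _ emp]) simp

lemma sq_extend:
  assumes q: "sq k q" and a: "a \<epsilon> k"
  shows "\<exists>q'. sq k q' \<and> (\<forall>z. z \<epsilon> q \<longrightarrow> z \<epsilon> q') \<and> (\<exists>n. pair n a \<epsilon> q')"
proof (cases "\<exists>n. pair n a \<epsilon> q")
  case True
  then show ?thesis using q by blast
next
  case False
  obtain n where n: "n \<epsilon> om" "isinj q n k" using q sq_def by blast
  let ?q = "un q (upair (pair n a) (pair n a))"
  have m: "pair m y \<epsilon> ?q \<longleftrightarrow> pair m y \<epsilon> q \<or> (m = n \<and> y = a)" for m y by auto
  have nn: "\<not> pair n y \<epsilon> q" for y using isinj_dom(1)[OF n(2)] irrefl by blast
  have "isinj ?q (suc n) k" unfolding isinj_def isfun_def m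
  proof (intro conjI allI impI)
    show "\<exists>x y. x \<epsilon> suc n \<and> y \<epsilon> k \<and> z = pair x y" if "z \<epsilon> ?q" for z
      using that isinj_mem[OF n(2), of z] a by auto
    show "\<exists>y. pair x y \<epsilon> q \<or> (x = n \<and> y = a)" if "x \<epsilon> suc n" for x
      using that isinj_tot[OF n(2)] by auto
    show "y = y'" if "(pair x y \<epsilon> q \<or> x = n \<and> y = a) \<and> (pair x y' \<epsilon> q \<or> x = n \<and> y' = a)" for x y y'
      using that nn isinj_fun[OF n(2)] by blast
    show "x = x'" if "(pair x y \<epsilon> q \<or> x = n \<and> y = a) \<and> (pair x' y \<epsilon> q \<or> x' = n \<and> y = a)" for x x' y
      using that False isinj_inj[OF n(2)] by blast
  qed
  then have "sq k ?q" unfolding sq_def using n suc_om by blast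
  moreover have "\<exists>n. pair n a \<epsilon> ?q" unfolding m by blast
  ultimately show ?thesis by (intro exI[of _ ?q]) auto
qed

definition lt :: "'a \<Rightarrow> 'a \<Rightarrow> bool" where
  "lt q q' \<longleftrightarrow> len q \<epsilon> len q' \<or> (len q = len q' \<and>
     (\<exists>m. m \<epsilon> len q \<and> (\<forall>i. i \<epsilon> m \<longrightarrow> app q i = app q' i) \<and> app q m \<epsilon> app q' m))"

lemma dfn_lt [dfs]: "df t \<Longrightarrow> df s \<Longrightarrow> dfn (\<lambda>e. lt (t e) (s e))"
  by (rule dfn_lift2[of lt]) (unfold lt_def, intro dfs)

lemma lt_asym: "Ord (len q) \<Longrightarrow> lt q q' \<Longrightarrow> \<not> lt q' q"
proof
  assume o: "Ord (len q)" and a: "lt q q'" "lt q' q"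
  then have l: "len q = len q'" unfolding lt_def using no_cycle irrefl by metis
  obtain m where m: "m \<epsilon> len q" "\<forall>i. i \<epsilon> m \<longrightarrow> app q i = app q' i" "app q m \<epsilon> app q' m"
    using a l irrefl unfolding lt_def by metis
  obtain m' where m': "m' \<epsilon> len q" "\<forall>i. i \<epsilon> m' \<longrightarrow> app q' i = app q i" "app q' m' \<epsilon> app q m'"
    using a l irrefl unfolding lt_def by metis
  have "m \<epsilon> m' \<or> m = m' \<or> m' \<epsilon> m" using Ord_linear Ord_mem[OF o] m m' by blast
  then show False using m m' no_cycle irrefl by metis
qed

text \<open>Among the sequences of least length, minimality is achieved entry by entry:
  \<open>G m t\<close> says that \<open>t\<close> is lexicographically minimal as far as the first
  \<open>m\<close> entries show. The induction on \<open>m\<close> inside the model works because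
  the entries are ordinals below \<open>k\<close>.\<close>

lemma lex_min:
  assumes d: "dfn (\<lambda>e. C (e 0))" and k: "Ord k" and C: "\<And>q. C q \<Longrightarrow> sq k q" and "C q0"
  shows "\<exists>q. C q \<and> (\<forall>q'. C q' \<longrightarrow> q = q' \<or> lt q q')"
proof -
  note d' = dfn_lift1[of C, OF d]
  have "dfn (\<lambda>e. \<exists>q. C q \<and> len q = e 0)" by (intro dfs d')
  from Ord_least[OF this, of "len q0"] obtain n where n: "Ord n" "\<exists>q. C q \<and> len q = n"
    "\<And>m. m \<epsilon> n \<Longrightarrow> \<not> (\<exists>q. C q \<and> len q = m)"
    using \<open>C q0\<close> Ord_nat sq_isinj[OF C] by blast
  then have nom: "n \<epsilon> om" using sq_isinj[OF C] by blast
  have inj: "isinj q n k" if "C q" "len q = n" for q using sq_isinj[OF C[OF that(1)]] that by simp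
  define G where "G m t \<longleftrightarrow> C t \<and> len t = n \<and> (\<forall>s. C s \<and> len s = n \<longrightarrow>
    (\<forall>j. j \<epsilon> m \<longrightarrow> j \<epsilon> n \<longrightarrow> app s j = app t j) \<or>
    (\<exists>j. j \<epsilon> n \<and> j \<epsilon> m \<and> (\<forall>i. i \<epsilon> j \<longrightarrow> app t i = app s i) \<and> app t j \<epsilon> app s j))" for m t
  have dG: "dfn (\<lambda>e. \<exists>t. G (e 0) t)" unfolding G_def by (intro dfs d')
  have "\<exists>t. G n t"
  proof (rule om_induct[of "\<lambda>m. \<exists>t. G m t", OF dG nom])
    show "\<exists>t. G emp t" unfolding G_def using n by auto
    fix m assume m: "m \<epsilon> om" and "\<exists>t. G m t"
    then obtain t where t: "G m t" by blast
    show "\<exists>t. G (suc m) t"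
    proof (cases "m \<epsilon> n")
      case False
      then have "G (suc m) t" using t unfolding G_def by (auto; metis)
      then show ?thesis by blast
    next
      case mn: True
      have tt: "C t" "len t = n" using t unfolding G_def by auto
      \<comment> \<open>The values at \<open>m\<close> of the candidates agreeing with
        \<open>t\<close> below \<open>m\<close>; a candidate \<open>u\<close> attaining the least
        one replaces \<open>t\<close>.\<close>
      let ?V = "\<lambda>b. \<exists>s. C s \<and> len s = n \<and> (\<forall>j. j \<epsilon> m \<longrightarrow> app s j = app t j) \<and> app s m = b"
      have "dfn (\<lambda>e. ?V (e 0))" by (intro dfs d')
      moreover have ok: "Ord (app s m)" if "C s" "len s = n" for s
        using isinj_dom(2)[OF inj[OF that] isinj_app_mem[OF inj[OF that] mn]] k Ord_mem by blast
      ultimately obtain b where b: "Ord b" "?V b" "\<And>z. z \<epsilon> b \<Longrightarrow> \<not> ?V z"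
        using Ord_least[of ?V "app t m"] tt by blast
      obtain u where u: "C u" "len u = n" "\<And>j. j \<epsilon> m \<Longrightarrow> app u j = app t j" "app u m = b" using b(2) by blast
      have "G (suc m) u" unfolding G_def
      proof (intro conjI allI impI u)
        fix s assume s: "C s \<and> len s = n"
        consider "\<forall>j. j \<epsilon> m \<longrightarrow> j \<epsilon> n \<longrightarrow> app s j = app t j"
          | j where "j \<epsilon> n" "j \<epsilon> m" "\<forall>i. i \<epsilon> j \<longrightarrow> app t i = app s i" "app t j \<epsilon> app s j"
          using t s unfolding G_def by blast
        then show "(\<forall>j. j \<epsilon> suc m \<longrightarrow> j \<epsilon> n \<longrightarrow> app s j = app u j) \<or>
          (\<exists>j. j \<epsilon> n \<and> j \<epsilon> suc m \<and> (\<forall>i. i \<epsilon> j \<longrightarrow> app u i = app s i) \<and> app u j \<epsilon> app s j)"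
        proof cases
          case 1
          have jn: "j \<epsilon> n" if "j \<epsilon> m" for j using Ord_trans[OF n(1) mn that] .
          have V: "?V (app s m)" using s 1 jn by blast
          then have "b = app s m \<or> b \<epsilon> app s m" using b(3)[of "app s m"] Ord_linear[OF b(1) ok] s by blast
          then show ?thesis
          proof
            assume "b = app s m"
            then have "app s j = app u j" if "j \<epsilon> suc m" for j using that 1 u(3,4) jn by auto
            then show ?thesis by blast
          next
            assume "b \<epsilon> app s m"
            then have "app u m \<epsilon> app s m" "\<forall>i. i \<epsilon> m \<longrightarrow> app u i = app s i" using 1 u(3,4) jn by simp_all
            moreover have "m \<epsilon> suc m" by simp
            ultimately show ?thesis using mn by blast
          qed
        next
          case 2
          have "app u i = app s i" if "i \<epsilon> j" for i
            using u(3)[of i] that 2 Ord_trans[OF Ord_nat[OF m]] by metis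
          moreover have "j \<epsilon> suc m" "app u j = app t j" using 2(2) u(3) by simp_all
          ultimately show ?thesis using 2 by auto
        qed
      qed
      then show ?thesis by blast
    qed
  qed
  then obtain t where t: "G n t" by blast
  have "t = s \<or> lt t s" if Cs: "C s" for s
  proof (cases "len s = n")
    case True
    consider "\<forall>j. j \<epsilon> n \<longrightarrow> app s j = app t j"
      | j where "j \<epsilon> n" "\<forall>i. i \<epsilon> j \<longrightarrow> app t i = app s i" "app t j \<epsilon> app s j"
      using t Cs True unfolding G_def by blast
    then show ?thesis
    proof cases
      case 1
      have "s = t" by (rule isinj_eqI[OF inj[OF Cs True] inj]) (use t 1 in \<open>auto simp: G_def\<close>)
      then show ?thesis by simp
    next
      case 2
      then show ?thesis using t True unfolding lt_def G_def by metis
    qed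
  next
    case False
    have "n \<epsilon> len s" using Ord_linear[OF n(1), of "len s"] False n(3) that sq_isinj[OF C[OF that]] Ord_nat by blast
    then show ?thesis using t unfolding lt_def G_def by blast
  qed
  then show ?thesis using t unfolding G_def by blast
qed

lemma cntb_singleton: "cntb (upair x x)"
  unfolding cntb_def isinj_def isfun_def
  by (rule exI[of _ "upair (pair x emp) (pair x emp)"]) (auto intro: emp_om)

end

text \<open>The conditions are \<open>emp\<close>, serving as the top, and the triples \<open>((i, x), q)\<close> in \<open>R\<close>. They are
  ordered by \<open>i\<close> and \<open>q\<close> only, so that \<open>x\<close> is a mere decoration: below each \<open>i\<close> the forcing is
  equivalent to the collapse of \<open>k\<close> by finite injective sequences \<open>q\<close>. A maximal antichain without
  the top would yield a choice of decorations, namely the one at the lexicographically least \<open>q\<close>.\<close>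

locale levy = zf E for E :: "'a::countable \<Rightarrow> 'a \<Rightarrow> bool" (infix "\<epsilon>" 50) +
  fixes k J R :: 'a
  assumes k: "is_om1 k"
    and J_ne: "\<exists>i. i \<epsilon> J"
    and R_elem: "r \<epsilon> R \<Longrightarrow> \<exists>i x q. r = pair (pair i x) q \<and> i \<epsilon> J \<and> sq k q"
    and R_full: "i \<epsilon> J \<Longrightarrow> sq k q \<Longrightarrow> \<exists>x. pair (pair i x) q \<epsilon> R"
    and nosel: "(\<And>r. r \<epsilon> c \<Longrightarrow> r \<epsilon> R) \<Longrightarrow> (\<And>i. i \<epsilon> J \<Longrightarrow> \<exists>!r. r \<epsilon> c \<and> fs (fs r) = i) \<Longrightarrow> False"
begin

definition PP :: 'a where "PP = un R (upair emp emp)"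

definition LE :: 'a where
  "LE = mk (\<lambda>z. \<exists>r r'. r \<epsilon> PP \<and> r' \<epsilon> PP \<and> z = pair r r' \<and>
     (r' = emp \<or> (r \<noteq> emp \<and> fs (fs r) = fs (fs r') \<and> (\<forall>z. z \<epsilon> sn r' \<longrightarrow> z \<epsilon> sn r))))"

lemma mem_PP: "r \<epsilon> PP \<longleftrightarrow> r \<epsilon> R \<or> r = emp"
  unfolding PP_def by simp

lemma R_ne: "r \<epsilon> R \<Longrightarrow> r \<noteq> emp"
  using R_elem pair_ne by blast

lemma mem_LE: "z \<epsilon> LE \<longleftrightarrow> (\<exists>r r'. r \<epsilon> PP \<and> r' \<epsilon> PP \<and> z = pair r r' \<and>
     (r' = emp \<or> (r \<noteq> emp \<and> fs (fs r) = fs (fs r') \<and> (\<forall>z. z \<epsilon> sn r' \<longrightarrow> z \<epsilon> sn r))))"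
  unfolding LE_def by (rule mem_mk, rule small_sub[of _ "prod PP PP"], intro dfs) auto

lemma LE_pair: "pair r r' \<epsilon> LE \<longleftrightarrow> r \<epsilon> PP \<and> r' \<epsilon> PP \<and>
     (r' = emp \<or> (r \<noteq> emp \<and> fs (fs r) = fs (fs r') \<and> (\<forall>z. z \<epsilon> sn r' \<longrightarrow> z \<epsilon> sn r)))"
  unfolding mem_LE by auto

lemma LE_R: "pair r r' \<epsilon> LE \<Longrightarrow> r' \<epsilon> R \<Longrightarrow>
    r \<epsilon> R \<and> fs (fs r) = fs (fs r') \<and> (\<forall>z. z \<epsilon> sn r' \<longrightarrow> z \<epsilon> sn r)"
  unfolding LE_pair mem_PP using R_ne by blast

lemma LE_I: "r \<epsilon> R \<Longrightarrow> r' \<epsilon> R \<Longrightarrow> fs (fs r) = fs (fs r') \<Longrightarrow> (\<And>z. z \<epsilon> sn r' \<Longrightarrow> z \<epsilon> sn r) \<Longrightarrow> pair r r' \<epsilon> LE"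
  unfolding LE_pair mem_PP using R_ne by blast

lemma LE_emp: "r \<epsilon> PP \<Longrightarrow> pair r emp \<epsilon> LE"
  unfolding LE_pair mem_PP by blast

lemma R_sq: "r \<epsilon> R \<Longrightarrow> sq k (sn r) \<and> fs (fs r) \<epsilon> J"
  using R_elem by fastforce

lemma nof_levy: "nof PP LE emp"
  unfolding nof_def
proof (intro conjI allI impI)
  show "\<exists>p q. p \<epsilon> PP \<and> q \<epsilon> PP \<and> z = pair p q" if "z \<epsilon> LE" for z using that unfolding mem_LE by blast
  show "pair p p \<epsilon> LE" if "p \<epsilon> PP" for p using that unfolding LE_pair by blast
  show "pair p r \<epsilon> LE" if "pair p q \<epsilon> LE \<and> pair q r \<epsilon> LE" for p q r
    using that unfolding LE_pair by auto
  show "emp \<epsilon> PP" unfolding mem_PP by blast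
  show "pair p emp \<epsilon> LE" if "p \<epsilon> PP" for p using that by (rule LE_emp)
qed

text \<open>An antichain containing the top is a singleton. A maximal one without the top meets
  every copy, and within a copy its least sequence determines the member uniquely; these members
  form the selection excluded by \<open>nosel\<close>.\<close>

lemma ccc1_levy: "ccc1 PP LE"
  unfolding ccc1_def
proof (intro allI impI)
  fix A assume "maxanti PP LE A"
  then have A: "\<And>z. z \<epsilon> A \<Longrightarrow> z \<epsilon> PP" "\<And>p q. p \<epsilon> A \<Longrightarrow> q \<epsilon> A \<Longrightarrow> compat PP LE p q \<Longrightarrow> p = q"
    and max: "\<And>B. antich PP LE B \<Longrightarrow> (\<And>z. z \<epsilon> A \<Longrightarrow> z \<epsilon> B) \<Longrightarrow> A = B"
    unfolding maxanti_def antich_def by blast+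
  have refl: "pair p p \<epsilon> LE" if "p \<epsilon> PP" for p using that unfolding LE_pair by blast
  show "cntb A"
  proof (cases "emp \<epsilon> A")
    case True
    have "z = emp" if z: "z \<epsilon> A" for z
      using A(2)[OF z True] A(1)[OF z] refl LE_emp unfolding compat_def by blast
    then have "A = upair emp emp" using True unfolding set_eq[of A] mem_upair by blast
    then show ?thesis using cntb_singleton by simp
  next
    case False
    then have AR: "r \<epsilon> R" if "r \<epsilon> A" for r using that A(1) mem_PP by blast
    \<comment> \<open>A copy avoided by \<open>A\<close> is incompatible with all of
      \<open>A\<close>, so the empty sequence of that copy could be added to
      \<open>A\<close>.\<close>
    have ex: "\<exists>r. r \<epsilon> A \<and> fs (fs r) = i" if i: "i \<epsilon> J" for i
    proof (rule ccontr)
      assume n: "\<not> ?thesis"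
      obtain x where x: "pair (pair i x) emp \<epsilon> R" using R_full[OF i sq_emp] by blast
      let ?r = "pair (pair i x) emp"
      have nc: "\<not> compat PP LE ?r a" "\<not> compat PP LE a ?r" if "a \<epsilon> A" for a
        using that n LE_R[OF _ x] LE_R[OF _ AR[OF that]] unfolding compat_def by (metis fs_pair)+
      have "antich PP LE (un A (upair ?r ?r))" unfolding antich_def
        using A nc x mem_PP by auto
      then have "A = un A (upair ?r ?r)" by (rule max) simp
      then have "?r \<epsilon> A" by (metis mem_un mem_upair)
      then show False using n by auto
    qed
    let ?c = "\<lambda>r. r \<epsilon> A \<and> (\<forall>r'. r' \<epsilon> A \<and> fs (fs r') = fs (fs r) \<longrightarrow> sn r = sn r' \<or> lt (sn r) (sn r'))"
    have sc: "small ?c" by (rule small_sub[of _ A]) (intro dfs, blast)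
    have "\<exists>!r. r \<epsilon> mk ?c \<and> fs (fs r) = i" if i: "i \<epsilon> J" for i
    proof -
      let ?C = "\<lambda>q. \<exists>r. r \<epsilon> A \<and> fs (fs r) = i \<and> sn r = q"
      have "dfn (\<lambda>e. ?C (e 0))" by (intro dfs)
      moreover have "sq k q" if "?C q" for q using that R_sq AR by blast
      moreover obtain q0 where "?C q0" using ex[OF i] by blast
      ultimately obtain q where q: "?C q" "\<And>q'. ?C q' \<Longrightarrow> q = q' \<or> lt q q'"
        using lex_min[of ?C k q0] k unfolding is_om1_def by blast
      then obtain r where r: "r \<epsilon> A" "fs (fs r) = i" "sn r = q" by blast
      have "sn r = sn r' \<or> lt (sn r) (sn r')" if "r' \<epsilon> A" "fs (fs r') = fs (fs r)" for r'
      proof -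
        have "?C (sn r')" using that r(2) by auto
        then show ?thesis using q(2) r(3) by blast
      qed
      then have cr: "?c r" using r(1) by blast
      moreover have "r' = r" if r': "?c r'" "fs (fs r') = i" for r'
      proof -
        have "sn r' = q \<or> lt (sn r') q" "q = sn r' \<or> lt q (sn r')"
          using r' r(1,3) cr r(2) by (metis, metis)
        moreover have "Ord (len q)" using R_sq[OF AR[OF r(1)]] sq_isinj Ord_nat r by blast
        ultimately have "sn r' = q" using lt_asym by blast
        \<comment> \<open>Equal copy and equal sequence make the conditions equivalent whatever
          their decorations, so in an antichain they coincide.\<close>
        then have "pair r r' \<epsilon> LE" using AR r r' by (intro LE_I) auto
        then have "compat PP LE r r'" unfolding compat_def using r refl A(1) by blast
        then show ?thesis using A(2)[OF r(1)] r' by blast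
      qed
      ultimately show ?thesis unfolding mem_mk[OF sc] using r(2) by blast
    qed
    then have False using nosel[of "mk ?c"] AR unfolding mem_mk[OF sc] by blast
    then show ?thesis ..
  qed
qed

text \<open>With no automorphisms and the single support \<open>emp\<close>, every name is
  hereditarily symmetric and \<open>hld_forces\<close> applies.\<close>

interpretation F: symsys "(\<epsilon>)" PP LE emp emp "upair emp emp" "\<lambda>g p. p" "\<lambda>s g. True"
  by unfold_locales (rule nof_levy | rule df_var | rule dfn_const | simp)+

lemma HS_nm: "F.HS x \<longleftrightarrow> nm PP x"
  unfolding F.HS_def nm_def F.sym_def by simp

lemma LE_lq: "F.lq p q \<longleftrightarrow> pair p q \<epsilon> LE"
  unfolding F.lq_def ..

text \<open>The name pairs \<open>(a, n)\<close> with every condition whose sequence takes the value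
  \<open>a\<close> at \<open>n\<close>. Its value in the extension is the generic sequence read
  backwards, an injection of \<open>k\<close> into \<open>om\<close>.\<close>

lemma collapse_levy: "F.fK (Defs.countable 0 1) (\<lambda>_. F.chk k) emp"
proof (rule F.fK_if_generic)
  show "emp \<epsilon> PP" unfolding mem_PP by blast
  show "F.HS (F.chk k)" by simp
  fix G E' val
  assume "genext (\<epsilon>) PP LE emp emp (upair emp emp) (\<lambda>g p. p) (\<lambda>s g. True) G E' val"
  then interpret X: genext "(\<epsilon>)" PP LE emp emp "upair emp emp" "\<lambda>g p. p" "\<lambda>s g. True" G E' val .
  have opn: "X.opn (F.chk a) (F.chk n) = X.opn (F.chk a') (F.chk n') \<longleftrightarrow> a = a' \<and> n = n'" for a n a' n'
    using X.val_opn[of "F.chk a" "F.chk n"] X.val_opn[of "F.chk a'" "F.chk n'"] by (metis F.HS_chk X.N.pair_inj X.val_chk_inj)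
  let ?Q = "\<lambda>s p. \<exists>a n. a \<epsilon> k \<and> n \<epsilon> om \<and> s = X.opn (F.chk a) (F.chk n) \<and> p \<epsilon> R \<and> pair n a \<epsilon> sn p"
  have "df (\<lambda>e. X.opn (F.chk (fs (e 0))) (F.chk (sn (e 0))))" by (intro dfs F.df_chk X.df_opn)
  from small_img[of "\<lambda>z. X.opn (F.chk (fs z)) (F.chk (sn z))", OF this, of "prod k om"]
  obtain t where t: "\<And>y. y \<epsilon> t \<longleftrightarrow> (\<exists>z. z \<epsilon> prod k om \<and> y = X.opn (F.chk (fs z)) (F.chk (sn z)))"
    unfolding small_def by blast
  have "\<exists>y. F.HS y \<and> (\<forall>s p. pair s p \<epsilon> y \<longleftrightarrow> ?Q s p) \<and> (\<forall>a. E' a (val y) \<longleftrightarrow> (\<exists>s p. ?Q s p \<and> p \<in> G \<and> a = val s))"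
  proof (rule X.name_ex)
    show "dfn (\<lambda>e. ?Q (e 0) (e 1))" by (intro dfs F.df_chk X.df_opn)
    show "F.HS s \<and> s \<epsilon> t \<and> p \<epsilon> PP" if q: "?Q s p" for s p
    proof -
      obtain a n where an: "a \<epsilon> k" "n \<epsilon> om" "s = X.opn (F.chk a) (F.chk n)" "p \<epsilon> R" using q by blast
      have "s \<epsilon> t" unfolding t using an by (intro exI[of _ "pair a n"]) auto
      then show ?thesis using an X.HS_opn mem_PP by simp
    qed
    show "emp \<epsilon> upair emp emp" by simp
  qed simp
  then obtain f where f0: "\<forall>a. E' a (val f) \<longleftrightarrow> (\<exists>s p. ?Q s p \<and> p \<in> G \<and> a = val s)"
    by (elim exE conjE) (rule that)
  have f: "E' c (val f) \<longleftrightarrow> (\<exists>a n p. a \<epsilon> k \<and> n \<epsilon> om \<and> p \<in> G \<and> p \<epsilon> R \<and> pair n a \<epsilon> sn p \<and>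
      c = X.N.pair (val (F.chk a)) (val (F.chk n)))" for c
    unfolding f0[rule_format] using X.val_opn[OF F.HS_chk F.HS_chk] by metis
  have f': "E' (X.N.pair u w) (val f) \<longleftrightarrow> (\<exists>a n p. a \<epsilon> k \<and> n \<epsilon> om \<and> p \<in> G \<and> p \<epsilon> R \<and> pair n a \<epsilon> sn p \<and>
      u = val (F.chk a) \<and> w = val (F.chk n))" for u w
    unfolding f by auto
  \<comment> \<open>Sequences of conditions in the filter cohere: a common lower bound lies in the
    same copy and extends both. This gives both single-valuedness and injectivity.\<close>
  have common: "\<exists>r. sq k (sn r) \<and> (\<forall>z. z \<epsilon> sn p \<longrightarrow> z \<epsilon> sn r) \<and> (\<forall>z. z \<epsilon> sn q \<longrightarrow> z \<epsilon> sn r)"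
    if pq: "p \<in> G" "p \<epsilon> R" "q \<in> G" "q \<epsilon> R" for p q
  proof -
    obtain r where "F.lq r p" "F.lq r q" using X.G_below2 pq by blast
    then show ?thesis using LE_R pq R_sq unfolding LE_lq by blast
  qed
  have "X.N.isinj (val f) (val (F.chk k)) X.N.om" unfolding X.N.isinj_def X.N.isfun_def
  proof (intro conjI allI impI)
    show "\<exists>x y. E' x (val (F.chk k)) \<and> E' y X.N.om \<and> z = X.N.pair x y" if "E' z (val f)" for z
      using that unfolding f X.val_chk_om[symmetric] X.mem_val_chk by blast
    show "\<exists>y. E' (X.N.pair x y) (val f)" if x: "E' x (val (F.chk k))" for x
    proof -
      obtain a where a: "a \<epsilon> k" "x = val (F.chk a)" using x X.mem_val_chk by blast
      have "\<exists>r. F.lq r p \<and> r \<epsilon> R \<and> (\<exists>n. pair n a \<epsilon> sn r)" if p: "p \<epsilon> PP" for p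
      proof (cases "p \<epsilon> R")
        case True
        obtain i y q where q: "p = pair (pair i y) q" "i \<epsilon> J" "sq k q" using R_elem[OF True] by blast
        obtain q' where q': "sq k q'" "\<forall>z. z \<epsilon> q \<longrightarrow> z \<epsilon> q'" "\<exists>n. pair n a \<epsilon> q'" using sq_extend[OF q(3) a(1)] by blast
        obtain y' where y': "pair (pair i y') q' \<epsilon> R" using R_full[OF q(2) q'(1)] by blast
        have "pair (pair (pair i y') q') p \<epsilon> LE" by (rule LE_I[OF y' True]) (use q q' in auto)
        then show ?thesis using y' q' unfolding LE_lq by (metis sn_pair)
      next
        case False
        \<comment> \<open>The top carries no sequence, so one first enters an arbitrary copy at a
          sequence that has \<open>a\<close> as a value.\<close>
        then have "p = emp" using p mem_PP by blast
        obtain i where i: "i \<epsilon> J" using J_ne by blast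
        obtain q' where q': "sq k q'" "\<exists>n. pair n a \<epsilon> q'" using sq_extend[OF sq_emp a(1)] by blast
        obtain y' where y': "pair (pair i y') q' \<epsilon> R" using R_full[OF i q'(1)] by blast
        then show ?thesis using LE_emp[of "pair (pair i y') q'"] mem_PP \<open>p = emp\<close> q' unfolding LE_lq by (metis sn_pair)
      qed
      moreover have "dfn (\<lambda>e. e 0 \<epsilon> R \<and> (\<exists>n. pair n a \<epsilon> sn (e 0)))" by (intro dfs)
      ultimately obtain r where r: "r \<in> G" "r \<epsilon> R \<and> (\<exists>n. pair n a \<epsilon> sn r)"
        using F.generic_dense[OF X.gen, of "\<lambda>r. r \<epsilon> R \<and> (\<exists>n. pair n a \<epsilon> sn r)"] by blast
      then obtain n where n: "pair n a \<epsilon> sn r" by blast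
      have "isinj (sn r) (len (sn r)) k \<and> len (sn r) \<epsilon> om" using R_sq r sq_isinj by blast
      then have "n \<epsilon> om" using n isinj_dom om_trans by blast
      then show ?thesis unfolding f' using a r n by blast
    qed
    show "y = y'" if xy: "E' (X.N.pair x y) (val f) \<and> E' (X.N.pair x y') (val f)" for x y y'
    proof -
      obtain a n p a' n' p' where a: "p \<in> G" "p \<epsilon> R" "pair n a \<epsilon> sn p" "x = val (F.chk a)" "y = val (F.chk n)"
        "p' \<in> G" "p' \<epsilon> R" "pair n' a' \<epsilon> sn p'" "x = val (F.chk a')" "y' = val (F.chk n')"
        using xy unfolding f' by blast
      have "a = a'" using a by simp
      obtain r where r: "sq k (sn r)" "pair n a \<epsilon> sn r" "pair n' a \<epsilon> sn r"
        using common[OF a(1,2) a(6,7)] a(3,8) \<open>a = a'\<close> by blast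
      then have "n = n'" using isinj_inj sq_isinj by blast
      then show ?thesis using a by simp
    qed
    show "x = x'" if xy: "E' (X.N.pair x y) (val f) \<and> E' (X.N.pair x' y) (val f)" for x x' y
    proof -
      obtain a n p a' n' p' where a: "p \<in> G" "p \<epsilon> R" "pair n a \<epsilon> sn p" "x = val (F.chk a)" "y = val (F.chk n)"
        "p' \<in> G" "p' \<epsilon> R" "pair n' a' \<epsilon> sn p'" "x' = val (F.chk a')" "y = val (F.chk n')"
        using xy unfolding f' by blast
      have "n = n'" using a by simp
      obtain r where r: "sq k (sn r)" "pair n a \<epsilon> sn r" "pair n a' \<epsilon> sn r"
        using common[OF a(1,2) a(6,7)] a(3,8) \<open>n = n'\<close> by blast
      then have "a = a'" using isinj_fun sq_isinj by blast
      then show ?thesis using a by simp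
    qed
  qed
  then show "sat E' (\<lambda>i. val (F.chk k)) (Defs.countable 0 1)"
    unfolding X.N.sat_countable X.N.cntb_def by blast
qed

lemma hld_collapses:
  assumes "Pv < n" "lv < n" "ov < n" "v Pv = PP" "v lv = LE" "v ov = emp"
  shows "hld w (collapses_omega1 Pv lv ov) n v"
proof -
  have f: "hld w (forces Pv lv (Defs.countable 0 1) (\<lambda>_. Suc n) ov) (Suc (Suc n)) (v(n := k, Suc n := F.chk k))"
    by (subst F.hld_forces[OF HS_nm]) (use assms collapse_levy mem_PP in \<open>auto simp: fun_upd_apply\<close>)
  show ?thesis unfolding collapses_omega1_def hold_ex hold_conj
  proof (intro bexI conjI)
    show "hld w (is_omega1 n) (Suc (Suc n)) (v(n := k, Suc n := F.chk k))"
      using k by (simp add: hld_is_omega1)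
    show "hld w (is_check ov n (Suc n)) (Suc (Suc n)) (v(n := k, Suc n := F.chk k))"
      using assms F.chk_ischk[of k] by (simp add: hld_is_check)
  qed (use f in simp_all)
qed

end

section \<open>Failures of choice that yield such forcings\<close>

context zf
begin

lemma compat_sym: "compat P le p q \<Longrightarrow> compat P le q p"
  unfolding compat_def by blast

definition imgs :: "'a \<Rightarrow> 'a \<Rightarrow> 'a" where "imgs f x = mk (\<lambda>y. \<exists>b. b \<epsilon> x \<and> y = app f b)"

lemma mem_imgs: "y \<epsilon> imgs f x \<longleftrightarrow> (\<exists>b. b \<epsilon> x \<and> y = app f b)"
  unfolding imgs_def by (rule mem_mk, rule small_img, intro dfs)

lemma df_imgs [dfs]: "df t \<Longrightarrow> df s \<Longrightarrow> df (\<lambda>e. imgs (t e) (s e))"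
  by (rule df_lift2[of imgs]) (rule df_eqI, unfold mem_imgs, intro dfs)

text \<open>A function that extends every antichain avoiding the top by one more element, iterated
  along the ordinals, would inject the ordinals into \<open>C\<close>.\<close>

lemma no_antichain_extension:
  assumes nof: "nof C le one"
    and ch: "\<And>A. antich C le A \<Longrightarrow> \<not> one \<epsilon> A \<Longrightarrow>
      ch A \<epsilon> C \<and> ch A \<noteq> one \<and> (\<forall>a. a \<epsilon> A \<longrightarrow> \<not> compat C le a (ch A))"
    and dch: "df (\<lambda>e. ch (e 0))"
  shows False
proof -
  note dch' = df_lift1[of ch, OF dch]
  have self: "compat C le c c" if "c \<epsilon> C" for c using nof that unfolding nof_def compat_def by blast
  \<comment> \<open>Transfinite recursion: \<open>g x\<close> is the value of \<open>ch\<close> at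
    the set \<open>A x\<close> of all earlier values.\<close>
  define g where "g = wrec (\<lambda>a x f. ch (imgs f x)) emp"
  have dH: "df (\<lambda>e. ch (imgs (e 2) (e 1)))" by (intro dfs dch')
  have dg: "df (\<lambda>e. g (e 0))" unfolding g_def by (rule df_wrec[OF dH]) (intro dfs)+
  note dg' = df_lift1[of g, OF dg]
  define A where "A x = imgs (blam x g) x" for x
  have A: "y \<epsilon> A x \<longleftrightarrow> (\<exists>b. b \<epsilon> x \<and> y = g b)" for x y
    unfolding A_def mem_imgs using app_blam[OF dg bl_mem] by metis
  have g: "g x = ch (A x)" for x unfolding A_def g_def by (rule wrec[OF dH])
  have dA: "df (\<lambda>e. A (e 0))" by (rule df_eqI, unfold A, intro dfs dg')
  note dA' = df_lift1[of A, OF dA]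
  have good: "Ord x \<longrightarrow> antich C le (A x) \<and> \<not> one \<epsilon> A x" for x
  proof (rule eps_induct[of "\<lambda>x. Ord x \<longrightarrow> antich C le (A x) \<and> \<not> one \<epsilon> A x"], intro dfs dA', intro impI)
    fix x assume IH: "\<And>y. y \<epsilon> x \<Longrightarrow> Ord y \<longrightarrow> antich C le (A y) \<and> \<not> one \<epsilon> A y" and x: "Ord x"
    have gy: "g y \<epsilon> C \<and> g y \<noteq> one \<and> (\<forall>a. a \<epsilon> A y \<longrightarrow> \<not> compat C le a (g y))" if "y \<epsilon> x" for y
      unfolding g[of y] using ch IH[OF that] Ord_mem[OF x that] by blast
    have inc: "\<not> compat C le (g y) (g z)" if "y \<epsilon> x" "z \<epsilon> x" "y \<epsilon> z" for y z
      using gy[OF that(2)] A that by blast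
    have "\<not> compat C le p q" if pq: "p \<epsilon> A x" "q \<epsilon> A x" "p \<noteq> q" for p q
    proof -
      obtain y z where yz: "y \<epsilon> x" "z \<epsilon> x" "p = g y" "q = g z" using pq A by blast
      then have "y \<epsilon> z \<or> z \<epsilon> y" using Ord_linear[of y z] Ord_mem[OF x] pq by blast
      then show ?thesis using inc yz compat_sym by blast
    qed
    moreover have "z \<epsilon> C \<and> z \<noteq> one" if z: "z \<epsilon> A x" for z
    proof -
      obtain y where "y \<epsilon> x" "z = g y" using z A by blast
      then show ?thesis using gy by simp
    qed
    ultimately show "antich C le (A x) \<and> \<not> one \<epsilon> A x" unfolding antich_def by blast
  qed
  have gC: "g x \<epsilon> C" if "Ord x" for x unfolding g using ch good that by blast
  have inj: "x = y" if xy: "Ord x" "Ord y" "g x = g y" for x y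
  proof -
    have no: "\<not> u \<epsilon> v" if uv: "Ord v" "g u = g v" for u v
    proof
      assume "u \<epsilon> v"
      then have "g u \<epsilon> A v" using A by blast
      then have "\<not> compat C le (g u) (g v)" using ch[of "A v"] good uv g by metis
      then show False using self[OF gC[OF uv(1)]] uv by simp
    qed
    show ?thesis using Ord_linear[OF xy(1,2)] no xy by metis
  qed
  \<comment> \<open>Replacement along the inverse of \<open>g\<close> would make the ordinals a
    set.\<close>
  have "small (\<lambda>x. \<exists>c. c \<epsilon> C \<and> (Ord x \<and> g x = c))"
    by (rule small_repl) (intro dfs dg', use inj in blast)
  then obtain s where s: "\<And>x. x \<epsilon> s \<longleftrightarrow> (\<exists>c. c \<epsilon> C \<and> (Ord x \<and> g x = c))" unfolding small_def by blast
  obtain y where "Ord y" "\<not> y \<epsilon> s" using no_Ord_set by blast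
  then show False using s gC by blast
qed

end

text \<open>The copies are indexed by the antichains avoiding the top. A selection from
  \<open>R\<close> also picks sequences; forgetting them leaves a function that extends each
  antichain, which \<open>no_antichain_extension\<close> refutes.\<close>

theorem levy_of_no_antichain:
  fixes E :: "'a::countable \<Rightarrow> 'a \<Rightarrow> bool" (infix "\<epsilon>" 50)
  assumes "zf E" and nof: "zf.nof E C le one" and nt: "\<exists>p. p \<epsilon> C \<and> p \<noteq> one" and na: "zf.noanti E C le one"
  shows "\<exists>k J R. levy E k J R"
proof -
  interpret zf E by fact
  obtain k where k: "is_om1 k" using om1_ex by blast
  have "small (\<lambda>A. antich C le A \<and> \<not> one \<epsilon> A)"
    by (rule small_sub[of _ "Pw C"]) (intro dfs, auto simp: antich_def)
  then obtain J where J: "\<And>A. A \<epsilon> J \<longleftrightarrow> antich C le A \<and> \<not> one \<epsilon> A" unfolding small_def by blast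
  let ?X = "\<lambda>A x. x \<epsilon> C \<and> x \<noteq> one \<and> (\<forall>a. a \<epsilon> A \<longrightarrow> \<not> compat C le a x)"
  \<comment> \<open>For the empty antichain this is nontriviality. Otherwise \<open>A\<close> is not
    maximal, and a new element of a larger antichain differs from the top because the top is
    compatible with every member of \<open>A\<close>.\<close>
  have X: "\<exists>x. ?X A x" if A: "A \<epsilon> J" for A
  proof (cases "\<exists>a. a \<epsilon> A")
    case False
    then show ?thesis using nt by blast
  next
    case True
    have AC: "\<And>z. z \<epsilon> A \<Longrightarrow> z \<epsilon> C" using A J antich_def by blast
    then have "\<not> maxanti C le A" using na A J unfolding noanti_def by blast
    then obtain B where B: "antich C le B" "\<And>z. z \<epsilon> A \<Longrightarrow> z \<epsilon> B" "A \<noteq> B" using A J unfolding maxanti_def by blast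
    then obtain x where x: "x \<epsilon> B" "\<not> x \<epsilon> A" using set_eq by blast
    have xx: "x \<epsilon> C" "\<forall>a. a \<epsilon> A \<longrightarrow> \<not> compat C le a x" using B x unfolding antich_def by blast+
    obtain a where a: "a \<epsilon> A" using True by blast
    have "compat C le a one" using nof AC[OF a] unfolding nof_def compat_def by blast
    then show ?thesis using xx a by blast
  qed
  have "small (\<lambda>r. \<exists>A x q. A \<epsilon> J \<and> ?X A x \<and> sq k q \<and> r = pair (pair A x) q)"
    by (rule small_sub[of _ "prod (prod J C) (Pw (prod om k))"]) (intro dfs, use sq_bound in auto)
  then obtain R where R: "\<And>r. r \<epsilon> R \<longleftrightarrow> (\<exists>A x q. A \<epsilon> J \<and> ?X A x \<and> sq k q \<and> r = pair (pair A x) q)"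
    unfolding small_def by blast
  have "levy E k J R"
  proof (unfold_locales, fact k)
    have "antich C le emp" unfolding antich_def by simp
    then show "\<exists>i. i \<epsilon> J" using J mem_emp by blast
    show "\<exists>i x q. r = pair (pair i x) q \<and> i \<epsilon> J \<and> sq k q" if "r \<epsilon> R" for r using that R by blast
    show "\<exists>x. pair (pair i x) q \<epsilon> R" if "i \<epsilon> J" "sq k q" for i q using X[OF that(1)] that R by blast
    fix c assume cR: "\<And>r. r \<epsilon> c \<Longrightarrow> r \<epsilon> R" and c: "\<And>i. i \<epsilon> J \<Longrightarrow> \<exists>!r. r \<epsilon> c \<and> fs (fs r) = i"
    \<comment> \<open>Dropping the sequences leaves the pairs of an antichain and its selected
      condition.\<close>
    have "small (\<lambda>z. \<exists>r. r \<epsilon> c \<and> z = fs r)" by (rule small_img) (intro dfs)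
    then obtain d where d: "\<And>z. z \<epsilon> d \<longleftrightarrow> (\<exists>r. r \<epsilon> c \<and> z = fs r)" unfolding small_def by blast
    show False
    proof (rule no_antichain_extension[OF nof, of "app d"])
      fix A assume "antich C le A" "\<not> one \<epsilon> A"
      then have A: "A \<epsilon> J" using J by blast
      then obtain r where r: "r \<epsilon> c" "fs (fs r) = A" "\<And>r'. r' \<epsilon> c \<Longrightarrow> fs (fs r') = A \<Longrightarrow> r' = r" using c by blast
      obtain A' x q where x: "r = pair (pair A' x) q" "?X A' x" using cR[OF r(1)] R by blast
      have "A' = A" using x(1) r(2) by simp
      have "app d A = x"
      proof (rule app_eq)
        show "pair A x \<epsilon> d" unfolding d using r(1) x \<open>A' = A\<close> by (intro exI[of _ r]) simp
        fix y assume "pair A y \<epsilon> d"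
        then obtain r' where r': "r' \<epsilon> c" "pair A y = fs r'" unfolding d by blast
        then have "r' = r" using r(3)[OF r'(1)] by (metis fs_pair)
        then show "y = x" using r' x by simp
      qed
      then show "app d A \<epsilon> C \<and> app d A \<noteq> one \<and> (\<forall>a. a \<epsilon> A \<longrightarrow> \<not> compat C le a (app d A))"
        using x \<open>A' = A\<close> by simp
    qed (intro dfs)
  qed
  then show ?thesis by blast
qed

text \<open>The sequence of sets is coded by the relation \<open>X\<close>, and the infinite sets of indices are
  the unbounded ones.\<close>

definition (in zf) nochoice :: "'a \<Rightarrow> bool" where
  "nochoice X \<longleftrightarrow> (\<forall>z. z \<epsilon> X \<longrightarrow> (\<exists>n x. n \<epsilon> om \<and> z = pair n x)) \<and>
    (\<forall>n. n \<epsilon> om \<longrightarrow> (\<exists>x. pair n x \<epsilon> X)) \<and>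
    \<not> (\<exists>c. (\<forall>z. z \<epsilon> c \<longrightarrow> z \<epsilon> X) \<and> (\<forall>n x x'. pair n x \<epsilon> c \<and> pair n x' \<epsilon> c \<longrightarrow> x = x') \<and>
      (\<forall>m. m \<epsilon> om \<longrightarrow> (\<exists>n x. pair n x \<epsilon> c \<and> \<not> n \<epsilon> m)))"

context zf
begin

text \<open>For ordinals \<open>un\<close> is the maximum, so it is not below \<open>m\<close> once
  one argument is not. This is how row numbers are shown to be unbounded.\<close>

lemma un_not_mem: "Ord i \<Longrightarrow> Ord j \<Longrightarrow> Ord m \<Longrightarrow> \<not> j \<epsilon> m \<Longrightarrow> \<not> un i j \<epsilon> m \<and> \<not> un j i \<epsilon> m"
proof -
  assume o: "Ord i" "Ord j" "Ord m" and j: "\<not> j \<epsilon> m"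
  have c: "un i j = un j i" by (rule extensional) auto
  have "\<not> un i j \<epsilon> m"
  proof
    assume u: "un i j \<epsilon> m"
    then have "j \<epsilon> un i j \<or> j = un i j"
      using Ord_subset[OF o(2), of "un i j"] Ord_mem[OF o(3) u] mem_un by blast
    then show False using u j Ord_trans[OF o(3) u] by metis
  qed
  then show ?thesis using c by simp
qed

text \<open>A family of elements of \<open>X\<close>, indexed by \<open>n\<close> with infinitely many levels \<open>l\<close>, can be thinned out
  to a choice function by taking for each level the least \<open>n\<close> reaching it.\<close>

lemma nochoice_family:
  assumes X: "nochoice X"
    and dD: "dfn (\<lambda>e. D (e 0) (e 1) (e 2))"
    and D: "\<And>n l x. D n l x \<Longrightarrow> n \<epsilon> om \<and> pair l x \<epsilon> X"
    and fn: "\<And>n l x x'. D n l x \<Longrightarrow> D n l x' \<Longrightarrow> x = x'"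
    and inf: "\<And>m. m \<epsilon> om \<Longrightarrow> \<exists>n l x. D n l x \<and> \<not> l \<epsilon> m"
  shows False
proof -
  note dD' = dfn_lift3[of D, OF dD]
  let ?C = "\<lambda>z. \<exists>l x n. z = pair l x \<and> D n l x \<and> (\<forall>n'. n' \<epsilon> n \<longrightarrow> \<not> (\<exists>x'. D n' l x'))"
  have sC: "small ?C" by (rule small_sub[of _ X]) (intro dfs dD', use D in blast)
  then obtain c where c: "\<And>z. z \<epsilon> c \<longleftrightarrow> ?C z" unfolding small_def by blast
  have c': "pair l x \<epsilon> c \<longleftrightarrow> (\<exists>n. D n l x \<and> (\<forall>n'. n' \<epsilon> n \<longrightarrow> \<not> (\<exists>x'. D n' l x')))" for l x
    unfolding c by auto
  have "z \<epsilon> X" if "z \<epsilon> c" for z using that D unfolding c by blast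
  moreover have "x = x'" if xx: "pair l x \<epsilon> c \<and> pair l x' \<epsilon> c" for l x x'
  proof -
    obtain n n' where n: "D n l x" "\<forall>n'. n' \<epsilon> n \<longrightarrow> \<not> (\<exists>x'. D n' l x')"
      "D n' l x'" "\<forall>n''. n'' \<epsilon> n' \<longrightarrow> \<not> (\<exists>x'. D n'' l x')" using xx unfolding c' by blast
    have "n \<epsilon> n' \<or> n = n' \<or> n' \<epsilon> n" using Ord_linear Ord_nat D n by blast
    then have "n = n'" using n by blast
    then show ?thesis using n fn by blast
  qed
  moreover have "\<exists>l x. pair l x \<epsilon> c \<and> \<not> l \<epsilon> m" if "m \<epsilon> om" for m
  proof -
    obtain n l x where n: "D n l x" "\<not> l \<epsilon> m" using inf[OF \<open>m \<epsilon> om\<close>] by blast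
    have "dfn (\<lambda>e. \<exists>x. D (e 0) l x)" by (intro dfs dD')
    then obtain n' x' where "D n' l x'" "\<forall>n''. n'' \<epsilon> n' \<longrightarrow> \<not> (\<exists>x. D n'' l x)"
      using Ord_least[of "\<lambda>n. \<exists>x. D n l x" n] n(1) D Ord_nat by blast
    then show ?thesis unfolding c' using n(2) by blast
  qed
  ultimately show False using X unfolding nochoice_def by blast
qed

end

text \<open>Two kinds of families contradict \<open>nochoice\<close> in the same way: a selection of
  one condition per copy, and a decreasing sequence without lower bound. In both, the decorations
  are read off as elements of \<open>X\<close> at unboundedly many levels.\<close>

theorem levy_of_nochoice:
  fixes E :: "'a::countable \<Rightarrow> 'a \<Rightarrow> bool" (infix "\<epsilon>" 50)
  assumes "zf E" and X: "zf.nochoice E X"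
  shows "\<exists>k J R. levy E k J R \<and> zf.sigcl E (levy.PP E R) (levy.LE E R)"
proof -
  interpret zf E by fact
  obtain k where k: "is_om1 k" using om1_ex by blast
  have Xn: "\<exists>x. pair n x \<epsilon> X" if "n \<epsilon> om" for n using X that unfolding nochoice_def by blast
  have "small (\<lambda>r. \<exists>n x q. n \<epsilon> om \<and> sq k q \<and> pair (un n (len q)) x \<epsilon> X \<and> r = pair (pair n x) q)"
    by (rule small_sub[of _ "prod (prod om (Unn (Unn X))) (Pw (prod om k))"])
      (intro dfs, use sq_bound pair_mem_UnnD in \<open>fastforce simp del: mem_Unn mem_Pw\<close>)
  then obtain R where R: "\<And>r. r \<epsilon> R \<longleftrightarrow> (\<exists>n x q. n \<epsilon> om \<and> sq k q \<and> pair (un n (len q)) x \<epsilon> X \<and> r = pair (pair n x) q)"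
    unfolding small_def by blast
  have R': "pair (pair n x) q \<epsilon> R \<longleftrightarrow> n \<epsilon> om \<and> sq k q \<and> pair (un n (len q)) x \<epsilon> X" for n x q
    unfolding R by auto
  have un_om: "un n m \<epsilon> om" if "n \<epsilon> om" "m \<epsilon> om" for n m
    using Ord_un[OF Ord_nat[OF that(1)] Ord_nat[OF that(2)]] that by auto
  have "levy E k om R"
  proof (unfold_locales, fact k)
    show "\<exists>i. i \<epsilon> om" using emp_om by blast
    show "\<exists>i x q. r = pair (pair i x) q \<and> i \<epsilon> om \<and> sq k q" if "r \<epsilon> R" for r using that R by blast
    show "\<exists>x. pair (pair i x) q \<epsilon> R" if "i \<epsilon> om" "sq k q" for i q
      unfolding R' using Xn[OF un_om[OF that(1)]] sq_isinj[OF that(2)] that by blast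
    fix c assume cR: "\<And>r. r \<epsilon> c \<Longrightarrow> r \<epsilon> R" and c: "\<And>i. i \<epsilon> om \<Longrightarrow> \<exists>!r. r \<epsilon> c \<and> fs (fs r) = i"
    \<comment> \<open>The condition selected in copy \<open>n\<close> has its decoration in row
      \<open>un n (len q)\<close>, which is not below \<open>n\<close>.\<close>
    let ?D = "\<lambda>n l x. \<exists>q. pair (pair n x) q \<epsilon> c \<and> l = un n (len q)"
    show False
    proof (rule nochoice_family[OF X, of ?D])
      show "dfn (\<lambda>e. ?D (e 0) (e 1) (e 2))" by (intro dfs)
      show "n \<epsilon> om \<and> pair l x \<epsilon> X" if "?D n l x" for n l x using that cR R' by blast
      show "x = x'" if xx: "?D n l x" "?D n l x'" for n l x x'
      proof -
        obtain q q' where q: "pair (pair n x) q \<epsilon> c" "pair (pair n x') q' \<epsilon> c" using xx by blast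
        have "n \<epsilon> om" using cR[OF q(1)] R' by blast
        then have "pair (pair n x) q = pair (pair n x') q'" using c[OF \<open>n \<epsilon> om\<close>] q fs_pair by metis
        then show ?thesis by simp
      qed
      show "\<exists>n l x. ?D n l x \<and> \<not> l \<epsilon> m" if m: "m \<epsilon> om" for m
      proof -
        obtain r where r: "r \<epsilon> c" "fs (fs r) = m" using c[OF m] by blast
        obtain n x q where n: "r = pair (pair n x) q" "sq k q" using cR[OF r(1)] R by blast
        have "n = m" using n r by simp
        have "\<not> un m (len q) \<epsilon> m"
          using un_not_mem[of "len q" m m] Ord_nat[OF m] Ord_nat sq_isinj[OF n(2)] by simp
        then show ?thesis using r(1) n \<open>n = m\<close> by blast
      qed
    qed
  qed
  then interpret L: levy E k om R .
  have "sigcl L.PP L.LE" unfolding sigcl_def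
  proof (intro allI impI, elim conjE)
    fix f assume f: "isfun f om L.PP" and dec: "\<forall>n p q. pair n p \<epsilon> f \<and> pair (suc n) q \<epsilon> f \<longrightarrow> pair q p \<epsilon> L.LE"
    have fn: "\<And>n p p'. pair n p \<epsilon> f \<Longrightarrow> pair n p' \<epsilon> f \<Longrightarrow> p = p'"
      and tot: "\<And>n. n \<epsilon> om \<Longrightarrow> \<exists>p. pair n p \<epsilon> f"
      and dm: "\<And>n p. pair n p \<epsilon> f \<Longrightarrow> n \<epsilon> om \<and> p \<epsilon> L.PP"
      using f unfolding isfun_def by (blast, blast, fastforce)
    note n1 = L.nof_levy[unfolded nof_def]
    have LEt: "pair p r \<epsilon> L.LE" if "pair p q \<epsilon> L.LE" "pair q r \<epsilon> L.LE" for p q r using n1 that by blast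
    have LEr: "pair p p \<epsilon> L.LE" if "p \<epsilon> L.PP" for p using n1 that by blast
    have mono: "\<forall>n p q. (n \<epsilon> m \<or> n = m) \<and> pair n p \<epsilon> f \<and> pair m q \<epsilon> f \<longrightarrow> pair q p \<epsilon> L.LE" if m: "m \<epsilon> om" for m
    proof (rule om_induct[of "\<lambda>m. \<forall>n p q. (n \<epsilon> m \<or> n = m) \<and> pair n p \<epsilon> f \<and> pair m q \<epsilon> f \<longrightarrow> pair q p \<epsilon> L.LE", OF _ m])
      show "dfn (\<lambda>e. \<forall>n p q. (n \<epsilon> e 0 \<or> n = e 0) \<and> pair n p \<epsilon> f \<and> pair (e 0) q \<epsilon> f \<longrightarrow> pair q p \<epsilon> L.LE)"
        by (intro dfs)
      show "\<forall>n p q. (n \<epsilon> emp \<or> n = emp) \<and> pair n p \<epsilon> f \<and> pair emp q \<epsilon> f \<longrightarrow> pair q p \<epsilon> L.LE"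
        using fn LEr dm by (metis mem_emp)
      fix m assume m: "m \<epsilon> om" and IH: "\<forall>n p q. (n \<epsilon> m \<or> n = m) \<and> pair n p \<epsilon> f \<and> pair m q \<epsilon> f \<longrightarrow> pair q p \<epsilon> L.LE"
      show "\<forall>n p q. (n \<epsilon> suc m \<or> n = suc m) \<and> pair n p \<epsilon> f \<and> pair (suc m) q \<epsilon> f \<longrightarrow> pair q p \<epsilon> L.LE"
      proof (intro allI impI, elim conjE)
        fix n p q assume n: "n \<epsilon> suc m \<or> n = suc m" and p: "pair n p \<epsilon> f" and q: "pair (suc m) q \<epsilon> f"
        show "pair q p \<epsilon> L.LE"
        proof (cases "n = suc m")
          case True
          then show ?thesis using fn p q LEr dm by blast
        next
          case False
          obtain r where r: "pair m r \<epsilon> f" using tot[OF m] by blast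
          have "pair r p \<epsilon> L.LE" using IH n False p r by auto
          moreover have "pair q r \<epsilon> L.LE" using dec q r by blast
          ultimately show ?thesis using LEt by blast
        qed
      qed
    qed
    show "\<exists>r. r \<epsilon> L.PP \<and> (\<forall>n p. pair n p \<epsilon> f \<longrightarrow> pair r p \<epsilon> L.LE)"
    proof (rule ccontr)
      assume nb: "\<not> ?thesis"
      \<comment> \<open>Since \<open>p\<close> is not a lower bound, some later \<open>p'\<close>
        fails to lie above it. It is then stronger than \<open>p\<close> and properly longer: with
        equal lengths the sequences would be equal and the two conditions equivalent.\<close>
      have step: "\<exists>n' p'. pair n' p' \<epsilon> f \<and> p' \<epsilon> R \<and> (p \<epsilon> R \<longrightarrow> len (sn p) \<epsilon> len (sn p'))" if p: "pair n p \<epsilon> f" for n p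
      proof -
        obtain n' p' where p': "pair n' p' \<epsilon> f" "\<not> pair p p' \<epsilon> L.LE" using nb dm[OF p] by blast
        have no: "n \<epsilon> om" "n' \<epsilon> om" using dm p p' by blast+
        then have "\<not> (n' \<epsilon> n \<or> n' = n)" using mono[OF no(1)] p p' by blast
        then have "n \<epsilon> n'" using Ord_linear[OF Ord_nat[OF no(1)] Ord_nat[OF no(2)]] by blast
        then have le: "pair p' p \<epsilon> L.LE" using mono[OF no(2)] p p' by blast
        have pp: "p \<epsilon> L.PP" "p' \<epsilon> L.PP" using dm p p' by blast+
        have R': "p' \<epsilon> R" using p'(2) L.LE_emp[OF pp(1)] pp(2) L.mem_PP by blast
        have "len (sn p) \<epsilon> len (sn p')" if pR: "p \<epsilon> R"
        proof (rule ccontr)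
          assume nl: "\<not> ?thesis"
          have sub: "fs (fs p') = fs (fs p)" "\<And>z. z \<epsilon> sn p \<Longrightarrow> z \<epsilon> sn p'" using L.LE_R[OF le pR] by blast+
          have q: "isinj (sn p) (len (sn p)) k" "isinj (sn p') (len (sn p')) k" "Ord (len (sn p))" "Ord (len (sn p'))"
            using L.R_sq pR R' sq_isinj Ord_nat by blast+
          have "m \<epsilon> len (sn p')" if "m \<epsilon> len (sn p)" for m using that sub(2) unfolding mem_len by blast
          then have eq: "len (sn p) = len (sn p')" using Ord_subset[OF q(3,4)] nl by blast
          have "app (sn p) m = app (sn p') m" if "m \<epsilon> len (sn p)" for m
            using isinj_app[OF q(2) sub(2)[OF isinj_app_mem[OF q(1) that]]] by simp
          then have "sn p = sn p'" using isinj_eqI[OF q(1) q(2)[folded eq]] by blast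
          then have "pair p p' \<epsilon> L.LE" using pR R' sub(1) by (intro L.LE_I) auto
          then show False using p' by blast
        qed
        then show ?thesis using p'(1) R' by blast
      qed
      have long: "\<exists>n p. pair n p \<epsilon> f \<and> p \<epsilon> R \<and> \<not> len (sn p) \<epsilon> m" if m: "m \<epsilon> om" for m
      proof (rule om_induct[of "\<lambda>m. \<exists>n p. pair n p \<epsilon> f \<and> p \<epsilon> R \<and> \<not> len (sn p) \<epsilon> m", OF _ m])
        show "dfn (\<lambda>e. \<exists>n p. pair n p \<epsilon> f \<and> p \<epsilon> R \<and> \<not> len (sn p) \<epsilon> e 0)" by (intro dfs)
        obtain p where p: "pair emp p \<epsilon> f" using tot[OF emp_om] by blast
        show "\<exists>n p. pair n p \<epsilon> f \<and> p \<epsilon> R \<and> \<not> len (sn p) \<epsilon> emp" using step[OF p] mem_emp by blast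
        fix m assume m: "m \<epsilon> om" and "\<exists>n p. pair n p \<epsilon> f \<and> p \<epsilon> R \<and> \<not> len (sn p) \<epsilon> m"
        then obtain n p where p: "pair n p \<epsilon> f" "p \<epsilon> R" "\<not> len (sn p) \<epsilon> m" by blast
        obtain n' p' where p': "pair n' p' \<epsilon> f" "p' \<epsilon> R" "len (sn p) \<epsilon> len (sn p')" using step[OF p(1)] p(2) by blast
        have "\<not> len (sn p') \<epsilon> suc m" using p p'(3) Ord_trans[OF Ord_nat[OF m]] by auto
        then show "\<exists>n p. pair n p \<epsilon> f \<and> p \<epsilon> R \<and> \<not> len (sn p) \<epsilon> suc m" using p' by blast
      qed
      \<comment> \<open>Here the family is indexed by the position in the decreasing sequence, and
        its levels are unbounded because the lengths are.\<close>
      let ?D = "\<lambda>n l x. \<exists>i q. pair n (pair (pair i x) q) \<epsilon> f \<and> pair (pair i x) q \<epsilon> R \<and> l = un i (len q)"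
      show False
      proof (rule nochoice_family[OF X, of ?D])
        show "dfn (\<lambda>e. ?D (e 0) (e 1) (e 2))" by (intro dfs)
        show "n \<epsilon> om \<and> pair l x \<epsilon> X" if "?D n l x" for n l x using that dm R' by blast
        show "x = x'" if "?D n l x" "?D n l x'" for n l x x' using that fn by (metis pair_inj)
        show "\<exists>n l x. ?D n l x \<and> \<not> l \<epsilon> m" if m: "m \<epsilon> om" for m
        proof -
          obtain n p where p: "pair n p \<epsilon> f" "p \<epsilon> R" "\<not> len (sn p) \<epsilon> m" using long[OF m] by blast
          obtain i x q where x: "p = pair (pair i x) q" "i \<epsilon> om" "sq k q" using p(2) R by blast
          have "\<not> un i (len q) \<epsilon> m"
            using un_not_mem[of i "len q" m] p(3) x Ord_nat m sq_isinj[OF x(3)] by simp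
          then show ?thesis using p x(1) by blast
        qed
      qed
    qed
  qed
  then show ?thesis using L.levy_axioms by blast
qed

section \<open>A symmetric model without countable choice\<close>

text \<open>Conditions are partial functions on \<open>om\<^sup>3\<close> with values in \<open>om\<close>, coded as sets of quadruples
  \<open>(n, i, k, m)\<close>, whose coordinates \<open>i\<close> and \<open>k\<close> are bounded. The generic function is a matrix of
  reals \<open>al n i\<close>, and the automorphisms exchange two reals in one row \<open>n\<close>.\<close>

locale cohen = zf E for E :: "'a::countable \<Rightarrow> 'a \<Rightarrow> bool" (infix "\<epsilon>" 50)
begin

definition tu :: "'a \<Rightarrow> 'a \<Rightarrow> 'a \<Rightarrow> 'a \<Rightarrow> 'a" where "tu n i k m = pair n (pair i (pair k m))"

lemma tu_inj [simp]: "tu n i k m = tu n' i' k' m' \<longleftrightarrow> n = n' \<and> i = i' \<and> k = k' \<and> m = m'"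
  unfolding tu_def by simp

lemma df_tu [dfs]: "df t \<Longrightarrow> df s \<Longrightarrow> df u \<Longrightarrow> df w \<Longrightarrow> df (\<lambda>e. tu (t e) (s e) (u e) (w e))"
  unfolding tu_def by (intro dfs)

definition cond :: "'a \<Rightarrow> bool" where
  "cond p \<longleftrightarrow> (\<forall>z. z \<epsilon> p \<longrightarrow> (\<exists>n i k m. n \<epsilon> om \<and> i \<epsilon> om \<and> k \<epsilon> om \<and> m \<epsilon> om \<and> z = tu n i k m)) \<and>
    (\<forall>n i k m m'. tu n i k m \<epsilon> p \<and> tu n i k m' \<epsilon> p \<longrightarrow> m = m') \<and>
    (\<exists>t. t \<epsilon> om \<and> (\<forall>n i k m. tu n i k m \<epsilon> p \<longrightarrow> i \<epsilon> t \<and> k \<epsilon> t))"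

lemma dfn_cond [dfs]: "df t \<Longrightarrow> dfn (\<lambda>e. cond (t e))"
  by (rule dfn_lift1[of cond]) (unfold cond_def, intro dfs)

definition CP :: 'a where "CP = mk cond"

lemma mem_CP: "p \<epsilon> CP \<longleftrightarrow> cond p"
  unfolding CP_def
  by (rule mem_mk, rule small_sub[of _ "Pw (prod om (prod om (prod om om)))"], intro dfs)
    (unfold cond_def tu_def mem_Pw mem_prod, metis)

definition CL :: 'a where
  "CL = mk (\<lambda>z. \<exists>p q. cond p \<and> cond q \<and> z = pair p q \<and> (\<forall>z. z \<epsilon> q \<longrightarrow> z \<epsilon> p))"

lemma mem_CL: "z \<epsilon> CL \<longleftrightarrow> (\<exists>p q. cond p \<and> cond q \<and> z = pair p q \<and> (\<forall>z. z \<epsilon> q \<longrightarrow> z \<epsilon> p))"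
  unfolding CL_def by (rule mem_mk, rule small_sub[of _ "prod CP CP"], intro dfs) (auto simp: mem_CP)

lemma CL_pair: "pair p q \<epsilon> CL \<longleftrightarrow> cond p \<and> cond q \<and> (\<forall>z. z \<epsilon> q \<longrightarrow> z \<epsilon> p)"
  unfolding mem_CL by auto

lemma condI:
  assumes "\<And>z. z \<epsilon> p \<Longrightarrow> \<exists>n i k m. z = tu n i k m"
    and "\<And>n i k m. tu n i k m \<epsilon> p \<Longrightarrow> n \<epsilon> om \<and> i \<epsilon> om \<and> k \<epsilon> om \<and> m \<epsilon> om \<and> i \<epsilon> t \<and> k \<epsilon> t"
    and "\<And>n i k m m'. tu n i k m \<epsilon> p \<Longrightarrow> tu n i k m' \<epsilon> p \<Longrightarrow> m = m'"
    and "t \<epsilon> om"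
  shows "cond p"
  unfolding cond_def
proof (rule conjI, intro allI impI)
  fix z assume z: "z \<epsilon> p"
  then obtain n i k m where "z = tu n i k m" using assms(1) by blast
  then show "\<exists>n i k m. n \<epsilon> om \<and> i \<epsilon> om \<and> k \<epsilon> om \<and> m \<epsilon> om \<and> z = tu n i k m" using assms(2) z by blast
next
  show "(\<forall>n i k m m'. tu n i k m \<epsilon> p \<and> tu n i k m' \<epsilon> p \<longrightarrow> m = m') \<and>
    (\<exists>t. t \<epsilon> om \<and> (\<forall>n i k m. tu n i k m \<epsilon> p \<longrightarrow> i \<epsilon> t \<and> k \<epsilon> t))" using assms(2-) by blast
qed

lemma cond_emp: "cond emp"
  by (rule condI[OF _ _ _ emp_om]) simp_all

lemma nof_cohen: "nof CP CL emp"
  unfolding nof_def CL_pair mem_CP using cond_emp by (auto simp: mem_CL)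

text \<open>\<open>g = pair n (pair i j)\<close> stands for the transposition of \<open>i\<close>
  and \<open>j\<close> in row \<open>n\<close>; all other rows are left alone.\<close>

definition act :: "'a \<Rightarrow> 'a \<Rightarrow> 'a \<Rightarrow> 'a" where
  "act g n i = (if n = fs g then if i = fs (sn g) then sn (sn g) else if i = sn (sn g) then fs (sn g) else i else i)"

lemma df_act [dfs]: "df t \<Longrightarrow> df s \<Longrightarrow> df u \<Longrightarrow> df (\<lambda>e. act (t e) (s e) (u e))"
  unfolding act_def by (intro dfs)

lemma act_inv [simp]: "act g n (act g n i) = i"
  unfolding act_def by auto

lemma act_other: "n \<noteq> fs g \<Longrightarrow> act g n i = i"
  unfolding act_def by simp

definition swp :: "'a \<Rightarrow> 'a \<Rightarrow> 'a" where
  "swp g p = mk (\<lambda>z. \<exists>w. w \<epsilon> p \<and> (\<exists>n i k m. w = tu n i k m \<and> z = tu n (act g n i) k m))"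

lemma mem_swp: "z \<epsilon> swp g p \<longleftrightarrow> (\<exists>w. w \<epsilon> p \<and> (\<exists>n i k m. w = tu n i k m \<and> z = tu n (act g n i) k m))"
  unfolding swp_def by (rule mem_mk, rule small_repl, intro dfs) auto

lemma df_swp: "df t \<Longrightarrow> df s \<Longrightarrow> df (\<lambda>e. swp (t e) (s e))"
  by (rule df_lift2[of swp]) (rule df_eqI, unfold mem_swp, intro dfs)

lemma tu_swp: "tu n i k m \<epsilon> swp g p \<longleftrightarrow> tu n (act g n i) k m \<epsilon> p"
  unfolding mem_swp by (metis act_inv tu_inj)

lemma swp_elem: "z \<epsilon> swp g p \<Longrightarrow> \<exists>n i k m. z = tu n i k m"
  unfolding mem_swp by blast

lemma cond_elem: "cond p \<Longrightarrow> z \<epsilon> p \<Longrightarrow> \<exists>n i k m. z = tu n i k m"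
  unfolding cond_def by blast

lemma cond_om: "cond p \<Longrightarrow> tu n i k m \<epsilon> p \<Longrightarrow> n \<epsilon> om \<and> i \<epsilon> om \<and> k \<epsilon> om \<and> m \<epsilon> om"
  unfolding cond_def by fastforce

lemma cond_fun: "cond p \<Longrightarrow> tu n i k m \<epsilon> p \<Longrightarrow> tu n i k m' \<epsilon> p \<Longrightarrow> m = m'"
  unfolding cond_def by blast

lemma un_om: "n \<epsilon> om \<Longrightarrow> m \<epsilon> om \<Longrightarrow> un n m \<epsilon> om"
  using Ord_un[OF Ord_nat Ord_nat] by metis

definition II :: 'a where "II = prod om (prod om om)"

lemma act_om: "g \<epsilon> II \<Longrightarrow> i \<epsilon> om \<Longrightarrow> act g n i \<epsilon> om"
  unfolding II_def act_def by auto

lemma swp_cond: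
  assumes g: "g \<epsilon> II" and p: "cond p"
  shows "cond (swp g p)"
proof -
  obtain t where t: "t \<epsilon> om" "\<And>n i k m. tu n i k m \<epsilon> p \<Longrightarrow> i \<epsilon> t \<and> k \<epsilon> t" using p unfolding cond_def by blast
  obtain n i j where g': "g = pair n (pair i j)" "i \<epsilon> om" "j \<epsilon> om" using g unfolding II_def by auto
  show ?thesis
  proof (rule condI[where t = "un t (un (suc i) (suc j))"])
    show "\<exists>n i k m. z = tu n i k m" if "z \<epsilon> swp g p" for z using that by (rule swp_elem)
    show "m = m'" if "tu n i k m \<epsilon> swp g p" "tu n i k m' \<epsilon> swp g p" for n i k m m'
      using that unfolding tu_swp by (rule cond_fun[OF p])
    show "un t (un (suc i) (suc j)) \<epsilon> om" using t g' un_om suc_om by simp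
    fix n' i' k m assume "tu n' i' k m \<epsilon> swp g p"
    then have a: "tu n' (act g n' i') k m \<epsilon> p" unfolding tu_swp .
    have "i' = act g n' (act g n' i')" by simp
    also have "\<dots> \<epsilon> om" using act_om[OF g] cond_om[OF p a] by blast
    finally have "i' \<epsilon> om" .
    moreover have "i' \<epsilon> un t (un (suc i) (suc j))"
      using t(2)[OF a] unfolding act_def g' by (auto split: if_splits)
    moreover have "k \<epsilon> un t (un (suc i) (suc j))" using t(2)[OF a] by simp
    ultimately show "n' \<epsilon> om \<and> i' \<epsilon> om \<and> k \<epsilon> om \<and> m \<epsilon> om \<and> i' \<epsilon> un t (un (suc i) (suc j)) \<and> k \<epsilon> un t (un (suc i) (suc j))"
      using cond_om[OF p a] by blast
  qed
qed

lemma swp_eqI: "cond p \<Longrightarrow> (\<And>n i k m. tu n i k m \<epsilon> q \<longleftrightarrow> tu n i k m \<epsilon> p) \<Longrightarrow>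
    (\<And>z. z \<epsilon> q \<Longrightarrow> \<exists>n i k m. z = tu n i k m) \<Longrightarrow> q = p"
  using cond_elem by (intro extensional) metis

text \<open>A support is a number \<open>s\<close>, and it is fixed by the swaps in rows outside
  \<open>s\<close>. Swaps in different rows commute, so for a swap in row \<open>n\<close> the
  support required by \<open>S_comm\<close> is the maximum of \<open>s\<close> and
  \<open>suc n\<close>.\<close>

interpretation C: symsys "(\<epsilon>)" CP CL emp II om swp "\<lambda>s g. \<not> fs g \<epsilon> s"
proof (unfold_locales, goal_cases)
  case 1
  show ?case by (rule nof_cohen)
next
  case (2 g p)
  then show ?case using swp_cond unfolding mem_CP by blast
next
  case (3 g p)
  then show ?case unfolding mem_CP by (intro swp_eqI) (auto simp: tu_swp intro: swp_elem)
next
  case (4 g p q)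
  have l: "forcing.lq (\<epsilon>) CL = (\<lambda>p q. pair p q \<epsilon> CL)"
    by (intro ext forcing.lq_def) (unfold_locales, rule nof_cohen)
  show ?case using 4 unfolding l CL_pair mem_swp[of _ g p] mem_swp[of _ g q] using swp_cond by blast
next
  case (5 g)
  show ?case by (rule swp_eqI[OF cond_emp]) (auto simp: tu_swp intro: swp_elem)
next
  case 6
  show ?case by (rule df_swp) (rule df_var)+
next
  case 7
  show ?case by (intro dfs)
next
  case 8
  show ?case using emp_om by blast
next
  case (9 s s')
  then show ?case using un_om by (intro exI[of _ "un s s'"]) auto
next
  case (10 g s)
  then obtain n where n: "n \<epsilon> om" "fs g = n" unfolding II_def by auto
  show ?case
  proof (rule exI[of _ "un s (suc n)"], intro conjI allI impI)
    show "un s (suc n) \<epsilon> om" using 10 n un_om suc_om by simp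
    fix h assume h: "h \<epsilon> II" "\<not> fs h \<epsilon> un s (suc n)"
    then show "\<not> fs h \<epsilon> s" by simp
    have "fs h \<noteq> n" using h by auto
    then have "act h n' (act g n' i) = act g n' (act h n' i)" for n' i
      using act_other[of n' g] act_other[of n' h] n by metis
    then show "swp g (swp h p) = swp h (swp g p)" if "p \<epsilon> CP" for p
      using that swp_cond h(1) 10(1) unfolding mem_CP by (intro swp_eqI) (auto simp: tu_swp intro: swp_elem)
  qed
qed

section \<open>Names for the generic reals\<close>

definition al :: "'a \<Rightarrow> 'a \<Rightarrow> 'a" where
  "al n i = mk (\<lambda>z. \<exists>k m p. p \<epsilon> CP \<and> tu n i k m \<epsilon> p \<and> z = pair (C.chk (pair k m)) p)"

lemma mem_al: "z \<epsilon> al n i \<longleftrightarrow> (\<exists>k m p. p \<epsilon> CP \<and> tu n i k m \<epsilon> p \<and> z = pair (C.chk (pair k m)) p)"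
proof -
  have d: "df (\<lambda>e. C.chk (e 0))" by (rule C.df_chk) (rule df_var)
  from small_img[of C.chk, OF d, of "prod om om"]
  obtain t where t: "\<And>y. y \<epsilon> t \<longleftrightarrow> (\<exists>z. z \<epsilon> prod om om \<and> y = C.chk z)" unfolding small_def by blast
  show ?thesis unfolding al_def
    by (rule mem_mk, rule small_sub[of _ "prod t CP"], intro dfs C.df_chk)
      (use cond_om mem_CP t in \<open>fastforce\<close>)
qed

lemma df_al [dfs]: "df t \<Longrightarrow> df s \<Longrightarrow> df (\<lambda>e. al (t e) (s e))"
  by (rule df_lift2[of al]) (rule df_eqI, unfold mem_al, intro dfs C.df_chk)

lemma tau_al: "g \<epsilon> II \<Longrightarrow> C.tau g (al n i) = al n (act g n i)"
proof (rule extensional)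
  fix z assume g: "g \<epsilon> II"
  have "z \<epsilon> C.tau g (al n i) \<longleftrightarrow> (\<exists>k m p. p \<epsilon> CP \<and> tu n i k m \<epsilon> p \<and> z = pair (C.chk (pair k m)) (swp g p))"
    unfolding C.mem_tau mem_al using C.tau_chk[OF g] by (metis pair_inj)
  also have "\<dots> \<longleftrightarrow> (\<exists>k m p. p \<epsilon> CP \<and> tu n (act g n i) k m \<epsilon> p \<and> z = pair (C.chk (pair k m)) p)"
    using C.T_P[OF g] C.T_inv[OF g] tu_swp act_inv by metis
  also have "\<dots> \<longleftrightarrow> z \<epsilon> al n (act g n i)" unfolding mem_al ..
  finally show "z \<epsilon> C.tau g (al n i) \<longleftrightarrow> z \<epsilon> al n (act g n i)" .
qed

lemma HS_al: "n \<epsilon> om \<Longrightarrow> C.HS (al n i)"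
proof (rule C.HS_intro[where ?s0.0 = "suc n"])
  show "\<exists>s p. C.HS s \<and> p \<epsilon> CP \<and> z = pair s p" if "z \<epsilon> al n i" for z using that C.HS_chk unfolding mem_al by blast
  show "suc n \<epsilon> om" if "n \<epsilon> om" using that by simp
  fix g s p assume g: "g \<epsilon> II" "\<not> fs g \<epsilon> suc n" and p: "pair s p \<epsilon> al n i"
  have "n \<noteq> fs g" using g by auto
  then have "C.tau g (al n i) = al n i" using tau_al[OF g(1)] act_other by simp
  then show "pair (C.tau g s) (swp g p) \<epsilon> al n i" using C.tau_pair[OF p, of g] by simp
qed

lemma generic_reals_distinct:
  assumes "genext (\<epsilon>) CP CL emp II om swp (\<lambda>s g. \<not> fs g \<epsilon> s) G E' val"
    and n: "n \<epsilon> om" and i: "i \<epsilon> om" and j: "j \<epsilon> om" and ij: "i \<noteq> j"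
  shows "val (al n i) \<noteq> val (al n j)"
proof
  interpret X: genext "(\<epsilon>)" CP CL emp II om swp "\<lambda>s g. \<not> fs g \<epsilon> s" G E' val by fact
  let ?Q = "\<lambda>p. \<exists>k m m'. tu n i k m \<epsilon> p \<and> tu n j k m' \<epsilon> p \<and> m \<noteq> m'"
  assume eq: "val (al n i) = val (al n j)"
  have "dfn (\<lambda>e. ?Q (e 0))" by (intro dfs)
  moreover have "\<exists>r. C.lq r p \<and> ?Q r" if "p \<epsilon> CP" for p
  proof -
    have p: "cond p" using that mem_CP by simp
    obtain t where t: "t \<epsilon> om" "\<And>n i k m. tu n i k m \<epsilon> p \<Longrightarrow> i \<epsilon> t \<and> k \<epsilon> t" using p unfolding cond_def by blast
    \<comment> \<open>All arguments used by \<open>p\<close> are below \<open>t\<close>, so both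
      reals are still undefined at \<open>t\<close> and can be given the values 0 and 1.\<close>
    let ?r = "un p (upair (tu n i t emp) (tu n j t (suc emp)))"
    have "cond ?r"
    proof (rule condI[where t = "un (suc t) (un (suc i) (suc j))"])
      show "\<exists>n i k m. z = tu n i k m" if "z \<epsilon> ?r" for z using that cond_elem[OF p] by auto
      show "a \<epsilon> om \<and> b \<epsilon> om \<and> k \<epsilon> om \<and> m \<epsilon> om \<and> b \<epsilon> un (suc t) (un (suc i) (suc j)) \<and> k \<epsilon> un (suc t) (un (suc i) (suc j))"
        if "tu a b k m \<epsilon> ?r" for a b k m
        using that cond_om[OF p] t(1) t(2)[of a b k m] n i j emp_om suc_om[OF emp_om] by auto
      show "m = m'" if "tu a b k m \<epsilon> ?r" "tu a b k m' \<epsilon> ?r" for a b k m m'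
        using that cond_fun[OF p] ij t(2)[of a b k m] t(2)[of a b k m'] by auto
      show "un (suc t) (un (suc i) (suc j)) \<epsilon> om" using t i j un_om suc_om by simp
    qed
    then have "C.lq ?r p" unfolding C.lq_def CL_pair using p by simp
    moreover have "emp \<noteq> suc emp" by (metis mem_emp mem_suc)
    then have "?Q ?r" by (intro exI[of _ t] exI[of _ emp] exI[of _ "suc emp"]) simp
    ultimately show ?thesis by blast
  qed
  ultimately have "\<exists>r\<in>G. ?Q r" by (rule C.generic_dense[OF X.gen])
  then obtain p k m m' where p: "p \<in> G" "tu n i k m \<epsilon> p" "tu n j k m' \<epsilon> p" "m \<noteq> m'" by blast
  have "E' (val (C.chk (pair k m))) (val (al n i))"
    unfolding X.mem_val[OF HS_al[OF n]] mem_al using p X.G_P by blast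
  then obtain q where q: "q \<in> G" "tu n j k m \<epsilon> q"
    unfolding eq X.mem_val[OF HS_al[OF n]] mem_al by auto
  obtain r where "r \<in> G" "C.lq r p" "C.lq r q" using X.G_below2[OF p(1) q(1)] by blast
  then show False using p q cond_fun[of r n j k m m'] unfolding C.lq_def CL_pair by blast
qed

text \<open>At depth 1 the level 0 is the de Bruijn index 0. Having functionality as a formula lets
  a condition force it and thereby carry it into another extension.\<close>

definition fun_fm :: fm where
  "fun_fm = (\<^bold>\<forall>x. \<^bold>\<forall>y. \<^bold>\<forall>z. pair_in x y 0 \<^bold>\<and> pair_in x z 0 \<^bold>\<longrightarrow> y \<^bold>= z) 1"

theorem nochoice_ex: "\<exists>E' :: nat \<Rightarrow> nat \<Rightarrow> bool. zf E' \<and> (\<exists>X. zf.nochoice E' X)"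
proof -
  have sat_fun: "sat E' e fun_fm \<longleftrightarrow> (\<forall>x y z. E' (zf.pair E' x y) (e 0) \<and> E' (zf.pair E' x z) (e 0) \<longrightarrow> y = z)"
    if "zf E'" for E' :: "nat \<Rightarrow> nat \<Rightarrow> bool" and e
  proof -
    interpret N: zf E' by fact
    have "sat E' e fun_fm \<longleftrightarrow> N.hld (\<lambda>i. e (Suc i)) (\<^bold>\<forall>x. \<^bold>\<forall>y. \<^bold>\<forall>z. pair_in x y 0 \<^bold>\<and> pair_in x z 0 \<^bold>\<longrightarrow> y \<^bold>= z) 1 (\<lambda>_. e 0)"
      unfolding fun_fm_def hold_def by (rule satk_cong) auto
    then show ?thesis by (simp add: hold_basic N.hld_pair_in)
  qed
  have ext: "\<exists>G E' val. genext (\<epsilon>) CP CL emp II om swp (\<lambda>s g. \<not> fs g \<epsilon> s) G (E' :: nat \<Rightarrow> nat \<Rightarrow> bool) val \<and> p \<in> G"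
    if p: "p \<epsilon> CP" for p
  proof -
    obtain G where G: "C.generic G" "p \<in> G" using C.generic_ex[OF p] by blast
    obtain E' val where ev: "val ` {x. C.HS x} = (UNIV :: nat set)"
      "\<forall>x y. C.HS x \<longrightarrow> C.HS y \<longrightarrow> (val x = val y \<longleftrightarrow> C.eqG G x y)"
      "\<forall>x y. C.HS x \<longrightarrow> C.HS y \<longrightarrow> (E' (val x) (val y) \<longleftrightarrow> C.memG G x y)"
      using C.extension_ex[OF G(1)] by blast
    have "genext (\<epsilon>) CP CL emp II om swp (\<lambda>s g. \<not> fs g \<epsilon> s) G E' val"
      by unfold_locales (rule G(1) ev(1) ev(2)[rule_format] ev(3)[rule_format]; assumption)+
    then show ?thesis using G(2) by blast
  qed
  obtain G E' val where X: "genext (\<epsilon>) CP CL emp II om swp (\<lambda>s g. \<not> fs g \<epsilon> s) G (E' :: nat \<Rightarrow> nat \<Rightarrow> bool) val"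
    using ext[of emp] cond_emp mem_CP by blast
  interpret X: genext "(\<epsilon>)" CP CL emp II om swp "\<lambda>s g. \<not> fs g \<epsilon> s" G E' val by (rule X)
  \<comment> \<open>The name of the family has the top as its only condition; a swap permutes the
    reals within a row, so the empty support suffices.\<close>
  let ?Q = "\<lambda>s p. p = emp \<and> (\<exists>n i. n \<epsilon> om \<and> i \<epsilon> om \<and> s = X.opn (C.chk n) (al n i))"
  have "df (\<lambda>e. X.opn (C.chk (fs (e 0))) (al (fs (e 0)) (sn (e 0))))" by (intro dfs C.df_chk X.df_opn)
  from small_img[of "\<lambda>z. X.opn (C.chk (fs z)) (al (fs z) (sn z))", OF this, of "prod om om"]
  obtain t where t: "\<And>y. y \<epsilon> t \<longleftrightarrow> (\<exists>z. z \<epsilon> prod om om \<and> y = X.opn (C.chk (fs z)) (al (fs z) (sn z)))"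
    unfolding small_def by blast
  have "\<exists>y. C.HS y \<and> (\<forall>s p. pair s p \<epsilon> y \<longleftrightarrow> ?Q s p) \<and> (\<forall>a. E' a (val y) \<longleftrightarrow> (\<exists>s p. ?Q s p \<and> p \<in> G \<and> a = val s))"
  proof (rule X.name_ex[where ?s0.0 = emp])
    show "dfn (\<lambda>e. ?Q (e 0) (e 1))" by (intro dfs C.df_chk X.df_opn)
    show "C.HS s \<and> s \<epsilon> t \<and> p \<epsilon> CP" if q: "?Q s p" for s p
    proof -
      obtain n i where ni: "n \<epsilon> om" "i \<epsilon> om" "s = X.opn (C.chk n) (al n i)" using q by blast
      have "s \<epsilon> t" unfolding t using ni by (intro exI[of _ "pair n i"]) auto
      then show ?thesis using q ni X.HS_opn HS_al cond_emp mem_CP by simp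
    qed
    show "emp \<epsilon> om" by simp
    show "?Q (C.tau g s) (swp g p)" if g: "g \<epsilon> II" and q: "?Q s p" for g s p
    proof -
      obtain n i where ni: "n \<epsilon> om" "i \<epsilon> om" "s = X.opn (C.chk n) (al n i)" using q by blast
      have "C.tau g s = X.opn (C.chk n) (al n (act g n i))"
        unfolding ni(3) using X.tau_opn[OF g] C.tau_chk[OF g] tau_al[OF g] by simp
      then show ?thesis using q ni act_om[OF g] C.T_one[OF g] by blast
    qed
  qed
  then obtain Y where Y0: "\<forall>a. E' a (val Y) \<longleftrightarrow> (\<exists>s p. ?Q s p \<and> p \<in> G \<and> a = val s)"
    by (elim exE conjE) (rule that)
  have Y: "E' a (val Y) \<longleftrightarrow> (\<exists>n i. n \<epsilon> om \<and> i \<epsilon> om \<and> a = X.N.pair (val (C.chk n)) (val (al n i)))" for a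
    unfolding Y0[rule_format] using X.val_opn[OF C.HS_chk HS_al] X.G_one by metis
  have omN: "E' u X.N.om \<longleftrightarrow> (\<exists>n. n \<epsilon> om \<and> u = val (C.chk n))" for u
    unfolding X.val_chk_om[symmetric] X.mem_val_chk ..
  have "X.N.nochoice (val Y)" unfolding X.N.nochoice_def
  proof (intro conjI allI impI notI)
    show "\<exists>n x. E' n X.N.om \<and> z = X.N.pair n x" if "E' z (val Y)" for z using that unfolding Y omN by blast
    show "\<exists>x. E' (X.N.pair n x) (val Y)" if "E' n X.N.om" for n using that emp_om unfolding Y omN by blast
    assume "\<exists>c. (\<forall>z. E' z c \<longrightarrow> E' z (val Y)) \<and>
      (\<forall>n x x'. E' (X.N.pair n x) c \<and> E' (X.N.pair n x') c \<longrightarrow> x = x') \<and>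
      (\<forall>m. E' m X.N.om \<longrightarrow> (\<exists>n x. E' (X.N.pair n x) c \<and> \<not> E' n m))"
    then obtain c where c: "\<And>z. E' z c \<Longrightarrow> E' z (val Y)"
      "\<forall>n x x'. E' (X.N.pair n x) c \<and> E' (X.N.pair n x') c \<longrightarrow> x = x'"
      "\<And>m. E' m X.N.om \<Longrightarrow> \<exists>n x. E' (X.N.pair n x) c \<and> \<not> E' n m" by blast
    obtain d where d: "C.HS d" "c = val d" using X.val_ex by metis
    obtain s where s: "s \<epsilon> om" "\<And>g. g \<epsilon> II \<Longrightarrow> \<not> fs g \<epsilon> s \<Longrightarrow> C.tau g d = d" using X.HS_supp[OF d(1)] by blast
    obtain u x where u: "E' (X.N.pair u x) c" "\<not> E' u (val (C.chk s))" using c(3)[of "val (C.chk s)"] omN s by blast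
    obtain n i where ni: "n \<epsilon> om" "i \<epsilon> om" "u = val (C.chk n)" "x = val (al n i)" using c(1)[OF u(1)] unfolding Y by auto
    have ns: "\<not> n \<epsilon> s" using u(2) ni X.mem_val_chk by blast
    have HSo: "C.HS (X.opn (C.chk n) (al n j))" for j by (rule X.HS_opn[OF C.HS_chk HS_al[OF ni(1)]])
    have "E' (val (X.opn (C.chk n) (al n i))) (val d)"
      using u(1) ni d X.val_opn[OF C.HS_chk HS_al[OF ni(1)]] by simp
    then obtain p1 where p1: "p1 \<in> G" "C.fmem p1 (X.opn (C.chk n) (al n i)) d" using X.mem_val'[OF HSo d(1)] by blast
    \<comment> \<open>Functionality is needed as a forced statement, because the contradiction will
      appear in a different extension.\<close>
    have "sat E' (\<lambda>_. val d) fun_fm" unfolding sat_fun[OF X.N.zf_axioms] using c(2) d by blast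
    then obtain p2 where p2: "p2 \<in> G" "C.fK fun_fm (\<lambda>_. d) p2" using X.val_truth[of "\<lambda>_. d" fun_fm] d(1) by blast
    obtain p where p: "p \<in> G" "C.lq p p1" "C.lq p p2" using X.G_below2[OF p1(1) p2(1)] by blast
    have cp: "cond p" using X.G_P[OF p(1)] mem_CP by simp
    obtain t where t: "t \<epsilon> om" "\<And>n i k m. tu n i k m \<epsilon> p \<Longrightarrow> i \<epsilon> t \<and> k \<epsilon> t" using cp unfolding cond_def by blast
    define j where "j = un t (suc i)"
    have j: "j \<epsilon> om" "\<not> j \<epsilon> t" "i \<noteq> j"
    proof -
      show "j \<epsilon> om" unfolding j_def using t ni un_om suc_om by blast
      show "\<not> j \<epsilon> t" unfolding j_def using un_not_mem[of "suc i" t t] Ord_nat t ni by simp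
      have "i \<epsilon> j" unfolding j_def by simp
      then show "i \<noteq> j" using irrefl by blast
    qed
    define g where "g = pair n (pair i j)"
    have g: "g \<epsilon> II" "fs g = n" "act g n i = j" unfolding g_def II_def act_def using ni j by auto
    have td: "C.tau g d = d" using s(2) g ns by simp
    have "C.fmem p (X.opn (C.chk n) (al n i)) d" using C.fmem_mono[OF p1(2) p(2)] .
    from C.fmem_tau1[OF g(1) HSo d(1) X.G_P[OF p(1)] this]
    have q: "C.fmem (swp g p) (X.opn (C.chk n) (al n j)) d"
      unfolding td X.tau_opn[OF g(1)] C.tau_chk[OF g(1)] tau_al[OF g(1)] g(3) .
    let ?r = "un p (swp g p)"
    have cq: "cond (swp g p)" by (rule swp_cond[OF g(1) cp])
    \<comment> \<open>In row \<open>n\<close> both \<open>i'\<close> and its image are used by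
      \<open>p\<close>, so neither is \<open>j\<close>; hence the swap does not move
      \<open>i'\<close> and the values agree since \<open>p\<close> is a function.\<close>
    have mix: "m = m'" if a: "tu n' i' k m \<epsilon> p" "tu n' i' k m' \<epsilon> swp g p" for n' i' k m m'
    proof (cases "n' = n")
      case False
      then show ?thesis using a cond_fun[OF cp] act_other[of n' g] g(2) unfolding tu_swp by metis
    next
      case True
      have "tu n (act g n i') k m' \<epsilon> p" using a(2) True unfolding tu_swp by simp
      moreover have "i' \<noteq> j" "act g n i' \<noteq> j" using t(2) a(1) calculation j(2) by blast+
      then have "act g n i' = i'" unfolding g_def act_def by (auto split: if_splits)
      ultimately show ?thesis using a(1) True cond_fun[OF cp] by simp
    qed
    obtain t' where t': "t' \<epsilon> om" "\<And>n i k m. tu n i k m \<epsilon> swp g p \<Longrightarrow> i \<epsilon> t' \<and> k \<epsilon> t'" using cq unfolding cond_def by blast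
    have cr: "cond ?r"
    proof (rule condI[where t = "un t t'"])
      show "\<exists>n i k m. z = tu n i k m" if "z \<epsilon> ?r" for z using that cond_elem[OF cp] cond_elem[OF cq] by auto
      show "a \<epsilon> om \<and> b \<epsilon> om \<and> k \<epsilon> om \<and> m \<epsilon> om \<and> b \<epsilon> un t t' \<and> k \<epsilon> un t t'" if "tu a b k m \<epsilon> ?r" for a b k m
        using that cond_om[OF cp, of a b k m] cond_om[OF cq, of a b k m] t(2)[of a b k m] t'(2)[of a b k m] by auto
      show "m = m'" if "tu a b k m \<epsilon> ?r" "tu a b k m' \<epsilon> ?r" for a b k m m'
        using that cond_fun[OF cp] cond_fun[OF cq] mix unfolding mem_un by metis
      show "un t t' \<epsilon> om" using t t' un_om by blast
    qed
    then have rP: "?r \<epsilon> CP" using mem_CP by simp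
    have rp: "C.lq ?r p" "C.lq ?r (swp g p)" unfolding C.lq_def CL_pair using cr cp cq by auto
    \<comment> \<open>The original filter need not contain the union of \<open>p\<close> and its
      swap, so a second generic filter is taken through it; both conditions are above the
      union.\<close>
    obtain G' E'' val' where X': "genext (\<epsilon>) CP CL emp II om swp (\<lambda>s g. \<not> fs g \<epsilon> s) G' (E'' :: nat \<Rightarrow> nat \<Rightarrow> bool) val'"
      "?r \<in> G'" using ext[OF rP] by blast
    interpret Y: genext "(\<epsilon>)" CP CL emp II om swp "\<lambda>s g. \<not> fs g \<epsilon> s" G' E'' val' by (rule X'(1))
    have pG: "p \<in> G'" "swp g p \<in> G'" using Y.G_up[OF X'(2)] rp by blast+
    have "sat E'' (\<lambda>_. val' d) fun_fm"
      using Y.val_truth[of "\<lambda>_. d" fun_fm] d(1) C.fK_mono[OF p2(2) p(3)] pG(1) by blast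
    then have fn: "\<And>x y z. E'' (Y.N.pair x y) (val' d) \<Longrightarrow> E'' (Y.N.pair x z) (val' d) \<Longrightarrow> y = z"
      unfolding sat_fun[OF Y.N.zf_axioms] by blast
    have "E'' (Y.N.pair (val' (C.chk n)) (val' (al n i))) (val' d)"
      using Y.mem_val'[OF HSo d(1), of i] C.fmem_mono[OF p1(2) p(2)] pG(1)
      unfolding Y.val_opn[OF C.HS_chk HS_al[OF ni(1)]] by blast
    moreover have "E'' (Y.N.pair (val' (C.chk n)) (val' (al n j))) (val' d)"
      using Y.mem_val'[OF HSo d(1), of j] q pG(2)
      unfolding Y.val_opn[OF C.HS_chk HS_al[OF ni(1)]] by blast
    ultimately have "val' (al n i) = val' (al n j)" by (rule fn)
    then show False using generic_reals_distinct[OF X'(1) ni(1,2) j(1,3)] by blast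
  qed
  then show ?thesis using X.N.zf_axioms by blast
qed

end

section \<open>Provability and consistency\<close>

context levy
begin

lemma sat_collapse: "sat (\<epsilon>) w (sentence (\<^bold>\<exists>P le one. notion_of_forcing P le one \<^bold>\<and> CCC1 P le \<^bold>\<and>
    collapses_omega1 P le one))"
  unfolding satk_hold[where v = w] hold_ex hold_conj
  by (rule bexI[of _ PP], rule bexI[of _ LE], rule bexI[of _ emp])
    (simp_all add: hld_notion_of_forcing hld_CCC1 nof_levy ccc1_levy hld_collapses)

lemma sat_collapse_sigma_closed:
  assumes "sigcl PP LE"
  shows "sat (\<epsilon>) w (sentence (\<^bold>\<exists>P le one. notion_of_forcing P le one \<^bold>\<and> CCC1 P le \<^bold>\<and>
    collapses_omega1 P le one \<^bold>\<and> sigma_closed P le))"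
  unfolding satk_hold[where v = w] hold_ex hold_conj
  by (rule bexI[of _ PP], rule bexI[of _ LE], rule bexI[of _ emp])
    (simp_all add: hld_notion_of_forcing hld_CCC1 nof_levy ccc1_levy hld_collapses hld_sigma_closed assms)

end

lemma (in zf) sat_hypothesis:
  "sat (\<epsilon>) w (sentence (\<^bold>\<exists>C le one. notion_of_forcing C le one \<^bold>\<and> nontrivial C one \<^bold>\<and>
      no_antichain_avoiding_top C le one)) \<longleftrightarrow>
    (\<exists>C le one. nof C le one \<and> (\<exists>p. p \<epsilon> C \<and> p \<noteq> one) \<and> noanti C le one)"
  unfolding satk_hold[where v = w]
  by (simp add: hold_basic hld_notion_of_forcing hld_nontrivial hld_no_antichain_avoiding_top)

lemma sat_sentence_imp:
  "sat E e (sentence (A \<^bold>\<longrightarrow> B)) \<longleftrightarrow> (sat E e (sentence A) \<longrightarrow> sat E e (sentence B))"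
  unfolding satk_hold[where v = e] hold_imp ..

lemma ZF_completeness:
  assumes "\<And>(E :: nat \<Rightarrow> nat \<Rightarrow> bool) e. zf E \<Longrightarrow> sat E e \<phi>"
  shows "ZF \<turnstile> \<phi>"
proof (rule inconsistent_insert_NegD, rule notI)
  assume "consistent (insert (Neg \<phi>) ZF)"
  then obtain E :: "nat \<Rightarrow> nat \<Rightarrow> bool" and e where E: "\<forall>\<psi>\<in>insert (Neg \<phi>) ZF. sat E e \<psi>"
    using completeness[of "insert (Neg \<phi>) ZF"] unfolding ZF_def by blast
  then have "zf E" unfolding zf_ZF[of E e] by blast
  then show False using assms E by fastforce
qed

lemma ZF_consistency:
  assumes "zf E" "\<And>e. sat E e \<phi>"
  shows "consistent (insert \<phi> ZF)"
  unfolding consistent_def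
proof (rule notI, elim exE conjE)
  fix \<psi> assume d: "insert \<phi> ZF \<turnstile> \<psi>" "insert \<phi> ZF \<turnstile> Neg \<psi>"
  have "\<forall>\<chi>\<in>insert \<phi> ZF. sat E undefined \<chi>" using assms zf_ZF by blast
  then show False using soundness[OF d(1)] soundness[OF d(2)] by fastforce
qed

theorem corollary6p3:
  shows "ZF \<turnstile> sentence
           ((\<^bold>\<exists>C le one. notion_of_forcing C le one \<^bold>\<and> nontrivial C one \<^bold>\<and>
                no_antichain_avoiding_top C le one)
            \<^bold>\<longrightarrow> (\<^bold>\<exists>P le one. notion_of_forcing P le one \<^bold>\<and> CCC1 P le \<^bold>\<and>
                collapses_omega1 P le one))
       \<and> (consistent ZFC \<longrightarrow>
          consistent (insert (sentence
            (\<^bold>\<exists>P le one. notion_of_forcing P le one \<^bold>\<and> CCC1 P le \<^bold>\<and>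
                collapses_omega1 P le one \<^bold>\<and> sigma_closed P le)) ZF))"
proof (intro conjI impI)
  show "ZF \<turnstile> sentence
           ((\<^bold>\<exists>C le one. notion_of_forcing C le one \<^bold>\<and> nontrivial C one \<^bold>\<and>
                no_antichain_avoiding_top C le one)
            \<^bold>\<longrightarrow> (\<^bold>\<exists>P le one. notion_of_forcing P le one \<^bold>\<and> CCC1 P le \<^bold>\<and>
                collapses_omega1 P le one))"
  proof (rule ZF_completeness, unfold sat_sentence_imp, rule impI)
    fix E :: "nat \<Rightarrow> nat \<Rightarrow> bool" and e
    assume zf: "zf E" and "sat E e (sentence (\<^bold>\<exists>C le one. notion_of_forcing C le one \<^bold>\<and> nontrivial C one \<^bold>\<and>
                no_antichain_avoiding_top C le one))"
    then obtain C le one where "zf.nof E C le one" "\<exists>p. E p C \<and> p \<noteq> one" "zf.noanti E C le one"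
      unfolding zf.sat_hypothesis[OF zf] by blast
    then obtain k J R where "levy E k J R" using levy_of_no_antichain[OF zf] by blast
    then show "sat E e (sentence (\<^bold>\<exists>P le one. notion_of_forcing P le one \<^bold>\<and> CCC1 P le \<^bold>\<and>
                collapses_omega1 P le one))" by (rule levy.sat_collapse)
  qed
next
  assume "consistent ZFC"
  then obtain E :: "nat \<Rightarrow> nat \<Rightarrow> bool" and e where "\<forall>\<psi>\<in>ZFC. sat E e \<psi>"
    using completeness[of ZFC] unfolding ZFC_def ZF_def by blast
  then have "zf E" unfolding zf_ZF[of E e] ZFC_def by blast
  \<comment> \<open>The symmetric extension is again a structure on \<open>nat\<close>, so the
    collapse can be constructed over it.\<close>
  then obtain E' :: "nat \<Rightarrow> nat \<Rightarrow> bool" and X where E': "zf E'" "zf.nochoice E' X"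
    using cohen.nochoice_ex[OF cohen.intro] by blast
  then obtain k J R where "levy E' k J R" "zf.sigcl E' (levy.PP E' R) (levy.LE E' R)"
    using levy_of_nochoice by blast
  then show "consistent (insert (sentence
            (\<^bold>\<exists>P le one. notion_of_forcing P le one \<^bold>\<and> CCC1 P le \<^bold>\<and>
                collapses_omega1 P le one \<^bold>\<and> sigma_closed P le)) ZF)"
    by (intro ZF_consistency[OF E'(1)] levy.sat_collapse_sigma_closed)
qed

end
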